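(* For a convex function $f:\mathbb{R}\to\mathbb{R}$ and vectors $a\in\mathbb{R}^n_{>0}$, $b\in\mathbb{R}^n$, both $(a,b,f)$-S/NC/C and $(a,b,f)$-S/NC/I can be solved in $O(n\log m)$ time.
   Context: Let $\mathcal{N}=\{1,\ldots,n\}$, $\mathcal{M}=\{1,\ldots,m\}$, $R\in\mathbb{R}$, let $\mathcal{N}_1\subset\cdots\subset\mathcal{N}_m\subset\mathcal{N}$ be nested subsets, and let bounds $l,u\in\mathbb{R}^n$ and $L,U\in\mathbb{R}^m$ be given. The problem $(a,b,f)$-S/NC/$\gamma$ is $$\min_x\ \sum_{i\in\mathcal{N}}a_if\left(\frac{x_i}{a_i}+b_i\right)\quad\text{s.t.}\quad\sum_{i\in\mathcal{N}}x_i=R,\quad L_j\le\sum_{i\in\mathcal{N}_j}x_i\le U_j\ (j\in\mathcal{M}),\quad l_i\le x_i\le u_i\ (i\in\mathcal{N}),$$ with $x\in\mathbb{R}^n$ if $\gamma=\text{C}$ and $x\in\mathbb{Z}^n$ if $\gamma=\text{I}$. Solving the problem means computing an optimal solution. *)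

theory Defs
  imports Complex_Main "HOL-Analysis.Convex"
begin

section \<open>A real RAM\<close>

text \<open>
  Running times are measured on a real RAM, presented as a while language over named
  arrays of natural numbers (for indices, with indirect addressing) and of reals
  (exact arithmetic). A scalar is cell 0 of an array. The only access to real functions
  beyond the field operations is through named oracles. There is no conversion from
  reals to natural numbers, and the constants in programs are integers, so no real
  data can be hidden in a program.
\<close>

datatype nexp =
    NConst nat
  | NGet string nexp
  | NPlus nexp nexp
  | NMinus nexp nexp

datatype rexp =
    RConst int
  | ROfNat nexp
  | RGet string nexp
  | RPlus rexp rexp
  | RMinus rexp rexp
  | RTimes rexp rexp
  | RDivide rexp rexp
  | ROracle string rexp

datatype bexp =
    NLess nexp nexp
  | RLess rexp rexp
  | BNot bexp
  | BAnd bexp bexp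

datatype com =
    Skip
  | NPut string nexp nexp
  | RPut string nexp rexp
  | Seq com com
  | Cond bexp com com
  | While bexp com

record state =
  nats :: "string \<Rightarrow> nat \<Rightarrow> nat"
  reals :: "string \<Rightarrow> nat \<Rightarrow> real"

fun nval :: "nexp \<Rightarrow> state \<Rightarrow> nat" where
  "nval (NConst k) s = k"
| "nval (NGet v e) s = nats s v (nval e s)"
| "nval (NPlus d e) s = nval d s + nval e s"
| "nval (NMinus d e) s = nval d s - nval e s"

fun rval :: "(string \<Rightarrow> real \<Rightarrow> real) \<Rightarrow> rexp \<Rightarrow> state \<Rightarrow> real" where
  "rval F (RConst k) s = of_int k"
| "rval F (ROfNat e) s = of_nat (nval e s)"
| "rval F (RGet v e) s = reals s v (nval e s)"
| "rval F (RPlus d e) s = rval F d s + rval F e s"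
| "rval F (RMinus d e) s = rval F d s - rval F e s"
| "rval F (RTimes d e) s = rval F d s * rval F e s"
| "rval F (RDivide d e) s = rval F d s / rval F e s"
| "rval F (ROracle g e) s = F g (rval F e s)"

fun bval :: "(string \<Rightarrow> real \<Rightarrow> real) \<Rightarrow> bexp \<Rightarrow> state \<Rightarrow> bool" where
  "bval F (NLess d e) s \<longleftrightarrow> nval d s < nval e s"
| "bval F (RLess d e) s \<longleftrightarrow> rval F d s < rval F e s"
| "bval F (BNot p) s \<longleftrightarrow> \<not> bval F p s"
| "bval F (BAnd p q) s \<longleftrightarrow> bval F p s \<and> bval F q s"

definition nput :: "string \<Rightarrow> nat \<Rightarrow> nat \<Rightarrow> state \<Rightarrow> state" where
  "nput v i k s = s\<lparr>nats := (nats s)(v := (nats s v)(i := k))\<rparr>"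

definition rput :: "string \<Rightarrow> nat \<Rightarrow> real \<Rightarrow> state \<Rightarrow> state" where
  "rput v i r s = s\<lparr>reals := (reals s)(v := (reals s v)(i := r))\<rparr>"

text \<open>
  \<open>exec F c s t s'\<close>: with oracles \<open>F\<close>, program \<open>c\<close> started in \<open>s\<close> terminates in \<open>s'\<close>
  after \<open>t\<close> steps. Evaluating an expression counts as part of one step: a program
  contains finitely many expressions, so this is accurate up to a constant factor
  that depends only on the program. An oracle call thus takes constant time.
\<close>

inductive exec ::
  "(string \<Rightarrow> real \<Rightarrow> real) \<Rightarrow> com \<Rightarrow> state \<Rightarrow> nat \<Rightarrow> state \<Rightarrow> bool"
  for F where
  Skip: "exec F Skip s 1 s"
| NPut: "exec F (NPut v d e) s 1 (nput v (nval d s) (nval e s) s)"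
| RPut: "exec F (RPut v d e) s 1 (rput v (nval d s) (rval F e s) s)"
| Seq: "exec F c s t s' \<Longrightarrow> exec F c' s' t' s'' \<Longrightarrow> exec F (Seq c c') s (t + t') s''"
| CondTrue: "bval F p s \<Longrightarrow> exec F c s t s' \<Longrightarrow> exec F (Cond p c c') s (1 + t) s'"
| CondFalse: "\<not> bval F p s \<Longrightarrow> exec F c' s t s' \<Longrightarrow> exec F (Cond p c c') s (1 + t) s'"
| WhileFalse: "\<not> bval F p s \<Longrightarrow> exec F (While p c) s 1 s"
| WhileTrue: "bval F p s \<Longrightarrow> exec F c s t s' \<Longrightarrow> exec F (While p c) s' t' s''
    \<Longrightarrow> exec F (While p c) s (1 + t + t') s''"


section \<open>Separable convex resource allocation with nested constraints\<close>

datatype vartype = Continuous | Integral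

text \<open>
  Since \<open>n\<close> and \<open>m\<close> are part of the instance, vectors of length \<open>k\<close> are functions
  on \<open>nat\<close> of which only the values on \<open>{1..k}\<close> matter.
\<close>

record nc_problem =
  num_vars :: nat                           (* n *)
  num_nested :: nat                         (* m *)
  weight :: "nat \<Rightarrow> real"                  (* a *)
  shift :: "nat \<Rightarrow> real"                   (* b *)
  total :: real                             (* R *)
  nested :: "nat \<Rightarrow> nat set"               (* N_1, ..., N_m *)
  nested_lower :: "nat \<Rightarrow> real"            (* L *)
  nested_upper :: "nat \<Rightarrow> real"            (* U *)
  var_lower :: "nat \<Rightarrow> real"               (* l *)
  var_upper :: "nat \<Rightarrow> real"               (* u *)

definition nc_wf :: "nc_problem \<Rightarrow> bool" where
  "nc_wf P \<longleftrightarrow>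
     1 \<le> num_vars P \<and> 1 \<le> num_nested P \<and>
     (\<forall>i\<in>{1..num_vars P}. 0 < weight P i) \<and>
     (\<forall>j\<in>{1..<num_nested P}. nested P j \<subset> nested P (Suc j)) \<and>
     nested P (num_nested P) \<subset> {1..num_vars P}"

definition objective :: "(real \<Rightarrow> real) \<Rightarrow> nc_problem \<Rightarrow> (nat \<Rightarrow> real) \<Rightarrow> real" where
  "objective f P x = (\<Sum>i = 1..num_vars P. weight P i * f (x i / weight P i + shift P i))"

definition feasible :: "vartype \<Rightarrow> nc_problem \<Rightarrow> (nat \<Rightarrow> real) \<Rightarrow> bool" where
  "feasible \<gamma> P x \<longleftrightarrow>
     (\<Sum>i = 1..num_vars P. x i) = total P \<and>
     (\<forall>j\<in>{1..num_nested P}.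
        nested_lower P j \<le> (\<Sum>i\<in>nested P j. x i) \<and>
        (\<Sum>i\<in>nested P j. x i) \<le> nested_upper P j) \<and>
     (\<forall>i\<in>{1..num_vars P}. var_lower P i \<le> x i \<and> x i \<le> var_upper P i) \<and>
     (\<gamma> = Integral \<longrightarrow> (\<forall>i\<in>{1..num_vars P}. x i \<in> \<int>))"

definition optimal ::
  "(real \<Rightarrow> real) \<Rightarrow> vartype \<Rightarrow> nc_problem \<Rightarrow> (nat \<Rightarrow> real) \<Rightarrow> bool" where
  "optimal f \<gamma> P x \<longleftrightarrow>
     feasible \<gamma> P x \<and> (\<forall>y. feasible \<gamma> P y \<longrightarrow> objective f P x \<le> objective f P y)"


section \<open>Solving the problem in a given time\<close>

text \<open>
  The nested sets are given to the machine by one number per variable: the index of the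
  first set containing it, or \<open>m + 1\<close> if there is none. Listing the members of each set
  would already take up to \<open>n * m\<close> cells.
\<close>

definition level :: "nc_problem \<Rightarrow> nat \<Rightarrow> nat" where
  "level P i = (LEAST j. 1 \<le> j \<and> (j \<le> num_nested P \<longrightarrow> i \<in> nested P j))"

definition restrict0 :: "nat \<Rightarrow> (nat \<Rightarrow> 'a::zero) \<Rightarrow> nat \<Rightarrow> 'a" where
  "restrict0 k v i = (if i \<in> {1..k} then v i else 0)"

definition input_state :: "nc_problem \<Rightarrow> state" where
  "input_state P =
     \<lparr>nats = (\<lambda>_ _. 0)
        (''n'' := (\<lambda>_. 0)(0 := num_vars P),
         ''m'' := (\<lambda>_. 0)(0 := num_nested P),
         ''level'' := restrict0 (num_vars P) (level P)),
      reals = (\<lambda>_ _. 0)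
        (''a'' := restrict0 (num_vars P) (weight P),
         ''b'' := restrict0 (num_vars P) (shift P),
         ''R'' := (\<lambda>_. 0)(0 := total P),
         ''L'' := restrict0 (num_nested P) (nested_lower P),
         ''U'' := restrict0 (num_nested P) (nested_upper P),
         ''l'' := restrict0 (num_vars P) (var_lower P),
         ''u'' := restrict0 (num_vars P) (var_upper P))\<rparr>"

definition solution :: "state \<Rightarrow> nat \<Rightarrow> real" where
  "solution s = reals s ''x''"

text \<open>
  Rounding is available only for integer variables, where the bounds may be
  arbitrary reals.
\<close>

definition oracles :: "(real \<Rightarrow> real) \<Rightarrow> vartype \<Rightarrow> string \<Rightarrow> real \<Rightarrow> real" where
  "oracles f \<gamma> =
     (case \<gamma> of
        Continuous \<Rightarrow> (\<lambda>_. f)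
      | Integral \<Rightarrow> (\<lambda>_. f)(''floor'' := (\<lambda>r. of_int \<lfloor>r\<rfloor>)))"

text \<open>
  One program has to work for all instances, and the constant hidden in the
  \<open>O\<close>-notation is independent of the instance. Infeasible instances have no optimal
  solution and are left out; feasible ones always have one for convex \<open>f\<close>.
\<close>

definition solvable_in_O ::
  "(real \<Rightarrow> real) \<Rightarrow> vartype \<Rightarrow> (nat \<Rightarrow> nat \<Rightarrow> real) \<Rightarrow> bool" where
  "solvable_in_O f \<gamma> T \<longleftrightarrow>
     (\<exists>c K. \<forall>P. nc_wf P \<and> (\<exists>x. feasible \<gamma> P x) \<longrightarrow>
        (\<exists>t s. exec (oracles f \<gamma>) c (input_state P) t s \<and>
               optimal f \<gamma> P (solution s) \<and>
               real t \<le> K * T (num_vars P) (num_nested P)))"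

text \<open>
  \<open>n log m\<close> vanishes at \<open>m = 1\<close>, where it is read as \<open>n\<close>. For \<open>m \<ge> 2\<close> the maximum
  is the logarithm itself.
\<close>

definition n_log_m :: "nat \<Rightarrow> nat \<Rightarrow> real" where
  "n_log_m n m = real n * max 1 (log 2 (real m))"

end

theory Submission imports Defs "HOL-Library.Product_Lexorder"
begin

text \<open>Round the bounds (integer case) and add to every group of variables of the same level two slack variables,
  which leave zero only when all original variables are at a bound, so that every subproblem is solvable. Split the groups into
  two blocks and fix the resource consumed before and after a block at the lower or upper bound of the adjacent nested
  constraints. By monotonicity, the solutions of the two halves with the common constraint at its two bounds give
  bounds on the variables such that the solution of the whole block only needs a single sum constraint. Such an
  allocation is a search for a multiplier, found in linear time by pruning around approximate medians; in the integer
  case the multiplier ranges over unit steps ordered by their cost, and the continuous relaxation confines the search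
  to linearly many of them. Merging bottom up costs \<open>O(n)\<close> for each of \<open>O(log m)\<close> levels. Optimality follows by summation
  by parts from the complementary slackness of the group multipliers.\<close>

section \<open>Weakest preconditions that count steps\<close>

section \<open>Running programs\<close>

text \<open>With the resource at a cut fixed to one of its bounds, a block need not have any
  feasible point, even though the whole instance has one; this is the obstacle behind the slack
  variables. They need no penalty function: their cost is \<open>f\<close> itself, shifted by
  \<open>M\<close> or \<open>- M\<close>, which places them beyond the positions of all boxes on the
  axis of \<open>f\<close>. At the root they vanish not by a cost argument but by comparing resource
  paths with that of an arbitrary feasible point. Both this comparison and the monotonicity of child
  solutions rest on one squeezing argument for two prefix-sum paths, \<open>path_compare\<close>.
  Four solutions are kept per block, since each end has two bounds. Sorting by cost would take
  \<open>n log n\<close>, so it never happens: variables are arranged by counting sort on levels,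
  and multipliers are found with pivots. The pivots come from a sample that shrinks by a factor 4
  per round while the blocks in which ranks are computed by brute force only double, so that
  quadratic ranking stays linear overall.\<close>

definition runs ::
  "(string \<Rightarrow> real \<Rightarrow> real) \<Rightarrow> com \<Rightarrow> (nat \<Rightarrow> state \<Rightarrow> bool) \<Rightarrow> state \<Rightarrow> bool" where
  "runs F c Q s \<longleftrightarrow> (\<exists>t s'. exec F c s t s' \<and> Q t s')"

inductive_cases SkipE: "exec F Skip s t s'"
inductive_cases NPutE: "exec F (NPut v d e) s t s'"
inductive_cases RPutE: "exec F (RPut v d e) s t s'"
inductive_cases SeqE: "exec F (Seq c c') s t s'"
inductive_cases CondE: "exec F (Cond p c c') s t s'"

lemma runs_Skip: "runs F Skip Q s \<longleftrightarrow> Q 1 s"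
  unfolding runs_def
proof
  assume "Q 1 s"
  then show "\<exists>t s'. exec F Skip s t s' \<and> Q t s'"
    using exec.Skip[of F s] by blast
qed (elim exE conjE SkipE, simp)

lemma runs_NPut: "runs F (NPut v d e) Q s \<longleftrightarrow> Q 1 (nput v (nval d s) (nval e s) s)"
  unfolding runs_def
proof
  assume "Q 1 (nput v (nval d s) (nval e s) s)"
  then show "\<exists>t s'. exec F (NPut v d e) s t s' \<and> Q t s'"
    using exec.NPut[of F v d e s] by blast
qed (elim exE conjE NPutE, simp)

lemma runs_RPut: "runs F (RPut v d e) Q s \<longleftrightarrow> Q 1 (rput v (nval d s) (rval F e s) s)"
  unfolding runs_def
proof
  assume "Q 1 (rput v (nval d s) (rval F e s) s)"
  then show "\<exists>t s'. exec F (RPut v d e) s t s' \<and> Q t s'"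
    using exec.RPut[of F v d e s] by blast
qed (elim exE conjE RPutE, simp)

lemma runs_Seq:
  "runs F (Seq c c') Q s \<longleftrightarrow> runs F c (\<lambda>t s'. runs F c' (\<lambda>t' s''. Q (t + t') s'') s') s"
  unfolding runs_def by (blast intro: exec.Seq elim!: SeqE)

lemma runs_Cond:
  "runs F (Cond p c c') Q s \<longleftrightarrow>
     (if bval F p s then runs F c (\<lambda>t. Q (1 + t)) s else runs F c' (\<lambda>t. Q (1 + t)) s)"
proof (cases "bval F p s")
  case True
  show ?thesis
  proof
    assume "runs F (Cond p c c') Q s"
    then show "if bval F p s then runs F c (\<lambda>t. Q (1 + t)) s else runs F c' (\<lambda>t. Q (1 + t)) s"
      unfolding runs_def using True by (elim exE conjE CondE) auto
  next
    assume "if bval F p s then runs F c (\<lambda>t. Q (1 + t)) s else runs F c' (\<lambda>t. Q (1 + t)) s"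
    then obtain t s' where "exec F c s t s'" "Q (1 + t) s'"
      unfolding runs_def using True by auto
    then show "runs F (Cond p c c') Q s"
      unfolding runs_def using exec.CondTrue[OF True] by blast
  qed
next
  case False
  show ?thesis
  proof
    assume "runs F (Cond p c c') Q s"
    then show "if bval F p s then runs F c (\<lambda>t. Q (1 + t)) s else runs F c' (\<lambda>t. Q (1 + t)) s"
      unfolding runs_def using False by (elim exE conjE CondE) auto
  next
    assume "if bval F p s then runs F c (\<lambda>t. Q (1 + t)) s else runs F c' (\<lambda>t. Q (1 + t)) s"
    then obtain t s' where "exec F c' s t s'" "Q (1 + t) s'"
      unfolding runs_def using False by auto
    then show "runs F (Cond p c c') Q s"
      unfolding runs_def using exec.CondFalse[OF False] by blast
  qed
qed

lemmas runs_simps = runs_Skip runs_NPut runs_RPut runs_Seq runs_Cond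

lemma runs_mono: "runs F c Q s \<Longrightarrow> (\<And>t s'. Q t s' \<Longrightarrow> Q' t s') \<Longrightarrow> runs F c Q' s"
  unfolding runs_def by blast

text \<open>One function serves as variant and as account: every round pays for its test and body
  out of the drop of \<open>\<Phi>\<close>, so termination comes with the time bound. The extra 1 is
  the final failing test.\<close>

lemma runs_While:
  fixes \<Phi> :: "state \<Rightarrow> nat"
  assumes "I s"
    and body: "\<And>s. I s \<Longrightarrow> bval F p s \<Longrightarrow> runs F c (\<lambda>t s'. I s' \<and> 1 + t + \<Phi> s' \<le> \<Phi> s) s"
    and exit: "\<And>t s'. I s' \<Longrightarrow> \<not> bval F p s' \<Longrightarrow> t + \<Phi> s' \<le> \<Phi> s + 1 \<Longrightarrow> Q t s'"
  shows "runs F (While p c) Q s"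
proof -
  have "\<exists>t s'. exec F (While p c) s t s' \<and> I s' \<and> \<not> bval F p s' \<and> t + \<Phi> s' \<le> \<Phi> s + 1"
    using assms(1)
  proof (induction "\<Phi> s" arbitrary: s rule: less_induct)
    case less
    show ?case
    proof (cases "bval F p s")
      case True
      obtain t s' where s': "exec F c s t s'" "I s'" "1 + t + \<Phi> s' \<le> \<Phi> s"
        using body[OF less.prems True] unfolding runs_def by blast
      obtain t' s'' where "exec F (While p c) s' t' s''" "I s''" "\<not> bval F p s''"
          "t' + \<Phi> s'' \<le> \<Phi> s' + 1"
        using less.hyps[of s'] s' by auto
      then show ?thesis
        using exec.WhileTrue[OF True s'(1)] s'(3)
        by (intro exI[of _ "1 + t + t'"] exI[of _ s'']) auto
    next
      case False
      then show ?thesis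
        using less.prems exec.WhileFalse[OF False] by (intro exI[of _ 1] exI[of _ s]) auto
    qed
  qed
  then show ?thesis
    unfolding runs_def using exit by blast
qed

abbreviation nsc :: "string \<Rightarrow> nexp" where "nsc v \<equiv> NGet v (NConst 0)"
abbreviation rsc :: "string \<Rightarrow> rexp" where "rsc v \<equiv> RGet v (NConst 0)"
abbreviation nset :: "string \<Rightarrow> nexp \<Rightarrow> com" where "nset v e \<equiv> NPut v (NConst 0) e"
abbreviation rset :: "string \<Rightarrow> rexp \<Rightarrow> com" where "rset v e \<equiv> RPut v (NConst 0) e"
abbreviation ninc :: "string \<Rightarrow> com" where "ninc v \<equiv> nset v (NPlus (nsc v) (NConst 1))"
notation Seq (infixr ";;" 60)

definition For :: "string \<Rightarrow> nexp \<Rightarrow> nexp \<Rightarrow> com \<Rightarrow> com" where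
  "For v lo hi c = nset v lo ;; While (NLess (nsc v) hi) (c ;; ninc v)"

lemma nput_sel [simp]:
  "nats (nput v i k s) = (nats s)(v := (nats s v)(i := k))"
  "reals (nput v i k s) = reals s"
  by (simp_all add: nput_def)

lemma rput_sel [simp]:
  "nats (rput v i r s) = nats s"
  "reals (rput v i r s) = (reals s)(v := (reals s v)(i := r))"
  by (simp_all add: rput_def)

text \<open>In \<open>body\<close> the name \<open>s\<close> is rebound, so the start state is
  passed once more as \<open>s0\<close>. Each round adds 2 to its body for test and increment; the
  other 2 are the initial assignment and the last test.\<close>

lemma runs_For:
  fixes cost :: "nat \<Rightarrow> nat"
  assumes init: "I (nval lo s) (nput v 0 (nval lo s) s)" and le: "nval lo s \<le> H"
    and hi: "\<And>k s. I k s \<Longrightarrow> nats s v 0 = k \<Longrightarrow> nval hi s = H"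
    and body: "\<And>k s. I k s \<Longrightarrow> nats s v 0 = k \<Longrightarrow> k < H \<Longrightarrow> nval lo s0 \<le> k \<Longrightarrow>
      runs F c (\<lambda>t s'. t \<le> cost k \<and> nats s' v 0 = k \<and> I (Suc k) (nput v 0 (Suc k) s')) s"
    and s0: "s0 = s"
    and exit: "\<And>t s'. I H s' \<Longrightarrow> nats s' v 0 = H \<Longrightarrow>
      t \<le> 2 + (\<Sum>k = nval lo s..<H. cost k + 2) \<Longrightarrow> Q t s'"
  shows "runs F (For v lo hi c) Q s"
  unfolding For_def runs_Seq runs_NPut
proof (rule runs_While[where I = "\<lambda>s'. \<exists>k. I k s' \<and> nats s' v 0 = k \<and> nval lo s \<le> k \<and> k \<le> H"
      and \<Phi> = "\<lambda>s'. \<Sum>k = nats s' v 0..<H. cost k + 2"])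
  show "\<exists>k. I k (nput v (nval (NConst 0) s) (nval lo s) s) \<and>
      nats (nput v (nval (NConst 0) s) (nval lo s) s) v 0 = k \<and> nval lo s \<le> k \<and> k \<le> H"
    using init le by simp
next
  fix s'
  assume "\<exists>k. I k s' \<and> nats s' v 0 = k \<and> nval lo s \<le> k \<and> k \<le> H"
    and b: "bval F (NLess (nsc v) hi) s'"
  then obtain k where k: "I k s'" "nats s' v 0 = k" "nval lo s \<le> k" by blast
  with b hi have "k < H" by auto
  then show "runs F (c ;; ninc v)
      (\<lambda>t s''. (\<exists>k. I k s'' \<and> nats s'' v 0 = k \<and> nval lo s \<le> k \<and> k \<le> H) \<and>
        1 + t + (\<Sum>k = nats s'' v 0..<H. cost k + 2) \<le> (\<Sum>k = nats s' v 0..<H. cost k + 2)) s'"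
    unfolding runs_Seq runs_NPut
    using k s0 by (intro runs_mono[OF body[OF k(1,2)]]) (auto simp: sum.atLeast_Suc_lessThan)
next
  fix t s'
  assume "\<exists>k. I k s' \<and> nats s' v 0 = k \<and> nval lo s \<le> k \<and> k \<le> H"
    and b: "\<not> bval F (NLess (nsc v) hi) s'"
    and t: "t + (\<Sum>k = nats s' v 0..<H. cost k + 2)
      \<le> (\<Sum>k = nats (nput v (nval (NConst 0) s) (nval lo s) s) v 0..<H. cost k + 2) + 1"
  then obtain k where k: "I k s'" "nats s' v 0 = k" "k \<le> H" by blast
  with b hi have "k = H" by auto
  then show "Q (1 + t) s'"
    using exit[of s' "1 + t"] k t by simp
qed

lemma runs_For_const:
  assumes "nval lo s = A" "A \<le> H"
    and "I A (nput v 0 A s)"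
    and "\<And>k s. I k s \<Longrightarrow> nats s v 0 = k \<Longrightarrow> nval hi s = H"
    and "\<And>k s. I k s \<Longrightarrow> nats s v 0 = k \<Longrightarrow> k < H \<Longrightarrow> A \<le> k \<Longrightarrow>
      runs F c (\<lambda>t s'. t \<le> C \<and> nats s' v 0 = k \<and> I (Suc k) (nput v 0 (Suc k) s')) s"
    and "\<And>t s'. I H s' \<Longrightarrow> nats s' v 0 = H \<Longrightarrow> t \<le> 2 + (H - A) * (C + 2) \<Longrightarrow> Q t s'"
  shows "runs F (For v lo hi c) Q s"
  using assms by (intro runs_For[where I = I and H = H and cost = "\<lambda>_. C" and s0 = s]) auto

text \<open>A frame condition: naming the arrays that may change reduces the preservation of all
  others to membership of string literals in finite sets.\<close>

definition chg :: "string set \<Rightarrow> string set \<Rightarrow> state \<Rightarrow> state \<Rightarrow> bool" where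
  "chg NS RS s s' \<longleftrightarrow>
     (\<forall>v. v \<notin> NS \<longrightarrow> nats s' v = nats s v) \<and> (\<forall>v. v \<notin> RS \<longrightarrow> reals s' v = reals s v)"

lemma chg_nats: "chg NS RS s s' \<Longrightarrow> v \<notin> NS \<Longrightarrow> nats s' v = nats s v"
  by (simp add: chg_def)

lemma chg_reals: "chg NS RS s s' \<Longrightarrow> v \<notin> RS \<Longrightarrow> reals s' v = reals s v"
  by (simp add: chg_def)

lemma chg_trans: "chg NS RS s s' \<Longrightarrow> chg NS' RS' s' s'' \<Longrightarrow> NS \<union> NS' \<subseteq> NS'' \<Longrightarrow> RS \<union> RS' \<subseteq> RS''
    \<Longrightarrow> chg NS'' RS'' s s''"
  unfolding chg_def by (metis UnCI subsetD)

section \<open>Comparison, optimality and merging of multiplier paths\<close>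

section \<open>Multipliers for nested constraints\<close>

text \<open>On a maximal run of hot indices the two paths squeeze each other: the path of
  \<open>g\<close> enters the run weakly above, rises at least as fast, and leaves it weakly below,
  so all increments in the run coincide.\<close>

lemma path_compare:
  fixes g h :: "nat \<Rightarrow> real"
  assumes ends: "a' \<le> a" "a + sum g {v..<w} \<le> a' + sum h {v..<w}"
    and hot: "\<And>j. v \<le> j \<Longrightarrow> j < w \<Longrightarrow> hot j \<Longrightarrow> h j \<le> g j"
    and enter: "\<And>j. v \<le> j \<Longrightarrow> Suc j < w \<Longrightarrow> \<not> hot j \<Longrightarrow> hot (Suc j) \<Longrightarrow>
      a' + sum h {v..<Suc j} \<le> a + sum g {v..<Suc j}"
    and leave: "\<And>j. v \<le> j \<Longrightarrow> Suc j < w \<Longrightarrow> hot j \<Longrightarrow> \<not> hot (Suc j) \<Longrightarrow>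
      a + sum g {v..<Suc j} \<le> a' + sum h {v..<Suc j}"
    and k: "v \<le> k" "k < w" "hot k"
  shows "g k \<le> h k"
proof -
  \<comment> \<open>The order at the left end of a hot index is carried forward, the order at its
    right end (\<open>bwd\<close>) is carried backward; subtracting the two gives the claim for the
    increment.\<close>
  have fwd: "hot j \<longrightarrow> a' + sum h {v..<j} \<le> a + sum g {v..<j}" if "v \<le> j" "j < w" for j
    using that
  proof (induction j rule: dec_induct)
    case base
    then show ?case using ends by simp
  next
    case (step j)
    then show ?case
      using hot[of j] enter[of j] by (cases "hot j") (auto simp: sum.atLeastLessThan_Suc)
  qed
  have bwd: "hot j \<longrightarrow> a + sum g {v..<Suc j} \<le> a' + sum h {v..<Suc j}" if "j < w" "v \<le> j" for j
  proof -
    have "j \<le> w - 1" using that by simp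
    then show ?thesis using that(2)
    proof (induction j rule: inc_induct)
      case base
      then show ?case using ends that by simp
    next
      case (step j)
      then have "Suc j < w" by simp
      then show ?case
        using step hot[of "Suc j"] leave[of j]
        by (cases "hot (Suc j)") (auto simp: sum.atLeastLessThan_Suc)
    qed
  qed
  from fwd[of k] bwd[of k] k show ?thesis
    by (simp add: sum.atLeastLessThan_Suc)
qed

text \<open>The multipliers form an arbitrary linear order and \<open>\<xi> i \<kappa>\<close> is
  the response of variable \<open>i\<close> to one of them. Thus one theory covers positions on the
  real axis and lexicographic keys of unit steps.\<close>

locale nested_groups =
  fixes I :: "nat set" and lev :: "nat \<Rightarrow> nat" and \<xi> :: "nat \<Rightarrow> 'k::linorder \<Rightarrow> real"
    and Lb Ub :: "nat \<Rightarrow> real"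
  assumes fin: "finite I"
    and mono_xi: "\<And>i \<kappa> \<kappa>'. i \<in> I \<Longrightarrow> \<kappa> \<le> \<kappa>' \<Longrightarrow> \<xi> i \<kappa> \<le> \<xi> i \<kappa>'"
begin

definition grp :: "nat \<Rightarrow> nat set" where "grp k = {i \<in> I. lev i = k}"
definition gs :: "(nat \<Rightarrow> real) \<Rightarrow> nat \<Rightarrow> real" where "gs x k = sum x (grp k)"

text \<open>The paper's multiplier \<open>\<lambda>\<close> of group \<open>k\<close> may only change across a tight nested constraint.
  Blocks of groups are half-open, with resource \<open>a\<close> used before and \<open>b\<close> after the block.\<close>

definition sol ::
  "nat \<Rightarrow> nat \<Rightarrow> real \<Rightarrow> real \<Rightarrow> (nat \<Rightarrow> 'k) \<Rightarrow> (nat \<Rightarrow> real) \<Rightarrow> bool" where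
  "sol v w a b lam x \<longleftrightarrow>
     (\<forall>k i. v \<le> k \<longrightarrow> k < w \<longrightarrow> i \<in> grp k \<longrightarrow> x i = \<xi> i (lam k)) \<and>
     a + sum (gs x) {v..<w} = b \<and>
     (\<forall>k. v \<le> k \<longrightarrow> Suc k < w \<longrightarrow>
        Lb k \<le> a + sum (gs x) {v..<Suc k} \<and> a + sum (gs x) {v..<Suc k} \<le> Ub k \<and>
        (lam k < lam (Suc k) \<longrightarrow> a + sum (gs x) {v..<Suc k} = Ub k) \<and>
        (lam (Suc k) < lam k \<longrightarrow> a + sum (gs x) {v..<Suc k} = Lb k))"

lemma fin_grp: "finite (grp k)"
  unfolding grp_def using fin by simp

lemma gs_mono: "(\<And>i. i \<in> grp k \<Longrightarrow> x i \<le> y i) \<Longrightarrow> gs x k \<le> gs y k"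
  unfolding gs_def by (rule sum_mono)

lemma gs_cong: "(\<And>i. i \<in> grp k \<Longrightarrow> x i = y i) \<Longrightarrow> gs x k = gs y k"
  unfolding gs_def by (rule sum.cong) auto

lemma sum_gs:
  assumes "v \<le> w"
  shows "sum (gs x) {v..<w} = sum x {i\<in>I. v \<le> lev i \<and> lev i < w}"
proof -
  have "{i\<in>I. v \<le> lev i \<and> lev i < w} = (\<Union>k\<in>{v..<w}. grp k)" by (auto simp: grp_def)
  then show ?thesis
    unfolding gs_def by (simp only:) (rule sum.UNION_disjoint[symmetric], auto simp: fin_grp, auto simp: grp_def)
qed

lemma gs_squeeze:
  assumes "\<And>i. i \<in> grp k \<Longrightarrow> x i \<le> y i" "gs y k \<le> gs x k" "i \<in> grp k"
  shows "x i = y i"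
proof -
  have "(\<Sum>i\<in>grp k. y i - x i) \<le> 0"
    using assms(2) by (simp add: gs_def sum_subtractf)
  moreover have "y i - x i \<le> (\<Sum>i\<in>grp k. y i - x i)"
    using assms(1,3) by (intro member_le_sum) (auto simp: fin_grp)
  ultimately show ?thesis using assms(1)[OF assms(3)] by simp
qed

lemma sol_cong:
  assumes "\<And>i. i \<in> I \<Longrightarrow> v \<le> lev i \<Longrightarrow> lev i < w \<Longrightarrow> x i = y i"
  shows "sol v w a b lam x \<longleftrightarrow> sol v w a b lam y"
proof -
  have "sum (gs x) {v..<j} = sum (gs y) {v..<j}" if "j \<le> w" for j
    using that assms by (intro sum.cong refl gs_cong) (auto simp: grp_def)
  moreover have "x i = y i" if "v \<le> k" "k < w" "i \<in> grp k" for i k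
    using that assms by (auto simp: grp_def)
  ultimately show ?thesis
    unfolding sol_def by (auto simp del: sum.op_ivl_Suc)
qed

text \<open>Where \<open>lam'\<close> is not below \<open>lam\<close> the claim is monotonicity of
  \<open>\<xi>\<close>; the remaining groups are hot. A group turns hot only because
  \<open>lam\<close> rises, which puts the first path at \<open>Ub\<close>, or because
  \<open>lam'\<close> falls, which puts the second at \<open>Lb\<close>. Either way the paths have
  the order that \<open>path_compare\<close> asks for, and symmetrically on leaving.\<close>

lemma sol_mono:
  assumes S: "sol v w a b lam x" and S': "sol v w a' b' lam' x'"
    and ab: "a' \<le> a" "b \<le> b'" and i: "i \<in> I" "v \<le> lev i" "lev i < w"
  shows "x i \<le> x' i"
proof (cases "lam' (lev i) < lam (lev i)")
  case False
  then show ?thesis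
    using S S' i mono_xi[OF i(1)] by (auto simp: sol_def grp_def)
next
  case True
  have le: "x' i \<le> x i" if "i \<in> grp k" "lam' k < lam k" "v \<le> k" "k < w" for i k
    using that S S' mono_xi[of i "lam' k" "lam k"] by (auto simp: sol_def grp_def)
  have "gs x (lev i) \<le> gs x' (lev i)"
  proof (rule path_compare[where v = v and w = w and hot = "\<lambda>j. lam' j < lam j" and a = a and a' = a'])
    show "a + sum (gs x) {v..<w} \<le> a' + sum (gs x') {v..<w}"
      using S S' ab by (simp add: sol_def)
    show "gs x' j \<le> gs x j" if "v \<le> j" "j < w" "lam' j < lam j" for j
      using le that by (intro gs_mono) auto
    fix j assume j: "v \<le> j" "Suc j < w"
    show "a' + sum (gs x') {v..<Suc j} \<le> a + sum (gs x) {v..<Suc j}"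
      if "\<not> lam' j < lam j" "lam' (Suc j) < lam (Suc j)"
    proof (cases "lam j < lam (Suc j)")
      case True
      then show ?thesis using S S' j unfolding sol_def by metis
    next
      case False
      then have "lam' (Suc j) < lam' j" using that by auto
      then show ?thesis using S S' j unfolding sol_def by metis
    qed
    show "a + sum (gs x) {v..<Suc j} \<le> a' + sum (gs x') {v..<Suc j}"
      if "lam' j < lam j" "\<not> lam' (Suc j) < lam (Suc j)"
    proof (cases "lam (Suc j) < lam j")
      case True
      then show ?thesis using S S' j unfolding sol_def by metis
    next
      case False
      then have "lam' j < lam' (Suc j)" using that by auto
      then show ?thesis using S S' j unfolding sol_def by metis
    qed
  qed (use ab True i in auto)
  then have "x' i = x i"
    using le[of _ "lev i"] True i by (intro gs_squeeze[of "lev i"]) (auto simp: grp_def)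
  then show ?thesis by simp
qed

text \<open>The second path now belongs to an arbitrary feasible point instead of another multiplier
  solution. Hot are the groups whose multiplier lies on the far side of that of \<open>i\<close>;
  there \<open>x\<close> and \<open>z\<close> are ordered pointwise, so the squeeze makes them
  equal. Applied with a \<open>z\<close> that is zero on the slacks, this removes the
  slacks.\<close>

lemma sol_bounded_by_feasible:
  assumes S: "sol v w a b lam x"
    and z: "a + sum (gs z) {v..<w} = b"
      "\<And>k. v \<le> k \<Longrightarrow> Suc k < w \<Longrightarrow> Lb k \<le> a + sum (gs z) {v..<Suc k} \<and> a + sum (gs z) {v..<Suc k} \<le> Ub k"
    and i: "i \<in> I" "v \<le> lev i" "lev i < w"
  shows "(\<forall>\<kappa> \<ge> lam (lev i). \<forall>i\<in>I. z i \<le> \<xi> i \<kappa>) \<Longrightarrow> x i = z i"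
    and "(\<forall>\<kappa> \<le> lam (lev i). \<forall>i\<in>I. \<xi> i \<kappa> \<le> z i) \<Longrightarrow> x i = z i"
proof -
  define \<theta> where "\<theta> = lam (lev i)"
  have x: "x i = \<xi> i (lam k)" if "i \<in> grp k" "v \<le> k" "k < w" for i k
    using that S by (simp add: sol_def)
  { assume A: "\<forall>\<kappa> \<ge> lam (lev i). \<forall>i\<in>I. z i \<le> \<xi> i \<kappa>"
    have ge: "z i \<le> x i" if "i \<in> grp k" "\<theta> \<le> lam k" "v \<le> k" "k < w" for i k
      using x[OF that(1,3,4)] A that by (auto simp: \<theta>_def grp_def)
    have "gs x (lev i) \<le> gs z (lev i)"
    proof (rule path_compare[where v = v and w = w and hot = "\<lambda>j. \<theta> \<le> lam j" and a = a and a' = a])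
      show "a + sum (gs x) {v..<w} \<le> a + sum (gs z) {v..<w}"
        using S z by (simp add: sol_def)
      show "gs z j \<le> gs x j" if "v \<le> j" "j < w" "\<theta> \<le> lam j" for j
        using ge that by (intro gs_mono) auto
      fix j assume j: "v \<le> j" "Suc j < w"
      show "a + sum (gs z) {v..<Suc j} \<le> a + sum (gs x) {v..<Suc j}"
        if "\<not> \<theta> \<le> lam j" "\<theta> \<le> lam (Suc j)"
      proof -
        have "lam j < lam (Suc j)" using that by auto
        then show ?thesis using S z j unfolding sol_def by metis
      qed
      show "a + sum (gs x) {v..<Suc j} \<le> a + sum (gs z) {v..<Suc j}"
        if "\<theta> \<le> lam j" "\<not> \<theta> \<le> lam (Suc j)"
      proof -
        have "lam (Suc j) < lam j" using that by auto
        then show ?thesis using S z j unfolding sol_def by metis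
      qed
    qed (use i in \<open>auto simp: \<theta>_def\<close>)
    then have "z i = x i"
      using ge[of _ "lev i"] i by (intro gs_squeeze[of "lev i"]) (auto simp: grp_def \<theta>_def)
    then show "x i = z i" by simp }
  { assume A: "\<forall>\<kappa> \<le> lam (lev i). \<forall>i\<in>I. \<xi> i \<kappa> \<le> z i"
    have ge: "x i \<le> z i" if "i \<in> grp k" "lam k \<le> \<theta>" "v \<le> k" "k < w" for i k
      using x[OF that(1,3,4)] A that by (auto simp: \<theta>_def grp_def)
    have "gs z (lev i) \<le> gs x (lev i)"
    proof (rule path_compare[where v = v and w = w and hot = "\<lambda>j. lam j \<le> \<theta>" and a = a and a' = a])
      show "a + sum (gs z) {v..<w} \<le> a + sum (gs x) {v..<w}"
        using S z by (simp add: sol_def)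
      show "gs x j \<le> gs z j" if "v \<le> j" "j < w" "lam j \<le> \<theta>" for j
        using ge that by (intro gs_mono) auto
      fix j assume j: "v \<le> j" "Suc j < w"
      show "a + sum (gs x) {v..<Suc j} \<le> a + sum (gs z) {v..<Suc j}"
        if "\<not> lam j \<le> \<theta>" "lam (Suc j) \<le> \<theta>"
      proof -
        have "lam (Suc j) < lam j" using that by auto
        then show ?thesis using S z j unfolding sol_def by metis
      qed
      show "a + sum (gs z) {v..<Suc j} \<le> a + sum (gs x) {v..<Suc j}"
        if "lam j \<le> \<theta>" "\<not> lam (Suc j) \<le> \<theta>"
      proof -
        have "lam j < lam (Suc j)" using that by auto
        then show ?thesis using S z j unfolding sol_def by metis
      qed
    qed (use i in \<open>auto simp: \<theta>_def\<close>)
    then show "x i = z i"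
      using ge[of _ "lev i"] i by (intro gs_squeeze[of "lev i"]) (auto simp: grp_def \<theta>_def) }
qed

text \<open>Here \<open>sg\<close> translates multipliers into marginal costs. A rise of the
  multiplier means that \<open>x\<close> has reached \<open>Ub\<close>, so the deviation
  \<open>D\<close> of any competitor is nonpositive there; a fall means \<open>Lb\<close> and a
  nonnegative \<open>D\<close>. Hence each term of the summation by parts is nonnegative.\<close>

lemma sol_optimal:
  assumes S: "sol v w a b lam x" and "v \<le> w"
    and y: "a + sum (gs y) {v..<w} = b"
      "\<And>k. v \<le> k \<Longrightarrow> Suc k < w \<Longrightarrow> Lb k \<le> a + sum (gs y) {v..<Suc k} \<and> a + sum (gs y) {v..<Suc k} \<le> Ub k"
    and sg: "\<And>\<kappa> \<kappa>'. \<kappa> \<le> \<kappa>' \<Longrightarrow> sg \<kappa> \<le> (sg \<kappa>' :: real)"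
  shows "0 \<le> (\<Sum>k = v..<w. sg (lam k) * (gs y k - gs x k))"
proof (cases "v = w")
  case False
  define D where "D j = sum (gs y) {v..<j} - sum (gs x) {v..<j}" for j
  \<comment> \<open>Keeping the boundary term on the left makes the induction close; at
    \<open>w\<close> it vanishes because both totals equal \<open>b\<close>.\<close>
  have *: "sg (lam n) * D (Suc n) \<le> (\<Sum>k = v..<Suc n. sg (lam k) * (gs y k - gs x k))"
    if "v \<le> n" "n < w" for n
    using that
  proof (induction n rule: dec_induct)
    case base
    then show ?case by (simp add: D_def)
  next
    case (step n)
    have "0 \<le> (sg (lam n) - sg (lam (Suc n))) * D (Suc n)"
    proof (cases "lam n" "lam (Suc n)" rule: linorder_cases)
      case less
      then have "D (Suc n) \<le> 0" "sg (lam n) \<le> sg (lam (Suc n))"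
        using S y(2)[of n] step sg[of "lam n" "lam (Suc n)"] unfolding sol_def D_def by fastforce+
      then show ?thesis by (simp add: mult_nonpos_nonpos)
    next
      case greater
      then have "0 \<le> D (Suc n)" "sg (lam (Suc n)) \<le> sg (lam n)"
        using S y(2)[of n] step sg[of "lam (Suc n)" "lam n"] unfolding sol_def D_def by fastforce+
      then show ?thesis by simp
    qed simp
    moreover have "(\<Sum>k = v..<Suc (Suc n). sg (lam k) * (gs y k - gs x k)) =
        (\<Sum>k = v..<Suc n. sg (lam k) * (gs y k - gs x k)) + sg (lam (Suc n)) * (D (Suc (Suc n)) - D (Suc n))"
      using step by (simp add: D_def)
    moreover have "sg (lam n) * D (Suc n) \<le> (\<Sum>k = v..<Suc n. sg (lam k) * (gs y k - gs x k))"
      using step by (simp del: sum.op_ivl_Suc)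
    ultimately show ?case
      unfolding left_diff_distrib right_diff_distrib by linarith
  qed
  have "D w = 0" using S y(1) by (simp add: sol_def D_def)
  with *[of "w - 1"] False \<open>v \<le> w\<close> show ?thesis by simp
qed simp

lemma sol_single:
  assumes "\<And>i. i \<in> grp v \<Longrightarrow> x i = \<xi> i \<sigma>" "a + gs x v = b"
  shows "sol v (Suc v) a b (\<lambda>_. \<sigma>) x"
  using assms by (auto simp: sol_def le_less_Suc_eq)

text \<open>The solutions of each half with the cut at \<open>Lb s\<close> and at
  \<open>Ub s\<close> bracket the merged one, and the remaining freedom is one common multiplier
  \<open>\<sigma>\<close>. On the right half the roles of the two solutions are exchanged, since
  more resource used before the cut leaves less to be placed after it.\<close>

lemma sol_merge:
  assumes vtw: "v \<le> s" "Suc s < w"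
    and aL: "sol v (Suc s) a (Lb s) laL xaL" and aU: "sol v (Suc s) a (Ub s) laU xaU"
    and bL: "sol (Suc s) w (Lb s) b lLb xLb" and bU: "sol (Suc s) w (Ub s) b lUb xUb"
    and LU: "Lb s \<le> Ub s"
    and xl: "\<And>i. i \<in> I \<Longrightarrow> v \<le> lev i \<Longrightarrow> lev i \<le> s \<Longrightarrow> x i = max (xaL i) (min (\<xi> i \<sigma>) (xaU i))"
    and xr: "\<And>i. i \<in> I \<Longrightarrow> s < lev i \<Longrightarrow> lev i < w \<Longrightarrow> x i = max (xUb i) (min (\<xi> i \<sigma>) (xLb i))"
    and tot: "a + sum (gs x) {v..<w} = b"
  shows "\<exists>lam. sol v w a b lam x"
proof -
  \<comment> \<open>\<open>Z\<close> is the path of \<open>x\<close>; \<open>ZP\<close> and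
    \<open>ZQ\<close> glue the child paths that pass the cut at \<open>Lb s\<close> and at
    \<open>Ub s\<close>. Their allocations are \<open>xP\<close> and \<open>xQ\<close>, their
    multipliers \<open>P\<close> and \<open>Q\<close>.\<close>
  define Z where "Z j = a + sum (gs x) {v..<j}" for j
  define ZP where "ZP j = (if j \<le> Suc s then a + sum (gs xaL) {v..<j} else Lb s + sum (gs xLb) {Suc s..<j})" for j
  define ZQ where "ZQ j = (if j \<le> Suc s then a + sum (gs xaU) {v..<j} else Ub s + sum (gs xUb) {Suc s..<j})" for j
  define xP where "xP i = (if lev i \<le> s then xaL i else xLb i)" for i
  define xQ where "xQ i = (if lev i \<le> s then xaU i else xUb i)" for i
  define P where "P k = (if k \<le> s then laL k else lLb k)" for k
  define Q where "Q k = (if k \<le> s then laU k else lUb k)" for k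
  have ZPs: "ZP (Suc s) = Lb s" "ZQ (Suc s) = Ub s" and Zv: "ZP v = a" "ZQ v = a" "Z v = a"
    and Zw: "ZP w = b" "ZQ w = b" "Z w = b"
    using aL aU bL bU vtw tot by (auto simp: ZP_def ZQ_def Z_def sol_def)
  have gPc: "gs xP k = (if k \<le> s then gs xaL k else gs xLb k)" for k
    by (auto intro!: gs_cong simp: xP_def grp_def)
  have gQc: "gs xQ k = (if k \<le> s then gs xaU k else gs xUb k)" for k
    by (auto intro!: gs_cong simp: xQ_def grp_def)
  have ZPS: "ZP (Suc k) = ZP k + gs xP k" and ZQS: "ZQ (Suc k) = ZQ k + gs xQ k"
    and ZS: "Z (Suc k) = Z k + gs x k" if "v \<le> k" "k < w" for k
    using that ZPs by (auto simp: ZP_def ZQ_def Z_def gPc gQc le_Suc_eq split: if_splits)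
  have xP: "xP i = \<xi> i (P k)" and xQ: "xQ i = \<xi> i (Q k)"
    if "v \<le> k" "k < w" "i \<in> grp k" for i k
    using that aL aU bL bU by (auto simp: xP_def xQ_def P_def Q_def sol_def grp_def)
  have PQl: "xP i \<le> xQ i" if "i \<in> grp k" "v \<le> k" "k \<le> s" for i k
    using that sol_mono[OF aL aU order_refl LU, of i] by (auto simp: xP_def xQ_def grp_def)
  have PQr: "xQ i \<le> xP i" if "i \<in> grp k" "s < k" "k < w" for i k
    using that sol_mono[OF bU bL LU order_refl, of i] by (auto simp: xP_def xQ_def grp_def)
  have xl': "x i = max (xP i) (min (\<xi> i \<sigma>) (xQ i))" if "i \<in> grp k" "v \<le> k" "k \<le> s" for i k
    using that xl[of i] by (auto simp: xP_def xQ_def grp_def)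
  have xr': "x i = max (xQ i) (min (\<xi> i \<sigma>) (xP i))" if "i \<in> grp k" "s < k" "k < w" for i k
    using that xr[of i] by (auto simp: xP_def xQ_def grp_def)
  have sandl: "ZP j \<le> Z j \<and> Z j \<le> ZQ j" if "v \<le> j" "j \<le> Suc s" for j
    using that
  proof (induction j rule: dec_induct)
    case base
    then show ?case using Zv by simp
  next
    case (step j)
    have "gs xP j \<le> gs x j" "gs x j \<le> gs xQ j"
      using xl'[of _ j] PQl[of _ j] step by (force intro!: gs_mono)+
    then show ?case using step ZPS[of j] ZQS[of j] ZS[of j] vtw by simp
  qed
  have sandr: "ZP j \<le> Z j \<and> Z j \<le> ZQ j" if "j \<le> w" "s < j" for j
    using that
  proof (induction j rule: inc_induct)
    case base
    then show ?case using Zw by simp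
  next
    case (step j)
    have "gs xQ j \<le> gs x j" "gs x j \<le> gs xP j"
      using xr'[of _ j] PQr[of _ j] step by (force intro!: gs_mono)+
    then show ?case using step ZPS[of j] ZQS[of j] ZS[of j] vtw by simp
  qed
  have sand: "ZP j \<le> Z j" "Z j \<le> ZQ j" if "v \<le> j" "j \<le> w" for j
    using sandl[of j] sandr[of j] that by (cases "j \<le> s"; simp)+
  have nb: "Lb k \<le> ZP (Suc k)" "ZQ (Suc k) \<le> Ub k" if "v \<le> k" "Suc k < w" for k
  proof -
    consider "k < s" | "k = s" | "s < k" by linarith
    then show "Lb k \<le> ZP (Suc k)" "ZQ (Suc k) \<le> Ub k"
      by (cases; use that aL aU bL bU ZPs in \<open>simp add: sol_def ZP_def ZQ_def\<close>)+
  qed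
  \<comment> \<open>The cut itself is excluded: the glued multipliers come from independent
    solutions on its two sides and obey no slackness condition there.\<close>
  have Pup: "ZP (Suc k) = Ub k" if "v \<le> k" "Suc k < w" "k \<noteq> s" "P k < P (Suc k)" for k
    using that aL bL by (cases "k < s") (auto simp: sol_def ZP_def P_def simp del: sum.op_ivl_Suc split: if_splits)
  have Pdn: "ZP (Suc k) = Lb k" if "v \<le> k" "Suc k < w" "k \<noteq> s" "P (Suc k) < P k" for k
    using that aL bL by (cases "k < s") (auto simp: sol_def ZP_def P_def simp del: sum.op_ivl_Suc split: if_splits)
  have Qup: "ZQ (Suc k) = Ub k" if "v \<le> k" "Suc k < w" "k \<noteq> s" "Q k < Q (Suc k)" for k
    using that aU bU by (cases "k < s") (auto simp: sol_def ZQ_def Q_def simp del: sum.op_ivl_Suc split: if_splits)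
  have Qdn: "ZQ (Suc k) = Lb k" if "v \<le> k" "Suc k < w" "k \<noteq> s" "Q (Suc k) < Q k" for k
    using that aU bU by (cases "k < s") (auto simp: sol_def ZQ_def Q_def simp del: sum.op_ivl_Suc split: if_splits)
  have inI: "i \<in> I" if "i \<in> grp k" for i k using that by (simp add: grp_def)

  have eqlQ: "x i = xQ i" if "i \<in> grp k" "v \<le> k" "k \<le> s" "Q k < \<sigma>" for i k
    using xl'[OF that(1-3)] PQl[OF that(1-3)] xQ[of k i] mono_xi[OF inI[OF that(1)] less_imp_le[OF that(4)]] that vtw
    by (auto simp: max_def min_def split: if_splits)
  have eqlP: "x i = xP i" if "i \<in> grp k" "v \<le> k" "k \<le> s" "\<sigma> < P k" for i k
    using xl'[OF that(1-3)] PQl[OF that(1-3)] xP[of k i] mono_xi[OF inI[OF that(1)] less_imp_le[OF that(4)]] that vtw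
    by (auto simp: max_def min_def split: if_splits)
  have eql: "xP i = xQ i" if "i \<in> grp k" "v \<le> k" "k \<le> s" "Q k < P k" for i k
    using PQl[OF that(1-3)] xP[of k i] xQ[of k i] mono_xi[OF inI[OF that(1)] less_imp_le[OF that(4)]] that vtw
    by simp
  have eqrP: "x i = xP i" if "i \<in> grp k" "s < k" "k < w" "P k < \<sigma>" for i k
    using xr'[OF that(1-3)] PQr[OF that(1-3)] xP[of k i] mono_xi[OF inI[OF that(1)] less_imp_le[OF that(4)]] that vtw
    by (auto simp: max_def min_def split: if_splits)
  have eqrQ: "x i = xQ i" if "i \<in> grp k" "s < k" "k < w" "\<sigma> < Q k" for i k
    using xr'[OF that(1-3)] PQr[OF that(1-3)] xQ[of k i] mono_xi[OF inI[OF that(1)] less_imp_le[OF that(4)]] that vtw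
    by (auto simp: max_def min_def split: if_splits)
  have eqr: "xP i = xQ i" if "i \<in> grp k" "s < k" "k < w" "P k < Q k" for i k
    using PQr[OF that(1-3)] xP[of k i] xQ[of k i] mono_xi[OF inI[OF that(1)] less_imp_le[OF that(4)]] that vtw
    by simp

  text \<open>Where a child's multiplier lies on the wrong side of \<open>\<sigma>\<close>, the merged path follows that child.\<close>
  have L1: "Q k < \<sigma> \<longrightarrow> Z (Suc k) = ZQ (Suc k)" if "v \<le> k" "k \<le> s" for k
    using that
  proof (induction k rule: dec_induct)
    case base
    have "gs x v = gs xQ v" if "Q v < \<sigma>"
      using eqlQ[of _ v] that vtw by (auto intro!: gs_cong)
    then show ?case using Zv ZS[of v] ZPS[of v] ZQS[of v] vtw by auto
  next
    case (step k)
    have "Z (Suc k) = ZQ (Suc k)" if "Q (Suc k) < \<sigma>"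
      using step that Qdn[of k] nb[of k] sand[of "Suc k"] vtw by force
    moreover have "gs x (Suc k) = gs xQ (Suc k)" if "Q (Suc k) < \<sigma>"
      using eqlQ[of _ "Suc k"] that step by (auto intro!: gs_cong)
    ultimately show ?case using ZS[of "Suc k"] ZPS[of "Suc k"] ZQS[of "Suc k"] step vtw by auto
  qed
  have L2: "\<sigma> < P k \<longrightarrow> Z (Suc k) = ZP (Suc k)" if "v \<le> k" "k \<le> s" for k
    using that
  proof (induction k rule: dec_induct)
    case base
    have "gs x v = gs xP v" if "\<sigma> < P v"
      using eqlP[of _ v] that vtw by (auto intro!: gs_cong)
    then show ?case using Zv ZS[of v] ZPS[of v] ZQS[of v] vtw by auto
  next
    case (step k)
    have "Z (Suc k) = ZP (Suc k)" if "\<sigma> < P (Suc k)"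
      using step that Pup[of k] nb[of k] sand[of "Suc k"] vtw by force
    moreover have "gs x (Suc k) = gs xP (Suc k)" if "\<sigma> < P (Suc k)"
      using eqlP[of _ "Suc k"] that step by (auto intro!: gs_cong)
    ultimately show ?case using ZS[of "Suc k"] ZPS[of "Suc k"] ZQS[of "Suc k"] step vtw by auto
  qed
  \<comment> \<open>The child allocations are ordered, but their multipliers need not be. Where they
    are in the wrong order the two child paths coincide, so \<open>Z\<close> between them is
    determined as well.\<close>
  have L0: "Q k < P k \<longrightarrow> ZP (Suc k) = ZQ (Suc k)" if "v \<le> k" "k \<le> s" for k
    using that
  proof (induction k rule: dec_induct)
    case base
    have "gs xP v = gs xQ v" if "Q v < P v"
      using eql[of _ v] that vtw by (auto intro!: gs_cong)
    then show ?case using Zv ZS[of v] ZPS[of v] ZQS[of v] vtw by auto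
  next
    case (step k)
    have "ZP (Suc k) = ZQ (Suc k)" if "Q (Suc k) < P (Suc k)"
    proof -
      have "\<not> (\<not> Q k < P k \<and> \<not> Q (Suc k) < Q k \<and> \<not> P k < P (Suc k))"
        using that by (metis linorder_not_less order.trans)
      then consider "Q k < P k" | "Q (Suc k) < Q k" | "P k < P (Suc k)" by blast
      then show ?thesis
        using step Pup[of k] Qdn[of k] nb[of k] sand[of "Suc k"] vtw by cases auto
    qed
    moreover have "gs xP (Suc k) = gs xQ (Suc k)" if "Q (Suc k) < P (Suc k)"
      using eql[of _ "Suc k"] that step by (auto intro!: gs_cong)
    ultimately show ?case using ZS[of "Suc k"] ZPS[of "Suc k"] ZQS[of "Suc k"] step vtw by auto
  qed
  have R1: "P k < \<sigma> \<longrightarrow> Z k = ZP k" if "k \<le> w - 1" "s < k" for k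
    using that
  proof (induction k rule: inc_induct)
    case base
    have "gs x (w - 1) = gs xP (w - 1)" if "P (w - 1) < \<sigma>"
      using eqrP[of _ "w - 1"] that vtw by (auto intro!: gs_cong)
    moreover have "v \<le> w - 1" using vtw by simp
    ultimately show ?case using Zw ZS[of "w - 1"] ZPS[of "w - 1"] ZQS[of "w - 1"] vtw by auto
  next
    case (step k)
    have "Z (Suc k) = ZP (Suc k)" if "P k < \<sigma>"
      using step that Pup[of k] nb[of k] sand[of "Suc k"] vtw by force
    moreover have "gs x k = gs xP k" if "P k < \<sigma>"
      using eqrP[of _ k] that step by (auto intro!: gs_cong)
    ultimately show ?case using ZS[of k] ZPS[of k] ZQS[of k] step vtw by auto
  qed
  have R2: "\<sigma> < Q k \<longrightarrow> Z k = ZQ k" if "k \<le> w - 1" "s < k" for k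
    using that
  proof (induction k rule: inc_induct)
    case base
    have "gs x (w - 1) = gs xQ (w - 1)" if "\<sigma> < Q (w - 1)"
      using eqrQ[of _ "w - 1"] that vtw by (auto intro!: gs_cong)
    moreover have "v \<le> w - 1" using vtw by simp
    ultimately show ?case using Zw ZS[of "w - 1"] ZPS[of "w - 1"] ZQS[of "w - 1"] vtw by auto
  next
    case (step k)
    have "Z (Suc k) = ZQ (Suc k)" if "\<sigma> < Q k"
      using step that Qdn[of k] nb[of k] sand[of "Suc k"] vtw by force
    moreover have "gs x k = gs xQ k" if "\<sigma> < Q k"
      using eqrQ[of _ k] that step by (auto intro!: gs_cong)
    ultimately show ?case using ZS[of k] ZPS[of k] ZQS[of k] step vtw by auto
  qed
  have R0: "P k < Q k \<longrightarrow> ZP k = ZQ k" if "k \<le> w - 1" "s < k" for k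
    using that
  proof (induction k rule: inc_induct)
    case base
    have "gs xP (w - 1) = gs xQ (w - 1)" if "P (w - 1) < Q (w - 1)"
      using eqr[of _ "w - 1"] that vtw by (auto intro!: gs_cong)
    moreover have "v \<le> w - 1" using vtw by simp
    ultimately show ?case using Zw ZS[of "w - 1"] ZPS[of "w - 1"] ZQS[of "w - 1"] vtw by auto
  next
    case (step k)
    have "ZP (Suc k) = ZQ (Suc k)" if "P k < Q k"
    proof -
      have kw: "v \<le> k" "Suc k < w" using step vtw by auto
      have "\<not> (\<not> P (Suc k) < Q (Suc k) \<and> \<not> P k < P (Suc k) \<and> \<not> Q (Suc k) < Q k)"
        using that by (metis linorder_not_less order.trans)
      then consider "P (Suc k) < Q (Suc k)" | "P k < P (Suc k)" | "Q (Suc k) < Q k" by blast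
      then show ?thesis
        using step Pup[of k] Qdn[of k] nb[OF kw] sand[of "Suc k"] vtw kw by cases auto
    qed
    moreover have "gs xP k = gs xQ k" if "P k < Q k"
      using eqr[of _ k] that step by (auto intro!: gs_cong)
    ultimately show ?case using ZS[of k] ZPS[of k] ZQS[of k] step vtw by auto
  qed

  \<comment> \<open>The merged multiplier is \<open>\<sigma>\<close> clipped by the child
    multipliers. If these are in the wrong order, the outer \<open>max\<close> returns
    \<open>P k\<close> on the left and \<open>Q k\<close> on the right; \<open>mono_max\<close>
    shows that clipping multipliers clips responses.\<close>
  define lam where "lam k = (if k \<le> s then max (P k) (min \<sigma> (Q k)) else max (Q k) (min \<sigma> (P k)))" for k
  have mono_max: "\<xi> i (max p q) = max (\<xi> i p) (\<xi> i q)" "\<xi> i (min p q) = min (\<xi> i p) (\<xi> i q)"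
    if "i \<in> I" for i p q
    using mono_xi[OF that] by (auto simp: max_def min_def intro!: antisym)
  have 1: "x i = \<xi> i (lam k)" if "v \<le> k" "k < w" "i \<in> grp k" for k i
    using that xl'[of i k] xr'[of i k] xP[of k i] xQ[of k i] mono_max[of i] inI[of i k]
    by (auto simp: lam_def)
  have 2: "Z (Suc k) = Ub k" if k: "v \<le> k" "Suc k < w" and lam: "lam k < lam (Suc k)" for k
  proof -
    have sa: "ZP (Suc k) \<le> Z (Suc k)" "Z (Suc k) \<le> ZQ (Suc k)" using sand[of "Suc k"] k by auto
    note nbk = nb[OF k]
    consider "k < s" | "k = s" | "s < k" by linarith
    then show ?thesis
    proof cases
      case 1
      with lam have l: "max (P k) (min \<sigma> (Q k)) < max (P (Suc k)) (min \<sigma> (Q (Suc k)))"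
        by (simp add: lam_def)
      show ?thesis
      proof (cases "P k < P (Suc k)")
        case True
        then show ?thesis using Pup[of k] 1 k sa nbk by simp
      next
        case False
        with l have "Q k < \<sigma>" "Q k < Q (Suc k)" by (auto simp: max_def min_def split: if_splits)
        then show ?thesis using L1[of k] Qup[of k] 1 k by simp
      qed
    next
      case 2
      show ?thesis
      proof (cases "Q k < \<sigma>")
        case True
        then show ?thesis using L1[of k] 2 k ZPs by simp
      next
        case False
        with lam 2 have "\<sigma> < Q (Suc k)" by (auto simp: lam_def max_def min_def split: if_splits)
        then show ?thesis using R2[of "Suc k"] 2 k ZPs by simp
      qed
    next
      case 3
      with lam have l: "max (Q k) (min \<sigma> (P k)) < max (Q (Suc k)) (min \<sigma> (P (Suc k)))"
        by (simp add: lam_def)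
      show ?thesis
      proof (cases "P (Suc k) < Q (Suc k)")
        case True
        then have "Q k < Q (Suc k)" using l by (auto simp: max_def min_def split: if_splits)
        then show ?thesis using R0[of "Suc k"] True Qup[of k] 3 k sa by simp
      next
        case False
        then consider "Q k < Q (Suc k)" "\<sigma> < Q (Suc k)" | "P k < P (Suc k)"
          using l by (auto simp: max_def min_def split: if_splits)
        then show ?thesis
          using R2[of "Suc k"] Qup[of k] Pup[of k] 3 k sa nbk by cases auto
      qed
    qed
  qed
  have 3: "Z (Suc k) = Lb k" if k: "v \<le> k" "Suc k < w" and lam: "lam (Suc k) < lam k" for k
  proof -
    have sa: "ZP (Suc k) \<le> Z (Suc k)" "Z (Suc k) \<le> ZQ (Suc k)" using sand[of "Suc k"] k by auto
    note nbk = nb[OF k]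
    consider "k < s" | "k = s" | "s < k" by linarith
    then show ?thesis
    proof cases
      case 1
      with lam have l: "max (P (Suc k)) (min \<sigma> (Q (Suc k))) < max (P k) (min \<sigma> (Q k))"
        by (simp add: lam_def)
      show ?thesis
      proof (cases "Q k < P k")
        case True
        then have "P (Suc k) < P k" using l by (auto simp: max_def min_def split: if_splits)
        then show ?thesis using L0[of k] True Pdn[of k] 1 k sa by simp
      next
        case False
        then consider "P (Suc k) < P k" "\<sigma> < P k" | "Q (Suc k) < Q k"
          using l by (auto simp: max_def min_def split: if_splits)
        then show ?thesis
          using L2[of k] Qdn[of k] Pdn[of k] 1 k sa nbk by cases auto
      qed
    next
      case 2
      show ?thesis
      proof (cases "\<sigma> < P k")
        case True
        then show ?thesis using L2[of k] 2 k ZPs by simp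
      next
        case False
        with lam 2 have "P (Suc k) < \<sigma>" by (auto simp: lam_def max_def min_def split: if_splits)
        then show ?thesis using R1[of "Suc k"] 2 k ZPs by simp
      qed
    next
      case 3
      with lam have l: "max (Q (Suc k)) (min \<sigma> (P (Suc k))) < max (Q k) (min \<sigma> (P k))"
        by (simp add: lam_def)
      show ?thesis
      proof (cases "Q (Suc k) < Q k")
        case True
        then show ?thesis using Qdn[of k] 3 k sa nbk by simp
      next
        case False
        with l have "P (Suc k) < \<sigma>" "P (Suc k) < P k" by (auto simp: max_def min_def split: if_splits)
        then show ?thesis using R1[of "Suc k"] Pdn[of k] 3 k by simp
      qed
    qed
  qed
  have "sol v w a b lam x"
    unfolding sol_def
    using 1 tot 2 3 sand nb unfolding Z_def by (meson Suc_leD le_SucI less_imp_le order_trans)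
  then show ?thesis by (rule exI[of _ lam])
qed

end

section \<open>Deterministic approximate medians by repeated thinning\<close>

section \<open>An approximate median in linear time\<close>

lemma card_less_member:
  assumes "finite A" "B \<subseteq> A" "p \<in> A" "p \<notin> B"
  shows "card B < card A"
proof (rule psubset_card_mono[OF assms(1)])
  show "B \<subset> A" using assms(2-4) by blast
qed

lemma bij_betw_filter:
  assumes "bij_betw r B S"
  shows "bij_betw r {p\<in>B. T (r p)} {x\<in>S. T x}"
proof -
  have "r ` {p\<in>B. T (r p)} = {x\<in>S. T x}"
    using assms unfolding bij_betw_def by blast
  then show ?thesis
    using assms unfolding bij_betw_def by (metis (no_types, lifting) inj_on_subset mem_Collect_eq subsetI)
qed

lemma rank_bij:
  fixes g :: "'a \<Rightarrow> 'k::linorder"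
  assumes "finite B" "inj_on g B"
  shows "bij_betw (\<lambda>p. card {q\<in>B. g q < g p}) B {..<card B}"
proof -
  let ?r = "\<lambda>p. card {q\<in>B. g q < g p}"
  have less: "?r p < ?r p'" if "p \<in> B" "p' \<in> B" "g p < g p'" for p p'
    by (rule card_less_member[of _ _ p]) (use assms that in auto)
  have inj: "inj_on ?r B"
  proof (rule inj_onI)
    fix p p' assume *: "p \<in> B" "p' \<in> B" "?r p = ?r p'"
    then have "g p = g p'"
      using less[of p p'] less[of p' p] by (cases "g p" "g p'" rule: linorder_cases) auto
    then show "p = p'" using * assms(2) by (simp add: inj_on_eq_iff)
  qed
  have "?r p < card B" if "p \<in> B" for p
    by (rule card_less_member[of _ _ p]) (use assms that in auto)
  then have "?r ` B \<subseteq> {..<card B}" by auto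
  then have "?r ` B = {..<card B}"
    using card_image[OF inj] by (intro card_subset_eq) auto
  with inj show ?thesis unfolding bij_betw_def by simp
qed

text \<open>Translates thresholds on keys into thresholds on ranks, so that counting the survivors
  of a thinning becomes counting a residue class in an initial segment of the naturals.\<close>

lemma rank_less_iff:
  fixes g :: "'a \<Rightarrow> 'k::linorder"
  assumes "finite B" "p \<in> B"
  shows "card {q\<in>B. g q < g p} < card {q\<in>B. g q \<le> y} \<longleftrightarrow> g p \<le> y"
    and "card {q\<in>B. g q < g p} < card {q\<in>B. g q < y} \<longleftrightarrow> g p < y"
proof -
  have "card {q\<in>B. g q < g p} < card {q\<in>B. g q \<le> y}" if "g p \<le> y"
    by (rule card_less_member[of _ _ p]) (use assms that in auto)
  moreover have "card {q\<in>B. g q \<le> y} \<le> card {q\<in>B. g q < g p}" if "y < g p"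
    by (rule card_mono) (use assms that in auto)
  ultimately show "card {q\<in>B. g q < g p} < card {q\<in>B. g q \<le> y} \<longleftrightarrow> g p \<le> y"
    by (meson linorder_not_le)
  have "card {q\<in>B. g q < g p} < card {q\<in>B. g q < y}" if "g p < y"
    by (rule card_less_member[of _ _ p]) (use assms that in auto)
  moreover have "card {q\<in>B. g q < y} \<le> card {q\<in>B. g q < g p}" if "y \<le> g p"
    by (rule card_mono) (use assms that in auto)
  ultimately show "card {q\<in>B. g q < g p} < card {q\<in>B. g q < y} \<longleftrightarrow> g p < y"
    by (meson linorder_not_le)
qed

lemma card_mod4: "card {r. r < k \<and> r mod 4 = 3} = k div (4::nat)"
proof (induction k)
  case (Suc k)
  have "{r. r < Suc k \<and> r mod 4 = 3} = (if k mod 4 = 3 then insert k else id) {r. r < k \<and> r mod 4 = 3}"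
    by (auto simp: less_Suc_eq)
  then show ?case using Suc by (simp split: if_splits) presburger+
qed simp

text \<open>Keeping the ranks congruent to 3 modulo 4 divides counts from below by four and rounds
  down. The left estimate therefore has no error, and the whole rounding loss, at most 3 per block,
  falls on the right one.\<close>

lemma quantiles_block:
  fixes g :: "'a \<Rightarrow> 'k::linorder"
  assumes B: "finite B" "inj_on g B" "card B = 4 * H"
  defines "K \<equiv> {p\<in>B. card {q\<in>B. g q < g p} mod 4 = 3}"
  shows "card K = H"
    and "4 * card {p\<in>K. g p \<le> y} \<le> card {p\<in>B. g p \<le> y}"
    and "4 * card {p\<in>K. y \<le> g p} \<le> card {p\<in>B. y \<le> g p} + 3"
proof -
  let ?r = "\<lambda>p. card {q\<in>B. g q < g p}"
  have bij: "bij_betw ?r B {..<4 * H}"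
    using rank_bij[OF B(1,2)] B(3) by simp
  have card: "card {p\<in>K. P p} = card {r. r < 4 * H \<and> r mod 4 = 3 \<and> R r}"
    if "\<And>p. p \<in> B \<Longrightarrow> P p \<longleftrightarrow> R (?r p)" for P R
  proof -
    have "{p\<in>K. P p} = {p\<in>B. ?r p mod 4 = 3 \<and> R (?r p)}"
      unfolding K_def using that by blast
    then show ?thesis
      using bij_betw_same_card[OF bij_betw_filter[OF bij, of "\<lambda>r. r mod 4 = 3 \<and> R r"]] by simp
  qed
  show K: "card K = H"
    using card[of "\<lambda>_. True" "\<lambda>_. True"] card_mod4[of "4 * H"] by simp
  have le: "card {p\<in>B. P p} \<le> 4 * H" for P
    using B card_mono[of B "{p\<in>B. P p}"] by auto
  have "{r. r < 4 * H \<and> r mod 4 = 3 \<and> r < card {p\<in>B. g p \<le> y}} = {r. r < card {p\<in>B. g p \<le> y} \<and> r mod 4 = 3}"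
    using le[of "\<lambda>p. g p \<le> y"] by auto
  then have "card {p\<in>K. g p \<le> y} = card {p\<in>B. g p \<le> y} div 4"
    using card[of "\<lambda>p. g p \<le> y" "\<lambda>r. r < card {p\<in>B. g p \<le> y}", OF rank_less_iff(1)[OF B(1), symmetric]]
      card_mod4
    by simp
  then show "4 * card {p\<in>K. g p \<le> y} \<le> card {p\<in>B. g p \<le> y}" by simp
  have "{r. r < 4 * H \<and> r mod 4 = 3 \<and> r < card {p\<in>B. g p < y}} = {r. r < card {p\<in>B. g p < y} \<and> r mod 4 = 3}"
    using le[of "\<lambda>p. g p < y"] by auto
  then have 1: "card {p\<in>K. g p < y} = card {p\<in>B. g p < y} div 4"
    using card[of "\<lambda>p. g p < y" "\<lambda>r. r < card {p\<in>B. g p < y}", OF rank_less_iff(2)[OF B(1), symmetric]]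
      card_mod4
    by simp
  have split: "card {p\<in>A. g p < y} + card {p\<in>A. y \<le> g p} = card A" if "finite A" for A
  proof -
    have "card ({p\<in>A. g p < y} \<union> {p\<in>A. y \<le> g p}) = card {p\<in>A. g p < y} + card {p\<in>A. y \<le> g p}"
      using that by (intro card_Un_disjoint) auto
    moreover have "{p\<in>A. g p < y} \<union> {p\<in>A. y \<le> g p} = A" by auto
    ultimately show ?thesis by simp
  qed
  have "finite K" using B by (simp add: K_def)
  then show "4 * card {p\<in>K. y \<le> g p} \<le> card {p\<in>B. y \<le> g p} + 3"
    using split[of K] split[of B] 1 K B by simp
qed

definition block :: "nat \<Rightarrow> nat \<Rightarrow> nat set" where
  "block G p = {p div G * G..<p div G * G + G}"

lemma quantiles:
  fixes g :: "nat \<Rightarrow> 'k::linorder"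
  assumes "inj_on g {..<4 * H * nb}" "0 < H"
  defines "K \<equiv> \<lambda>n. {p. p < n \<and> card {q\<in>block (4 * H) p. g q < g p} mod 4 = 3}"
  shows "card (K (4 * H * nb)) = H * nb"
    and "4 * card {p\<in>K (4 * H * nb). g p \<le> y} \<le> card {p. p < 4 * H * nb \<and> g p \<le> y}"
    and "4 * card {p\<in>K (4 * H * nb). y \<le> g p} \<le> card {p. p < 4 * H * nb \<and> y \<le> g p} + 3 * nb"
proof -
  have "card (K (4 * H * nb)) = H * nb \<and>
      4 * card {p\<in>K (4 * H * nb). g p \<le> y} \<le> card {p. p < 4 * H * nb \<and> g p \<le> y} \<and>
      4 * card {p\<in>K (4 * H * nb). y \<le> g p} \<le> card {p. p < 4 * H * nb \<and> y \<le> g p} + 3 * nb"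
    using assms(1)
  proof (induction nb)
    case 0
    then show ?case by (simp add: K_def)
  next
    case (Suc nb)
    let ?n = "4 * H * nb" and ?B = "{4 * H * nb..<4 * H * nb + 4 * H}"
    have div: "p div (4 * H) = nb" if "p \<in> ?B" for p
      using that \<open>0 < H\<close> by (intro div_nat_eqI) (auto simp: algebra_simps)
    have blk: "block (4 * H) p = ?B" if "p \<in> ?B" for p
      unfolding block_def div[OF that] by (simp add: algebra_simps)
    have inj: "inj_on g ?B" "inj_on g {..<?n}"
      using Suc.prems by (auto elim!: inj_on_subset simp: algebra_simps)
    let ?KB = "{p\<in>?B. card {q\<in>?B. g q < g p} mod 4 = 3}"
    note Q = quantiles_block(1)[OF _ inj(1), of H] quantiles_block(2,3)[OF _ inj(1), of H y]
    have Ksplit: "{p \<in> K (4 * H * Suc nb). P p} = {p \<in> K ?n. P p} \<union> {p\<in>?KB. P p}" for P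
    proof -
      have "p < 4 * H * Suc nb \<longleftrightarrow> p < ?n \<or> p \<in> ?B" for p
        by (auto simp: algebra_simps)
      then show ?thesis unfolding K_def using blk by auto
    qed
    have card_split: "card {p \<in> K (4 * H * Suc nb). P p} = card {p \<in> K ?n. P p} + card {p\<in>?KB. P p}" for P
      unfolding Ksplit by (rule card_Un_disjoint) (auto simp: K_def)
    have all_split: "card {p. p < 4 * H * Suc nb \<and> P p} = card {p. p < ?n \<and> P p} + card {p\<in>?B. P p}" for P
    proof -
      have split: "{p. p < 4 * H * Suc nb \<and> P p} = {p. p < ?n \<and> P p} \<union> {p\<in>?B. P p}"
        by (auto simp: algebra_simps)
      show ?thesis
        unfolding split by (rule card_Un_disjoint) auto
    qed
    from Q Suc.IH[OF inj(2)] show ?case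
      using card_split[of "\<lambda>_. True"] card_split[of "\<lambda>p. g p \<le> y"] card_split[of "\<lambda>p. y \<le> g p"]
        all_split[of "\<lambda>p. g p \<le> y"] all_split[of "\<lambda>p. y \<le> g p"]
      by (simp add: algebra_simps)
  qed
  then show "card (K (4 * H * nb)) = H * nb"
    and "4 * card {p\<in>K (4 * H * nb). g p \<le> y} \<le> card {p. p < 4 * H * nb \<and> g p \<le> y}"
    and "4 * card {p\<in>K (4 * H * nb). y \<le> g p} \<le> card {p. p < 4 * H * nb \<and> y \<le> g p} + 3 * nb"
    by blast+
qed

text \<open>Two real components decide first; the index at the end tells apart events that agree in
  both.\<close>

type_synonym lexkey = "real \<times> real \<times> nat"

definition key :: "state \<Rightarrow> nat \<Rightarrow> lexkey" where
  "key s e = (reals s ''k1'' e, reals s ''k2'' e, nats s ''k3'' e)"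

definition bor :: "bexp \<Rightarrow> bexp \<Rightarrow> bexp" where "bor p q = BNot (BAnd (BNot p) (BNot q))"

definition less_key :: "nexp \<Rightarrow> nexp \<Rightarrow> bexp" where
  "less_key d e =
     bor (RLess (RGet ''k1'' d) (RGet ''k1'' e))
       (BAnd (BNot (RLess (RGet ''k1'' e) (RGet ''k1'' d)))
         (bor (RLess (RGet ''k2'' d) (RGet ''k2'' e))
           (BAnd (BNot (RLess (RGet ''k2'' e) (RGet ''k2'' d)))
             (NLess (NGet ''k3'' d) (NGet ''k3'' e)))))"

lemma bval_bor [simp]: "bval F (bor p q) s \<longleftrightarrow> bval F p s \<or> bval F q s"
  by (auto simp: bor_def)

lemma bval_less_key [simp]: "bval F (less_key d e) s \<longleftrightarrow> key s (nval d s) < key s (nval e s)"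
  by (auto simp: less_key_def key_def less_prod_def')

lemma key_cong:
  "reals s' ''k1'' = reals s ''k1'' \<Longrightarrow> reals s' ''k2'' = reals s ''k2'' \<Longrightarrow> nats s' ''k3'' = nats s ''k3''
    \<Longrightarrow> key s' = key s"
  by (simp add: key_def fun_eq_iff)

definition rank_com :: com where
  "rank_com = nset ''c'' (NConst 0) ;;
     For ''q'' (NConst 0) (nsc ''G'')
       (Cond (less_key (NGet ''sm'' (NPlus (nsc ''bb'') (nsc ''q''))) (NGet ''sm'' (nsc ''p'')))
         (ninc ''c'') Skip)"

lemma runs_rank_com:
  assumes post: "\<And>t s'. chg {''c'', ''q''} {} s s' \<Longrightarrow> t \<le> 4 * nats s ''G'' 0 + 3 \<Longrightarrow>
      nats s' ''c'' 0 = card {q. q < nats s ''G'' 0 \<and>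
        key s (nats s ''sm'' (nats s ''bb'' 0 + q)) < key s (nats s ''sm'' (nats s ''p'' 0))} \<Longrightarrow> Q t s'"
  shows "runs F rank_com Q s"
proof -
  let ?P = "\<lambda>q. key s (nats s ''sm'' (nats s ''bb'' 0 + q)) < key s (nats s ''sm'' (nats s ''p'' 0))"
  have step: "{q. q < Suc k \<and> ?P q} = (if ?P k then insert k else id) {q. q < k \<and> ?P q}" for k
    by (auto simp: less_Suc_eq)
  show ?thesis
    unfolding rank_com_def runs_simps
  proof (rule runs_For_const[where A = 0 and H = "nats s ''G'' 0" and C = 2 and
        I = "\<lambda>k s'. chg {''c'', ''q''} {} s s' \<and> nats s' ''c'' 0 = card {q. q < k \<and> ?P q}"], goal_cases)
    case (5 k s')
    then have eq: "reals s' = reals s" "v \<notin> {''c'', ''q''} \<Longrightarrow> nats s' v = nats s v" for v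
      by (auto simp: chg_def)
    have "key s' = key s" by (rule key_cong) (simp_all add: eq)
    then show ?case
      using 5 eq by (auto simp: runs_simps chg_def step)
  next
    case (6 t s')
    then show ?case by (intro post) auto
  qed (auto simp: chg_def)
qed

text \<open>Naturals have no division on this machine. Repeated subtraction takes time linear in the
  rank, hence no more than the scan that computed the rank, up to a constant.\<close>

definition mod4_com :: com where
  "mod4_com = While (NLess (NConst 3) (nsc ''c'')) (nset ''c'' (NMinus (nsc ''c'') (NConst 4)))"

lemma runs_mod4_com:
  assumes post: "\<And>t s'. chg {''c''} {} s s' \<Longrightarrow> t \<le> 2 * nats s ''c'' 0 + 1 \<Longrightarrow>
      nats s' ''c'' 0 = nats s ''c'' 0 mod 4 \<Longrightarrow> Q t s'"
  shows "runs F mod4_com Q s"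
  unfolding mod4_com_def
proof (rule runs_While[where \<Phi> = "\<lambda>s'. 2 * nats s' ''c'' 0" and
      I = "\<lambda>s'. chg {''c''} {} s s' \<and> nats s' ''c'' 0 mod 4 = nats s ''c'' 0 mod 4"], goal_cases)
  case (2 s')
  then show ?case by (auto simp: runs_simps chg_def le_mod_geq)
next
  case (3 t s')
  then show ?case by (intro post) auto
qed (auto simp: chg_def)

definition copy_com :: com where
  "copy_com = For ''p'' (NConst 0) (nsc ''no'') (NPut ''sm'' (nsc ''p'') (NGet ''so'' (nsc ''p'')))"

lemma runs_copy_com:
  assumes post: "\<And>t s'. chg {''p'', ''sm''} {} s s' \<Longrightarrow> t \<le> 3 * nats s ''no'' 0 + 2 \<Longrightarrow>
      (\<And>p. p < nats s ''no'' 0 \<Longrightarrow> nats s' ''sm'' p = nats s ''so'' p) \<Longrightarrow> Q t s'"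
  shows "runs F copy_com Q s"
  unfolding copy_com_def
proof (rule runs_For_const[where A = 0 and H = "nats s ''no'' 0" and C = 1 and
      I = "\<lambda>k s'. chg {''p'', ''sm''} {} s s' \<and> (\<forall>p<k. nats s' ''sm'' p = nats s ''so'' p)"], goal_cases)
  case (5 k s')
  then have "nats s' ''so'' = nats s ''so''" by (simp add: chg_def)
  with 5 show ?case by (simp add: runs_simps chg_def less_Suc_eq)
next
  case (6 t s')
  then show ?case by (intro post) auto
qed (simp_all add: chg_def)

text \<open>\<open>bb\<close> follows \<open>p\<close> as the start of its block. Survivors are
  collected in \<open>so\<close> and copied back only at the end, because the ranks within a block
  refer to the old sample.\<close>

definition thin_com :: com where
  "thin_com = nset ''no'' (NConst 0) ;; nset ''bb'' (NConst 0) ;;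
     For ''p'' (NConst 0) (nsc ''ln'')
       (Cond (NLess (nsc ''p'') (NPlus (nsc ''bb'') (nsc ''G''))) Skip
          (nset ''bb'' (NPlus (nsc ''bb'') (nsc ''G''))) ;;
        rank_com ;; mod4_com ;;
        Cond (NLess (NConst 2) (nsc ''c''))
          (NPut ''so'' (nsc ''no'') (NGet ''sm'' (nsc ''p'')) ;; ninc ''no'') Skip) ;;
     copy_com"

lemma bij_betw_extend:
  assumes "bij_betw e {..<n} A" "k \<notin> A"
  shows "bij_betw (e(n := k)) {..<Suc n} (insert k A)"
proof -
  have "bij_betw (e(n := k)) {..<n} A"
    using assms(1) by (subst bij_betw_cong[of _ _ e]) auto
  moreover have "bij_betw (e(n := k)) {n} {k}" by (simp add: bij_betw_def)
  ultimately have "bij_betw (e(n := k)) ({..<n} \<union> {n}) (A \<union> {k})"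
    by (rule bij_betw_combine) (use assms(2) in auto)
  then show ?thesis by (simp add: lessThan_Suc)
qed

definition thinned :: "(nat \<Rightarrow> 'k::linorder) \<Rightarrow> nat \<Rightarrow> nat \<Rightarrow> nat set" where
  "thinned g G n = {p. p < n \<and> card {q\<in>block G p. g q < g p} mod 4 = 3}"

lemma thinned_Suc:
  "thinned g G (Suc n) =
     (if card {q\<in>block G n. g q < g n} mod 4 = 3 then insert n (thinned g G n) else thinned g G n)"
proof -
  have "p < Suc n \<longleftrightarrow> p < n \<or> p = n" for p by auto
  then show ?thesis unfolding thinned_def by (cases "card {q\<in>block G n. g q < g n} mod 4 = 3") auto
qed

text \<open>On entry with index \<open>k\<close> the base is still the one of \<open>k - 1\<close>;
  truncated subtraction makes this correct at \<open>k = 0\<close> too.\<close>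

lemma block_base:
  assumes "0 < G" "b = (k - 1) div G * G"
  shows "(if k < b + G then b else b + G) = k div G * (G::nat)"
proof (cases k)
  case (Suc j)
  have "j div G * G \<le> j" "j < j div G * G + G"
    using assms(1) div_mult_mod_eq[of j G] mod_less_divisor[of G j] by linarith+
  moreover define d where "d = j div G"
  ultimately have d: "d * G \<le> j" "j < d * G + G" by simp_all
  then have "Suc j div G = (if Suc j < d * G + G then d else Suc d)"
    by (auto intro!: div_nat_eqI simp: algebra_simps)
  then show ?thesis using Suc assms(2) by (simp add: d_def)
qed (use assms in simp)

lemma nput_same: "nats s v i = k \<Longrightarrow> nput v i k s = s"
  by (cases s) (auto simp: nput_def fun_upd_idem)

lemma runs_thin_com:
  fixes s :: state
  defines "f \<equiv> nats s ''sm''" and "G \<equiv> nats s ''G'' 0" and "n \<equiv> nats s ''ln'' 0"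
  assumes "0 < G"
    and post: "\<And>t s' e. chg {''no'', ''bb'', ''p'', ''c'', ''q'', ''so'', ''sm''} {} s s' \<Longrightarrow>
      bij_betw e {..<nats s' ''no'' 0} (thinned (key s \<circ> f) G n) \<Longrightarrow>
      (\<And>j. j < nats s' ''no'' 0 \<Longrightarrow> nats s' ''sm'' j = f (e j)) \<Longrightarrow>
      t \<le> n * (6 * G + 20) + 3 * nats s' ''no'' 0 + 6 \<Longrightarrow> Q t s'"
  shows "runs F thin_com Q s"
  unfolding thin_com_def runs_simps
proof (rule runs_For_const[where A = 0 and H = n and C = "6 * G + 18" and
      I = "\<lambda>k s'. chg {''no'', ''bb'', ''p'', ''c'', ''q'', ''so''} {} s s' \<and>
        nats s' ''bb'' 0 = (k - 1) div G * G \<and>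
        (\<exists>e. bij_betw e {..<nats s' ''no'' 0} (thinned (key s \<circ> f) G k) \<and>
          (\<forall>j<nats s' ''no'' 0. nats s' ''so'' j = f (e j)))"], goal_cases)
  case 3
  then show ?case by (auto simp: chg_def thinned_def)
next
  case (5 k s1)
  then obtain e where e: "bij_betw e {..<nats s1 ''no'' 0} (thinned (key s \<circ> f) G k)"
      "\<And>j. j < nats s1 ''no'' 0 \<Longrightarrow> nats s1 ''so'' j = f (e j)"
    by blast
  from 5 have chg: "chg {''no'', ''bb'', ''p'', ''c'', ''q'', ''so''} {} s s1"
    and bb: "nats s1 ''bb'' 0 = (k - 1) div G * G" and p: "nats s1 ''p'' 0 = k" "k < n" by auto
  let ?r = "card {q\<in>block G k. (key s \<circ> f) q < (key s \<circ> f) k}"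
  \<comment> \<open>The program scans offsets inside the block, \<open>thinned\<close> speaks of
    absolute indices; the shift by the block base matches the two counts.\<close>
  have rank: "card {q. q < G \<and> key s (f (k div G * G + q)) < key s (f k)} = ?r"
  proof (rule bij_betw_same_card[of "\<lambda>q. k div G * G + q"])
    show "bij_betw (\<lambda>q. k div G * G + q) {q. q < G \<and> key s (f (k div G * G + q)) < key s (f k)}
        {q\<in>block G k. (key s \<circ> f) q < (key s \<circ> f) k}"
      unfolding bij_betw_def
    proof (intro conjI set_eqI iffI)
      fix q assume "q \<in> {q \<in> block G k. (key s \<circ> f) q < (key s \<circ> f) k}"
      then show "q \<in> (+) (k div G * G) ` {q. q < G \<and> key s (f (k div G * G + q)) < key s (f k)}"
        by (intro image_eqI[of _ _ "q - k div G * G"]) (auto simp: block_def)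
    qed (auto simp: block_def)
  qed
  have rG: "?r \<le> G"
    unfolding rank[symmetric] using card_mono[of "{..<G}" "{q. q < G \<and> key s (f (k div G * G + q)) < key s (f k)}"]
    by auto
  define s2 where "s2 = nput ''bb'' 0 (k div G * G) s1"
  have s2: "chg {''bb''} {} s1 s2" "nats s2 ''bb'' 0 = k div G * G"
    by (auto simp: s2_def chg_def)
  have keys: "key s2 = key s" using chg s2(1) by (intro key_cong) (auto simp: chg_def)
  have body: "runs F (rank_com ;; mod4_com ;;
        Cond (NLess (NConst 2) (nsc ''c''))
          (NPut ''so'' (nsc ''no'') (NGet ''sm'' (nsc ''p'')) ;; ninc ''no'') Skip)
       (\<lambda>t s'. t \<le> 6 * G + 15 \<and> nats s' ''p'' 0 = k \<and> chg {''no'', ''bb'', ''p'', ''c'', ''q'', ''so''} {} s s' \<and>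
          nats s' ''bb'' 0 = k div G * G \<and>
          (\<exists>e. bij_betw e {..<nats s' ''no'' 0} (thinned (key s \<circ> f) G (Suc k)) \<and>
          (\<forall>j<nats s' ''no'' 0. nats s' ''so'' j = f (e j)))) s2"
    unfolding runs_Seq
  proof (rule runs_rank_com)
    fix t s3
    assume s3: "chg {''c'', ''q''} {} s2 s3" "t \<le> 4 * nats s2 ''G'' 0 + 3"
      "nats s3 ''c'' 0 = card {q. q < nats s2 ''G'' 0 \<and>
        key s2 (nats s2 ''sm'' (nats s2 ''bb'' 0 + q)) < key s2 (nats s2 ''sm'' (nats s2 ''p'' 0))}"
    have G2: "nats s2 ''G'' 0 = G" "nats s2 ''sm'' = f" "nats s2 ''p'' 0 = k"
      using chg s2 p by (auto simp: chg_def G_def f_def s2_def)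
    have c: "nats s3 ''c'' 0 = ?r"
      using s3(3) unfolding G2 s2(2) keys rank .
    show "runs F mod4_com (\<lambda>ta s'. runs F (Cond (NLess (NConst 2) (nsc ''c''))
          (NPut ''so'' (nsc ''no'') (NGet ''sm'' (nsc ''p'')) ;; ninc ''no'') Skip)
       (\<lambda>t' s'. t + (ta + t') \<le> 6 * G + 15 \<and> nats s' ''p'' 0 = k \<and> chg {''no'', ''bb'', ''p'', ''c'', ''q'', ''so''} {} s s' \<and>
          nats s' ''bb'' 0 = k div G * G \<and>
          (\<exists>e. bij_betw e {..<nats s' ''no'' 0} (thinned (key s \<circ> f) G (Suc k)) \<and>
          (\<forall>j<nats s' ''no'' 0. nats s' ''so'' j = f (e j)))) s') s3"
    proof (rule runs_mod4_com)
      fix t' s4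
      assume s4: "chg {''c''} {} s3 s4" "t' \<le> 2 * nats s3 ''c'' 0 + 1" "nats s4 ''c'' 0 = nats s3 ''c'' 0 mod 4"
      have eqs: "nats s4 ''p'' = nats s1 ''p''" "nats s4 ''no'' = nats s1 ''no''" "nats s4 ''so'' = nats s1 ''so''"
        "nats s4 ''sm'' = f" "nats s4 ''bb'' 0 = k div G * G"
        using s2 s3 s4 G2 by (auto simp: chg_def)
      have chg4: "chg {''no'', ''bb'', ''p'', ''c'', ''q'', ''so''} {} s s4"
        using chg s2(1) s3(1) s4(1) by (auto simp: chg_def)
      have t: "t + t' \<le> 6 * G + 4" using s3(2) s4(2) c G2 rG by simp
      show "runs F (Cond (NLess (NConst 2) (nsc ''c''))
          (NPut ''so'' (nsc ''no'') (NGet ''sm'' (nsc ''p'')) ;; ninc ''no'') Skip)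
       (\<lambda>ta s'. t + (t' + ta) \<le> 6 * G + 15 \<and> nats s' ''p'' 0 = k \<and> chg {''no'', ''bb'', ''p'', ''c'', ''q'', ''so''} {} s s' \<and>
          nats s' ''bb'' 0 = k div G * G \<and>
          (\<exists>e. bij_betw e {..<nats s' ''no'' 0} (thinned (key s \<circ> f) G (Suc k)) \<and>
          (\<forall>j<nats s' ''no'' 0. nats s' ''so'' j = f (e j)))) s4"
      proof (cases "?r mod 4 = 3")
        case True
        have "bij_betw (e(nats s1 ''no'' 0 := k)) {..<Suc (nats s1 ''no'' 0)} (thinned (key s \<circ> f) G (Suc k))"
          using bij_betw_extend[OF e(1), of k] True by (simp add: thinned_Suc) (simp add: thinned_def)
        note bij' = this
        have c2: "bval F (NLess (NConst 2) (nsc ''c'')) s4" using True s4(3) c by simp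
        show ?thesis
          unfolding runs_Cond if_P[OF c2] runs_Seq runs_NPut
        proof (intro conjI exI[of _ "e(nats s1 ''no'' 0 := k)"], goal_cases)
          case 3
          then show ?case using chg4 by (simp add: chg_def)
        next
          case 5
          then show ?case using bij' eqs by simp
        next
          case 6
          then show ?case using e(2) eqs p by (simp add: less_Suc_eq)
        qed (use t eqs p in simp_all)
      next
        case False
        have "?r mod 4 < 4" by simp
        with False have c2: "\<not> bval F (NLess (NConst 2) (nsc ''c'')) s4"
          using s4(3) c by auto
        show ?thesis
          unfolding runs_Cond if_not_P[OF c2] runs_Skip
        proof (intro conjI exI[of _ e], goal_cases)
          case 5
          then show ?case using e(1) eqs False by (simp add: thinned_Suc)
        next
          case 6
          then show ?case using e(2) eqs by simp
        qed (use t eqs p chg4 in simp_all)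
      qed
    qed
  qed
  have G1: "nats s1 ''G'' 0 = G" using chg by (auto simp: chg_def G_def)
  have bb2: "(if k < (k - 1) div G * G + G then (k - 1) div G * G else (k - 1) div G * G + G) = k div G * G"
    by (rule block_base) (use \<open>0 < G\<close> in auto)
  have fin: "(\<lambda>t s'. t \<le> 6 * G + 15 \<and> nats s' ''p'' 0 = k \<and> chg {''no'', ''bb'', ''p'', ''c'', ''q'', ''so''} {} s s' \<and>
          nats s' ''bb'' 0 = k div G * G \<and>
          (\<exists>e. bij_betw e {..<nats s' ''no'' 0} (thinned (key s \<circ> f) G (Suc k)) \<and>
          (\<forall>j<nats s' ''no'' 0. nats s' ''so'' j = f (e j)))) t s' \<Longrightarrow>
     2 + t \<le> 6 * G + 18 \<and> nats s' ''p'' 0 = k \<and> (chg {''no'', ''bb'', ''p'', ''c'', ''q'', ''so''} {} s (nput ''p'' 0 (Suc k) s') \<and>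
        nats (nput ''p'' 0 (Suc k) s') ''bb'' 0 = (Suc k - 1) div G * G \<and>
        (\<exists>e. bij_betw e {..<nats (nput ''p'' 0 (Suc k) s') ''no'' 0} (thinned (key s \<circ> f) G (Suc k)) \<and>
          (\<forall>j<nats (nput ''p'' 0 (Suc k) s') ''no'' 0. nats (nput ''p'' 0 (Suc k) s') ''so'' j = f (e j))))" for t s'
    by (auto simp: chg_def)
  show ?case
  proof (cases "k < (k - 1) div G * G + G")
    case True
    then have "nats s1 ''bb'' 0 = k div G * G" using bb2 bb by simp
    then have "s2 = s1" by (simp add: s2_def nput_same)
    then show ?thesis
      unfolding runs_Seq[of F "Cond _ _ _"] runs_Cond[of F _ Skip] runs_Skip runs_NPut
      using True bb G1 p runs_mono[OF body fin] by simp
  next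
    case False
    then have "s2 = nput ''bb'' 0 ((k - 1) div G * G + G) s1" using bb2 by (simp add: s2_def)
    then show ?thesis
      unfolding runs_Seq[of F "Cond _ _ _"] runs_Cond[of F _ Skip] runs_Skip runs_NPut
      using False bb G1 p runs_mono[OF body fin] by simp
  qed
next
  case (6 t s1)
  then obtain e where e: "bij_betw e {..<nats s1 ''no'' 0} (thinned (key s \<circ> f) G n)"
      "\<And>j. j < nats s1 ''no'' 0 \<Longrightarrow> nats s1 ''so'' j = f (e j)"
      and chg: "chg {''no'', ''bb'', ''p'', ''c'', ''q'', ''so''} {} s s1"
    by blast
  show ?case
  proof (rule runs_copy_com)
    fix t' s2
    assume s2: "chg {''p'', ''sm''} {} s1 s2" "t' \<le> 3 * nats s1 ''no'' 0 + 2"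
      "\<And>p. p < nats s1 ''no'' 0 \<Longrightarrow> nats s2 ''sm'' p = nats s1 ''so'' p"
    have no: "nats s2 ''no'' 0 = nats s1 ''no'' 0" using s2(1) by (auto simp: chg_def)
    show "Q (1 + (1 + (t + t'))) s2"
    proof (rule post)
      show "chg {''no'', ''bb'', ''p'', ''c'', ''q'', ''so'', ''sm''} {} s s2"
        using chg s2(1) by (auto simp: chg_def)
      show "bij_betw e {..<nats s2 ''no'' 0} (thinned (key s \<circ> f) G n)" using e no by simp
      show "nats s2 ''sm'' j = f (e j)" if "j < nats s2 ''no'' 0" for j
        using that s2(3) e(2) no by simp
      show "1 + (1 + (t + t')) \<le> n * (6 * G + 20) + 3 * nats s2 ''no'' 0 + 6"
        using 6(3) s2(2) no by (simp add: algebra_simps)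
    qed
  qed
qed (auto simp: chg_def n_def)

lemma thinned_counts:
  fixes g :: "nat \<Rightarrow> 'k::linorder"
  assumes inj: "inj_on g {..<n}" and n: "n = 8 * S * nb" "0 < S"
    and e: "bij_betw e {..<m} (thinned g (8 * S) n)" and g': "\<And>j. j < m \<Longrightarrow> g' j = g (e j)"
  shows "m = 2 * S * nb" and "inj_on g' {..<m}" and "\<And>j. j < m \<Longrightarrow> e j < n"
    and "4 * card {p. p < m \<and> g' p \<le> y} \<le> card {p. p < n \<and> g p \<le> y}"
    and "4 * card {p. p < m \<and> y \<le> g' p} \<le> card {p. p < n \<and> y \<le> g p} + 3 * nb"
proof -
  have K: "{p. p < 4 * (2 * S) * nb \<and> card {q \<in> block (4 * (2 * S)) p. g q < g p} mod 4 = 3} = thinned g (8 * S) n"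
    using n by (simp add: thinned_def)
  have "inj_on g {..<4 * (2 * S) * nb}" using inj n by simp
  note Q = quantiles[OF this, unfolded K]
  show "m = 2 * S * nb"
    using bij_betw_same_card[OF e] Q(1) n by simp
  show en: "e j < n" if "j < m" for j
    using that e by (auto simp: bij_betw_def thinned_def)
  show "inj_on g' {..<m}"
  proof (rule inj_onI)
    fix i j assume "i \<in> {..<m}" "j \<in> {..<m}" "g' i = g' j"
    then show "i = j"
      using g' en inj_onD[OF inj, of "e i" "e j"] bij_betw_imp_inj_on[OF e] by (auto simp: inj_on_eq_iff)
  qed
  have card: "card {p. p < m \<and> P (g' p)} = card {p \<in> thinned g (8 * S) n. P (g p)}" for P
  proof -
    have "{p. p < m \<and> P (g' p)} = {p \<in> {..<m}. P (g (e p))}" using g' by auto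
    then show ?thesis
      using bij_betw_same_card[OF bij_betw_filter[OF e, of "\<lambda>p. P (g p)"]] by simp
  qed
  show "4 * card {p. p < m \<and> g' p \<le> y} \<le> card {p. p < n \<and> g p \<le> y}"
    using Q(2)[of y] n card[of "\<lambda>x. x \<le> y"] by simp
  show "4 * card {p. p < m \<and> y \<le> g' p} \<le> card {p. p < n \<and> y \<le> g p} + 3 * nb"
    using Q(3)[of y] n card[of "\<lambda>x. y \<le> x"] by simp
qed

definition dbl :: "nexp \<Rightarrow> nexp" where "dbl e = NPlus e e"

lemma nval_dbl [simp]: "nval (dbl e) s = 2 * nval e s"
  by (simp add: dbl_def)

text \<open>A round costs about \<open>ln * S\<close>, since ranks are taken by brute force in
  blocks of length \<open>8 * S\<close>. It quarters \<open>ln\<close> and doubles \<open>S\<close>,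
  so this product halves and the costs form a geometric series.\<close>

definition refine_com :: com where
  "refine_com = While (NLess (nsc ''S'') (nsc ''ln''))
     (nset ''G'' (dbl (dbl (dbl (nsc ''S'')))) ;; thin_com ;; nset ''ln'' (nsc ''no'') ;;
      nset ''S'' (dbl (nsc ''S'')))"

text \<open>A sample of \<open>len\<close> elements represents \<open>U\<close> elements, each with weight \<open>\<omega>\<close>; the term \<open>6 * \<omega> * 8 ^ \<rho>\<close>
  is the error allowance for the remaining \<open>\<rho>\<close> thinning rounds.\<close>

definition sample_inv :: "(nat \<Rightarrow> 'k::linorder) \<Rightarrow> nat set \<Rightarrow> nat \<Rightarrow> (nat \<Rightarrow> nat) \<Rightarrow> nat \<Rightarrow> nat \<Rightarrow> nat \<Rightarrow> nat \<Rightarrow> bool" where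
  "sample_inv kf A U f len S \<rho> \<omega> \<longleftrightarrow>
     len = S * 8 ^ \<rho> \<and> U = \<omega> * len \<and> S * S = 4 * \<omega> \<and> even S \<and> 2 \<le> S \<and>
     inj_on (kf \<circ> f) {..<len} \<and> f ` {..<len} \<subseteq> A \<and>
     (\<forall>y. \<omega> * card {p. p < len \<and> kf (f p) \<le> y} \<le> card {a\<in>A. kf a \<le> y} \<and>
       8 * \<omega> * card {p. p < len \<and> y \<le> kf (f p)} + 6 * \<omega> * 8 ^ \<rho> \<le> 8 * card {a\<in>A. y \<le> kf a} + 3 * U)"

text \<open>The round loses 3 elements in each of \<open>8 ^ \<rho>\<close> blocks, with weight
  \<open>8 * \<omega>\<close> each. This is half of the old allowance
  \<open>6 * \<omega> * 8 ^ Suc \<rho>\<close>; the other half is the new allowance, as the weight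
  is multiplied by 4 while the power is divided by 8.\<close>

lemma sample_inv_step:
  assumes "sample_inv kf A U f len S (Suc \<rho>) \<omega>"
    and e: "bij_betw e {..<m} (thinned (kf \<circ> f) (8 * S) len)" and f': "\<And>j. j < m \<Longrightarrow> f' j = f (e j)"
  shows "sample_inv kf A U f' m (2 * S) \<rho> (4 * \<omega>)" "4 * m = len"
proof -
  note inv = assms(1)[unfolded sample_inv_def]
  have n: "len = 8 * S * 8 ^ \<rho>" "0 < S" using inv by auto
  have "inj_on (kf \<circ> f) {..<len}" using inv by blast
  note T = thinned_counts[OF this n e, of "kf \<circ> f'"]
  have f'': "(kf \<circ> f') j = (kf \<circ> f) (e j)" if "j < m" for j using f' that by simp
  have m: "m = 2 * S * 8 ^ \<rho>" using T(1) f'' by blast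
  then show "4 * m = len" using n by simp
  have c1: "4 * card {p. p < m \<and> kf (f' p) \<le> y} \<le> card {p. p < len \<and> kf (f p) \<le> y}" for y
    using T(4)[of y] f'' by simp
  have c2: "4 * card {p. p < m \<and> y \<le> kf (f' p)} \<le> card {p. p < len \<and> y \<le> kf (f p)} + 3 * 8 ^ \<rho>" for y
    using T(5)[of y] f'' by simp
  have "4 * \<omega> * card {p. p < m \<and> kf (f' p) \<le> y} \<le> card {a\<in>A. kf a \<le> y}" for y
  proof -
    have "4 * \<omega> * card {p. p < m \<and> kf (f' p) \<le> y} = \<omega> * (4 * card {p. p < m \<and> kf (f' p) \<le> y})" by simp
    also have "\<dots> \<le> \<omega> * card {p. p < len \<and> kf (f p) \<le> y}" using c1 by (rule mult_le_mono2)
    also have "\<dots> \<le> card {a\<in>A. kf a \<le> y}" using inv by blast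
    finally show ?thesis .
  qed
  moreover have "8 * (4 * \<omega>) * card {p. p < m \<and> y \<le> kf (f' p)} + 6 * (4 * \<omega>) * 8 ^ \<rho> \<le> 8 * card {a\<in>A. y \<le> kf a} + 3 * U" for y
  proof -
    have "8 * (4 * \<omega>) * card {p. p < m \<and> y \<le> kf (f' p)} + 6 * (4 * \<omega>) * 8 ^ \<rho> =
        8 * \<omega> * (4 * card {p. p < m \<and> y \<le> kf (f' p)}) + 24 * \<omega> * 8 ^ \<rho>" by simp
    also have "\<dots> \<le> 8 * \<omega> * (card {p. p < len \<and> y \<le> kf (f p)} + 3 * 8 ^ \<rho>) + 24 * \<omega> * 8 ^ \<rho>"
      using c2 by (intro add_mono mult_le_mono2) auto
    also have "\<dots> = 8 * \<omega> * card {p. p < len \<and> y \<le> kf (f p)} + 6 * \<omega> * 8 ^ Suc \<rho>"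
      by (simp add: algebra_simps)
    also have "\<dots> \<le> 8 * card {a\<in>A. y \<le> kf a} + 3 * U" using inv by blast
    finally show ?thesis .
  qed
  moreover have "inj_on (kf \<circ> f') {..<m}" using T(2) f'' by blast
  moreover have "f' ` {..<m} \<subseteq> A"
    using T(3) f' f'' inv by fastforce
  ultimately show "sample_inv kf A U f' m (2 * S) \<rho> (4 * \<omega>)"
    using inv m unfolding sample_inv_def by (simp add: algebra_simps)
qed

abbreviation "refine_vars \<equiv> {''no'', ''bb'', ''p'', ''c'', ''q'', ''so'', ''sm'', ''G'', ''ln'', ''S''}"

lemma runs_refine_com:
  assumes inv: "sample_inv (key s) A U (nats s ''sm'') (nats s ''ln'' 0) (nats s ''S'' 0) \<rho> \<omega>"
    and post: "\<And>t s' \<omega>. chg refine_vars {} s s' \<Longrightarrow>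
      sample_inv (key s) A U (nats s' ''sm'') (nats s' ''ln'' 0) (nats s' ''S'' 0) 0 \<omega> \<Longrightarrow>
      t \<le> 120 * (nats s ''ln'' 0 * nats s ''S'' 0) + 1 \<Longrightarrow> Q t s'"
  shows "runs F refine_com Q s"
  unfolding refine_com_def
\<comment> \<open>A round that reduces the sample from \<open>4 * m\<close> to \<open>m\<close>
  lowers the potential by \<open>240 * (m * S)\<close>. Its cost, at most
  \<open>192 * (m * S) + 83 * m + 6\<close> and a few steps, stays below because
  \<open>S \<ge> 2\<close>.\<close>
proof (rule runs_While[where \<Phi> = "\<lambda>s'. 120 * (nats s' ''ln'' 0 * nats s' ''S'' 0)" and
      I = "\<lambda>s'. chg refine_vars {} s s' \<and> (\<exists>\<rho> \<omega>.
        sample_inv (key s) A U (nats s' ''sm'') (nats s' ''ln'' 0) (nats s' ''S'' 0) \<rho> \<omega>)"], goal_cases)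
  case 1
  then show ?case using inv by (auto simp: chg_def)
next
  case (2 s1)
  then obtain \<rho>' \<omega> where chg: "chg refine_vars {} s s1"
    and I1: "sample_inv (key s) A U (nats s1 ''sm'') (nats s1 ''ln'' 0) (nats s1 ''S'' 0) \<rho>' \<omega>"
    by blast
  from I1 2 obtain \<rho> where \<rho>: "\<rho>' = Suc \<rho>" by (cases \<rho>') (auto simp: sample_inv_def)
  let ?S = "nats s1 ''S'' 0" and ?len = "nats s1 ''ln'' 0"
  define s2 where "s2 = nput ''G'' 0 (8 * ?S) s1"
  have S2: "2 \<le> ?S" using I1 by (simp add: sample_inv_def)
  have s2: "nats s2 ''sm'' = nats s1 ''sm''" "nats s2 ''G'' 0 = 8 * ?S" "nats s2 ''ln'' 0 = ?len"
    "nats s2 ''S'' 0 = ?S" "chg refine_vars {} s s2"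
    using chg by (auto simp: s2_def chg_def)
  have key: "key s2 = key s" using s2(5) by (intro key_cong) (auto simp: chg_def)
  have "runs F (thin_com ;; nset ''ln'' (nsc ''no'') ;; nset ''S'' (dbl (nsc ''S'')))
      (\<lambda>t s'. (chg refine_vars {} s s' \<and> (\<exists>\<rho> \<omega>.
        sample_inv (key s) A U (nats s' ''sm'') (nats s' ''ln'' 0) (nats s' ''S'' 0) \<rho> \<omega>)) \<and>
        1 + (1 + t) + 120 * (nats s' ''ln'' 0 * nats s' ''S'' 0) \<le> 120 * (?len * ?S)) s2"
    unfolding runs_Seq runs_NPut
  proof (rule runs_thin_com, goal_cases)
    case 1
    then show ?case using S2 s2 by simp
  next
    case (2 t s3 e)
    note s3 = this
    note st = sample_inv_step[OF I1[unfolded \<rho>], of e "nats s3 ''no'' 0" "nats s3 ''sm''"]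
    have st1: "sample_inv (key s) A U (nats s3 ''sm'') (nats s3 ''no'' 0) (2 * ?S) \<rho> (4 * \<omega>)"
      and no: "4 * nats s3 ''no'' 0 = ?len"
      using st s3(2,3) unfolding s2 key by blast+
    have S3: "nats s3 ''S'' 0 = ?S" using s3(1) s2 by (simp add: chg_def)
    define m where "m = nats s3 ''no'' 0"
    have m1: "1 \<le> m" using st1 S2 by (auto simp: sample_inv_def m_def)
    have lm: "?len = 4 * m" using no m_def by simp
    have "t \<le> 4 * m * (48 * ?S + 20) + 3 * m + 6"
      using s3(4) unfolding s2 lm by (simp add: m_def)
    also have "\<dots> = 192 * (m * ?S) + 83 * m + 6" by (simp add: algebra_simps)
    finally have t: "t \<le> 192 * (m * ?S) + 83 * m + 6" .
    have mS: "2 * m \<le> m * ?S" "2 \<le> m * ?S"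
      using S2 m1 mult_le_mono[of 1 m 2 ?S] mult_le_mono2[of 2 ?S m] by auto
    have fin: "chg refine_vars {} s (nput ''S'' 0 (2 * ?S) (nput ''ln'' 0 m s3))"
      using s2(5) s3(1) by (auto simp: chg_def)
    show ?case
    proof (intro conjI, goal_cases)
      case 1
      then show ?case using fin by (simp add: S3 m_def)
    next
      case 2
      then show ?case using st1 by (auto simp: S3)
    next
      case 3
      have "4 + t \<le> 240 * (m * ?S)" using t mS by linarith
      then have "4 + t + 120 * (m * (2 * ?S)) \<le> 120 * (4 * m * ?S)" by simp
      then show ?case by (simp add: S3 m_def no[symmetric])
    qed
  qed
  then show ?case
    unfolding runs_Seq[of F "nset _ _"] runs_NPut by (simp add: s2_def)
next
  case (3 t s1)
  then obtain \<rho>' \<omega> where chg: "chg refine_vars {} s s1"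
    and I1: "sample_inv (key s) A U (nats s1 ''sm'') (nats s1 ''ln'' 0) (nats s1 ''S'' 0) \<rho>' \<omega>"
    by blast
  \<comment> \<open>The loop guard fails exactly when no factor 8 is left between \<open>ln\<close>
    and \<open>S\<close>.\<close>
  have "\<rho>' = 0"
  proof (rule ccontr)
    assume "\<rho>' \<noteq> 0"
    then have "1 < (8::nat) ^ \<rho>'" by (intro one_less_power) auto
    then have "nats s1 ''S'' 0 * 1 < nats s1 ''S'' 0 * 8 ^ \<rho>'"
      using I1 by (intro mult_strict_left_mono) (auto simp: sample_inv_def)
    then show False using I1 3(2) by (simp add: sample_inv_def)
  qed
  then show ?case using post[OF chg] I1 3(3) by simp
qed

definition neq :: "nexp \<Rightarrow> nexp \<Rightarrow> bexp" where
  "neq d e = bor (NLess d e) (NLess e d)"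

lemma bval_neq [simp]: "bval F (neq d e) s \<longleftrightarrow> nval d s \<noteq> nval e s"
  by (auto simp: neq_def)

definition median_com :: com where
  "median_com = nset ''bb'' (NConst 0) ;; nset ''G'' (nsc ''S'') ;;
     For ''p'' (NConst 0) (nsc ''S'')
       (rank_com ;; Cond (neq (dbl (nsc ''c'')) (nsc ''S'')) Skip (nset ''pv'' (NGet ''sm'' (nsc ''p''))))"

lemma runs_median_com:
  fixes s :: state
  defines "f \<equiv> nats s ''sm''" and "S \<equiv> nats s ''S'' 0"
  assumes inj: "inj_on (key s \<circ> f) {..<S}" and S: "even S" "0 < S"
    and post: "\<And>t s' p. chg {''bb'', ''G'', ''p'', ''c'', ''q'', ''pv''} {} s s' \<Longrightarrow>
      p < S \<Longrightarrow> nats s' ''pv'' 0 = f p \<Longrightarrow>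
      2 * card {q. q < S \<and> key s (f q) < key s (f p)} = S \<Longrightarrow> t \<le> S * (10 + 4 * S) + 4 \<Longrightarrow> Q t s'"
  shows "runs F median_com Q s"
proof -
  let ?r = "\<lambda>p. card {q. q < S \<and> key s (f q) < key s (f p)}"
  \<comment> \<open>Ranks of distinct keys are a permutation of the indices, so exactly one element
    has rank \<open>S div 2\<close>; this is why the loop may test for equality and overwrite
    nothing.\<close>
  have bij: "bij_betw ?r {..<S} {..<S}"
  proof -
    have "{q \<in> {..<S}. (key s \<circ> f) q < (key s \<circ> f) p} = {q. q < S \<and> key s (f q) < key s (f p)}" for p
      by auto
    then show ?thesis using rank_bij[OF finite_lessThan inj] by (simp only: card_lessThan)
  qed
  obtain h where h: "S = 2 * h" using S(1) by (elim evenE)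
  then have "h \<in> ?r ` {..<S}" using bij S(2) by (simp add: bij_betw_imp_surj_on)
  then obtain p0 where p0: "p0 < S" "2 * ?r p0 = S" using h by auto
  have uniq: "p = p0" if "p < S" "2 * ?r p = S" for p
    using that p0 bij_betw_imp_inj_on[OF bij] by (auto dest!: inj_onD[of _ _ p p0])
  show ?thesis
    unfolding median_com_def runs_simps
  proof (rule runs_For_const[where A = 0 and H = S and C = "4 * S + 8" and
        I = "\<lambda>k s'. chg {''bb'', ''G'', ''p'', ''c'', ''q'', ''pv''} {} s s' \<and>
          nats s' ''bb'' 0 = 0 \<and> nats s' ''G'' 0 = S \<and> (p0 < k \<longrightarrow> nats s' ''pv'' 0 = f p0)"], goal_cases)
    case (5 k s1)
    then have chg1: "chg {''bb'', ''G'', ''p'', ''c'', ''q'', ''pv''} {} s s1" by blast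
    have "key s1 = key s" using chg1 by (intro key_cong) (simp_all add: chg_def)
    moreover have "nats s1 ''sm'' = f" using chg1 by (simp add: chg_def f_def)
    ultimately have eqs: "nats s1 ''sm'' = f" "key s1 = key s" "nats s1 ''bb'' 0 = 0" "nats s1 ''G'' 0 = S"
      "nats s1 ''p'' 0 = k" using 5 by simp_all
    show ?case
      unfolding runs_Seq
    proof (rule runs_rank_com, unfold eqs, goal_cases)
      case (1 t s2)
      then have eqs2: "nats s2 ''sm'' = f" "nats s2 ''S'' 0 = S" "nats s2 ''p'' 0 = k" "nats s2 ''pv'' = nats s1 ''pv''"
        "nats s2 ''bb'' 0 = 0" "nats s2 ''G'' 0 = S"
        "chg {''bb'', ''G'', ''p'', ''c'', ''q'', ''pv''} {} s s2"
        using 5(1,2) chg1 eqs by (simp_all add: chg_def S_def)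
      have c: "nats s2 ''c'' 0 = ?r k" using 1(3) by simp
      show ?case
      proof (cases "2 * ?r k = S")
        case True
        then have "k = p0" using uniq 5 by simp
        have c2: "\<not> bval F (neq (dbl (nsc ''c'')) (nsc ''S'')) s2" using True c eqs2 by simp
        show ?thesis
          unfolding runs_Cond if_not_P[OF c2] runs_NPut
        proof (intro conjI, goal_cases)
          case 3
          then show ?case using eqs2(7) by (simp add: chg_def)
        qed (use 1(2) eqs2 \<open>k = p0\<close> in simp_all)
      next
        case False
        then have "k \<noteq> p0" using p0 by auto
        have c2: "bval F (neq (dbl (nsc ''c'')) (nsc ''S'')) s2" using False c eqs2 by simp
        show ?thesis
          unfolding runs_Cond if_P[OF c2] runs_Skip
        proof (intro conjI, goal_cases)
          case 3
          then show ?case using eqs2(7) by (simp add: chg_def)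
        qed (use 1(2) eqs2 5 \<open>k \<noteq> p0\<close> in simp_all)
      qed
    qed
  next
    case (6 t s1)
    then show ?case using p0 by (intro post[of s1 p0]) auto
  qed (auto simp: chg_def S_def)
qed

text \<open>The thinning schedule needs a sample of length \<open>2 * 8 ^ \<rho>\<close>. The
  largest such length below the number of candidates falls short by a factor less than 8.\<close>

definition grow_com :: com where
  "grow_com = While (BNot (NLess (nsc ''na'') (dbl (dbl (dbl (nsc ''ln''))))))
     (nset ''ln'' (dbl (dbl (dbl (nsc ''ln'')))))"

lemma runs_grow_com:
  assumes "nats s ''ln'' 0 = 2" "2 \<le> nats s ''na'' 0"
    and post: "\<And>t s' \<rho>. chg {''ln''} {} s s' \<Longrightarrow> nats s' ''ln'' 0 = 2 * 8 ^ \<rho> \<Longrightarrow>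
      nats s' ''ln'' 0 \<le> nats s ''na'' 0 \<Longrightarrow> nats s ''na'' 0 < 8 * nats s' ''ln'' 0 \<Longrightarrow>
      t \<le> 2 * nats s ''na'' 0 + 1 \<Longrightarrow> Q t s'"
  shows "runs F grow_com Q s"
  unfolding grow_com_def
proof (rule runs_While[where \<Phi> = "\<lambda>s'. 2 * (nats s ''na'' 0 - nats s' ''ln'' 0)" and
      I = "\<lambda>s'. chg {''ln''} {} s s' \<and> (\<exists>\<rho>. nats s' ''ln'' 0 = 2 * 8 ^ \<rho>) \<and>
        2 \<le> nats s' ''ln'' 0 \<and> nats s' ''ln'' 0 \<le> nats s ''na'' 0"], goal_cases)
  case 1
  then show ?case using assms by (auto simp: chg_def intro!: exI[of _ 0])
next
  case (2 s1)
  then obtain \<rho> where \<rho>: "nats s1 ''ln'' 0 = 2 * 8 ^ \<rho>" by blast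
  have na: "nats s1 ''na'' = nats s ''na''" using 2 by (simp add: chg_def)
  have "\<exists>\<rho>. 8 * nats s1 ''ln'' 0 = 2 * 8 ^ \<rho>"
    using \<rho> by (intro exI[of _ "Suc \<rho>"]) simp
  moreover have "Suc (Suc (2 * (nats s ''na'' 0 - 8 * nats s1 ''ln'' 0))) \<le> 2 * (nats s ''na'' 0 - nats s1 ''ln'' 0)"
  proof -
    have "2 \<le> nats s1 ''ln'' 0" "8 * nats s1 ''ln'' 0 \<le> nats s ''na'' 0" using 2 na by auto
    then show ?thesis by linarith
  qed
  ultimately show ?case using 2 na by (simp add: runs_simps chg_def)
next
  case (3 t s1)
  then obtain \<rho> where \<rho>: "nats s1 ''ln'' 0 = 2 * 8 ^ \<rho>" by blast
  have na: "nats s1 ''na'' = nats s ''na''" using 3 by (simp add: chg_def)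
  show ?case using 3 na \<rho> by (intro post[of s1 \<rho>]) auto
qed

definition pivot_com :: com where
  "pivot_com = Cond (NLess (nsc ''na'') (NConst 2)) (nset ''pv'' (NGet ''ac'' (NConst 0)))
     (nset ''ln'' (NConst 2) ;; grow_com ;;
      For ''p'' (NConst 0) (nsc ''ln'') (NPut ''sm'' (nsc ''p'') (NGet ''ac'' (nsc ''p''))) ;;
      nset ''S'' (NConst 2) ;; refine_com ;; median_com)"

abbreviation "pivot_vars \<equiv> {''no'', ''bb'', ''p'', ''c'', ''q'', ''so'', ''sm'', ''G'', ''ln'', ''S'', ''pv''}"

text \<open>Half of the final sample lies on either side of its median. On the left this accounts
  for half of the \<open>U\<close> represented elements; on the right
  \<open>4 * U \<le> 8 * card + 3 * U\<close> leaves an eighth of them. With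
  \<open>n < 8 * U\<close> the guaranteed fraction is one in 64.\<close>

lemma runs_pivot_com:
  fixes s :: state
  defines "f \<equiv> nats s ''ac''" and "n \<equiv> nats s ''na'' 0"
  assumes inj: "inj_on (key s \<circ> f) {..<n}" and n: "0 < n"
    and post: "\<And>t s' j. chg pivot_vars {} s s' \<Longrightarrow>
      j < n \<Longrightarrow> nats s' ''pv'' 0 = f j \<Longrightarrow>
      n \<le> 64 * card {i. i < n \<and> key s (f i) \<le> key s (f j)} \<Longrightarrow>
      n \<le> 64 * card {i. i < n \<and> key s (f j) \<le> key s (f i)} \<Longrightarrow> t \<le> 300 * n \<Longrightarrow> Q t s'"
  shows "runs F pivot_com Q s"
proof (cases "n < 2")
  case True
  with n have n1: "n = 1" by simp
  have "{i. i < (1::nat) \<and> key s (f i) \<le> key s (f 0)} = {0}" "{i. i < (1::nat) \<and> key s (f 0) \<le> key s (f i)} = {0}"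
    by auto
  then show ?thesis
    using n1 unfolding pivot_com_def runs_simps
    by (simp add: n_def[symmetric]) (rule post[of _ 0], auto simp: chg_def f_def)
next
  case False
  let ?k = "key s"
  have na: "\<not> bval F (NLess (nsc ''na'') (NConst 2)) s" using False n_def by simp
  show ?thesis
    unfolding pivot_com_def runs_Cond if_not_P[OF na] runs_Seq runs_NPut
  proof (rule runs_grow_com, goal_cases)
    case (3 t1 s1 \<rho>)
    define U where "U = nats s1 ''ln'' 0"
    have eq1: "chg {''ln''} {} s s1" "nats s1 ''ac'' = f" "U = 2 * 8 ^ \<rho>" "U \<le> n" "n < 8 * U" "t1 \<le> 2 * n + 1"
      using 3 by (auto simp: chg_def f_def n_def U_def)
    show ?case
    proof (rule runs_For_const[where A = 0 and H = U and C = 1 and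
        I = "\<lambda>k s'. chg {''ln'', ''p'', ''sm''} {} s s' \<and> nats s' ''ln'' 0 = U \<and>
          (\<forall>p<k. nats s' ''sm'' p = f p)"], goal_cases)
      case (5 k s2)
      then have "nats s2 ''ac'' = f" by (simp add: chg_def f_def)
      with 5 show ?case by (simp add: runs_simps chg_def less_Suc_eq)
    next
      case (6 t2 s2)
      define s3 where "s3 = nput ''S'' 0 2 s2"
      have s3: "chg {''ln'', ''p'', ''sm'', ''S''} {} s s3" "nats s3 ''ln'' 0 = U" "nats s3 ''S'' 0 = 2"
        "\<And>p. p < U \<Longrightarrow> nats s3 ''sm'' p = f p"
        using 6 by (auto simp: s3_def chg_def)
      have key3: "key s3 = ?k" using s3(1) by (intro key_cong) (auto simp: chg_def)
      let ?A = "f ` {..<U}"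
      have inj2: "inj_on (?k \<circ> f) {..<U}" using inj eq1(4) by (auto elim: inj_on_subset)
      have cardA: "card {a \<in> ?A. P (?k a)} = card {p. p < U \<and> P (?k (f p))}" for P
      proof -
        have "{a \<in> ?A. P (?k a)} = f ` {p. p < U \<and> P (?k (f p))}" by auto
        moreover have "inj_on f {p. p < U \<and> P (?k (f p))}"
          using inj2 by (auto simp: inj_on_def)
        ultimately show ?thesis by (simp add: card_image)
      qed
      have card3: "{p. p < U \<and> P (nats s3 ''sm'' p)} = {p. p < U \<and> P (f p)}" for P
        using s3(4) by auto
      have "sample_inv (key s3) ?A U (nats s3 ''sm'') (nats s3 ''ln'' 0) (nats s3 ''S'' 0) \<rho> 1"
        unfolding sample_inv_def s3 key3 card3[of "\<lambda>x. ?k x \<le> _"] card3[of "\<lambda>x. _ \<le> ?k x"]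
          cardA[of "\<lambda>x. x \<le> _"] cardA[of "\<lambda>x. _ \<le> x"]
      proof (intro conjI allI, goal_cases)
        case 6
        show ?case using inj2 s3(4) by (subst inj_on_cong[of _ _ "?k \<circ> f"]) auto
      next
        case 7
        show ?case using s3(4) by auto
      qed (auto simp: eq1(3))
      then have "runs F refine_com (\<lambda>t s'. runs F median_com (\<lambda>t' s''.
            Q (1 + (1 + (t1 + (t2 + (1 + (t + t')))))) s'') s') s3"
      proof (rule runs_refine_com, goal_cases)
        case (1 t4 s4 \<omega>)
        have t4: "t4 \<le> 240 * U + 1" using 1(3) s3 by simp
        have chg4: "chg pivot_vars {} s s4" using 1(1) s3(1) by (auto simp: chg_def)
        have key4: "key s4 = ?k" using chg4 by (intro key_cong) (auto simp: chg_def)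
        let ?S = "nats s4 ''S'' 0"
        note inv = 1(2)[unfolded sample_inv_def key3]
        have ln4: "nats s4 ''ln'' 0 = ?S" using inv by simp
        have inv': "U = \<omega> * ?S" "?S * ?S = 4 * \<omega>" "even ?S" "2 \<le> ?S"
          "inj_on (?k \<circ> nats s4 ''sm'') {..<?S}" "nats s4 ''sm'' ` {..<?S} \<subseteq> ?A"
          using inv[unfolded ln4] by blast+
        have ally: "\<omega> * card {p. p < ?S \<and> ?k (nats s4 ''sm'' p) \<le> y} \<le> card {a \<in> ?A. ?k a \<le> y}"
          "8 * \<omega> * card {p. p < ?S \<and> y \<le> ?k (nats s4 ''sm'' p)} + 6 * \<omega> \<le> 8 * card {a \<in> ?A. y \<le> ?k a} + 3 * U" for y
          using inv[unfolded ln4 power_0 mult_1_right] by blast+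
        show ?case
        proof (rule runs_median_com, goal_cases)
          case (4 t5 s5 p)
          let ?g = "nats s4 ''sm''"
          from 4(2) inv'(6) obtain j where j: "j < U" "?g p = f j" by auto
          have le: "\<omega> * card {q. q < ?S \<and> ?k (?g q) \<le> ?k (?g p)} \<le> card {i. i < U \<and> ?k (f i) \<le> ?k (?g p)}"
            and ge: "8 * \<omega> * card {q. q < ?S \<and> ?k (?g p) \<le> ?k (?g q)} + 6 * \<omega> \<le>
              8 * card {i. i < U \<and> ?k (?g p) \<le> ?k (f i)} + 3 * U"
            using ally[of "?k (?g p)"] cardA[of "\<lambda>x. x \<le> ?k (?g p)"] cardA[of "\<lambda>x. ?k (?g p) \<le> x"] by simp_all
          let ?L = "{q. q < ?S \<and> ?k (?g q) < ?k (?g p)}" and ?R = "{q. q < ?S \<and> ?k (?g p) \<le> ?k (?g q)}"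
          have L: "2 * card ?L = ?S" using 4(4) key4 by simp
          have "?L \<union> ?R = {..<?S}" by auto
          moreover have "card (?L \<union> ?R) = card ?L + card ?R" by (rule card_Un_disjoint) auto
          ultimately have "card ?L + card ?R = ?S" by simp
          with L have R: "2 * card ?R = ?S" by simp
          have "card ?L \<le> card {q. q < ?S \<and> ?k (?g q) \<le> ?k (?g p)}" by (rule card_mono) auto
          then have "\<omega> * (2 * card ?L) \<le> 2 * (\<omega> * card {q. q < ?S \<and> ?k (?g q) \<le> ?k (?g p)})" by simp
          then have U1: "U \<le> 2 * card {i. i < U \<and> ?k (f i) \<le> ?k (?g p)}"
            using le unfolding L inv'(1)[symmetric] by linarith
          have "8 * \<omega> * card ?R = 4 * (\<omega> * (2 * card ?R))" by simp
          then have "8 * \<omega> * card ?R = 4 * U" unfolding R inv'(1)[symmetric] .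
          then have U2: "U \<le> 8 * card {i. i < U \<and> ?k (?g p) \<le> ?k (f i)}"
            using ge by linarith
          have Un: "card {i. i < U \<and> P i} \<le> card {i. i < n \<and> P i}" for P
            using eq1(4) by (intro card_mono) auto
          \<comment> \<open>At the end \<open>U = \<omega> * S\<close> and
            \<open>S * S = 4 * \<omega>\<close>, so \<open>S\<close> is of order the cube root of
            \<open>U\<close> and the quadratic median search is affordable.\<close>
          have "?S * ?S \<le> 2 * (\<omega> * ?S)" using inv'(2,4) mult_le_mono2[of 2 ?S \<omega>] by simp
          then have SS: "?S * ?S \<le> 2 * U" using inv'(1) by simp
          have "?S * 1 \<le> ?S * ?S" using inv'(4) by (intro mult_le_mono2) auto
          then have "t5 \<le> 28 * U + 4"
          proof -
            have "?S * (10 + 4 * ?S) + 4 = 4 * (?S * ?S) + 10 * ?S + 4" by (simp add: algebra_simps)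
            with 4(5) SS \<open>?S * 1 \<le> ?S * ?S\<close> show ?thesis by linarith
          qed
          then have t: "1 + (1 + (t1 + (t2 + (1 + (t4 + t5))))) \<le> 300 * n"
            using t4 6(3) eq1 False by simp
          show ?case
          proof (rule post[OF _ _ _ _ _ t])
            show "chg pivot_vars {} s s5" using chg4 4(1) by (auto simp: chg_def)
            show "j < n" using j eq1 by simp
            show "nats s5 ''pv'' 0 = f j" using 4(3) j by simp
            show "n \<le> 64 * card {i. i < n \<and> ?k (f i) \<le> ?k (f j)}"
              using U1 Un[of "\<lambda>i. ?k (f i) \<le> ?k (?g p)"] eq1(5) j(2) by simp
            show "n \<le> 64 * card {i. i < n \<and> ?k (f j) \<le> ?k (f i)}"
              using U2 Un[of "\<lambda>i. ?k (?g p) \<le> ?k (f i)"] eq1(5) j(2) by simp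
          qed
        qed (use inv' key4 in auto)
      qed
      then show ?case by (simp add: s3_def)
    qed (use eq1 in \<open>auto simp: chg_def U_def\<close>)
  qed (use False n_def in auto)
qed

section \<open>Bisection over keyed events with geometrically shrinking candidate sets\<close>

section \<open>Prune and search\<close>

definition act :: "state \<Rightarrow> nat list" where
  "act s = map (nats s ''ac'') [0..<nats s ''na'' 0]"

text \<open>Compaction in place is safe because the write index \<open>no\<close> never overtakes
  the read index \<open>p\<close>.\<close>

definition filter_com :: "bexp \<Rightarrow> com" where
  "filter_com b = nset ''no'' (NConst 0) ;;
     For ''p'' (NConst 0) (nsc ''na'')
       (Cond b (NPut ''ac'' (nsc ''no'') (NGet ''ac'' (nsc ''p'')) ;; ninc ''no'') Skip) ;;
     nset ''na'' (nsc ''no'')"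

lemma runs_filter_com:
  assumes b: "\<And>s'. chg {''ac'', ''no'', ''p''} {} s s' \<Longrightarrow>
      bval F b s' \<longleftrightarrow> T (nats s' ''ac'' (nats s' ''p'' 0))"
    and post: "\<And>t s'. chg {''ac'', ''no'', ''p'', ''na''} {} s s' \<Longrightarrow>
      act s' = filter T (act s) \<Longrightarrow> t \<le> 5 * nats s ''na'' 0 + 4 \<Longrightarrow> Q t s'"
  shows "runs F (filter_com b) Q s"
proof -
  let ?a = "nats s ''ac''"
  show ?thesis
    unfolding filter_com_def runs_Seq runs_NPut
  proof (rule runs_For_const[where A = 0 and H = "nats s ''na'' 0" and C = 3 and
        I = "\<lambda>k s'. chg {''ac'', ''no'', ''p''} {} s s' \<and> nats s' ''no'' 0 \<le> k \<and>
          map (nats s' ''ac'') [0..<nats s' ''no'' 0] = filter T (map ?a [0..<k]) \<and>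
          (\<forall>j\<ge>k. nats s' ''ac'' j = ?a j)"], goal_cases)
    case (5 k s1)
    let ?no = "nats s1 ''no'' 0"
    have chg: "chg {''ac'', ''no'', ''p''} {} s s1" and no: "?no \<le> k"
      and m: "map (nats s1 ''ac'') [0..<?no] = filter T (map ?a [0..<k])"
      and r: "\<And>j. k \<le> j \<Longrightarrow> nats s1 ''ac'' j = ?a j" and p: "nats s1 ''p'' 0 = k" using 5 by auto
    have bT: "bval F b s1 \<longleftrightarrow> T (?a k)" using b[OF chg] p r by simp
    have upd: "map ((nats s1 ''ac'')(?no := ?a k)) [0..<Suc ?no] = map (nats s1 ''ac'') [0..<?no] @ [?a k]"
      by simp
    show ?case
    proof (cases "T (?a k)")
      case True
      then have bv: "bval F b s1" using bT by simp
      show ?thesis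
        unfolding runs_Cond if_P[OF bv] runs_Seq runs_NPut
        using True chg no m p r upd
        by (simp add: r del: upt_Suc) (simp add: chg_def)
    next
      case False
      then have bv: "\<not> bval F b s1" using bT by simp
      show ?thesis
        unfolding runs_Cond if_not_P[OF bv] runs_Skip
        using False chg no m p r by simp (simp add: chg_def)
    qed
  next
    case (6 t s1)
    show ?case
    proof (rule post)
      show "chg {''ac'', ''no'', ''p'', ''na''} {} s (nput ''na'' (nval (NConst 0) s1) (nval (nsc ''no'') s1) s1)"
        using 6 by (auto simp: chg_def)
      show "act (nput ''na'' (nval (NConst 0) s1) (nval (nsc ''no'') s1) s1) = filter T (act s)"
        using 6 by (simp add: act_def)
    qed (use 6 in simp)
  qed (simp_all add: chg_def)
qed

definition sum_com :: com where
  "sum_com = rset ''W2'' (rsc ''W'') ;; rset ''V2'' (rsc ''V'') ;;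
     For ''p'' (NConst 0) (nsc ''na'')
       (Cond (less_key (nsc ''pv'') (NGet ''ac'' (nsc ''p''))) Skip
         (rset ''W2'' (RPlus (rsc ''W2'') (RGet ''w'' (NGet ''ac'' (nsc ''p'')))) ;;
          rset ''V2'' (RPlus (rsc ''V2'') (RGet ''v'' (NGet ''ac'' (nsc ''p''))))))"

lemma runs_sum_com:
  assumes dist: "distinct (act s)"
    and post: "\<And>t s'. chg {''p''} {''W2'', ''V2''} s s' \<Longrightarrow>
      reals s' ''W2'' 0 = reals s ''W'' 0 + (\<Sum>e | e \<in> set (act s) \<and> key s e \<le> key s (nats s ''pv'' 0). reals s ''w'' e) \<Longrightarrow>
      reals s' ''V2'' 0 = reals s ''V'' 0 + (\<Sum>e | e \<in> set (act s) \<and> key s e \<le> key s (nats s ''pv'' 0). reals s ''v'' e) \<Longrightarrow>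
      t \<le> 5 * nats s ''na'' 0 + 4 \<Longrightarrow> Q t s'"
  shows "runs F sum_com Q s"
proof -
  let ?a = "nats s ''ac''" and ?n = "nats s ''na'' 0"
  let ?P = "\<lambda>e. key s e \<le> key s (nats s ''pv'' 0)"
  have sum: "(\<Sum>p<?n. if ?P (?a p) then f (?a p) else 0) = (\<Sum>e | e \<in> set (act s) \<and> ?P e. f e)" for f :: "nat \<Rightarrow> real"
  proof -
    have inj: "inj_on ?a {..<?n}"
      using dist by (simp add: act_def distinct_map lessThan_atLeast0)
    have set: "set (act s) = ?a ` {..<?n}" by (auto simp: act_def)
    have "(\<Sum>e | e \<in> set (act s) \<and> ?P e. f e) = (\<Sum>e\<in>?a ` {..<?n}. if ?P e then f e else 0)"
      unfolding set by (simp add: sum.inter_filter)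
    then show ?thesis using sum.reindex[OF inj, of "\<lambda>e. if ?P e then f e else 0"] by simp
  qed
  show ?thesis
    unfolding sum_com_def runs_Seq runs_RPut
  proof (rule runs_For_const[where A = 0 and H = ?n and C = 3 and
        I = "\<lambda>k s'. chg {''p''} {''W2'', ''V2''} s s' \<and>
          reals s' ''W2'' 0 = reals s ''W'' 0 + (\<Sum>p<k. if ?P (?a p) then reals s ''w'' (?a p) else 0) \<and>
          reals s' ''V2'' 0 = reals s ''V'' 0 + (\<Sum>p<k. if ?P (?a p) then reals s ''v'' (?a p) else 0)"], goal_cases)
    case (5 k s1)
    then have chg: "chg {''p''} {''W2'', ''V2''} s s1" by blast
    then have eqs: "key s1 = key s" "nats s1 ''ac'' = ?a" "nats s1 ''pv'' = nats s ''pv''"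
      "reals s1 ''w'' = reals s ''w''" "reals s1 ''v'' = reals s ''v''"
      using key_cong[of s1 s] by (simp_all add: chg_def)
    show ?case
    proof (cases "?P (?a k)")
      case True
      then have bv: "\<not> bval F (less_key (nsc ''pv'') (NGet ''ac'' (nsc ''p''))) s1"
        using 5 eqs by simp
      show ?thesis
        unfolding runs_Cond if_not_P[OF bv] runs_Seq runs_RPut
        using True 5 chg eqs by simp (simp add: chg_def)
    next
      case False
      then have bv: "bval F (less_key (nsc ''pv'') (NGet ''ac'' (nsc ''p''))) s1"
        using 5 eqs by simp
      show ?thesis
        unfolding runs_Cond if_P[OF bv] runs_Skip
        using False 5 chg eqs by simp (simp add: chg_def)
    qed
  next
    case (6 t s1)
    then show ?case by (intro post) (simp_all add: sum)
  qed (simp_all add: chg_def)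
qed

text \<open>\<open>W\<close> and \<open>V\<close> summarize the accepted events, so a round touches
  only the active ones. \<open>hs\<close> records whether any pivot has been accepted, that is,
  whether \<open>pa\<close> means anything.\<close>

definition search_com :: com where
  "search_com = nset ''na'' (nsc ''E'') ;;
     For ''p'' (NConst 0) (nsc ''na'') (NPut ''ac'' (nsc ''p'') (nsc ''p'')) ;;
     rset ''W'' (RConst 0) ;; rset ''V'' (RConst 0) ;; nset ''hs'' (NConst 0) ;;
     While (NLess (NConst 0) (nsc ''na''))
       (pivot_com ;; sum_com ;;
        Cond (RLess (rsc ''ta'') (RPlus (RTimes (rsc ''W2'') (RGet ''k1'' (nsc ''pv''))) (rsc ''V2'')))
          (filter_com (less_key (NGet ''ac'' (nsc ''p'')) (nsc ''pv'')))
          (rset ''W'' (rsc ''W2'') ;; rset ''V'' (rsc ''V2'') ;; nset ''pa'' (nsc ''pv'') ;;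
           nset ''hs'' (NConst 1) ;; filter_com (less_key (nsc ''pv'') (NGet ''ac'' (nsc ''p'')))))"

text \<open>The events up to \<open>r\<close> contribute slope \<open>w\<close> and offset
  \<open>v\<close> to an affine function, which is evaluated at the breakpoint of \<open>r\<close>
  itself. Events with slope 0 and offset 1 are simply counted.\<close>

definition event_sum :: "state \<Rightarrow> nat \<Rightarrow> real" where
  "event_sum s r = (\<Sum>e | e < nats s ''E'' 0 \<and> key s e \<le> key s r. reals s ''w'' e * reals s ''k1'' r + reals s ''v'' e)"

text \<open>\<open>A\<close> is the set of accepted events: the keys at which the sum of all events up to this key does not
  exceed the target.\<close>

definition accepted :: "state \<Rightarrow> state \<Rightarrow> nat set \<Rightarrow> bool" where
  "accepted s s' A \<longleftrightarrow>
     A \<subseteq> {..<nats s ''E'' 0} \<and> reals s' ''W'' 0 = sum (reals s ''w'') A \<and> reals s' ''V'' 0 = sum (reals s ''v'') A \<and>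
     (if nats s' ''hs'' 0 = 0 then A = {}
      else nats s' ''pa'' 0 < nats s ''E'' 0 \<and>
        A = {e. e < nats s ''E'' 0 \<and> key s e \<le> key s (nats s' ''pa'' 0)} \<and>
        event_sum s (nats s' ''pa'' 0) \<le> reals s ''ta'' 0)"

abbreviation "search_nats \<equiv> pivot_vars \<union> {''ac'', ''na'', ''hs'', ''pa''}"
abbreviation "search_reals \<equiv> {''W'', ''V'', ''W2'', ''V2''}"

text \<open>No monotonicity of \<open>event_sum\<close> enters: as in bisection, one accepted and
  one rejected event are kept and the search ends when nothing lies between them. Monotonicity is
  left to the applications.\<close>

lemma runs_search_com:
  fixes s :: state
  defines "n \<equiv> nats s ''E'' 0"
  assumes inj: "inj_on (key s) {..<n}"
    and post: "\<And>t s' A. chg search_nats search_reals s s' \<Longrightarrow> accepted s s' A \<Longrightarrow>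
      A = {..<n} \<or> (\<exists>r<n. A = {e. e < n \<and> key s e < key s r} \<and> reals s ''ta'' 0 < event_sum s r) \<Longrightarrow>
      t \<le> 21800 * n + 10 \<Longrightarrow> Q t s'"
  shows "runs F search_com Q s"
proof -
  let ?k = "key s" and ?w = "reals s ''w''" and ?v = "reals s ''v''" and ?ta = "reals s ''ta'' 0"
  \<comment> \<open>\<open>rj\<close> is the latest rejected pivot, \<open>None\<close> before the
    first rejection; the active events are those after \<open>A\<close> and before
    \<open>rj\<close>.\<close>
  define Inv0 where "Inv0 s' A rj \<longleftrightarrow> chg search_nats search_reals s s' \<and> distinct (act s') \<and>
    accepted s s' A \<and> (\<forall>r. rj = Some r \<longrightarrow> r < n \<and> r \<notin> A \<and> ?ta < event_sum s r) \<and>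
      set (act s') = {e. e < n \<and> e \<notin> A \<and> (\<forall>r. rj = Some r \<longrightarrow> ?k e < ?k r)}" for s' A rj
  define Inv where "Inv s' \<longleftrightarrow> (\<exists>A rj. Inv0 s' A rj)" for s'
  have len: "length (act s') = nats s' ''na'' 0" for s' by (simp add: act_def)
  \<comment> \<open>A round costs at most 340 steps per active event and leaves at most 63 of every
    64 of them active, hence the factor \<open>21760 = 64 * 340\<close>.\<close>
  have body: "runs F (pivot_com ;; sum_com ;;
        Cond (RLess (rsc ''ta'') (RPlus (RTimes (rsc ''W2'') (RGet ''k1'' (nsc ''pv''))) (rsc ''V2'')))
          (filter_com (less_key (NGet ''ac'' (nsc ''p'')) (nsc ''pv'')))
          (rset ''W'' (rsc ''W2'') ;; rset ''V'' (rsc ''V2'') ;; nset ''pa'' (nsc ''pv'') ;;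
           nset ''hs'' (NConst 1) ;; filter_com (less_key (nsc ''pv'') (NGet ''ac'' (nsc ''p'')))))
        (\<lambda>t s'. Inv s' \<and> 1 + t + 21760 * nats s' ''na'' 0 \<le> 21760 * nats s1 ''na'' 0) s1"
    if I: "Inv s1" and na: "0 < nats s1 ''na'' 0" for s1
  proof -
    let ?n = "nats s1 ''na'' 0"
    from I obtain A rj where I0: "Inv0 s1 A rj" unfolding Inv_def by (elim exE)
    then have chg1: "chg search_nats search_reals s s1" and dist: "distinct (act s1)"
      and A: "accepted s s1 A" and rj: "\<forall>r. rj = Some r \<longrightarrow> r < n \<and> r \<notin> A \<and> ?ta < event_sum s r"
      and set: "set (act s1) = {e. e < n \<and> e \<notin> A \<and> (\<forall>r. rj = Some r \<longrightarrow> ?k e < ?k r)}"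
      unfolding Inv0_def by - (elim conjE, assumption)+
    have key1: "key s1 = ?k" using chg1 by (intro key_cong) (simp_all add: chg_def)
    have setn: "set (act s1) \<subseteq> {..<n}" using set by auto
    have down: "?k a < ?k e" if "a \<in> A" "e < n" "e \<notin> A" for a e
      using A that unfolding accepted_def n_def by (auto split: if_splits)
    have finA: "finite A" using A unfolding accepted_def by (auto intro: finite_subset)
    have "inj_on (nats s1 ''ac'') {..<?n}"
      using dist by (simp add: act_def distinct_map lessThan_atLeast0)
    moreover have "nats s1 ''ac'' ` {..<?n} \<subseteq> {..<n}" using setn by (simp add: act_def lessThan_atLeast0)
    ultimately have inj1: "inj_on (key s1 \<circ> nats s1 ''ac'') {..<?n}"
      using inj unfolding key1 by (intro comp_inj_on) (auto elim: inj_on_subset)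
    show ?thesis
      unfolding runs_Seq[of F pivot_com] 
    proof (rule runs_pivot_com[OF inj1 na], unfold key1, goal_cases)
      case (1 t2 s2 j)
      let ?pv = "nats s2 ''pv'' 0"
      have chg2: "chg search_nats search_reals s s2" using chg1 1(1) by (auto simp: chg_def)
      have act2: "act s2 = act s1" and na2: "nats s2 ''na'' 0 = ?n" and acc2: "accepted s s2 B \<longleftrightarrow> accepted s s1 B" for B
        using 1(1) by (simp_all add: act_def chg_def accepted_def)
      have pv: "?pv \<in> set (act s1)" using 1(2,3) by (auto simp: act_def)
      have cnt: "card {i. i < ?n \<and> P (nats s1 ''ac'' i)} + length (filter (\<lambda>e. \<not> P e) (act s1)) = ?n" for P
      proof -
        have "card {i. i < ?n \<and> P (nats s1 ''ac'' i)} = length (filter P (act s1))"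
          by (auto simp: act_def length_filter_conv_card intro!: arg_cong[of _ _ card])
        then show ?thesis using sum_length_filter_compl[of P "act s1"] len[of s1] by simp
      qed
      have key2: "key s2 = ?k" using chg2 by (intro key_cong) (simp_all add: chg_def)
      let ?C = "{e. e \<in> set (act s1) \<and> ?k e \<le> ?k ?pv}"
      have pv': "?pv < n" "?pv \<notin> A" "\<And>r. rj = Some r \<Longrightarrow> ?k ?pv < ?k r" using pv set by auto
      have An: "A \<subseteq> {..<n}" using A by (simp add: accepted_def n_def)
      have AC1: "A \<union> ?C = {e. e < n \<and> ?k e \<le> ?k ?pv}"
      proof (intro set_eqI iffI)
        fix e assume "e \<in> A \<union> ?C"
        then show "e \<in> {e. e < n \<and> ?k e \<le> ?k ?pv}"
          using An setn down[OF _ pv'(1,2), of e] by (auto simp: less_imp_le)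
      next
        fix e assume e: "e \<in> {e. e < n \<and> ?k e \<le> ?k ?pv}"
        then have "?k e < ?k r" if "rj = Some r" for r
          using pv'(3)[OF that] le_less_trans[of "?k e" "?k ?pv" "?k r"] e by blast
        with e show "e \<in> A \<union> ?C" unfolding set by simp
      qed
      have AC2: "A \<inter> ?C = {}" unfolding set by blast
      note AC = AC1 AC2
      have FS: "sum ?w (A \<union> ?C) * reals s ''k1'' ?pv + sum ?v (A \<union> ?C) = event_sum s ?pv"
        unfolding AC(1) event_sum_def n_def by (simp add: sum.distrib sum_distrib_right)
      show ?case
        unfolding runs_Seq[of F sum_com]
      proof (rule runs_sum_com, unfold key2 act2 na2, goal_cases)
        case 1
        then show ?case by (fact dist)
      next
        case (2 t3 s3)
        have chg3: "chg search_nats search_reals s s3" using chg2 2(1) by (auto simp: chg_def)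
        have W: "reals s3 ''W2'' 0 = sum ?w (A \<union> ?C)" "reals s3 ''V2'' 0 = sum ?v (A \<union> ?C)"
        proof -
          have "accepted s s2 A" using acc2 A by simp
          then have "reals s2 ''W'' 0 = sum ?w A" "reals s2 ''V'' 0 = sum ?v A"
            by (simp_all add: accepted_def)
          moreover have "reals s2 ''w'' = ?w" "reals s2 ''v'' = ?v" using chg2 by (simp_all add: chg_def)
          ultimately show "reals s3 ''W2'' 0 = sum ?w (A \<union> ?C)" "reals s3 ''V2'' 0 = sum ?v (A \<union> ?C)"
            using 2(2,3) sum.union_disjoint[OF finA _ AC(2), of ?w] sum.union_disjoint[OF finA _ AC(2), of ?v]
            by simp_all
        qed
        have eq3: "nats s3 ''pv'' = nats s2 ''pv''" "reals s3 ''ta'' = reals s ''ta''" "reals s3 ''k1'' = reals s ''k1''"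
            "act s3 = act s1" "nats s3 ''na'' 0 = ?n" "accepted s s3 B \<longleftrightarrow> accepted s s1 B" for B
          using 2(1) 1(1) chg1 by (simp_all add: chg_def act_def accepted_def)
        have key3: "key s3 = ?k" using chg3 by (intro key_cong) (simp_all add: chg_def)
        let ?b = "RLess (rsc ''ta'') (RPlus (RTimes (rsc ''W2'') (RGet ''k1'' (nsc ''pv''))) (rsc ''V2''))"
        have b: "bval F ?b s3 \<longleftrightarrow> ?ta < event_sum s ?pv"
          using W eq3 FS by simp
        have t23: "t2 + t3 \<le> 305 * ?n + 4" using 1(6) 2(4) by simp
        have c1: "64 * length (filter (\<lambda>e. ?k e < ?k ?pv) (act s1)) \<le> 63 * ?n"
          using cnt[of "\<lambda>e. ?k ?pv \<le> ?k e"] 1(3,5) by (simp add: not_le)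
        have c2: "64 * length (filter (\<lambda>e. ?k ?pv < ?k e) (act s1)) \<le> 63 * ?n"
          using cnt[of "\<lambda>e. ?k e \<le> ?k ?pv"] 1(3,4) by (simp add: not_le)
        show ?case
        proof (cases "?ta < event_sum s ?pv")
          case True
          then have bv: "bval F ?b s3" using b by simp
          show ?thesis
            unfolding runs_Cond if_P[OF bv]
          proof (rule runs_filter_com[where T = "\<lambda>e. ?k e < ?k ?pv"], unfold eq3, goal_cases)
            case (1 s4)
            then have "key s4 = ?k" using chg3 by (intro key_cong) (simp_all add: chg_def)
            then show ?case using 1 eq3 by (simp add: chg_def)
          next
            case (2 t4 s4)
            have chg4: "chg search_nats search_reals s s4" using chg3 2(1) by (auto simp: chg_def)
            have "accepted s s4 A \<longleftrightarrow> accepted s s3 A" using 2(1) by (simp add: chg_def accepted_def)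
            then have acc4: "accepted s s4 A" using A eq3(6)[of A] by simp
            have "set (act s4) = {e. e < n \<and> e \<notin> A \<and> (\<forall>r. Some ?pv = Some r \<longrightarrow> ?k e < ?k r)}"
            proof -
              have "?k e < ?k r" if "?k e < ?k ?pv" "rj = Some r" for e r
                by (rule less_trans[OF that(1) pv'(3)[OF that(2)]])
              then show ?thesis using 2(2) set by auto
            qed
            moreover have "distinct (act s4)" using 2(2) dist by simp
            moreover have "\<forall>r. Some ?pv = Some r \<longrightarrow> r < n \<and> r \<notin> A \<and> ?ta < event_sum s r"
              using True pv set by simp
            ultimately have "Inv0 s4 A (Some ?pv)" unfolding Inv0_def using chg4 acc4 by (intro conjI)
            then have "Inv s4" unfolding Inv_def by (intro exI)
            moreover have "64 * nats s4 ''na'' 0 \<le> 63 * ?n" using c1 2(2) len[of s4] by simp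
            ultimately show ?case using t23 2(3) na by simp
          qed
        next
          case False
          then have bv: "\<not> bval F ?b s3" using b by simp
          define s4 where "s4 = nput ''hs'' 0 1 (nput ''pa'' 0 ?pv (rput ''V'' 0 (reals s3 ''V2'' 0) (rput ''W'' 0 (reals s3 ''W2'' 0) s3)))"
          have eq4: "act s4 = act s1" "nats s4 ''na'' 0 = ?n" "nats s4 ''pv'' 0 = ?pv" "nats s4 ''pa'' 0 = ?pv"
            "nats s4 ''hs'' 0 = 1" "reals s4 ''W'' 0 = sum ?w (A \<union> ?C)" "reals s4 ''V'' 0 = sum ?v (A \<union> ?C)"
            using eq3 W by (simp_all add: s4_def act_def)
          have chg4: "chg search_nats search_reals s s4" using chg3 by (auto simp: chg_def s4_def)
          have "runs F (filter_com (less_key (nsc ''pv'') (NGet ''ac'' (nsc ''p''))))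
             (\<lambda>t' s'. Inv s' \<and> 1 + (t2 + (t3 + (1 + (1 + (1 + (1 + (1 + t'))))))) + 21760 * nats s' ''na'' 0 \<le> 21760 * ?n) s4"
          proof (rule runs_filter_com[where T = "\<lambda>e. ?k ?pv < ?k e"], unfold eq4, goal_cases)
            case (1 s5)
            then have "key s5 = ?k" using chg4 by (intro key_cong) (simp_all add: chg_def)
            then show ?case using 1 eq4 by (simp add: chg_def)
          next
            case (2 t5 s5)
            have chg5: "chg search_nats search_reals s s5" using chg4 2(1) by (auto simp: chg_def)
            have eq5: "nats s5 ''pa'' 0 = ?pv" "nats s5 ''hs'' 0 = 1"
                "reals s5 ''W'' 0 = sum ?w (A \<union> ?C)" "reals s5 ''V'' 0 = sum ?v (A \<union> ?C)"
              using 2(1) eq4 by (simp_all add: chg_def)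
            have pvn: "?pv < n" using pv set by simp
            have acc5: "accepted s s5 (A \<union> ?C)"
              unfolding accepted_def eq5 using AC(1) False pvn by (auto simp: n_def)
            have "set (act s5) = {e. e < n \<and> e \<notin> A \<union> ?C \<and> (\<forall>r. rj = Some r \<longrightarrow> ?k e < ?k r)}"
              using 2(2) set by auto
            moreover have "distinct (act s5)" using 2(2) dist by simp
            moreover have "\<forall>r. rj = Some r \<longrightarrow> r < n \<and> r \<notin> A \<union> ?C \<and> ?ta < event_sum s r"
              using rj set pv AC(1) by auto
            ultimately have "Inv0 s5 (A \<union> ?C) rj" unfolding Inv0_def using chg5 acc5 by (intro conjI)
            then have "Inv s5" unfolding Inv_def by (intro exI)
            moreover have "64 * nats s5 ''na'' 0 \<le> 63 * ?n" using c2 2(2) len[of s5] by simp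
            ultimately show ?case using t23 2(3) na by simp
          qed
          then show ?thesis
            unfolding runs_Cond if_not_P[OF bv] runs_Seq runs_RPut runs_NPut
            using eq3 by (simp add: s4_def)
        qed
      qed
    qed
  qed
  define s1 where "s1 = nput ''na'' 0 n s"
  show ?thesis
    unfolding search_com_def runs_Seq runs_NPut
  proof (rule runs_For_const[where A = 0 and H = n and C = 1 and
        I = "\<lambda>k s'. chg {''na'', ''p'', ''ac''} {} s s' \<and> nats s' ''na'' 0 = n \<and> (\<forall>p<k. nats s' ''ac'' p = p)"], goal_cases)
    case (6 t2 s2)
    define s3 where "s3 = nput ''hs'' 0 0 (rput ''V'' 0 0 (rput ''W'' 0 0 s2))"
    have act3: "act s3 = [0..<n]"
      using 6 map_idI[of "[0..<n]" "nats s2 ''ac''"] by (simp add: s3_def act_def)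
    have "accepted s s3 {}" by (simp add: accepted_def s3_def)
    moreover have "chg search_nats search_reals s s3" using 6 by (auto simp: chg_def s3_def)
    ultimately have Inv3: "Inv s3"
      unfolding Inv_def Inv0_def using act3 by (intro exI[of _ "{}"] exI[of _ None] conjI) auto
    have na3: "nats s3 ''na'' 0 = n" using 6 by (simp add: s3_def)
    have "runs F (While (NLess (NConst 0) (nsc ''na''))
       (pivot_com ;; sum_com ;;
        Cond (RLess (rsc ''ta'') (RPlus (RTimes (rsc ''W2'') (RGet ''k1'' (nsc ''pv''))) (rsc ''V2'')))
          (filter_com (less_key (NGet ''ac'' (nsc ''p'')) (nsc ''pv'')))
          (rset ''W'' (rsc ''W2'') ;; rset ''V'' (rsc ''V2'') ;; nset ''pa'' (nsc ''pv'') ;;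
           nset ''hs'' (NConst 1) ;; filter_com (less_key (nsc ''pv'') (NGet ''ac'' (nsc ''p''))))))
       (\<lambda>t. Q (1 + (t2 + (1 + (1 + (1 + t)))))) s3"
    proof (rule runs_While[where I = Inv and \<Phi> = "\<lambda>s'. 21760 * nats s' ''na'' 0"], goal_cases)
      case (2 s')
      then show ?case using body[of s'] by simp
    next
      case (3 t s')
      from 3(1) obtain A rj where I0: "Inv0 s' A rj" unfolding Inv_def by (elim exE)
      then have A: "chg search_nats search_reals s s'" "accepted s s' A"
        and rj: "\<forall>r. rj = Some r \<longrightarrow> r < n \<and> r \<notin> A \<and> ?ta < event_sum s r"
        and set: "set (act s') = {e. e < n \<and> e \<notin> A \<and> (\<forall>r. rj = Some r \<longrightarrow> ?k e < ?k r)}"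
        unfolding Inv0_def by - (elim conjE, assumption)+
      have e: "{e. e < n \<and> e \<notin> A \<and> (\<forall>r. rj = Some r \<longrightarrow> ?k e < ?k r)} = {}"
        using 3(2) set by (simp add: act_def)
      have down: "?k a < ?k e" if "a \<in> A" "e < n" "e \<notin> A" for a e
        using A that unfolding accepted_def n_def by (auto split: if_splits)
      have An: "A \<subseteq> {..<n}" using A(2) by (simp add: accepted_def n_def)
      have "A = {..<n} \<or> (\<exists>r<n. A = {e. e < n \<and> ?k e < ?k r} \<and> ?ta < event_sum s r)"
      proof (cases rj)
        case None
        then show ?thesis using e An by auto
      next
        case (Some r)
        have "A = {e. e < n \<and> ?k e < ?k r}" using rj[rule_format, OF Some] e Some down[of _ r] An by auto
        then show ?thesis using rj[rule_format, OF Some] by blast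
      qed
      then show ?case
        using A 6(3) 3(3) na3 by (intro post) auto
    qed (fact Inv3)
    then show ?case unfolding runs_RPut by (simp add: s3_def)
  qed (auto simp: chg_def n_def runs_simps less_Suc_eq)
qed

section \<open>Root finding for a sum of clipped affine functions\<close>

section \<open>Allocation with a single sum constraint, continuous variables\<close>

abbreviation clip :: "real \<Rightarrow> real \<Rightarrow> real \<Rightarrow> real" where
  "clip c x d \<equiv> max c (min x d)"

text \<open>Each variable gives two events: its slope \<open>a\<close> switches on at the position of its lower bound and
  off at the position of its upper bound.\<close>

lemma clip_hinge:
  assumes "0 < a" "c \<le> d"
  shows "a * max 0 (y - (c / a + b)) + (- a) * max 0 (y - (d / a + b)) = clip c (a * (y - b)) d - c"
proof -
  have "a * max 0 (y - (e / a + b)) = max 0 (a * (y - b) - e)" for e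
  proof -
    have "a * max 0 z = max 0 (a * z)" for z
      using assms(1) by (auto simp: max_def mult_le_0_iff zero_le_mult_iff)
    moreover have "a * (y - (e / a + b)) = a * (y - b) - e"
      using assms(1) by (simp add: field_simps)
    ultimately show ?thesis by simp
  qed
  then show ?thesis using assms(2) by (simp add: max_def min_def)
qed

text \<open>Events that share the breakpoint of \<open>r\<close> contribute zero, so it does not
  matter on which side of \<open>r\<close> the tie-breaking components put them.\<close>

lemma event_sum_hinge:
  assumes v: "\<And>e. e < nats s ''E'' 0 \<Longrightarrow> reals s ''v'' e = - (reals s ''w'' e * reals s ''k1'' e)"
  shows "event_sum s r = (\<Sum>e<nats s ''E'' 0. reals s ''w'' e * max 0 (reals s ''k1'' r - reals s ''k1'' e))"
proof -
  have "event_sum s r = (\<Sum>e<nats s ''E'' 0. if key s e \<le> key s r then reals s ''w'' e * reals s ''k1'' r + reals s ''v'' e else 0)"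
    unfolding event_sum_def using sum.inter_filter[of "{..<nats s ''E'' 0}"] by simp
  also have "\<dots> = (\<Sum>e<nats s ''E'' 0. reals s ''w'' e * max 0 (reals s ''k1'' r - reals s ''k1'' e))"
  proof (rule sum.cong)
    fix e assume "e \<in> {..<nats s ''E'' 0}"
    then have "reals s ''v'' e = - (reals s ''w'' e * reals s ''k1'' e)" using v by simp
    moreover have "reals s ''k1'' e \<le> reals s ''k1'' r" if "key s e \<le> key s r"
      using that by (auto simp: key_def less_eq_prod_def)
    moreover have "reals s ''k1'' r \<le> reals s ''k1'' e" if "\<not> key s e \<le> key s r"
      using that by (auto simp: key_def less_eq_prod_def)
    ultimately show "(if key s e \<le> key s r then reals s ''w'' e * reals s ''k1'' r + reals s ''v'' e else 0) =
        reals s ''w'' e * max 0 (reals s ''k1'' r - reals s ''k1'' e)"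
      by (simp add: algebra_simps)
  qed simp
  finally show ?thesis .
qed

lemma key_k1: "key s e \<le> key s r \<Longrightarrow> reals s ''k1'' e \<le> reals s ''k1'' r"
  by (auto simp: key_def less_eq_prod_def)

text \<open>Between the last accepted and the adjacent rejected breakpoint \<open>C\<close> is
  affine with slope \<open>W\<close> and offset \<open>V\<close> and crosses \<open>ta\<close>, so
  the slope is positive and the division gives the root. A nonpositive \<open>W\<close> arises only
  if everything was accepted; then \<open>C\<close> is constant from \<open>k pa\<close> on, and
  both bounds on \<open>ta\<close> meet there.\<close>

lemma accepted_root:
  fixes s :: state
  defines "n \<equiv> nats s ''E'' 0" and "k \<equiv> reals s ''k1''" and "w \<equiv> reals s ''w''" and "v \<equiv> reals s ''v''"
    and "ta \<equiv> reals s ''ta'' 0"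
  defines "C \<equiv> \<lambda>x. \<Sum>e<n. w e * max 0 (x - k e)"
  assumes acc: "accepted s s' A"
    and rej: "A = {..<n} \<or> (\<exists>r<n. A = {e. e < n \<and> key s e < key s r} \<and> ta < event_sum s r)"
    and v: "\<And>e. e < n \<Longrightarrow> v e = - (w e * k e)" and w0: "sum w {..<n} = 0"
    and ta: "0 \<le> ta" "ta \<le> sum v {..<n}" and n: "0 < n"
  shows "C (if 0 < reals s' ''W'' 0 then (ta - reals s' ''V'' 0) / reals s' ''W'' 0 else k (nats s' ''pa'' 0)) = ta"
proof -
  let ?W = "reals s' ''W'' 0" and ?V = "reals s' ''V'' 0" and ?pa = "nats s' ''pa'' 0"
  have W: "?W = sum w A" "?V = sum v A" and An: "A \<subseteq> {..<n}"
    using acc by (simp_all add: accepted_def n_def w_def v_def)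
  have ev: "event_sum s r = C (k r)" for r
    using event_sum_hinge[of s r] v by (simp add: C_def n_def w_def v_def k_def)
  have CA: "C x = ?W * x + ?V" if "\<And>e. e \<in> A \<Longrightarrow> k e \<le> x" "\<And>e. e < n \<Longrightarrow> e \<notin> A \<Longrightarrow> x \<le> k e" for x
  proof -
    have "C x = (\<Sum>e\<in>A. w e * max 0 (x - k e))"
      unfolding C_def using An that by (intro sum.mono_neutral_right) auto
    also have "\<dots> = (\<Sum>e\<in>A. w e * x + v e)"
      using An that v by (intro sum.cong) (auto simp: algebra_simps)
    also have "\<dots> = ?W * x + ?V" by (simp add: W sum.distrib sum_distrib_right)
    finally show ?thesis .
  qed
  have pa: "?pa < n" "A = {e. e < n \<and> key s e \<le> key s ?pa}" "C (k ?pa) \<le> ta" if "A \<noteq> {}"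
    using acc that ev[of ?pa] by (auto simp: accepted_def n_def ta_def split: if_splits)
  have leA: "k e \<le> k ?pa" if "e \<in> A" for e
  proof -
    have "A \<noteq> {}" using that by auto
    with that pa(2) have "key s e \<le> key s ?pa" by blast
    then show ?thesis using key_k1 by (simp add: k_def)
  qed
  from rej show ?thesis
  proof
    assume all: "A = {..<n}"
    then have "A \<noteq> {}" using n by auto
    have "?W = 0" using W all w0 by simp
    moreover have "C (k ?pa) = ?W * k ?pa + ?V"
      using all leA by (intro CA) auto
    ultimately show ?thesis using pa(3)[OF \<open>A \<noteq> {}\<close>] ta(2) W all by simp
  next
    assume "\<exists>r<n. A = {e. e < n \<and> key s e < key s r} \<and> ta < event_sum s r"
    then obtain r where r: "r < n" "A = {e. e < n \<and> key s e < key s r}" "ta < C (k r)"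
      using ev by auto
    have geA: "k r \<le> k e" if "e < n" "e \<notin> A" for e
      using that r(2) key_k1[of s r e] by (simp add: k_def not_less)
    have leAr: "k e \<le> k r" if "e \<in> A" for e
      using that r(2) key_k1[of s e r] by (simp add: k_def less_imp_le)
    have Cr: "C (k r) = ?W * k r + ?V" by (rule CA[OF leAr geA])
    have "A \<noteq> {}"
    proof
      assume "A = {}"
      then show False using Cr W r(3) ta(1) by simp
    qed
    note pa = pa[OF this]
    have par: "k ?pa \<le> k r" using leAr[of ?pa] pa(1,2) by simp
    have Cpa: "C (k ?pa) = ?W * k ?pa + ?V"
      using leA geA par by (intro CA) (auto intro: order_trans)
    show ?thesis
    proof (cases "0 < ?W")
      case True
      let ?x = "(ta - ?V) / ?W"
      have "k ?pa \<le> ?x" "?x \<le> k r"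
        using True pa(3) r(3) Cpa Cr by (simp_all add: field_simps)
      then have "C ?x = ?W * ?x + ?V"
        using leA geA by (intro CA) (auto intro: order_trans)
      then show ?thesis using True by simp
    next
      case False
      then have "?W * k r \<le> ?W * k ?pa" using par by (intro mult_left_mono_neg) auto
      then show ?thesis using r(3) pa(3) Cr Cpa by simp
    qed
  qed
qed

definition push_com :: "rexp \<Rightarrow> rexp \<Rightarrow> nexp \<Rightarrow> rexp \<Rightarrow> rexp \<Rightarrow> com" where
  "push_com e1 e2 e3 ew ev =
     RPut ''k1'' (nsc ''E'') e1 ;; RPut ''k2'' (nsc ''E'') e2 ;; NPut ''k3'' (nsc ''E'') e3 ;;
     RPut ''w'' (nsc ''E'') ew ;; RPut ''v'' (nsc ''E'') ev ;; ninc ''E''"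

abbreviation at_i :: "string \<Rightarrow> rexp" where "at_i v \<equiv> RGet v (nsc ''i'')"

text \<open>\<open>sg\<close> is 1 where the slope sets in and -1 where it ends; the offset makes
  the hinge vanish at its own breakpoint. The running event number in the key keeps keys
  distinct.\<close>

definition bound_event :: "string \<Rightarrow> rexp \<Rightarrow> com" where
  "bound_event e sg = push_com (RPlus (RDivide (at_i e) (at_i ''a'')) (at_i ''b'')) (RConst 0) (nsc ''E'')
     (RTimes sg (at_i ''a''))
     (RMinus (RConst 0) (RTimes (RTimes sg (at_i ''a'')) (RPlus (RDivide (at_i e) (at_i ''a'')) (at_i ''b''))))"

lemma runs_bound_event:
  assumes e: "e \<notin> {''k1'', ''k2'', ''w'', ''v''}" and sg: "sg = RConst z"
    and post: "\<And>t s'. t \<le> 6 \<Longrightarrow> chg {''E'', ''k3''} {''k1'', ''k2'', ''w'', ''v''} s s' \<Longrightarrow>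
      nats s' ''E'' 0 = Suc (nats s ''E'' 0) \<Longrightarrow>
      nats s' ''k3'' = (nats s ''k3'')(nats s ''E'' 0 := nats s ''E'' 0) \<Longrightarrow>
      reals s' ''k1'' = (reals s ''k1'')(nats s ''E'' 0 :=
        reals s e (nats s ''i'' 0) / reals s ''a'' (nats s ''i'' 0) + reals s ''b'' (nats s ''i'' 0)) \<Longrightarrow>
      reals s' ''w'' = (reals s ''w'')(nats s ''E'' 0 := of_int z * reals s ''a'' (nats s ''i'' 0)) \<Longrightarrow>
      reals s' ''v'' = (reals s ''v'')(nats s ''E'' 0 := - (of_int z * reals s ''a'' (nats s ''i'' 0) *
        (reals s e (nats s ''i'' 0) / reals s ''a'' (nats s ''i'' 0) + reals s ''b'' (nats s ''i'' 0)))) \<Longrightarrow> Q t s'"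
  shows "runs F (bound_event e sg) Q s"
  using e unfolding bound_event_def push_com_def
  by (simp add: runs_simps sg) (rule post, simp_all add: chg_def)

definition multiplier_com :: com where
  "multiplier_com = nset ''E'' (NConst 0) ;; rset ''ta'' (rsc ''T'') ;;
     For ''j'' (nsc ''rp'') (nsc ''rq'')
       (nset ''i'' (NGet ''o'' (nsc ''j'')) ;; bound_event ''c'' (RConst 1) ;; bound_event ''d'' (RConst (-1)) ;;
        rset ''ta'' (RMinus (rsc ''ta'') (at_i ''c''))) ;;
     search_com ;;
     Cond (RLess (RConst 0) (rsc ''W''))
       (rset ''lam'' (RDivide (RMinus (rsc ''ta'') (rsc ''V'')) (rsc ''W'')))
       (rset ''lam'' (RGet ''k1'' (nsc ''pa'')))"

abbreviation "multiplier_nats \<equiv> search_nats \<union> {''E'', ''j'', ''i'', ''k3''}"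
abbreviation "multiplier_reals \<equiv> search_reals \<union> {''ta'', ''k1'', ''k2'', ''w'', ''v'', ''lam''}"

lemma runs_multiplier_com:
  fixes s :: state
  defines "a \<equiv> \<lambda>j. reals s ''a'' (nats s ''o'' j)" and "b \<equiv> \<lambda>j. reals s ''b'' (nats s ''o'' j)"
    and "c \<equiv> \<lambda>j. reals s ''c'' (nats s ''o'' j)" and "d \<equiv> \<lambda>j. reals s ''d'' (nats s ''o'' j)"
    and "T \<equiv> reals s ''T'' 0" and "p \<equiv> nats s ''rp'' 0" and "q \<equiv> nats s ''rq'' 0"
  assumes pq: "p < q" and acd: "\<And>j. p \<le> j \<Longrightarrow> j < q \<Longrightarrow> 0 < a j \<and> c j \<le> d j"
    and T: "sum c {p..<q} \<le> T" "T \<le> sum d {p..<q}"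
    and post: "\<And>t s'. chg multiplier_nats multiplier_reals s s' \<Longrightarrow>
      (\<Sum>j = p..<q. clip (c j) (a j * (reals s' ''lam'' 0 - b j)) (d j)) = T \<Longrightarrow>
      t \<le> 43700 * (q - p) \<Longrightarrow> Q t s'"
  shows "runs F multiplier_com Q s"
proof -
  \<comment> \<open>The hinges represent each clipped term only up to its lower bound, so the lower
    bounds are deducted from the target \<open>ta\<close> along the way.\<close>
  define I where "I k s' \<longleftrightarrow> chg {''E'', ''j'', ''i'', ''k3''} {''ta'', ''k1'', ''k2'', ''w'', ''v''} s s' \<and>
      nats s' ''E'' 0 = 2 * (k - p) \<and>
      reals s' ''ta'' 0 = T - sum c {p..<k} \<and>
      sum (reals s' ''w'') {..<2 * (k - p)} = 0 \<and>
      sum (reals s' ''v'') {..<2 * (k - p)} = sum d {p..<k} - sum c {p..<k} \<and>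
      (\<forall>e<2 * (k - p). nats s' ''k3'' e = e \<and> reals s' ''v'' e = - (reals s' ''w'' e * reals s' ''k1'' e)) \<and>
      (\<forall>x. (\<Sum>e<2 * (k - p). reals s' ''w'' e * max 0 (x - reals s' ''k1'' e)) =
         (\<Sum>j = p..<k. clip (c j) (a j * (x - b j)) (d j)) - sum c {p..<k})" for k s'
  show ?thesis
    unfolding multiplier_com_def runs_Seq runs_NPut runs_RPut
  proof (rule runs_For_const[where A = p and H = q and C = 15 and I = I], goal_cases)
    case 3
    then show ?case by (simp add: I_def chg_def T_def)
  next
    case (4 k s1)
    then show ?case by (simp add: I_def chg_def q_def)
  next
    case (5 k s1)
    then have chg: "chg {''E'', ''j'', ''i'', ''k3''} {''ta'', ''k1'', ''k2'', ''w'', ''v''} s s1"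
      and E: "nats s1 ''E'' 0 = 2 * (k - p)" and j: "nats s1 ''j'' 0 = k" by (simp_all add: I_def)
    have eqs: "nats s1 ''o'' = nats s ''o''" "reals s1 ''a'' (nats s ''o'' k) = a k" "reals s1 ''b'' (nats s ''o'' k) = b k"
      "reals s1 ''c'' (nats s ''o'' k) = c k" "reals s1 ''d'' (nats s ''o'' k) = d k"
      using chg by (simp_all add: chg_def a_def b_def c_def d_def)
    have E2: "2 * (Suc k - p) = Suc (Suc (2 * (k - p)))" using 5(4) by simp
    have acd': "0 < a k" "c k \<le> d k" using acd[of k] 5 by auto
    note hinge = clip_hinge[OF acd', of _ "b k"]
    let ?E = "2 * (k - p)" and ?x = "c k / a k + b k" and ?y = "d k / a k + b k"
    have next_I: "I (Suc k) s2"
      if s2: "chg {''E'', ''j'', ''i'', ''k3''} {''ta'', ''k1'', ''k2'', ''w'', ''v''} s s2"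
        "nats s2 ''E'' 0 = Suc (Suc ?E)" "reals s2 ''ta'' 0 = reals s1 ''ta'' 0 - c k"
        "nats s2 ''k3'' = (nats s1 ''k3'')(?E := ?E, Suc ?E := Suc ?E)"
        "reals s2 ''k1'' = (reals s1 ''k1'')(?E := ?x, Suc ?E := ?y)"
        "reals s2 ''w'' = (reals s1 ''w'')(?E := a k, Suc ?E := - a k)"
        "reals s2 ''v'' = (reals s1 ''v'')(?E := - (a k * ?x), Suc ?E := - (- a k * ?y))" for s2
    proof -
      have sum2: "sum g {..<Suc (Suc ?E)} = sum h {..<?E} + g ?E + g (Suc ?E)"
        if "\<And>e. e < ?E \<Longrightarrow> g e = h e" for g h :: "nat \<Rightarrow> real"
        using that by (simp add: lessThan_Suc)
      have sc: "sum h {p..<Suc k} = sum h {p..<k} + h k" for h :: "nat \<Rightarrow> real"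
        using 5(4) by simp
      show ?thesis
        unfolding I_def E2 sc
      proof (intro conjI allI impI, goal_cases)
        case 4
        show ?case using 5(1) s2(6) by (subst sum2[where h = "reals s1 ''w''"]) (simp_all add: I_def)
      next
        case 5
        have "- (a k * ?x) + a k * ?y = d k - c k" using acd' by (simp add: field_simps)
        moreover have "sum (reals s1 ''v'') {..<?E} = sum d {p..<k} - sum c {p..<k}"
          using \<open>I k s1\<close> unfolding I_def by (elim conjE)
        ultimately show ?case using s2(7)
          by (subst sum2[where h = "reals s1 ''v''"]) simp_all
      next
        case (6 e)
        have "nats s1 ''k3'' e = e" if "e < ?E" using \<open>I k s1\<close> that by (simp add: I_def)
        then show ?case using 6 unfolding s2(4) less_Suc_eq by auto
      next
        case (7 e)
        have "reals s1 ''v'' e = - (reals s1 ''w'' e * reals s1 ''k1'' e)" if "e < ?E"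
          using \<open>I k s1\<close> that by (simp add: I_def)
        then show ?case using 7 unfolding s2(5-7) less_Suc_eq by auto
      next
        case (8 x)
        show ?case
          using \<open>I k s1\<close> s2(5,6) hinge[of x]
          by (subst sum2[where h = "\<lambda>e. reals s1 ''w'' e * max 0 (x - reals s1 ''k1'' e)"]) (simp_all add: I_def)
      qed (use 5(1) s2 in \<open>simp_all add: I_def less_Suc_eq\<close>)
    qed
    define s2 where "s2 = nput ''i'' 0 (nats s ''o'' k) s1"
    have s2: "chg {''i''} {} s1 s2" "nats s2 ''i'' 0 = nats s ''o'' k"
      by (simp_all add: s2_def chg_def)
    have "runs F (bound_event ''c'' (RConst 1) ;; bound_event ''d'' (RConst (- 1)) ;;
        rset ''ta'' (RMinus (rsc ''ta'') (at_i ''c'')))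
       (\<lambda>t s'. 1 + t \<le> 15 \<and> nats s' ''j'' 0 = k \<and> I (Suc k) (nput ''j'' 0 (Suc k) s')) s2"
      unfolding runs_Seq
    proof (rule runs_bound_event[where z = 1], goal_cases)
      case (3 t3 s3)
      show ?case
      proof (rule runs_bound_event[where z = "- 1"], goal_cases)
        case (3 t4 s4)
        have chg4: "chg {''E'', ''i'', ''k3''} {''k1'', ''k2'', ''w'', ''v''} s1 s4"
          using s2(1) \<open>chg _ _ s2 s3\<close> \<open>chg _ _ s3 s4\<close> by (simp add: chg_def)
        have eq3: "nats s3 ''i'' 0 = nats s ''o'' k" "reals s3 ''a'' (nats s ''o'' k) = a k"
          "reals s3 ''b'' (nats s ''o'' k) = b k" "reals s3 ''d'' (nats s ''o'' k) = d k"
          "reals s2 ''a'' (nats s ''o'' k) = a k" "reals s2 ''c'' (nats s ''o'' k) = c k"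
          "reals s2 ''b'' (nats s ''o'' k) = b k"
          "reals s4 ''c'' (nats s ''o'' k) = c k" "nats s4 ''i'' 0 = nats s ''o'' k" "nats s4 ''j'' 0 = k"
          "nats s2 ''E'' 0 = ?E" "nats s2 ''k3'' = nats s1 ''k3''" "reals s2 ''k1'' = reals s1 ''k1''"
          "reals s2 ''w'' = reals s1 ''w''" "reals s2 ''v'' = reals s1 ''v''" "reals s4 ''ta'' = reals s1 ''ta''"
          using s2 \<open>chg _ _ s2 s3\<close> \<open>chg _ _ s3 s4\<close> eqs j E by (simp_all add: chg_def)
        have "I (Suc k) (nput ''j'' 0 (Suc k) (rput ''ta'' 0 (reals s1 ''ta'' 0 - c k) s4))"
        proof (rule next_I, goal_cases)
          case 1
          show ?case using chg chg4 by (simp add: chg_def)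
        qed (use 3 \<open>nats s3 ''E'' 0 = _\<close> \<open>nats s3 ''k3'' = _\<close> \<open>reals s3 ''k1'' = _\<close> \<open>reals s3 ''w'' = _\<close>
             \<open>reals s3 ''v'' = _\<close> in \<open>simp_all add: eq3 s2(2)\<close>)
        then show ?case using \<open>t3 \<le> 6\<close> \<open>t4 \<le> 6\<close> by (simp add: runs_RPut eq3)
      qed simp_all
    qed simp_all
    then show ?case
      unfolding runs_Seq[of F "nset _ _"] runs_NPut by (simp add: s2_def j eqs)
  next
    case (6 t1 s1)
    then have I: "I q s1" by simp
    then have chg: "chg {''E'', ''j'', ''i'', ''k3''} {''ta'', ''k1'', ''k2'', ''w'', ''v''} s s1"
      and E: "nats s1 ''E'' 0 = 2 * (q - p)" and k3: "\<And>e. e < 2 * (q - p) \<Longrightarrow> nats s1 ''k3'' e = e"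
      by (simp_all add: I_def)
    show ?case
    proof (rule runs_search_com, goal_cases)
      case 1
      show ?case unfolding E by (rule inj_onI) (simp add: key_def k3)
    next
      case (2 t2 s2 A)
      let ?l = "if 0 < reals s2 ''W'' 0 then (reals s1 ''ta'' 0 - reals s2 ''V'' 0) / reals s2 ''W'' 0
        else reals s1 ''k1'' (nats s2 ''pa'' 0)"
      have "(\<Sum>e<nats s1 ''E'' 0. reals s1 ''w'' e * max 0 (?l - reals s1 ''k1'' e)) = reals s1 ''ta'' 0"
      proof (rule accepted_root[OF 2(2,3)])
        have "reals s1 ''ta'' 0 = T - sum c {p..<q}" "sum (reals s1 ''v'') {..<nats s1 ''E'' 0} = sum d {p..<q} - sum c {p..<q}"
          using I unfolding I_def E by - (elim conjE, assumption)+
        then show "0 \<le> reals s1 ''ta'' 0" "reals s1 ''ta'' 0 \<le> sum (reals s1 ''v'') {..<nats s1 ''E'' 0}"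
          using T by simp_all
      qed (use I E pq in \<open>simp_all add: I_def\<close>)
      then have root: "(\<Sum>j = p..<q. clip (c j) (a j * (?l - b j)) (d j)) = T"
        using I unfolding E by (simp add: I_def)
      have eq2: "reals s2 ''k1'' = reals s1 ''k1''" "reals s2 ''ta'' = reals s1 ''ta''"
        using 2(1) by (simp_all add: chg_def)
      \<comment> \<open>Two events per variable make the search cost \<open>2 * 21800\<close> per
        variable; 17 more create the events.\<close>
      have t: "t1 + t2 \<le> 43617 * (q - p) + 12" "1 \<le> q - p" using 6(3) 2(4) E pq by simp_all
      have chg2: "chg multiplier_nats multiplier_reals s (rput ''lam'' 0 z s2)" for z
        using chg 2(1) by (simp add: chg_def)
      show ?case
      proof (cases "0 < reals s2 ''W'' 0")
        case True
        then have bv: "bval F (RLess (RConst 0) (rsc ''W'')) s2" by simp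
        show ?thesis
          unfolding runs_Cond if_P[OF bv] runs_RPut
        proof (rule post, goal_cases)
          case 1
          show ?case using chg2 by simp
        qed (use True root eq2 t in simp_all)
      next
        case False
        then have bv: "\<not> bval F (RLess (RConst 0) (rsc ''W'')) s2" by simp
        show ?thesis
          unfolding runs_Cond if_not_P[OF bv] runs_RPut
        proof (rule post, goal_cases)
          case 1
          show ?case using chg2 by simp
        qed (use False root eq2 t in simp_all)
      qed
    qed
  qed (use pq in \<open>simp_all add: p_def q_def\<close>)
qed

definition rmax_com :: "string \<Rightarrow> nexp \<Rightarrow> rexp \<Rightarrow> com" where
  "rmax_com v i e = Cond (RLess (RGet v i) e) (RPut v i e) Skip"

definition rmin_com :: "string \<Rightarrow> nexp \<Rightarrow> rexp \<Rightarrow> com" where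
  "rmin_com v i e = Cond (RLess e (RGet v i)) (RPut v i e) Skip"

lemma rput_same: "reals s v i = r \<Longrightarrow> rput v i r s = s"
  by (cases s) (auto simp: rput_def fun_upd_idem)

lemma runs_rmax_com:
  assumes "\<And>t. t \<le> 2 \<Longrightarrow> Q t (rput v (nval i s) (max (reals s v (nval i s)) (rval F e s)) s)"
  shows "runs F (rmax_com v i e) Q s"
  using assms[of 2] unfolding rmax_com_def
  by (auto simp: runs_simps max_def rput_same numeral_2_eq_2 split: if_splits)

lemma runs_rmin_com:
  assumes "\<And>t. t \<le> 2 \<Longrightarrow> Q t (rput v (nval i s) (min (reals s v (nval i s)) (rval F e s)) s)"
  shows "runs F (rmin_com v i e) Q s"
  using assms[of 2] unfolding rmin_com_def
  by (auto simp: runs_simps min_def rput_same numeral_2_eq_2 split: if_splits)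

definition clip_com :: "string \<Rightarrow> rexp \<Rightarrow> com" where
  "clip_com v e = RPut v (nsc ''i'') e ;; rmin_com v (nsc ''i'') (at_i ''d'') ;; rmax_com v (nsc ''i'') (at_i ''c'')"

lemma runs_clip_com:
  assumes "v \<noteq> ''c''" "v \<noteq> ''d''"
    and post: "\<And>t s'. t \<le> 5 \<Longrightarrow> chg {} {v} s s' \<Longrightarrow>
      reals s' v = (reals s v)(nats s ''i'' 0 :=
        clip (reals s ''c'' (nats s ''i'' 0)) (rval F e s) (reals s ''d'' (nats s ''i'' 0))) \<Longrightarrow> Q t s'"
  shows "runs F (clip_com v e) Q s"
  unfolding clip_com_def runs_Seq runs_RPut
  by (intro runs_rmin_com runs_rmax_com post) (use assms(1,2) in \<open>auto simp: chg_def max.commute min.commute\<close>)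

definition rap_cont_com :: com where
  "rap_cont_com = multiplier_com ;;
     For ''j'' (nsc ''rp'') (nsc ''rq'')
       (nset ''i'' (NGet ''o'' (nsc ''j'')) ;;
        clip_com ''y'' (RTimes (at_i ''a'') (RMinus (rsc ''lam'') (at_i ''b''))))"

lemma runs_rap_cont_com:
  fixes s :: state
  defines "a \<equiv> reals s ''a''" and "b \<equiv> reals s ''b''" and "c \<equiv> reals s ''c''" and "d \<equiv> reals s ''d''"
    and "T \<equiv> reals s ''T'' 0" and "p \<equiv> nats s ''rp'' 0" and "q \<equiv> nats s ''rq'' 0" and "od \<equiv> nats s ''o''"
  assumes pq: "p < q" and acd: "\<And>j. p \<le> j \<Longrightarrow> j < q \<Longrightarrow> 0 < a (od j) \<and> c (od j) \<le> d (od j)"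
    and T: "(\<Sum>j = p..<q. c (od j)) \<le> T" "T \<le> (\<Sum>j = p..<q. d (od j))"
    and post: "\<And>t s' x. chg multiplier_nats (multiplier_reals \<union> {''y''}) s s' \<Longrightarrow>
      (\<And>j. p \<le> j \<Longrightarrow> j < q \<Longrightarrow>
        reals s' ''y'' (od j) = clip (c (od j)) (a (od j) * (x - b (od j))) (d (od j))) \<Longrightarrow>
      (\<Sum>j = p..<q. reals s' ''y'' (od j)) = T \<Longrightarrow>
      t \<le> 44000 * (q - p) \<Longrightarrow> Q t s'"
  shows "runs F rap_cont_com Q s"
  unfolding rap_cont_com_def runs_Seq
proof (rule runs_multiplier_com, goal_cases)
  case (5 t1 s1)
  define x where "x = reals s1 ''lam'' 0"
  have sum: "(\<Sum>j = p..<q. clip (c (od j)) (a (od j) * (x - b (od j))) (d (od j))) = T"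
    using 5(2) by (simp add: a_def b_def c_def d_def p_def q_def od_def T_def x_def)
  let ?f = "\<lambda>i. clip (c i) (a i * (x - b i)) (d i)"
  show ?case
  proof (rule runs_For_const[where A = p and H = q and C = 6 and
      I = "\<lambda>k s'. chg multiplier_nats (multiplier_reals \<union> {''y''}) s s' \<and> reals s' ''lam'' 0 = x \<and>
        (\<forall>j. p \<le> j \<longrightarrow> j < k \<longrightarrow> reals s' ''y'' (od j) = ?f (od j))"], goal_cases)
    case 1
    then show ?case using 5(1) by (simp add: chg_def p_def)
  next
    case 2
    then show ?case using pq by simp
  next
    case 3
    then show ?case using 5(1) by (simp add: chg_def x_def)
  next
    case (4 k s2)
    then show ?case by (simp add: chg_def q_def)
  next
    case (5 k s2)
    then have chg2: "chg multiplier_nats (multiplier_reals \<union> {''y''}) s s2" by blast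
    define s3 where "s3 = nput ''i'' 0 (od k) s2"
    have eq3: "nats s3 ''i'' 0 = od k" "reals s3 ''c'' = c" "reals s3 ''d'' = d" "reals s3 ''a'' = a" "reals s3 ''b'' = b"
      "reals s3 ''lam'' 0 = x" "nats s3 ''j'' 0 = k" "reals s3 ''y'' = reals s2 ''y''" "nats s2 ''o'' = od"
      using chg2 5(1,2) by (simp_all add: chg_def s3_def a_def b_def c_def d_def od_def)
    have chg3: "chg multiplier_nats (multiplier_reals \<union> {''y''}) s s3" using chg2 by (simp add: chg_def s3_def)
    have "runs F (clip_com ''y'' (RTimes (at_i ''a'') (RMinus (rsc ''lam'') (at_i ''b''))))
       (\<lambda>t s'. 1 + t \<le> 6 \<and> nats s' ''j'' 0 = k \<and>
          chg multiplier_nats (multiplier_reals \<union> {''y''}) s (nput ''j'' 0 (Suc k) s') \<and>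
          reals (nput ''j'' 0 (Suc k) s') ''lam'' 0 = x \<and>
          (\<forall>j. p \<le> j \<longrightarrow> j < Suc k \<longrightarrow> reals (nput ''j'' 0 (Suc k) s') ''y'' (od j) = ?f (od j))) s3"
    proof (rule runs_clip_com, goal_cases)
      case (3 t4 s4)
      have "chg multiplier_nats (multiplier_reals \<union> {''y''}) s (nput ''j'' 0 (Suc k) s4)"
        using chg3 3(2) by (simp add: chg_def)
      moreover have "nats s4 ''j'' 0 = k" "reals s4 ''lam'' 0 = x" using 3(2) eq3 by (simp_all add: chg_def)
      moreover have "reals s4 ''y'' = (reals s2 ''y'')(od k := ?f (od k))"
        using 3(3) by (simp add: eq3)
      ultimately show ?case using 3(1) 5(1) by (simp add: less_Suc_eq)
    qed simp_all
    then show ?case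
      unfolding runs_Seq[of F "nset _ _"] runs_NPut by (simp add: s3_def eq3 5(2))
  next
    case (6 t2 s2)
    have y: "reals s2 ''y'' (od j) = ?f (od j)" if "p \<le> j" "j < q" for j using 6(1) that by blast
    have "(\<Sum>j = p..<q. reals s2 ''y'' (od j)) = T"
      using y sum by (subst sum.cong[OF refl, of _ _ "\<lambda>j. ?f (od j)"]) auto
    moreover have "t1 + t2 \<le> 44000 * (q - p)" using 5(3) 6(3) pq by (simp add: p_def q_def)
    ultimately show ?case using 6(1) y by (intro post[of s2 x]) auto
  qed
qed (use pq acd T in \<open>simp_all add: a_def b_def c_def d_def p_def q_def od_def T_def\<close>)

section \<open>Left derivatives, ordered unit steps, and the window around the relaxation\<close>

section \<open>Subgradients and unit steps\<close>

text \<open>For convex \<open>f\<close> this is the left derivative, since slopes towards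
  \<open>x\<close> increase as \<open>t\<close> approaches \<open>x\<close>.\<close>

definition subgrad :: "(real \<Rightarrow> real) \<Rightarrow> real \<Rightarrow> real" where
  "subgrad f x = (SUP t\<in>{..<x}. (f x - f t) / (x - t))"

text \<open>Every slope from the left is at most every slope to the right. This bounds the supremum
  and gives the supporting line on both sides.\<close>

lemma subgrad:
  assumes "convex_on UNIV f"
  shows "f x + subgrad f x * (y - x) \<le> f y"
proof -
  have slope: "(f x - f t) / (x - t) \<le> (f y - f x) / (y - x)" if "t < x" "x < y" for t y
  proof -
    have "(f t - f x) / (t - x) \<le> (f t - f y) / (t - y)" "(f t - f y) / (t - y) \<le> (f x - f y) / (x - y)"
      using convex_on_slope_le[OF assms _ _ that] by auto
    then have "(f t - f x) / (t - x) \<le> (f x - f y) / (x - y)" by linarith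
    moreover have "(f t - f x) / (t - x) = (f x - f t) / (x - t)" "(f x - f y) / (x - y) = (f y - f x) / (y - x)"
      using that by (simp_all add: divide_simps) (simp_all add: algebra_simps)
    ultimately show ?thesis by simp
  qed
  have bdd: "bdd_above ((\<lambda>t. (f x - f t) / (x - t)) ` {..<x})"
    using slope[of _ "x + 1"] by (auto intro!: bdd_aboveI2)
  show ?thesis
  proof (cases x y rule: linorder_cases)
    case less
    have "subgrad f x \<le> (f y - f x) / (y - x)"
      unfolding subgrad_def using slope[OF _ less] by (intro cSUP_least) auto
    then show ?thesis using less by (simp add: field_simps)
  next
    case greater
    have "(f x - f y) / (x - y) \<le> subgrad f x"
      unfolding subgrad_def by (intro cSUP_upper bdd) (use greater in auto)
    then show ?thesis using greater by (simp add: field_simps)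
  qed simp
qed

lemma subgrad_mono:
  assumes "convex_on UNIV f" "x \<le> y"
  shows "subgrad f x \<le> subgrad f y"
proof (cases "x = y")
  case False
  have "0 \<le> (subgrad f y - subgrad f x) * (y - x)"
    using subgrad[OF assms(1), of x y] subgrad[OF assms(1), of y x] by (simp add: algebra_simps)
  then show ?thesis using False assms(2) by (simp add: zero_le_mult_iff)
qed simp

text \<open>Ties between steps of equal cost are broken by their position on the common axis of \<open>f\<close>; this makes the keys of
  each variable strictly increasing even where \<open>f\<close> is affine.\<close>

definition unit_key :: "(real \<Rightarrow> real) \<Rightarrow> (nat \<Rightarrow> real) \<Rightarrow> (nat \<Rightarrow> real) \<Rightarrow> nat \<Rightarrow> int \<Rightarrow> lexkey" where
  "unit_key f a b i t =
     ((f ((of_int t + 1) / a i + b i) - f (of_int t / a i + b i)) * a i, of_int t / a i + b i, i)"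

text \<open>A unit step of variable \<open>i\<close> covers an interval of length
  \<open>1 / a i\<close> on the axis of \<open>f\<close>, so its cost is the slope of
  \<open>f\<close> over that interval. Convexity orders the slopes of non-overlapping intervals,
  weakly; the position component makes the order strict.\<close>

lemma unit_key_less:
  assumes f: "convex_on UNIV f" and a: "0 < a i" "0 < a j"
    and disj: "(of_int t + 1) / a i + b i \<le> of_int t' / a j + b j"
  shows "unit_key f a b i t < unit_key f a b j t'"
proof -
  let ?x = "of_int t / a i + b i" and ?y = "(of_int t + 1) / a i + b i"
  let ?u = "of_int t' / a j + b j" and ?v = "(of_int t' + 1) / a j + b j"
  have yx: "(?y - ?x) * a i = 1" "(?v - ?u) * a j = 1" "?x < ?y"
    using a by (simp_all add: field_simps)
  have "(f ?y - f ?x) * a i \<le> subgrad f ?y * (?y - ?x) * a i"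
    using subgrad[OF f, of ?y ?x] a by (intro mult_right_mono) (simp_all add: algebra_simps)
  also have "\<dots> = subgrad f ?y" using yx by (simp add: mult.assoc)
  also have "\<dots> \<le> subgrad f ?u" using disj by (rule subgrad_mono[OF f])
  also have "\<dots> = subgrad f ?u * (?v - ?u) * a j" using yx by (simp add: mult.assoc)
  also have "\<dots> \<le> (f ?v - f ?u) * a j"
    using subgrad[OF f, of ?u ?v] a by (intro mult_right_mono) (simp_all add: algebra_simps)
  finally have "(f ?y - f ?x) * a i \<le> (f ?v - f ?u) * a j" .
  moreover have "?x < ?u" using yx disj by linarith
  ultimately show ?thesis by (auto simp: unit_key_def less_prod_def')
qed

lemma unit_key_strict_mono:
  assumes "convex_on UNIV f" "0 < a i" "t < t'"
  shows "unit_key f a b i t < unit_key f a b i t'"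
proof -
  have "(of_int t + 1) / a i \<le> of_int t' / a i"
    using assms(2,3) by (intro divide_right_mono) linarith+
  then show ?thesis using assms by (intro unit_key_less) auto
qed

lemma unit_key_mono_iff:
  assumes "convex_on UNIV f" "0 < a i"
  shows "unit_key f a b i t \<le> unit_key f a b i t' \<longleftrightarrow> t \<le> t'"
    and "unit_key f a b i t < unit_key f a b i t' \<longleftrightarrow> t < t'"
  using unit_key_strict_mono[of f a i t t' b, OF assms] unit_key_strict_mono[of f a i t' t b, OF assms]
  by (cases t t' rule: linorder_cases; auto simp: less_imp_le not_le)+

lemma down_closed_interval:
  fixes D :: "int set"
  assumes "D \<subseteq> {y..<z}" "\<And>t t'. t \<in> D \<Longrightarrow> y \<le> t' \<Longrightarrow> t' < t \<Longrightarrow> t' \<in> D"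
  shows "D = {y..<y + int (card D)}"
proof -
  have fin: "finite D" using assms(1) by (rule finite_subset) simp
  show ?thesis
  proof (cases "D = {}")
    case False
    define M where "M = Max D"
    have M: "M \<in> D" "\<And>t. t \<in> D \<Longrightarrow> t \<le> M" using Max_in[OF fin False] Max_ge[OF fin] by (auto simp: M_def)
    have "t \<in> D" if "y \<le> t" "t < M + 1" for t
      using assms(2)[OF M(1) that(1)] M(1) that(2) by (cases "t = M") auto
    then have D: "D = {y..<M + 1}" using M(2) assms(1) by force
    have "y \<le> M" using M(1) assms(1) by auto
    then have "y + int (card D) = M + 1" unfolding D by simp
    then show ?thesis using D by simp
  qed simp
qed

text \<open>The response of an integer variable. Counting the affordable steps, rather than locating
  the last one, makes monotonicity in \<open>\<kappa>\<close> immediate without any order on the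
  keys; \<open>step_val_cut\<close> recovers the cut.\<close>

definition step_val :: "(int \<Rightarrow> 'k::linorder) \<Rightarrow> int \<Rightarrow> int \<Rightarrow> 'k \<Rightarrow> real" where
  "step_val kf l u \<kappa> = of_int (l + int (card {t\<in>{l..<u}. kf t \<le> \<kappa>}))"

lemma step_val_cut:
  fixes kf :: "int \<Rightarrow> 'k::linorder"
  assumes mono: "\<And>t t'. t < t' \<Longrightarrow> kf t < kf t'" and "l \<le> u"
  obtains m where "l \<le> m" "m \<le> u" "step_val kf l u \<kappa> = of_int m"
    "\<And>t. l \<le> t \<Longrightarrow> t < u \<Longrightarrow> kf t \<le> \<kappa> \<longleftrightarrow> t < m"
proof -
  let ?D = "{t\<in>{l..<u}. kf t \<le> \<kappa>}"
  have D: "?D = {l..<l + int (card ?D)}"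
  proof (rule down_closed_interval)
    show "t' \<in> ?D" if "t \<in> ?D" "l \<le> t'" "t' < t" for t t'
      using that mono[of t' t] by (auto intro: less_imp_le less_le_trans)
  qed auto
  have "card ?D \<le> card {l..<u}" by (rule card_mono) auto
  then have "l + int (card ?D) \<le> u" using assms(2) by simp
  moreover have "kf t \<le> \<kappa> \<longleftrightarrow> t < l + int (card ?D)" if "l \<le> t" "t < u" for t
    using that D by (metis (no_types, lifting) atLeastLessThan_iff mem_Collect_eq)
  ultimately show ?thesis by (intro that[of "l + int (card ?D)"]) (auto simp: step_val_def)
qed

lemma step_val_mono:
  "\<kappa> \<le> \<kappa>' \<Longrightarrow> step_val kf l u \<kappa> \<le> step_val kf l u \<kappa>'"
proof -
  assume "\<kappa> \<le> \<kappa>'"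
  then have "{t\<in>{l..<u}. kf t \<le> \<kappa>} \<subseteq> {t\<in>{l..<u}. kf t \<le> \<kappa>'}" by (auto intro: order_trans)
  then have "card {t\<in>{l..<u}. kf t \<le> \<kappa>} \<le> card {t\<in>{l..<u}. kf t \<le> \<kappa>'}" by (rule card_mono[rotated]) (rule finite_subset[of _ "{l..<u}"], auto)
  then show ?thesis by (simp add: step_val_def)
qed

text \<open>Links a subproblem to the full variable: a cut found inside the smaller box
  \<open>[c, d]\<close> is the response over \<open>[l, u]\<close>, clipped. This is the form in
  which \<open>sol_merge\<close> expects the allocation.\<close>

lemma step_val_clip:
  fixes kf :: "int \<Rightarrow> 'k::linorder"
  assumes mono: "\<And>t t'. t < t' \<Longrightarrow> kf t < kf t'"
    and "l \<le> c" "c \<le> x" "x \<le> d" "d \<le> u"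
    and "\<And>t. c \<le> t \<Longrightarrow> t < x \<Longrightarrow> kf t \<le> \<kappa>" "\<And>t. x \<le> t \<Longrightarrow> t < d \<Longrightarrow> \<kappa> < kf t"
  shows "clip (of_int c) (step_val kf l u \<kappa>) (of_int d) = of_int x"
proof -
  obtain m where m: "l \<le> m" "m \<le> u" "step_val kf l u \<kappa> = of_int m"
    "\<And>t. l \<le> t \<Longrightarrow> t < u \<Longrightarrow> kf t \<le> \<kappa> \<longleftrightarrow> t < m"
    using step_val_cut[of kf l u \<kappa>, OF mono] assms(2-5) by auto
  have "x \<le> m" if "c < x" using m(4)[of "x - 1"] assms(6)[of "x - 1"] assms that by auto
  moreover have "m \<le> x" if "x < d"
  proof -
    have "\<not> kf x \<le> \<kappa>" using assms(7)[of x] that by (simp add: leD)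
    then show ?thesis using m(4)[of x] assms(2-5) that by simp
  qed
  ultimately have "max c (min m d) = x" using assms(3,4) by linarith
  then show ?thesis unfolding m(3) by (simp add: of_int_max[symmetric] of_int_min[symmetric] del: of_int_max of_int_min)
qed

text \<open>The real relaxation confines the optimal cut to a window of linearly many steps.\<close>

lemma window_size:
  fixes c d y z :: "nat \<Rightarrow> int" and w1 w2 :: "nat \<Rightarrow> real" and T :: int
  assumes V: "finite V" "\<And>i. i \<in> V \<Longrightarrow> c i \<le> d i"
    and y: "\<And>i. i \<in> V \<Longrightarrow> y i = max (c i) (min \<lfloor>w1 i\<rfloor> (d i))"
    and z: "\<And>i. i \<in> V \<Longrightarrow> z i = max (c i) (min \<lceil>w2 i\<rceil> (d i))"
    and S1: "(\<Sum>i\<in>V. clip (c i) (w1 i) (d i)) = max (sum c V) (T - card V - 1)"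
    and S2: "(\<Sum>i\<in>V. clip (c i) (w2 i) (d i)) = min (sum d V) (T + card V + 1)"
    and T: "sum c V \<le> T" "T \<le> sum d V"
  shows "sum y V \<le> T" "T \<le> sum z V" "sum z V - sum y V \<le> 4 * card V + 2"
proof -
  \<comment> \<open>Rounding moves each term by at most 1, which the margin
    \<open>card V + 1\<close> of the targets absorbs on either side. Two margins and two roundings
    give the width \<open>4 * card V + 2\<close>.\<close>
  have y1: "y i \<le> clip (c i) (w1 i) (d i)" "clip (c i) (w1 i) (d i) \<le> y i + 1"
    and z1: "clip (c i) (w2 i) (d i) \<le> z i" "z i \<le> clip (c i) (w2 i) (d i) + 1" if "i \<in> V" for i
    using V(2)[OF that] unfolding y[OF that] z[OF that] by (simp_all add: max_def min_def) linarith+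
  have "(\<Sum>i\<in>V. of_int (y i)) \<le> (\<Sum>i\<in>V. clip (c i) (w1 i) (d i))"
    by (rule sum_mono, erule y1(1))
  moreover have "(\<Sum>i\<in>V. clip (c i) (w2 i) (d i)) \<le> (\<Sum>i\<in>V. of_int (z i))"
    by (rule sum_mono, erule z1(1))
  moreover have "(\<Sum>i\<in>V. clip (c i) (w1 i) (d i)) \<le> (\<Sum>i\<in>V. of_int (y i) + 1)"
    by (rule sum_mono, drule y1(2), simp)
  moreover have "(\<Sum>i\<in>V. of_int (z i)) \<le> (\<Sum>i\<in>V. clip (c i) (w2 i) (d i) + 1)"
    by (rule sum_mono, drule z1(2), simp)
  ultimately show "sum y V \<le> T" "T \<le> sum z V" "sum z V - sum y V \<le> 4 * card V + 2"
    unfolding S1 S2 sum.distrib using T by (simp_all flip: of_int_sum)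
qed

text \<open>If the relaxed multipliers come out in the wrong order, monotonicity forces the two
  targets into the wrong order too. Their margins around \<open>T\<close> then leave only
  \<open>sum c V = sum d V\<close>, where every box is a single point.\<close>

lemma window_nonempty:
  fixes c d y z :: "nat \<Rightarrow> int" and T :: int
  assumes V: "finite V" "\<And>i. i \<in> V \<Longrightarrow> 0 < a i \<and> c i \<le> d i"
    and y: "\<And>i. i \<in> V \<Longrightarrow> y i = max (c i) (min \<lfloor>a i * (x1 - b i)\<rfloor> (d i))"
    and z: "\<And>i. i \<in> V \<Longrightarrow> z i = max (c i) (min \<lceil>a i * (x2 - b i)\<rceil> (d i))"
    and S1: "(\<Sum>i\<in>V. clip (c i) (a i * (x1 - b i)) (d i)) = max (sum c V) (T - card V - 1)"
    and S2: "(\<Sum>i\<in>V. clip (c i) (a i * (x2 - b i)) (d i)) = min (sum d V) (T + card V + 1)"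
    and T: "sum c V \<le> T" "T \<le> sum d V" and i: "i \<in> V"
  shows "y i \<le> z i"
proof (cases "x1 \<le> x2")
  case True
  have "a i * (x1 - b i) \<le> a i * (x2 - b i)" using True V(2)[OF i] by simp
  then have "\<lfloor>a i * (x1 - b i)\<rfloor> \<le> \<lceil>a i * (x2 - b i)\<rceil>" by linarith
  then show ?thesis unfolding y[OF i] z[OF i] by auto
next
  case False
  have mono: "clip (c i) (a i * (x2 - b i)) (d i) \<le> clip (c i) (a i * (x1 - b i)) (d i)" if "i \<in> V" for i
  proof -
    have "a i * (x2 - b i) \<le> a i * (x1 - b i)" using False V(2)[OF that] by simp
    then show ?thesis by auto
  qed
  have "real_of_int (min (sum d V) (T + card V + 1)) \<le> real_of_int (max (sum c V) (T - card V - 1))"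
    unfolding S1[symmetric] S2[symmetric] by (rule sum_mono) (rule mono)
  then have "min (sum d V) (T + card V + 1) \<le> max (sum c V) (T - card V - 1)" by (simp only: of_int_le_iff)
  then have "sum d V = sum c V" using T by linarith
  then have "(\<Sum>i\<in>V. d i - c i) = 0" by (simp add: sum_subtractf)
  then have "d i - c i = 0" using V i by (subst (asm) sum_nonneg_eq_0_iff) auto
  then show ?thesis unfolding y[OF i] z[OF i] by auto
qed

text \<open>The search compares only steps inside the window. Steps below it end at or before
  \<open>x1\<close>, while some selected window step starts at or after \<open>x1\<close>; steps
  above it start at or after \<open>x2\<close>, while some unselected window step ends at or before
  \<open>x2\<close>. Transitivity through these witnesses extends the order to all steps.\<close>

lemma window_order:
  fixes c d x y z :: "nat \<Rightarrow> int" and T :: int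
  assumes f: "convex_on UNIV f" and V: "finite V" "\<And>i. i \<in> V \<Longrightarrow> 0 < a i \<and> c i \<le> d i"
    and y: "\<And>i. i \<in> V \<Longrightarrow> y i = max (c i) (min \<lfloor>a i * (x1 - b i)\<rfloor> (d i))"
    and z: "\<And>i. i \<in> V \<Longrightarrow> z i = max (c i) (min \<lceil>a i * (x2 - b i)\<rceil> (d i))"
    and S1: "(\<Sum>i\<in>V. clip (c i) (a i * (x1 - b i)) (d i)) = max (sum c V) (T - card V - 1)"
    and S2: "(\<Sum>i\<in>V. clip (c i) (a i * (x2 - b i)) (d i)) = min (sum d V) (T + card V + 1)"
    and T: "sum x V = T" "sum c V \<le> T" "T \<le> sum d V"
    and x: "\<And>i. i \<in> V \<Longrightarrow> y i \<le> x i \<and> x i \<le> max (y i) (z i)"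
    and win: "\<And>i j t t'. i \<in> V \<Longrightarrow> j \<in> V \<Longrightarrow> y i \<le> t \<Longrightarrow> t < x i \<Longrightarrow> x j \<le> t' \<Longrightarrow> t' < z j \<Longrightarrow>
      unit_key f a b i t < unit_key f a b j t'"
    and ij: "i \<in> V" "j \<in> V" "c i \<le> t" "t < x i" "x j \<le> t'" "t' < d j"
  shows "unit_key f a b i t < unit_key f a b j t'"
proof -
  let ?w = "\<lambda>x i. a i * (x - b i)"
  have cx: "c i \<le> x i" "x i \<le> d i" if "i \<in> V" for i
  proof -
    have "y i \<le> d i" "z i \<le> d i" "c i \<le> y i" using V(2)[OF that] y[OF that] z[OF that] by auto
    then show "c i \<le> x i" "x i \<le> d i" using x[OF that] by auto
  qed
  have right: "of_int (t + 1) \<le> ?w x0 i \<longleftrightarrow> (of_int t + 1) / a i + b i \<le> x0"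
    and left: "?w x0 i \<le> of_int t \<longleftrightarrow> x0 \<le> of_int t / a i + b i" if "i \<in> V" for i t x0
    using V(2)[OF that] by (simp_all add: field_simps)
  have lo: "(of_int t + 1) / a i + b i \<le> x1" if "i \<in> V" "c i \<le> t" "t < y i" for i t
  proof -
    have "t + 1 \<le> \<lfloor>?w x1 i\<rfloor>" using that y[OF that(1)] by auto
    then show ?thesis using right[OF that(1), of t x1] by (simp add: le_floor_iff)
  qed
  have hi: "x2 \<le> of_int t / a i + b i" if "i \<in> V" "t < d i" "z i \<le> t" for i t
  proof -
    have "\<lceil>?w x2 i\<rceil> \<le> t" using that z[OF that(1)] by auto
    then show ?thesis using left[OF that(1), of x2 t] by (simp add: ceiling_le_iff)
  qed
  note ukl = unit_key_less[OF f]
  \<comment> \<open>Without such a step each \<open>x i\<close> exceeds its relaxed value by at most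
    1, so the sum would be at most \<open>(T - card V - 1) + card V < T\<close>.\<close>
  have low_step: "\<exists>i'\<in>V. \<exists>t0. y i' \<le> t0 \<and> t0 < x i' \<and> x1 \<le> of_int t0 / a i' + b i'"
    if "T - card V - 1 > sum c V"
  proof (rule ccontr)
    assume neg: "\<not> ?thesis"
    have "of_int (x i) \<le> clip (c i) (?w x1 i) (d i) + 1" if "i \<in> V" for i
    proof (cases "c i < x i")
      case True
      have "\<not> x1 \<le> of_int (x i - 1) / a i + b i"
      proof (cases "y i \<le> x i - 1")
        case True
        then show ?thesis using neg that by (metis zle_diff1_eq order_refl)
      next
        case False
        then have "(of_int (x i - 1) + 1) / a i + b i \<le> x1" using lo[of i "x i - 1"] that True by simp
        then show ?thesis using V(2)[OF that] by (simp add: divide_right_mono field_simps)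
      qed
      then have "of_int (x i - 1) < ?w x1 i" using left[OF that] by (meson not_le)
      then show ?thesis using cx[OF that] by (simp add: max_def min_def)
    next
      case False
      then show ?thesis using cx[OF that] by simp
    qed
    then have "(\<Sum>i\<in>V. of_int (x i)) \<le> (\<Sum>i\<in>V. clip (c i) (?w x1 i) (d i) + 1)" by (rule sum_mono)
    then have "of_int T \<le> real_of_int (max (sum c V) (T - card V - 1)) + card V"
      unfolding sum.distrib using S1 T by (simp flip: of_int_sum)
    then show False using that by (simp add: max_def)
  qed
  have high_step: "\<exists>i'\<in>V. \<exists>t0. x i' \<le> t0 \<and> t0 < z i' \<and> (of_int t0 + 1) / a i' + b i' \<le> x2"
    if "T + card V + 1 < sum d V"
  proof (rule ccontr)
    assume neg: "\<not> ?thesis"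
    have "clip (c i) (?w x2 i) (d i) - 1 \<le> of_int (x i)" if "i \<in> V" for i
    proof (cases "x i < d i")
      case True
      have "\<not> (of_int (x i) + 1) / a i + b i \<le> x2"
      proof (cases "x i < z i")
        case True
        then show ?thesis using neg that by blast
      next
        case False
        then have "x2 \<le> of_int (x i) / a i + b i" using hi[of i "x i"] that True by simp
        moreover have "of_int (x i) / a i < (of_int (x i) + 1) / a i"
          using V(2)[OF that] by (simp add: divide_strict_right_mono)
        ultimately show ?thesis by linarith
      qed
      then have "?w x2 i < of_int (x i + 1)" using right[OF that] by (meson not_le)
      then show ?thesis using cx[OF that] by (simp add: max_def min_def)
    next
      case False
      then show ?thesis using cx[OF that] V(2)[OF that] by (simp add: max_def min_def)
    qed
    then have "(\<Sum>i\<in>V. clip (c i) (?w x2 i) (d i) - 1) \<le> (\<Sum>i\<in>V. of_int (x i))" by (rule sum_mono)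
    then have "real_of_int (min (sum d V) (T + card V + 1)) - card V \<le> of_int T"
      unfolding sum_subtractf using S2 T by (simp flip: of_int_sum)
    then show False using that by (simp add: min_def)
  qed
  \<comment> \<open>A target clamped to \<open>sum c V\<close> pins all relaxed values to the lower
    bounds, and then there are no steps below the window.\<close>
  have lowT: "T - card V - 1 > sum c V" if "t < y i"
  proof (rule ccontr)
    assume "\<not> T - card V - 1 > sum c V"
    then have e: "max (sum c V) (T - int (card V) - 1) = sum c V" by simp
    have "(\<Sum>i\<in>V. clip (c i) (?w x1 i) (d i)) = (\<Sum>i\<in>V. of_int (c i))" using S1 unfolding e by simp
    then have "(\<Sum>i\<in>V. clip (c i) (?w x1 i) (d i) - of_int (c i)) = 0" by (simp add: sum_subtractf)
    then have "clip (c i) (?w x1 i) (d i) - of_int (c i) = 0"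
      using V(1) ij(1) by (subst (asm) sum_nonneg_eq_0_iff) auto
    moreover have "t + 1 \<le> \<lfloor>?w x1 i\<rfloor>" "t + 1 \<le> d i" using that y[OF ij(1)] ij(3) by auto
    ultimately show False using ij(3) by (simp add: le_floor_iff max_def min_def split: if_splits)
  qed
  have highT: "T + card V + 1 < sum d V" if "z j \<le> t'"
  proof (rule ccontr)
    assume "\<not> T + card V + 1 < sum d V"
    then have e: "min (sum d V) (T + int (card V) + 1) = sum d V" by simp
    have "(\<Sum>i\<in>V. clip (c i) (?w x2 i) (d i)) = (\<Sum>i\<in>V. of_int (d i))" using S2 unfolding e by simp
    then have "(\<Sum>i\<in>V. of_int (d i) - clip (c i) (?w x2 i) (d i)) = 0" by (simp add: sum_subtractf)
    then have "of_int (d j) - clip (c j) (?w x2 j) (d j) = 0"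
      using V ij(2) by (subst (asm) sum_nonneg_eq_0_iff) auto
    moreover have "\<lceil>?w x2 j\<rceil> \<le> t'" "c j \<le> t'" using that z[OF ij(2)] ij(6) by auto
    ultimately show False using ij(6) by (simp add: ceiling_le_iff max_def min_def split: if_splits)
  qed
  have ai: "0 < a i" "0 < a j" using V(2) ij by auto
  show ?thesis
  proof (cases "t < y i")
    case True
    note lo1 = lo[OF ij(1,3) True]
    obtain i' t0 where *: "i' \<in> V" "y i' \<le> t0" "t0 < x i'" "x1 \<le> of_int t0 / a i' + b i'"
      using low_step[OF lowT[OF True]] by blast
    then have 1: "unit_key f a b i t < unit_key f a b i' t0"
      using lo1 V(2) ai by (intro ukl) auto
    show ?thesis
    proof (cases "t' < z j")
      case True
      then show ?thesis using less_trans[OF 1 win[OF *(1) ij(2) *(2,3) ij(5)]] by simp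
    next
      case False
      obtain j' t1 where **: "j' \<in> V" "x j' \<le> t1" "t1 < z j'" "(of_int t1 + 1) / a j' + b j' \<le> x2"
        using high_step highT False by force
      have "unit_key f a b i' t0 < unit_key f a b j' t1" using * ** by (intro win)
      moreover have "unit_key f a b j' t1 < unit_key f a b j t'"
        using hi[OF ij(2,6)] False ** V(2) ai by (intro ukl) auto
      ultimately show ?thesis using 1 by (blast intro: less_trans)
    qed
  next
    case False
    show ?thesis
    proof (cases "t' < z j")
      case True
      then show ?thesis using False win ij by simp
    next
      case notz: False
      obtain j' t1 where **: "j' \<in> V" "x j' \<le> t1" "t1 < z j'" "(of_int t1 + 1) / a j' + b j' \<le> x2"
        using high_step highT notz by force
      have "unit_key f a b i t < unit_key f a b j' t1" using False ij ** by (intro win) auto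
      moreover have "unit_key f a b j' t1 < unit_key f a b j t'"
        using hi[OF ij(2,6)] notz ** V(2) ai by (intro ukl) auto
      ultimately show ?thesis by (blast intro: less_trans)
    qed
  qed
qed

lemma cut_exists:
  fixes c d x :: "nat \<Rightarrow> int" and K :: "nat \<Rightarrow> int \<Rightarrow> lexkey"
  assumes "finite V"
    and less: "\<And>i j t t'. i \<in> V \<Longrightarrow> j \<in> V \<Longrightarrow> c i \<le> t \<Longrightarrow> t < x i \<Longrightarrow> x j \<le> t' \<Longrightarrow> t' < d j \<Longrightarrow> K i t < K j t'"
  obtains \<kappa> where "\<And>i t. i \<in> V \<Longrightarrow> c i \<le> t \<Longrightarrow> t < x i \<Longrightarrow> K i t \<le> \<kappa>"
    "\<And>i t. i \<in> V \<Longrightarrow> x i \<le> t \<Longrightarrow> t < d i \<Longrightarrow> \<kappa> < K i t"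
proof -
  let ?X = "\<Union>i\<in>V. K i ` {c i..<x i}" and ?Y = "\<Union>i\<in>V. K i ` {x i..<d i}"
  have fin: "finite ?X" "finite ?Y" using assms(1) by auto
  show ?thesis
  proof (cases "?X = {}")
    case False
    have "Max ?X \<in> ?X" using Max_in[OF fin(1) False] .
    then obtain i t where "i \<in> V" "c i \<le> t" "t < x i" "Max ?X = K i t" by auto
    then have "Max ?X < K j t'" if "j \<in> V" "x j \<le> t'" "t' < d j" for j t'
      using less that by metis
    moreover have "K j t' \<le> Max ?X" if "j \<in> V" "c j \<le> t'" "t' < x j" for j t'
      using that by (intro Max_ge[OF fin(1)] UN_I[OF that(1)] imageI) auto
    ultimately show ?thesis by (intro that[of "Max ?X"]) blast+
  next
    case True
    \<comment> \<open>No step is selected, so any key below all remaining ones will do. If no step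
      remains either, \<open>Min\<close> of the empty set is unspecified, but then nothing is
      required of \<open>\<kappa>\<close>.\<close>
    define \<kappa> :: lexkey where "\<kappa> = (fst (Min ?Y) - 1, 0, 0)"
    have "\<kappa> < K j t'" if "j \<in> V" "x j \<le> t'" "t' < d j" for j t'
    proof -
      have "Min ?Y \<le> K j t'" using that by (intro Min_le[OF fin(2)] UN_I[OF that(1)] imageI) auto
      then have "fst (Min ?Y) \<le> fst (K j t')" by (auto simp: less_eq_prod_def)
      then show ?thesis by (simp add: \<kappa>_def less_prod_def)
    qed
    moreover have "K j t' \<le> \<kappa>" if "j \<in> V" "c j \<le> t'" "t' < x j" for j t'
      using True that by auto
    ultimately show ?thesis by (intro that)
  qed
qed

section \<open>Selecting the cheapest unit steps inside the window\<close>

section \<open>Allocation with a single sum constraint, integer variables\<close>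

text \<open>The number of enumerated steps varies from variable to variable and only its total is
  bounded, so a uniform cost per round would be too weak.\<close>

lemma runs_For_cost:
  assumes "nval lo s = A" "A \<le> H"
    and "I A (nput v 0 A s)"
    and "\<And>k s. I k s \<Longrightarrow> nats s v 0 = k \<Longrightarrow> nval hi s = H"
    and "\<And>k s. I k s \<Longrightarrow> nats s v 0 = k \<Longrightarrow> k < H \<Longrightarrow> A \<le> k \<Longrightarrow>
      runs F c (\<lambda>t s'. t \<le> cost k \<and> nats s' v 0 = k \<and> I (Suc k) (nput v 0 (Suc k) s')) s"
    and "\<And>t s'. I H s' \<Longrightarrow> nats s' v 0 = H \<Longrightarrow> t \<le> 2 + (\<Sum>k = A..<H. cost k + 2) \<Longrightarrow> Q t s'"
  shows "runs F (For v lo hi c) Q s"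
  using assms by (intro runs_For[where I = I and H = H and cost = cost and s0 = s]) auto

definition floor_exp :: "rexp \<Rightarrow> rexp" where "floor_exp e = ROracle ''floor'' e"
definition ceil_exp :: "rexp \<Rightarrow> rexp" where
  "ceil_exp e = RMinus (RConst 0) (floor_exp (RMinus (RConst 0) e))"

locale int_oracles =
  fixes F :: "string \<Rightarrow> real \<Rightarrow> real" and f :: "real \<Rightarrow> real"
  assumes F_floor: "F ''floor'' r = of_int \<lfloor>r\<rfloor>" and F_f: "F ''f'' = f" and conv: "convex_on UNIV f"
begin

lemma rval_floor_exp [simp]: "rval F (floor_exp e) s = of_int \<lfloor>rval F e s\<rfloor>"
  by (simp add: floor_exp_def F_floor)

lemma rval_ceil_exp [simp]: "rval F (ceil_exp e) s = of_int \<lceil>rval F e s\<rceil>"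
  by (simp add: ceil_exp_def ceiling_def)

end

text \<open>Slope 0 and offset 1 turn the event sum into a count. The third key component is the
  variable, from which \<open>count_com\<close> later reads the owner of an accepted step.\<close>

definition step_event :: com where
  "step_event =
     push_com
       (RTimes (RMinus (ROracle ''f'' (RPlus (RDivide (RPlus (rsc ''t'') (RConst 1)) (at_i ''a'')) (at_i ''b'')))
          (ROracle ''f'' (RPlus (RDivide (rsc ''t'') (at_i ''a'')) (at_i ''b'')))) (at_i ''a''))
       (RPlus (RDivide (rsc ''t'') (at_i ''a'')) (at_i ''b'')) (nsc ''i'') (RConst 0) (RConst 1) ;;
     rset ''t'' (RPlus (rsc ''t'') (RConst 1))"

definition enum_com :: com where
  "enum_com = rset ''t'' (at_i ''y'') ;; While (RLess (rsc ''t'') (at_i ''z'')) step_event"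

context int_oracles
begin

lemma runs_step_event:
  assumes t: "reals s ''t'' 0 = of_int \<tau>"
    and post: "\<And>t s'. t \<le> 7 \<Longrightarrow> chg {''E'', ''k3''} {''k1'', ''k2'', ''w'', ''v'', ''t''} s s' \<Longrightarrow>
      nats s' ''E'' 0 = Suc (nats s ''E'' 0) \<Longrightarrow>
      key s' = (key s)(nats s ''E'' 0 := unit_key f (reals s ''a'') (reals s ''b'') (nats s ''i'' 0) \<tau>) \<Longrightarrow>
      reals s' ''w'' = (reals s ''w'')(nats s ''E'' 0 := 0) \<Longrightarrow>
      reals s' ''v'' = (reals s ''v'')(nats s ''E'' 0 := 1) \<Longrightarrow>
      reals s' ''t'' 0 = of_int (\<tau> + 1) \<Longrightarrow> Q t s'"
  shows "runs F step_event Q s"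
  unfolding step_event_def push_com_def
  by (simp add: runs_simps F_f) (rule post, simp_all add: chg_def key_def fun_eq_iff unit_key_def t)

text \<open>\<open>g\<close> is ghost data: it identifies event numbers with pairs of a variable and
  a step, which the machine stores only implicitly in the keys.\<close>

lemma runs_enum_com:
  fixes s :: state
  defines "i \<equiv> nats s ''i'' 0"
  defines "kf \<equiv> unit_key f (reals s ''a'') (reals s ''b'')"
  assumes y: "reals s ''y'' i = of_int y" and z: "reals s ''z'' i = of_int z" and yz: "y \<le> z"
    and g: "bij_betw g {..<nats s ''E'' 0} S" and S: "\<And>t. (i, t) \<notin> S"
    and ev: "\<And>e. e < nats s ''E'' 0 \<Longrightarrow> key s e = kf (fst (g e)) (snd (g e)) \<and> reals s ''w'' e = 0 \<and> reals s ''v'' e = 1"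
    and post: "\<And>t s' g. chg {''E'', ''k3''} {''k1'', ''k2'', ''w'', ''v'', ''t''} s s' \<Longrightarrow>
      bij_betw g {..<nats s' ''E'' 0} (S \<union> {i} \<times> {y..<z}) \<Longrightarrow>
      (\<And>e. e < nats s' ''E'' 0 \<Longrightarrow> key s' e = kf (fst (g e)) (snd (g e)) \<and> reals s' ''w'' e = 0 \<and> reals s' ''v'' e = 1) \<Longrightarrow>
      t \<le> 8 * nat (z - y) + 2 \<Longrightarrow> Q t s'"
  shows "runs F enum_com Q s"
  unfolding enum_com_def runs_Seq runs_RPut
proof (rule runs_While[where \<Phi> = "\<lambda>s'. 8 * nat (z - \<lfloor>reals s' ''t'' 0\<rfloor>)" and
      I = "\<lambda>s'. chg {''E'', ''k3''} {''k1'', ''k2'', ''w'', ''v'', ''t''} s s' \<and>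
        (\<exists>\<tau> g. reals s' ''t'' 0 = of_int \<tau> \<and> y \<le> \<tau> \<and> \<tau> \<le> z \<and>
          bij_betw g {..<nats s' ''E'' 0} (S \<union> {i} \<times> {y..<\<tau>}) \<and>
          (\<forall>e<nats s' ''E'' 0. key s' e = kf (fst (g e)) (snd (g e)) \<and> reals s' ''w'' e = 0 \<and> reals s' ''v'' e = 1))"],
    goal_cases)
  case 1
  have "key (rput ''t'' 0 (of_int y) s) = key s" by (rule key_cong) simp_all
  then show ?case
    using y yz g ev by (auto simp: i_def[symmetric] chg_def intro!: exI[of _ y] exI[of _ g])
next
  case (2 s1)
  then obtain \<tau> g where chg: "chg {''E'', ''k3''} {''k1'', ''k2'', ''w'', ''v'', ''t''} s s1"
    and t: "reals s1 ''t'' 0 = of_int \<tau>" "y \<le> \<tau>" "\<tau> \<le> z"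
    and g: "bij_betw g {..<nats s1 ''E'' 0} (S \<union> {i} \<times> {y..<\<tau>})"
    and ev: "\<And>e. e < nats s1 ''E'' 0 \<Longrightarrow> key s1 e = kf (fst (g e)) (snd (g e)) \<and> reals s1 ''w'' e = 0 \<and> reals s1 ''v'' e = 1"
    by blast
  have eqs: "nats s1 ''i'' 0 = i" "reals s1 ''a'' = reals s ''a''" "reals s1 ''b'' = reals s ''b''"
    "reals s1 ''z'' i = of_int z" using chg z by (simp_all add: chg_def i_def)
  have tz: "\<tau> < z" using 2(2) t eqs by simp
  show ?case
  proof (rule runs_step_event[OF t(1)], goal_cases)
    case (1 t' s2)
    let ?E = "nats s1 ''E'' 0"
    have "bij_betw (g(?E := (i, \<tau>))) {..<Suc ?E} (insert (i, \<tau>) (S \<union> {i} \<times> {y..<\<tau>}))"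
      by (rule bij_betw_extend[OF g]) (use S in auto)
    moreover have "insert (i, \<tau>) (S \<union> {i} \<times> {y..<\<tau>}) = S \<union> {i} \<times> {y..<\<tau> + 1}"
      using t(2) by auto
    ultimately have g2: "bij_betw (g(?E := (i, \<tau>))) {..<nats s2 ''E'' 0} (S \<union> {i} \<times> {y..<\<tau> + 1})"
      using 1(3) by simp
    have "\<forall>e<nats s2 ''E'' 0. key s2 e = kf (fst ((g(?E := (i, \<tau>))) e)) (snd ((g(?E := (i, \<tau>))) e)) \<and>
        reals s2 ''w'' e = 0 \<and> reals s2 ''v'' e = 1"
      unfolding 1(3-6) eqs using ev by (auto simp: less_Suc_eq kf_def)
    moreover have "chg {''E'', ''k3''} {''k1'', ''k2'', ''w'', ''v'', ''t''} s s2"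
      using chg 1(2) by (simp add: chg_def)
    moreover have "1 + t' + 8 * nat (z - \<lfloor>reals s2 ''t'' 0\<rfloor>) \<le> 8 * nat (z - \<lfloor>reals s1 ''t'' 0\<rfloor>)"
      using 1(1,7) t tz by simp
    ultimately show ?case using g2 1(7) t tz by (intro conjI exI[of _ "\<tau> + 1"] exI[of _ "g(?E := (i, \<tau>))"]) auto
  qed
next
  case (3 t1 s1)
  then obtain \<tau> g where chg: "chg {''E'', ''k3''} {''k1'', ''k2'', ''w'', ''v'', ''t''} s s1"
    and t: "reals s1 ''t'' 0 = of_int \<tau>" "y \<le> \<tau>" "\<tau> \<le> z"
    and g: "bij_betw g {..<nats s1 ''E'' 0} (S \<union> {i} \<times> {y..<\<tau>})"
    and ev: "\<And>e. e < nats s1 ''E'' 0 \<Longrightarrow> key s1 e = kf (fst (g e)) (snd (g e)) \<and> reals s1 ''w'' e = 0 \<and> reals s1 ''v'' e = 1"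
    by blast
  have eqs: "nats s1 ''i'' 0 = i" "reals s1 ''z'' i = of_int z" using chg z by (simp_all add: chg_def i_def)
  have "\<tau> = z" using 3(2) t eqs by simp
  then show ?case
    using 3(3) y g ev t by (intro post[OF chg, of g]) (auto simp: i_def[symmetric])
qed

end

definition count_com :: com where
  "count_com = Cond (NLess (NConst 0) (nsc ''hs''))
     (For ''j'' (NConst 0) (nsc ''E'')
       (Cond (less_key (nsc ''pa'') (nsc ''j'')) Skip
         (RPut ''y'' (NGet ''k3'' (nsc ''j'')) (RPlus (RGet ''y'' (NGet ''k3'' (nsc ''j''))) (RConst 1))))) Skip"

lemma runs_count_com:
  fixes s :: state
  defines "A \<equiv> {e. 0 < nats s ''hs'' 0 \<and> e < nats s ''E'' 0 \<and> key s e \<le> key s (nats s ''pa'' 0)}"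
  assumes post: "\<And>t s'. chg {''j''} {''y''} s s' \<Longrightarrow>
      (\<And>i. reals s' ''y'' i = reals s ''y'' i + card {e\<in>A. nats s ''k3'' e = i}) \<Longrightarrow>
      t \<le> 4 * nats s ''E'' 0 + 3 \<Longrightarrow> Q t s'"
  shows "runs F count_com Q s"
proof (cases "0 < nats s ''hs'' 0")
  case False
  then show ?thesis
    unfolding count_com_def by (simp add: runs_simps) (rule post, auto simp: chg_def A_def)
next
  case True
  then have bv: "bval F (NLess (NConst 0) (nsc ''hs'')) s" by simp
  let ?P = "\<lambda>e. key s e \<le> key s (nats s ''pa'' 0)"
  show ?thesis
    unfolding count_com_def runs_Cond if_P[OF bv]
  proof (rule runs_For_const[where A = 0 and H = "nats s ''E'' 0" and C = 2 and
        I = "\<lambda>k s'. chg {''j''} {''y''} s s' \<and>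
          (\<forall>i. reals s' ''y'' i = reals s ''y'' i + card {e. e < k \<and> ?P e \<and> nats s ''k3'' e = i})"], goal_cases)
    case (5 k s1)
    then have chg: "chg {''j''} {''y''} s s1"
      and y1: "\<And>i. reals s1 ''y'' i = reals s ''y'' i + card {e. e < k \<and> ?P e \<and> nats s ''k3'' e = i}" by blast+
    have eqs: "key s1 = key s" "nats s1 ''k3'' = nats s ''k3''" "nats s1 ''pa'' = nats s ''pa''"
      using chg key_cong[of s1 s] by (simp_all add: chg_def)
    have "{e. e < Suc k \<and> ?P e \<and> nats s ''k3'' e = i} = (if ?P k \<and> nats s ''k3'' k = i then insert k {e. e < k \<and> ?P e \<and> nats s ''k3'' e = i}
        else {e. e < k \<and> ?P e \<and> nats s ''k3'' e = i})" for i by (auto simp: less_Suc_eq)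
    then have card: "card {e. e < Suc k \<and> ?P e \<and> nats s ''k3'' e = i} = card {e. e < k \<and> ?P e \<and> nats s ''k3'' e = i} +
        (if ?P k \<and> nats s ''k3'' k = i then 1 else 0)" for i by simp
    show ?case
    proof (cases "?P k")
      case True
      then have bv: "\<not> bval F (less_key (nsc ''pa'') (nsc ''j'')) s1" using eqs 5(2) by simp
      show ?thesis
        unfolding runs_Cond if_not_P[OF bv] runs_RPut
      proof (intro conjI, goal_cases)
        case 3
        then show ?case using chg by (simp add: chg_def)
      next
        case 4
        then show ?case using y1 card True eqs 5(2) by simp
      qed (use 5(2) in simp_all)
    next
      case False
      then have bv: "bval F (less_key (nsc ''pa'') (nsc ''j'')) s1" using eqs 5(2) by simp
      show ?thesis
        unfolding runs_Cond if_P[OF bv] runs_Skip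
      proof (intro conjI, goal_cases)
        case 3
        then show ?case using chg by (simp add: chg_def)
      next
        case 4
        then show ?case using y1 card False eqs 5(2) by simp
      qed (use 5(2) in simp_all)
    qed
  next
    case (6 t s1)
    have "{e. e < nats s ''E'' 0 \<and> ?P e \<and> nats s ''k3'' e = i} = {e\<in>A. nats s ''k3'' e = i}" for i
      using True by (auto simp: A_def)
    then show ?case using 6 by (intro post) auto
  qed (simp_all add: chg_def)
qed

definition window_com :: com where
  "window_com = nset ''E'' (NConst 0) ;; rset ''ta'' (rsc ''T0'') ;;
     For ''j'' (nsc ''rp'') (nsc ''rq'')
       (nset ''i'' (NGet ''o'' (nsc ''j'')) ;;
        clip_com ''y'' (floor_exp (RTimes (at_i ''a'') (RMinus (rsc ''l1'') (at_i ''b'')))) ;;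
        clip_com ''z'' (ceil_exp (RTimes (at_i ''a'') (RMinus (rsc ''l2'') (at_i ''b'')))) ;;
        rset ''ta'' (RMinus (rsc ''ta'') (at_i ''y'')) ;; enum_com)"

text \<open>The true target is saved in \<open>T0\<close>, while \<open>T\<close> is set to a
  lowered and a raised target for the two relaxations. Clamping these to the sums of the lower and
  upper bounds guarantees that both relaxed problems are solvable.\<close>

definition rap_int_com :: com where
  "rap_int_com = rset ''sc'' (RConst 0) ;; rset ''sd'' (RConst 0) ;;
     For ''j'' (nsc ''rp'') (nsc ''rq'')
       (nset ''i'' (NGet ''o'' (nsc ''j'')) ;; rset ''sc'' (RPlus (rsc ''sc'') (at_i ''c'')) ;;
        rset ''sd'' (RPlus (rsc ''sd'') (at_i ''d''))) ;;
     rset ''T0'' (rsc ''T'') ;;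
     rset ''T'' (RMinus (RMinus (rsc ''T0'') (ROfNat (NMinus (nsc ''rq'') (nsc ''rp'')))) (RConst 1)) ;;
     rmax_com ''T'' (NConst 0) (rsc ''sc'') ;; multiplier_com ;; rset ''l1'' (rsc ''lam'') ;;
     rset ''T'' (RPlus (RPlus (rsc ''T0'') (ROfNat (NMinus (nsc ''rq'') (nsc ''rp'')))) (RConst 1)) ;;
     rmin_com ''T'' (NConst 0) (rsc ''sd'') ;; multiplier_com ;; rset ''l2'' (rsc ''lam'') ;;
     window_com ;; search_com ;; count_com"

context int_oracles
begin

lemma runs_window_com:
  fixes s :: state and c d :: "nat \<Rightarrow> int"
  defines "a \<equiv> reals s ''a''" and "b \<equiv> reals s ''b''"
    and "p \<equiv> nats s ''rp'' 0" and "q \<equiv> nats s ''rq'' 0" and "od \<equiv> nats s ''o''"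
  defines "y \<equiv> \<lambda>i. max (c i) (min \<lfloor>a i * (reals s ''l1'' 0 - b i)\<rfloor> (d i))"
    and "z \<equiv> \<lambda>i. max (c i) (min \<lceil>a i * (reals s ''l2'' 0 - b i)\<rceil> (d i))"
  assumes pq: "p < q" and inj: "inj_on od {p..<q}"
    and cd: "\<And>j. p \<le> j \<Longrightarrow> j < q \<Longrightarrow> reals s ''c'' (od j) = of_int (c (od j)) \<and> reals s ''d'' (od j) = of_int (d (od j))"
    and yz: "\<And>j. p \<le> j \<Longrightarrow> j < q \<Longrightarrow> y (od j) \<le> z (od j)"
    and post: "\<And>t s' g. chg {''E'', ''k3'', ''j'', ''i''} {''k1'', ''k2'', ''w'', ''v'', ''t'', ''ta'', ''y'', ''z''} s s' \<Longrightarrow>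
      bij_betw g {..<nats s' ''E'' 0} (SIGMA i:od ` {p..<q}. {y i..<z i}) \<Longrightarrow>
      (\<And>e. e < nats s' ''E'' 0 \<Longrightarrow> key s' e = unit_key f a b (fst (g e)) (snd (g e)) \<and> reals s' ''w'' e = 0 \<and> reals s' ''v'' e = 1) \<Longrightarrow>
      (\<And>j. p \<le> j \<Longrightarrow> j < q \<Longrightarrow> reals s' ''y'' (od j) = of_int (y (od j))) \<Longrightarrow>
      reals s' ''ta'' 0 = reals s ''T0'' 0 - (\<Sum>j = p..<q. of_int (y (od j))) \<Longrightarrow>
      t \<le> 16 * (q - p) + 8 * (\<Sum>j = p..<q. nat (z (od j) - y (od j))) + 4 \<Longrightarrow> Q t s'"
  shows "runs F window_com Q s"
proof -
  let ?NS = "{''E'', ''k3'', ''j'', ''i''}" and ?RS = "{''k1'', ''k2'', ''w'', ''v'', ''t'', ''ta'', ''y'', ''z''}"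
  let ?kf = "unit_key f a b"
  define Inv where "Inv k s' \<longleftrightarrow> chg ?NS ?RS s s' \<and>
      (\<exists>g. bij_betw g {..<nats s' ''E'' 0} (SIGMA i:od ` {p..<k}. {y i..<z i}) \<and>
        (\<forall>e<nats s' ''E'' 0. key s' e = ?kf (fst (g e)) (snd (g e)) \<and> reals s' ''w'' e = 0 \<and> reals s' ''v'' e = 1)) \<and>
      (\<forall>j. p \<le> j \<longrightarrow> j < k \<longrightarrow> reals s' ''y'' (od j) = of_int (y (od j))) \<and>
      reals s' ''ta'' 0 = reals s ''T0'' 0 - (\<Sum>j = p..<k. of_int (y (od j)))" for k s'
  show ?thesis
    unfolding window_com_def runs_Seq runs_NPut runs_RPut
  proof (rule runs_For_cost[where A = p and H = q and I = Inv and cost = "\<lambda>k. 14 + 8 * nat (z (od k) - y (od k))"], goal_cases)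
    case 1
    then show ?case by (simp add: p_def)
  next
    case 2
    then show ?case using pq by simp
  next
    case 3
    then show ?case by (simp add: Inv_def chg_def) (simp add: bij_betw_def)
  next
    case (4 k s1)
    then show ?case by (simp add: Inv_def chg_def q_def)
  next
    case (5 k s1)
    then have kq: "k < q" "p \<le> k" by simp_all
    obtain g where chg: "chg ?NS ?RS s s1" and g: "bij_betw g {..<nats s1 ''E'' 0} (SIGMA i:od ` {p..<k}. {y i..<z i})"
      and ev: "\<And>e. e < nats s1 ''E'' 0 \<Longrightarrow> key s1 e = ?kf (fst (g e)) (snd (g e)) \<and> reals s1 ''w'' e = 0 \<and> reals s1 ''v'' e = 1"
      and y1: "\<And>j. p \<le> j \<Longrightarrow> j < k \<Longrightarrow> reals s1 ''y'' (od j) = of_int (y (od j))"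
      and ta: "reals s1 ''ta'' 0 = reals s ''T0'' 0 - (\<Sum>j = p..<k. of_int (y (od j)))"
      using 5(1) unfolding Inv_def by blast
    define s2 where "s2 = nput ''i'' 0 (od k) s1"
    have eq2: "nats s2 ''i'' 0 = od k" "nats s2 ''j'' 0 = k" "reals s2 = reals s1" "nats s1 ''o'' = od"
        "reals s1 ''a'' = a" "reals s1 ''b'' = b" "reals s1 ''l1'' = reals s ''l1''"
        "reals s1 ''c'' (od k) = of_int (c (od k))" "reals s1 ''d'' (od k) = of_int (d (od k))"
        "nats s2 ''E'' = nats s1 ''E''" "nats s2 ''k3'' = nats s1 ''k3''"
      using 5(2) chg cd[OF kq(2,1)] by (simp_all add: s2_def chg_def od_def a_def b_def)
    have chg2: "chg ?NS ?RS s s2" using chg by (simp add: chg_def s2_def)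
    \<comment> \<open>Injectivity of \<open>od\<close> ensures that the steps of the current
      variable have not been enumerated before, so \<open>g\<close> stays a bijection.\<close>
    have inS: "(od k, t) \<notin> (SIGMA i:od ` {p..<k}. {y i..<z i})" for t
    proof -
      have "od x \<noteq> od k" if "p \<le> x" "x < k" for x
        using inj_onD[OF inj, of x k] that kq by auto
      then show ?thesis by fastforce
    qed
    have "runs F (clip_com ''y'' (floor_exp (RTimes (at_i ''a'') (RMinus (rsc ''l1'') (at_i ''b'')))) ;;
        clip_com ''z'' (ceil_exp (RTimes (at_i ''a'') (RMinus (rsc ''l2'') (at_i ''b'')))) ;;
        rset ''ta'' (RMinus (rsc ''ta'') (at_i ''y'')) ;; enum_com)
        (\<lambda>t s'. 1 + t \<le> 14 + 8 * nat (z (od k) - y (od k)) \<and> nats s' ''j'' 0 = k \<and> Inv (Suc k) (nput ''j'' 0 (Suc k) s')) s2"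
      unfolding runs_Seq runs_RPut
    proof (rule runs_clip_com, goal_cases)
      case (3 t3 s3)
      have y3: "reals s3 ''y'' = (reals s1 ''y'')(od k := of_int (y (od k)))"
        using 3(3) unfolding rval_floor_exp by (simp add: eq2 y_def of_int_max of_int_min)
      have eq3: "nats s3 = nats s2" "reals s3 ''a'' = a" "reals s3 ''b'' = b" "reals s3 ''l2'' = reals s ''l2''"
        "reals s3 ''c'' (od k) = of_int (c (od k))" "reals s3 ''d'' (od k) = of_int (d (od k))"
        "reals s3 ''ta'' = reals s1 ''ta''" "reals s3 ''k1'' = reals s1 ''k1''" "reals s3 ''k2'' = reals s1 ''k2''"
        "reals s3 ''w'' = reals s1 ''w''" "reals s3 ''v'' = reals s1 ''v''"
        using 3(2) eq2 chg2 by (simp_all add: chg_def fun_eq_iff)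
      have chg3: "chg ?NS ?RS s s3" using chg2 3(2) by (simp add: chg_def)
      show ?case
      proof (rule runs_clip_com, goal_cases)
        case (3 t4 s4)
        define s5 where "s5 = rput ''ta'' 0 (reals s1 ''ta'' 0 - of_int (y (od k))) s4"
        have z4: "reals s4 ''z'' (od k) = of_int (z (od k))"
          using 3(3) unfolding rval_ceil_exp by (simp add: eq2 eq3 z_def of_int_max of_int_min)
        have eq4: "nats s4 = nats s2" "reals s4 ''y'' = reals s3 ''y''" "reals s4 ''ta'' = reals s1 ''ta''"
          using 3(2) eq3 by (simp_all add: chg_def fun_eq_iff)
        have chg5: "chg ?NS ?RS s s5" using chg3 3(2) by (simp add: chg_def s5_def)
        have eq5: "nats s5 = nats s2" "reals s5 ''y'' = reals s3 ''y''" "reals s5 ''z'' (od k) = of_int (z (od k))"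
          "reals s5 ''a'' = a" "reals s5 ''b'' = b" "reals s5 ''w'' = reals s1 ''w''" "reals s5 ''v'' = reals s1 ''v''"
          "reals s5 ''k1'' = reals s1 ''k1''" "reals s5 ''k2'' = reals s1 ''k2''"
          "reals s5 ''ta'' 0 = reals s1 ''ta'' 0 - of_int (y (od k))"
          using 3(2) eq3 eq4 z4 by (simp_all add: chg_def s5_def)
        have key5: "key s5 = key s1" by (rule key_cong) (simp_all add: eq5 eq2)
        have "runs F enum_com (\<lambda>t s'. 1 + (t3 + (t4 + (1 + t))) \<le> 14 + 8 * nat (z (od k) - y (od k)) \<and>
            nats s' ''j'' 0 = k \<and> Inv (Suc k) (nput ''j'' 0 (Suc k) s')) s5"
        proof (rule runs_enum_com[where y = "y (od k)" and z = "z (od k)" and g = g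
              and S = "SIGMA i:od ` {p..<k}. {y i..<z i}"], unfold eq5 eq2 key5, goal_cases)
          case (7 t6 s6 g')
          have "(SIGMA i:od ` {p..<k}. {y i..<z i}) \<union> {od k} \<times> {y (od k)..<z (od k)} =
              (SIGMA i:od ` {p..<Suc k}. {y i..<z i})"
            using kq by (auto simp: atLeastLessThanSuc)
          then have g6: "bij_betw g' {..<nats s6 ''E'' 0} (SIGMA i:od ` {p..<Suc k}. {y i..<z i})"
            using 7(2) by simp
          have key6: "key (nput ''j'' 0 (Suc k) s6) = key s6" by (rule key_cong) simp_all
          have eq6: "reals s6 ''y'' = (reals s1 ''y'')(od k := of_int (y (od k)))" "nats s6 ''j'' 0 = k"
            "reals s6 ''ta'' 0 = reals s1 ''ta'' 0 - of_int (y (od k))"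
            using 7(1) eq5 y3 eq2 by (simp_all add: chg_def)
          have chg6: "chg ?NS ?RS s (nput ''j'' 0 (Suc k) s6)" using chg5 7(1) by (simp add: chg_def)
          have "reals s6 ''y'' (od j) = of_int (y (od j))" if "p \<le> j" "j < Suc k" for j
            using y1 that eq6(1) by (auto simp: less_Suc_eq)
          moreover have "reals s6 ''ta'' 0 = reals s ''T0'' 0 - (\<Sum>j = p..<Suc k. of_int (y (od j)))"
            using eq6(3) ta kq by simp
          ultimately have "Inv (Suc k) (nput ''j'' 0 (Suc k) s6)"
            unfolding Inv_def key6 using chg6 g6 7(3) by (intro conjI exI[of _ g']) simp_all
          then show ?case using eq6(2) 7(4) 3(1) \<open>t3 \<le> 5\<close> by simp
        next
          case 1
          show ?case using y3 by simp
        qed (use yz[OF kq(2,1)] g ev inS in auto)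
        then show ?case using eq4 y3 eq2 by (simp add: s5_def)
      qed simp_all
    qed simp_all
    then show ?case
      unfolding runs_Seq[of F "nset _ _"] runs_NPut by (simp add: s2_def eq2 5(2))
  next
    case (6 t s1)
    then obtain g where "chg ?NS ?RS s s1" "bij_betw g {..<nats s1 ''E'' 0} (SIGMA i:od ` {p..<q}. {y i..<z i})"
      "\<And>e. e < nats s1 ''E'' 0 \<Longrightarrow> key s1 e = ?kf (fst (g e)) (snd (g e)) \<and> reals s1 ''w'' e = 0 \<and> reals s1 ''v'' e = 1"
      "\<And>j. p \<le> j \<Longrightarrow> j < q \<Longrightarrow> reals s1 ''y'' (od j) = of_int (y (od j))"
      "reals s1 ''ta'' 0 = reals s ''T0'' 0 - (\<Sum>j = p..<q. of_int (y (od j)))"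
      unfolding Inv_def by blast
    moreover have "1 + (1 + t) \<le> 16 * (q - p) + 8 * (\<Sum>j = p..<q. nat (z (od j) - y (od j))) + 4"
      using 6(3) by (simp add: sum.distrib sum_distrib_left)
    ultimately show ?case by (rule post)
  qed
qed

end

text \<open>The keys of one variable increase strictly with the step, so a set closed under smaller
  keys meets each variable in an initial segment of its window. Counting accepted steps per variable
  therefore locates the cut.\<close>

lemma selected_steps:
  fixes y z :: "nat \<Rightarrow> int" and n :: nat
  assumes conv: "convex_on UNIV f" and V: "finite V" "\<And>i. i \<in> V \<Longrightarrow> 0 < a i"
    and g: "bij_betw g {..<n} (SIGMA i:V. {y i..<z i})"
    and key: "\<And>e. e < n \<Longrightarrow> K e = unit_key f a b (fst (g e)) (snd (g e))"
    and A: "A \<subseteq> {..<n}" "\<And>e e'. e \<in> A \<Longrightarrow> e' < n \<Longrightarrow> e' \<notin> A \<Longrightarrow> K e < K e'"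
    and x: "\<And>i. i \<in> V \<Longrightarrow> x i = y i + int (card {e\<in>A. fst (g e) = i})"
  shows "\<And>i. i \<in> V \<Longrightarrow> y i \<le> x i \<and> x i \<le> max (y i) (z i)"
    and "sum x V = sum y V + card A"
    and "\<And>i j t t'. i \<in> V \<Longrightarrow> j \<in> V \<Longrightarrow> y i \<le> t \<Longrightarrow> t < x i \<Longrightarrow> x j \<le> t' \<Longrightarrow> t' < z j \<Longrightarrow>
      unit_key f a b i t < unit_key f a b j t'"
proof -
  have finA: "finite A" using A(1) by (rule finite_subset) simp
  have gV: "fst (g e) \<in> V" "y (fst (g e)) \<le> snd (g e)" "snd (g e) < z (fst (g e))" if "e < n" for e
  proof -
    have "g e \<in> (SIGMA i:V. {y i..<z i})" using bij_betwE[OF g] that by simp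
    then have "fst (g e) \<in> V \<and> y (fst (g e)) \<le> snd (g e) \<and> snd (g e) < z (fst (g e))"
      by (cases "g e") simp
    then show "fst (g e) \<in> V" "y (fst (g e)) \<le> snd (g e)" "snd (g e) < z (fst (g e))" by blast+
  qed
  have inj: "inj_on g {..<n}" using g by (rule bij_betw_imp_inj_on)
  have ex: "\<exists>e<n. g e = (i, t)" if "i \<in> V" "y i \<le> t" "t < z i" for i t
  proof -
    have "(i, t) \<in> g ` {..<n}" using that bij_betw_imp_surj_on[OF g] by simp
    then show ?thesis by force
  qed
  define D where "D i = {t. \<exists>e\<in>A. g e = (i, t)}" for i
  have cardD: "card (D i) = card {e\<in>A. fst (g e) = i}" for i
  proof (rule bij_betw_same_card[symmetric])
    show "bij_betw (snd \<circ> g) {e\<in>A. fst (g e) = i} (D i)"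
      unfolding bij_betw_def
    proof
      show "inj_on (snd \<circ> g) {e\<in>A. fst (g e) = i}"
        using inj A(1) by (auto simp: inj_on_def prod_eq_iff subset_eq)
      show "(snd \<circ> g) ` {e\<in>A. fst (g e) = i} = D i"
        by (force simp: D_def image_iff prod_eq_iff)
    qed
  qed
  have D: "D i = {y i..<x i}" if i: "i \<in> V" for i
  proof -
    have sub: "D i \<subseteq> {y i..<z i}"
      using gV A(1) by (force simp: D_def subset_eq)
    have "D i = {y i..<y i + int (card (D i))}"
    proof (rule down_closed_interval[OF sub])
      fix t t' assume t: "t \<in> D i" "y i \<le> t'" "t' < t"
      then obtain e where e: "e \<in> A" "g e = (i, t)" by (auto simp: D_def)
      obtain e' where e': "e' < n" "g e' = (i, t')" using ex[OF i t(2)] t(1,3) sub by force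
      have "e < n" using A(1) e(1) by auto
      have "K e' < K e"
        using key[OF e'(1)] key[OF \<open>e < n\<close>] e(2) e'(2) unit_key_strict_mono[OF conv, of a i t' t] V(2)[OF i] t(3)
        by simp
      then have "e' \<in> A" using A(2)[OF e(1) e'(1)] by (meson less_asym)
      then show "t' \<in> D i" using e'(2) by (auto simp: D_def)
    qed
    then show ?thesis using x[OF i] cardD by simp
  qed
  show 1: "y i \<le> x i \<and> x i \<le> max (y i) (z i)" if i: "i \<in> V" for i
  proof -
    have "x i \<le> z i" if "y i < x i"
    proof -
      have "x i - 1 \<in> D i" using D[OF i] that by simp
      then obtain e where "e \<in> A" "g e = (i, x i - 1)" by (auto simp: D_def)
      then show ?thesis using gV(3)[of e] A(1) by auto
    qed
    then show ?thesis using x[OF i] by (cases "y i < x i") simp_all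
  qed
  have "(\<Sum>i\<in>V. card {e\<in>A. fst (g e) = i}) = card A"
    using sum.group[OF finA V(1), of "fst \<circ> g" "\<lambda>_. 1::nat"] gV(1) A(1) by (force simp: subset_eq)
  then show "sum x V = sum y V + card A"
    using x by (simp add: sum.distrib flip: of_nat_sum)
  show "unit_key f a b i t < unit_key f a b j t'"
    if *: "i \<in> V" "j \<in> V" "y i \<le> t" "t < x i" "x j \<le> t'" "t' < z j" for i j t t'
  proof -
    have "t \<in> D i" using D[OF *(1)] * by simp
    then obtain e where e: "e \<in> A" "g e = (i, t)" by (auto simp: D_def)
    obtain e' where e': "e' < n" "g e' = (j, t')" 
    proof -
      have "y j \<le> t'" using 1[OF *(2)] *(5) by simp
      then show ?thesis using ex[OF *(2) _ *(6)] that by blast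
    qed
    have "t' \<notin> D j" using D[OF *(2)] *(5) by simp
    then have "e' \<notin> A" using e'(2) unfolding D_def by blast
    then show ?thesis using A(2)[OF e(1) e'(1)] key[of e] key[OF e'(1)] e e' A(1) by auto
  qed
qed

text \<open>With unit events the search stops exactly when as many events are accepted as are still to be placed.\<close>

lemma accepted_units:
  assumes acc: "accepted s s' A"
    and rej: "A = {..<n} \<or> (\<exists>r<n. A = {e. e < n \<and> key s e < key s r} \<and> reals s ''ta'' 0 < event_sum s r)"
    and n: "n = nats s ''E'' 0" and inj: "inj_on (key s) {..<n}"
    and wv: "\<And>e. e < n \<Longrightarrow> reals s ''w'' e = 0 \<and> reals s ''v'' e = 1"
    and ta: "reals s ''ta'' 0 = of_int \<tau>" "0 \<le> \<tau>" "\<tau> \<le> int n"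
  shows "int (card A) = \<tau>" "\<And>e e'. e \<in> A \<Longrightarrow> e' < n \<Longrightarrow> e' \<notin> A \<Longrightarrow> key s e < key s e'"
    "A \<subseteq> {..<n}" "A = {e. 0 < nats s' ''hs'' 0 \<and> e < n \<and> key s e \<le> key s (nats s' ''pa'' 0)}"
proof -
  have ev: "event_sum s r = card {e. e < n \<and> key s e \<le> key s r}" for r
    using wv unfolding event_sum_def n by (simp cong: sum.cong_simp conj_cong)
  show An: "A \<subseteq> {..<n}" and Ac: "A = {e. 0 < nats s' ''hs'' 0 \<and> e < n \<and> key s e \<le> key s (nats s' ''pa'' 0)}"
    using acc by (auto simp: accepted_def n split: if_splits)
  show "key s e < key s e'" if "e \<in> A" "e' < n" "e' \<notin> A" for e e'
    using that Ac by (auto simp: not_le intro: le_less_trans)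
  have le: "int (card A) \<le> \<tau>"
    using acc ev[of "nats s' ''pa'' 0"] ta by (auto simp: accepted_def n split: if_splits)
  from rej show "int (card A) = \<tau>"
  proof
    assume "A = {..<n}"
    then show ?thesis using le ta(3) by simp
  next
    assume "\<exists>r<n. A = {e. e < n \<and> key s e < key s r} \<and> reals s ''ta'' 0 < event_sum s r"
    then obtain r where r: "r < n" "A = {e. e < n \<and> key s e < key s r}" "reals s ''ta'' 0 < event_sum s r" by blast
    \<comment> \<open>Distinct keys let the count rise by exactly one at \<open>r\<close>, so
      exceeding the target at \<open>r\<close> means meeting it before.\<close>
    have "{e. e < n \<and> key s e \<le> key s r} = insert r A"
      using r(1,2) inj by (auto simp: le_less inj_on_def)
    moreover have "r \<notin> A" "finite A" using r(2) by auto
    ultimately have "\<tau> < int (card A) + 1" using r(3) ev[of r] ta(1) by simp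
    then show ?thesis using le by simp
  qed
qed

abbreviation "rap_reals \<equiv> multiplier_reals \<union> {''sc'', ''sd'', ''T0'', ''T'', ''l1'', ''l2'', ''t'', ''y'', ''z''}"

context int_oracles
begin

lemma runs_rap_int_com:
  fixes s :: state and c d :: "nat \<Rightarrow> int" and T :: int
  defines "a \<equiv> reals s ''a''" and "b \<equiv> reals s ''b''"
    and "p \<equiv> nats s ''rp'' 0" and "q \<equiv> nats s ''rq'' 0" and "od \<equiv> nats s ''o''"
  defines "V \<equiv> od ` {p..<q}"
  assumes pq: "p < q" and inj: "inj_on od {p..<q}"
    and cd: "\<And>i. i \<in> V \<Longrightarrow> reals s ''c'' i = of_int (c i) \<and> reals s ''d'' i = of_int (d i)"
    and acd: "\<And>i. i \<in> V \<Longrightarrow> 0 < a i \<and> c i \<le> d i"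
    and T: "reals s ''T'' 0 = of_int T" "sum c V \<le> T" "T \<le> sum d V"
    and post: "\<And>t s' x \<kappa>. chg multiplier_nats rap_reals s s' \<Longrightarrow>
      (\<And>i. i \<in> V \<Longrightarrow> reals s' ''y'' i = of_int (x i)) \<Longrightarrow>
      (\<And>i. i \<in> V \<Longrightarrow> c i \<le> x i \<and> x i \<le> d i) \<Longrightarrow> sum x V = T \<Longrightarrow>
      (\<And>i t. i \<in> V \<Longrightarrow> c i \<le> t \<Longrightarrow> t < x i \<Longrightarrow> unit_key f a b i t \<le> \<kappa>) \<Longrightarrow>
      (\<And>i t. i \<in> V \<Longrightarrow> x i \<le> t \<Longrightarrow> t < d i \<Longrightarrow> \<kappa> < unit_key f a b i t) \<Longrightarrow>
      t \<le> 250000 * (q - p) \<Longrightarrow> Q t s'"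
  shows "runs F rap_int_com Q s"
proof -
  let ?N = "q - p"
  have V: "finite V" "card V = ?N" using card_image[OF inj] by (simp_all add: V_def)
  have sumV: "(\<Sum>j = p..<q. h (od j)) = sum h V" for h :: "nat \<Rightarrow> 'b::comm_monoid_add"
    unfolding V_def using sum.reindex[OF inj, of h] by simp
  have odV: "od j \<in> V" if "p \<le> j" "j < q" for j using that by (simp add: V_def)
  define M1 where "M1 = max (sum c V) (T - card V - 1)"
  define M2 where "M2 = min (sum d V) (T + card V + 1)"
  have scd: "sum c V \<le> sum d V" using acd by (intro sum_mono) auto
  have stage1: "runs F (For ''j'' (nsc ''rp'') (nsc ''rq'')
       (nset ''i'' (NGet ''o'' (nsc ''j'')) ;; rset ''sc'' (RPlus (rsc ''sc'') (at_i ''c'')) ;;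
        rset ''sd'' (RPlus (rsc ''sd'') (at_i ''d'')))) R s1"
    if s1: "chg {} {''sc'', ''sd''} s s1" "reals s1 ''sc'' 0 = 0" "reals s1 ''sd'' 0 = 0"
      and R: "\<And>t s'. chg {''j'', ''i''} {''sc'', ''sd''} s s' \<Longrightarrow> reals s' ''sc'' 0 = of_int (sum c V) \<Longrightarrow>
        reals s' ''sd'' 0 = of_int (sum d V) \<Longrightarrow> t \<le> 2 + 5 * ?N \<Longrightarrow> R t s'" for R s1
  proof (rule runs_For_const[where A = p and H = q and C = 3 and
        I = "\<lambda>k s'. chg {''j'', ''i''} {''sc'', ''sd''} s s' \<and> reals s' ''sc'' 0 = (\<Sum>j = p..<k. of_int (c (od j))) \<and>
          reals s' ''sd'' 0 = (\<Sum>j = p..<k. of_int (d (od j)))"], goal_cases)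
    case 1
    then show ?case using s1 by (simp add: chg_def p_def)
  next
    case 3
    then show ?case using s1 by (simp add: chg_def)
  next
    case (4 k s2)
    then show ?case by (simp add: chg_def q_def)
  next
    case (5 k s2)
    then have "nats s2 ''o'' = od" "reals s2 ''c'' (od k) = of_int (c (od k))" "reals s2 ''d'' (od k) = of_int (d (od k))"
      using cd[OF odV, of k] by (simp_all add: chg_def od_def)
    then show ?case using 5 by (simp add: runs_simps) (simp add: chg_def)
  next
    case (6 t s2)
    then show ?case using sumV[of "\<lambda>i. real_of_int (c i)"] sumV[of "\<lambda>i. real_of_int (d i)"] by (intro R) auto
  qed (use pq in simp)
  have multiplier: "runs F multiplier_com R s1"
    if s1: "chg multiplier_nats rap_reals s s1" "reals s1 ''a'' = a" "reals s1 ''b'' = b" "reals s1 ''c'' = reals s ''c''"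
        "reals s1 ''d'' = reals s ''d''" "reals s1 ''T'' 0 = of_int tgt" "sum c V \<le> tgt" "tgt \<le> sum d V"
      and R: "\<And>t s'. chg multiplier_nats multiplier_reals s1 s' \<Longrightarrow>
        (\<Sum>i\<in>V. clip (c i) (a i * (reals s' ''lam'' 0 - b i)) (d i)) = tgt \<Longrightarrow> t \<le> 43700 * ?N \<Longrightarrow> R t s'" for s1 tgt R
  proof -
    have eq: "nats s1 ''o'' = od" "nats s1 ''rp'' 0 = p" "nats s1 ''rq'' 0 = q"
      using s1(1) by (simp_all add: chg_def od_def p_def q_def)
    have cs: "(\<Sum>j = p..<q. reals s ''c'' (od j)) = of_int (sum c V)" "(\<Sum>j = p..<q. reals s ''d'' (od j)) = of_int (sum d V)"
      using cd sumV[of "reals s ''c''"] sumV[of "reals s ''d''"] by simp_all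
    show ?thesis
    proof (rule runs_multiplier_com, unfold eq s1(2-6) cs, goal_cases)
      case (5 t s2)
      have "(\<Sum>j = p..<q. clip (reals s ''c'' (od j)) (a (od j) * (reals s2 ''lam'' 0 - b (od j))) (reals s ''d'' (od j))) =
        (\<Sum>i\<in>V. clip (c i) (a i * (reals s2 ''lam'' 0 - b i)) (d i))"
        using sumV[of "\<lambda>i. clip (reals s ''c'' i) (a i * (reals s2 ''lam'' 0 - b i)) (reals s ''d'' i)"] cd by simp
      then show ?case using 5 by (intro R) simp_all
    next
      case (2 j)
      then show ?case using acd[OF odV, of j] cd[OF odV, of j] by simp
    next
      case 3
      show ?case using s1(7) by (simp only: of_int_le_iff)
    next
      case 4
      show ?case using s1(8) by (simp only: of_int_le_iff)
    qed (use pq in simp_all)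
  qed
  have final: "runs F (window_com ;; search_com ;; count_com) R s1"
    if s1: "chg multiplier_nats rap_reals s s1" "reals s1 ''T0'' 0 = of_int T"
      and S1: "(\<Sum>i\<in>V. clip (c i) (a i * (reals s1 ''l1'' 0 - b i)) (d i)) = M1"
      and S2: "(\<Sum>i\<in>V. clip (c i) (a i * (reals s1 ''l2'' 0 - b i)) (d i)) = M2"
      and R: "\<And>t s' x \<kappa>. chg multiplier_nats rap_reals s s' \<Longrightarrow>
        (\<And>i. i \<in> V \<Longrightarrow> reals s' ''y'' i = of_int (x i)) \<Longrightarrow>
        (\<And>i. i \<in> V \<Longrightarrow> c i \<le> x i \<and> x i \<le> d i) \<Longrightarrow> sum x V = T \<Longrightarrow>
        (\<And>i t. i \<in> V \<Longrightarrow> c i \<le> t \<Longrightarrow> t < x i \<Longrightarrow> unit_key f a b i t \<le> \<kappa>) \<Longrightarrow>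
        (\<And>i t. i \<in> V \<Longrightarrow> x i \<le> t \<Longrightarrow> t < d i \<Longrightarrow> \<kappa> < unit_key f a b i t) \<Longrightarrow>
        t \<le> 131000 * ?N \<Longrightarrow> R t s'" for s1 R
  proof -
    have eq1: "reals s1 ''a'' = a" "reals s1 ''b'' = b" "reals s1 ''c'' = reals s ''c''" "reals s1 ''d'' = reals s ''d''"
      "nats s1 ''o'' = od" "nats s1 ''rp'' 0 = p" "nats s1 ''rq'' 0 = q"
      using s1(1) by (simp_all add: chg_def od_def p_def q_def a_def b_def)
    define y where "y = (\<lambda>i. max (c i) (min \<lfloor>a i * (reals s1 ''l1'' 0 - b i)\<rfloor> (d i)))"
    define z where "z = (\<lambda>i. max (c i) (min \<lceil>a i * (reals s1 ''l2'' 0 - b i)\<rceil> (d i)))"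
    have yi: "y i = max (c i) (min \<lfloor>a i * (reals s1 ''l1'' 0 - b i)\<rfloor> (d i))"
      and zi: "z i = max (c i) (min \<lceil>a i * (reals s1 ''l2'' 0 - b i)\<rceil> (d i))" for i
      by (simp_all add: y_def z_def)
    note S1' = S1[unfolded M1_def] and S2' = S2[unfolded M2_def]
    have yz: "y i \<le> z i" if "i \<in> V" for i
      by (rule window_nonempty[OF V(1) acd yi zi S1' S2' T(2,3) that])
    have size: "sum y V \<le> T" "T \<le> sum z V" "sum z V - sum y V \<le> 4 * card V + 2"
      by (rule window_size[OF V(1) _ yi zi S1' S2' T(2,3)], use acd in simp)+
    show ?thesis
      unfolding runs_Seq
    proof (rule runs_window_com[where c = c and d = d], unfold eq1 yi[symmetric] zi[symmetric] V_def[symmetric], goal_cases)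
      case (5 t2 s2 g)
      have chg2: "chg multiplier_nats rap_reals s s2" using s1(1) 5(1) by (simp add: chg_def)
      let ?E = "nats s2 ''E'' 0"
      have "?E = card (SIGMA i:V. {y i..<z i})" using bij_betw_same_card[OF 5(2)] by simp
      also have "\<dots> = (\<Sum>i\<in>V. nat (z i - y i))" by (subst card_SigmaI) (use V in auto)
      finally have E: "?E = (\<Sum>i\<in>V. nat (z i - y i))" .
      have "int ?E = (\<Sum>i\<in>V. z i - y i)" unfolding E of_nat_sum using yz by (intro sum.cong) auto
      then have E2: "int ?E = sum z V - sum y V" by (simp add: sum_subtractf)
      \<comment> \<open>\<open>4 * N + 2 \<le> 6 * N\<close> as the block is nonempty; this is what
        makes the search over single unit steps linear in the number of variables.\<close>
      then have E6: "?E \<le> 6 * ?N" using size(3) V(2) pq by simp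
      have ta: "reals s2 ''ta'' 0 = of_int (T - sum y V)"
        using 5(5) s1(2) sumV[of "\<lambda>i. real_of_int (y i)"] by simp
      \<comment> \<open>Equal keys have the same owner in the third component, and the keys of one
        variable are strictly increasing in the step.\<close>
      have injk: "inj_on (key s2) {..<?E}"
      proof (rule inj_onI)
        fix e e' assume *: "e \<in> {..<?E}" "e' \<in> {..<?E}" "key s2 e = key s2 e'"
        then have u: "unit_key f a b (fst (g e)) (snd (g e)) = unit_key f a b (fst (g e')) (snd (g e'))"
          using 5(3) by auto
        then have i: "fst (g e) = fst (g e')" by (simp add: unit_key_def)
        have "g e \<in> (SIGMA i:V. {y i..<z i})" using bij_betwE[OF 5(2)] *(1) by simp
        then have "fst (g e) \<in> V" by (cases "g e") simp
        then have "0 < a (fst (g e))" using acd by simp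
        then have "snd (g e) = snd (g e')"
          using unit_key_mono_iff(1)[OF conv, of a "fst (g e)" b "snd (g e)" "snd (g e')"]
            unit_key_mono_iff(1)[OF conv, of a "fst (g e)" b "snd (g e')" "snd (g e)"] u i by simp
        then show "e = e'" using i * inj_onD[OF bij_betw_imp_inj_on[OF 5(2)], of e e'] by (simp add: prod_eq_iff)
      qed
      show ?case
      proof (rule runs_search_com[OF injk], goal_cases)
        case (1 t3 s3 A)
        have wv: "e < ?E \<Longrightarrow> reals s2 ''w'' e = 0 \<and> reals s2 ''v'' e = 1" for e using 5(3) by blast
        have tau: "0 \<le> T - sum y V" "T - sum y V \<le> int ?E" using size E2 by auto
        note au = accepted_units[OF 1(2,3) refl injk wv ta tau]
        have eq3: "key s3 = key s2" "nats s3 ''k3'' = nats s2 ''k3''" "nats s3 ''E'' 0 = ?E" "reals s3 ''y'' = reals s2 ''y''"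
          using 1(1) key_cong[of s3 s2] by (simp_all add: chg_def)
        have A3: "{e. 0 < nats s3 ''hs'' 0 \<and> e < nats s3 ''E'' 0 \<and> key s3 e \<le> key s3 (nats s3 ''pa'' 0)} = A"
          using au(4) eq3 by simp
        have chg3: "chg multiplier_nats rap_reals s s3" using chg2 1(1) by (simp add: chg_def)
        show ?case
        proof (rule runs_count_com, unfold A3, unfold eq3, goal_cases)
          case (1 t4 s4)
          have k3: "nats s2 ''k3'' e = fst (g e)" if "e \<in> A" for e
          proof -
            have "key s2 e = unit_key f a b (fst (g e)) (snd (g e))" using 5(3) au(3) that by auto
            then show ?thesis by (simp add: key_def unit_key_def)
          qed
          have kA: "{e \<in> A. nats s2 ''k3'' e = i} = {e \<in> A. fst (g e) = i}" for i using k3 by auto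
          define x where "x i = y i + int (card {e \<in> A. fst (g e) = i})" for i
          have y4: "reals s4 ''y'' i = of_int (x i)" if i: "i \<in> V" for i
          proof -
            obtain j where "p \<le> j" "j < q" "i = od j" using i by (auto simp: V_def)
            then have "reals s2 ''y'' i = of_int (y i)" using 5(4) by simp
            then show ?thesis using 1(2)[of i] by (simp add: x_def kA)
          qed
          have key2: "e < ?E \<Longrightarrow> key s2 e = unit_key f a b (fst (g e)) (snd (g e))" for e using 5(3) by blast
          have apos: "i \<in> V \<Longrightarrow> 0 < a i" for i using acd by simp
          have "sum x V = sum y V + int (card A)"
            by (rule selected_steps(2)[OF conv V(1) apos 5(2) key2 au(3,2) x_def])
          then have sx: "sum x V = T" using au(1) by simp
          have xr: "y i \<le> x i \<and> x i \<le> max (y i) (z i)" if "i \<in> V" for i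
            by (rule selected_steps(1)[OF conv V(1) apos 5(2) key2 au(3,2) x_def that])
          have win: "unit_key f a b i t < unit_key f a b j t'"
            if "i \<in> V" "j \<in> V" "y i \<le> t" "t < x i" "x j \<le> t'" "t' < z j" for i j t t'
            by (rule selected_steps(3)[OF conv V(1) apos 5(2) key2 au(3,2) x_def that])
          have less: "unit_key f a b i t < unit_key f a b j t'"
            if "i \<in> V" "j \<in> V" "c i \<le> t" "t < x i" "x j \<le> t'" "t' < d j" for i j t t'
            by (rule window_order[OF conv V(1) acd yi zi S1' S2' sx T(2,3) xr win that])
          have "\<exists>\<kappa>. (\<forall>i\<in>V. \<forall>t. c i \<le> t \<longrightarrow> t < x i \<longrightarrow> unit_key f a b i t \<le> \<kappa>) \<and>
            (\<forall>i\<in>V. \<forall>t. x i \<le> t \<longrightarrow> t < d i \<longrightarrow> \<kappa> < unit_key f a b i t)"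
          proof (rule cut_exists[of V c x d "unit_key f a b"], goal_cases)
            case 1
            show ?case by (fact V(1))
          next
            case (2 i j t t')
            then show ?case by (rule less)
          next
            case (3 \<kappa>)
            then show ?case by (intro exI[of _ \<kappa>]) blast
          qed
          then obtain \<kappa> where k: "\<And>i t. i \<in> V \<Longrightarrow> c i \<le> t \<Longrightarrow> t < x i \<Longrightarrow> unit_key f a b i t \<le> \<kappa>"
            "\<And>i t. i \<in> V \<Longrightarrow> x i \<le> t \<Longrightarrow> t < d i \<Longrightarrow> \<kappa> < unit_key f a b i t"
            by blast
          have range: "c i \<le> x i \<and> x i \<le> d i" if "i \<in> V" for i
          proof -
            have "c i \<le> y i" "y i \<le> d i" "z i \<le> d i" using acd[OF that] yi[of i] zi[of i] by auto
            then show ?thesis using xr[OF that] by auto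
          qed
          have "t2 \<le> 64 * ?N + 8 * ?E + 4"
            using 5(6) E sumV[of "\<lambda>i. nat (z i - y i)"] by simp
          then have t: "t2 + (t3 + t4) \<le> 131000 * ?N"
            using \<open>t3 \<le> _\<close> 1(3) E6 pq by simp
          have "chg multiplier_nats rap_reals s s4" using chg3 1(1) by (simp add: chg_def)
          then show ?case by (rule R[OF _ y4 range sx k t])
        qed
      qed
    next
      case (3 j)
      then show ?case using cd[OF odV, of j] by simp
    next
      case (4 j)
      then show ?case using yz[OF odV, of j] by simp
    qed (use pq inj in simp_all)
  qed
  \<comment> \<open>The clamped targets lie between the sums of the bounds, as both relaxations
    require.\<close>
  have M: "sum c V \<le> M1" "M1 \<le> sum d V" "sum c V \<le> M2" "M2 \<le> sum d V"
    using T(2,3) scd by (auto simp: M1_def M2_def)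
  have NT: "real_of_int T - real ?N - 1 = of_int (T - card V - 1)" "real_of_int T + real ?N + 1 = of_int (T + card V + 1)"
    using V(2) by simp_all
  show ?thesis
    unfolding rap_int_com_def runs_Seq runs_RPut
  proof (rule stage1, goal_cases)
    case (4 t1 s1)
    have eq1: "nats s1 ''rp'' 0 = p" "nats s1 ''rq'' 0 = q" "reals s1 ''T'' 0 = of_int T"
      using 4(1) T(1) by (simp_all add: chg_def p_def q_def)
    show ?case
    proof (rule runs_rmax_com, rule multiplier[of _ M1], goal_cases)
      case (1 tm)
      then show ?case using 4(1) by (simp add: chg_def)
    next
      case (6 tm)
      show ?case using 4(2) NT by (simp add: eq1 M1_def of_int_max max.commute)
    next
      case (9 tm t2 s2)
      have eq2: "nats s2 ''rp'' 0 = p" "nats s2 ''rq'' 0 = q" "reals s2 ''T0'' 0 = of_int T"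
        "reals s2 ''sd'' 0 = of_int (sum d V)"
        using 9(2) 4(1,3) eq1 by (simp_all add: chg_def)
      have chg2: "chg multiplier_nats rap_reals s s2" using 4(1) 9(2) by (simp add: chg_def)
      show ?case
      proof (rule runs_rmin_com, rule multiplier[of _ M2], goal_cases)
        case (1 tn)
        then show ?case using chg2 by (simp add: chg_def)
      next
        case (6 tn)
        show ?case using NT by (simp add: eq2 M2_def of_int_min min.commute)
      next
        case (9 tn t3 s3)
        note t2 = \<open>t2 \<le> _\<close> and tm = \<open>tm \<le> 2\<close>
        have eq3: "reals s3 ''l1'' 0 = reals s2 ''lam'' 0" "reals s3 ''T0'' 0 = of_int T"
          using 9(2) eq2 by (simp_all add: chg_def)
        have chg3: "chg multiplier_nats rap_reals s s3" using chg2 9(2) by (simp add: chg_def)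
        show ?case
        proof (rule final[unfolded runs_Seq], goal_cases)
          case 1
          show ?case using chg3 by (simp add: chg_def)
        next
          case 3
          show ?case using \<open>(\<Sum>i\<in>V. clip _ (a i * (reals s2 ''lam'' 0 - b i)) _) = _\<close> by (simp add: eq3)
        next
          case 4
          show ?case using 9(3) by simp
        next
          case (5 t5 s5 x \<kappa>)
          show ?case
            by (rule post[OF 5(1-6)]) (use 5(7) 9(1,4) t2 tm \<open>t1 \<le> _\<close> pq in simp_all)
        qed (simp_all add: eq3)
      qed (use chg2 M in \<open>simp_all add: chg_def a_def b_def\<close>)
    qed (use 4(1) M in \<open>simp_all add: chg_def a_def b_def\<close>)
  qed (simp_all add: chg_def)
qed

end

section \<open>Bottom-up merging over a binary tree of group blocks\<close>

section \<open>Divide and conquer over the groups\<close>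

definition fetch_com :: "string \<Rightarrow> string \<Rightarrow> nexp \<Rightarrow> nexp \<Rightarrow> com" where
  "fetch_com dst src lo hi = For ''j'' lo hi
     (nset ''i'' (NGet ''o'' (nsc ''j'')) ;; RPut dst (nsc ''i'') (at_i src))"

lemma runs_fetch_com:
  assumes "nval lo s = p" "p \<le> q" "dst \<noteq> src" and hi: "\<And>s'. chg {''j'', ''i''} {dst} s s' \<Longrightarrow> nval hi s' = q"
    and post: "\<And>t s'. chg {''j'', ''i''} {dst} s s' \<Longrightarrow>
      (\<And>i. reals s' dst i = (if i \<in> nats s ''o'' ` {p..<q} then reals s src i else reals s dst i)) \<Longrightarrow>
      t \<le> 4 * (q - p) + 2 \<Longrightarrow> Q t s'"
  shows "runs F (fetch_com dst src lo hi) Q s"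
  unfolding fetch_com_def
proof (rule runs_For_const[where A = p and H = q and C = 2 and
      I = "\<lambda>k s'. chg {''j'', ''i''} {dst} s s' \<and>
        (\<forall>i. reals s' dst i = (if i \<in> nats s ''o'' ` {p..<k} then reals s src i else reals s dst i))"], goal_cases)
  case (5 k s1)
  then have chg: "chg {''j'', ''i''} {dst} s s1"
    and d: "\<And>i. reals s1 dst i = (if i \<in> nats s ''o'' ` {p..<k} then reals s src i else reals s dst i)" by blast+
  have eqs: "nats s1 ''o'' = nats s ''o''" "reals s1 src = reals s src"
    using chg assms(3) by (simp_all add: chg_def)
  have "{p..<Suc k} = insert k {p..<k}" using 5(4) by auto
  then show ?case
    using 5(2) d eqs by (simp add: runs_simps) (use chg in \<open>simp add: chg_def\<close>)
next
  case (6 t s1)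
  then show ?case by (intro post) auto
qed (use assms in \<open>auto simp: chg_def\<close>)

text \<open>\<open>a\<close> and \<open>b\<close> name the bound chosen before and after the block.
  On the right half the lower bounds come from \<open>''U'' @ b\<close> and the upper ones from
  \<open>''L'' @ b\<close>, because more resource at the cut leaves less behind it. The result goes
  to a separate array, as the old four still feed the other three solves.\<close>

definition solve_com :: "com \<Rightarrow> string \<Rightarrow> string \<Rightarrow> com" where
  "solve_com rapc a b =
     fetch_com ''c'' (a @ ''L'') (nsc ''rp'') (nsc ''rm'') ;; fetch_com ''d'' (a @ ''U'') (nsc ''rp'') (nsc ''rm'') ;;
     fetch_com ''c'' (''U'' @ b) (nsc ''rm'') (nsc ''rq'') ;; fetch_com ''d'' (''L'' @ b) (nsc ''rm'') (nsc ''rq'') ;;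
     rset ''T'' (RMinus (RGet b (NMinus (nsc ''ww'') (NConst 1))) (RGet a (NMinus (nsc ''vv'') (NConst 1)))) ;;
     rapc ;; fetch_com (''n'' @ a @ b) ''y'' (nsc ''rp'') (nsc ''rq'')"

definition node_com :: "com \<Rightarrow> com" where
  "node_com rapc =
     nset ''rp'' (NGet ''st'' (nsc ''vv'')) ;; nset ''rm'' (NGet ''st'' (nsc ''tt'')) ;;
     nset ''rq'' (NGet ''st'' (nsc ''ww'')) ;;
     solve_com rapc ''L'' ''L'' ;; solve_com rapc ''L'' ''U'' ;; solve_com rapc ''U'' ''L'' ;; solve_com rapc ''U'' ''U'' ;;
     fetch_com ''LL'' ''nLL'' (nsc ''rp'') (nsc ''rq'') ;; fetch_com ''LU'' ''nLU'' (nsc ''rp'') (nsc ''rq'') ;;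
     fetch_com ''UL'' ''nUL'' (nsc ''rp'') (nsc ''rq'') ;; fetch_com ''UU'' ''nUU'' (nsc ''rp'') (nsc ''rq'')"

abbreviation "solve_reals \<equiv> rap_reals \<union> {''c'', ''d'', ''nLL'', ''nLU'', ''nUL'', ''nUU''}"
abbreviation "node_nats \<equiv> multiplier_nats \<union> {''rp'', ''rm'', ''rq''}"
abbreviation "node_reals \<equiv> solve_reals \<union> {''LL'', ''LU'', ''UL'', ''UU''}"

text \<open>\<open>ok\<close> carries integrality through the recursion. The assumption
  \<open>leaf\<close> lets a single group absorb every difference between adjacent resource bounds,
  so no leaf is infeasible. \<open>runs_rap\<close> has an arbitrary postcondition to be chained
  like the other program rules.\<close>

locale divide_conquer = nested_groups I lev \<xi> Lb Ub
  for I :: "nat set" and lev :: "nat \<Rightarrow> nat" and \<xi> :: "nat \<Rightarrow> 'k::linorder \<Rightarrow> real" and Lb Ub :: "nat \<Rightarrow> real" +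
  fixes F :: "string \<Rightarrow> real \<Rightarrow> real" and rapc :: com and C K :: nat
    and a b lo up :: "nat \<Rightarrow> real" and ok :: "real \<Rightarrow> bool" and od st :: "nat \<Rightarrow> nat"
  assumes lo_up: "\<And>i \<kappa>. i \<in> I \<Longrightarrow> ok (lo i) \<and> ok (up i) \<and> lo i \<le> \<xi> i \<kappa> \<and> \<xi> i \<kappa> \<le> up i"
    and ok_diff: "\<And>x y. ok x \<Longrightarrow> ok y \<Longrightarrow> ok (x - y)"
    and bounds: "\<And>j. j \<le> K \<Longrightarrow> ok (Lb j) \<and> ok (Ub j) \<and> Lb j \<le> Ub j"
    and leaf: "\<And>k. 1 \<le> k \<Longrightarrow> k \<le> K \<Longrightarrow> sum lo (grp k) \<le> Lb k - Ub (k - 1) \<and> Ub k - Lb (k - 1) \<le> sum up (grp k)"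
    and ne: "\<And>k. 1 \<le> k \<Longrightarrow> k \<le> K \<Longrightarrow> grp k \<noteq> {}"
    and od: "\<And>v w. 1 \<le> v \<Longrightarrow> v \<le> w \<Longrightarrow> w \<le> Suc K \<Longrightarrow> od ` {st v..<st w} = {i\<in>I. v \<le> lev i \<and> lev i < w}"
      "\<And>v w. 1 \<le> v \<Longrightarrow> v \<le> w \<Longrightarrow> w \<le> Suc K \<Longrightarrow> inj_on od {st v..<st w}"
      "\<And>v w. 1 \<le> v \<Longrightarrow> v \<le> w \<Longrightarrow> w \<le> Suc K \<Longrightarrow> st v \<le> st w"
    and runs_rap: "\<And>s Q p q V. reals s ''a'' = a \<Longrightarrow> reals s ''b'' = b \<Longrightarrow> nats s ''o'' = od \<Longrightarrow>
      nats s ''rp'' 0 = p \<Longrightarrow> nats s ''rq'' 0 = q \<Longrightarrow> p < q \<Longrightarrow> inj_on od {p..<q} \<Longrightarrow>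
      V = od ` {p..<q} \<Longrightarrow> V \<subseteq> I \<Longrightarrow>
      (\<And>i. i \<in> V \<Longrightarrow> ok (reals s ''c'' i) \<and> ok (reals s ''d'' i) \<and>
        lo i \<le> reals s ''c'' i \<and> reals s ''c'' i \<le> reals s ''d'' i \<and> reals s ''d'' i \<le> up i) \<Longrightarrow>
      ok (reals s ''T'' 0) \<Longrightarrow> sum (reals s ''c'') V \<le> reals s ''T'' 0 \<Longrightarrow> reals s ''T'' 0 \<le> sum (reals s ''d'') V \<Longrightarrow>
      (\<And>t s' \<kappa>. chg multiplier_nats rap_reals s s' \<Longrightarrow>
        (\<And>i. i \<in> V \<Longrightarrow> ok (reals s' ''y'' i) \<and> reals s' ''y'' i = clip (reals s ''c'' i) (\<xi> i \<kappa>) (reals s ''d'' i)) \<Longrightarrow>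
        sum (reals s' ''y'') V = reals s ''T'' 0 \<Longrightarrow> t \<le> C * (q - p) \<Longrightarrow> Q t s') \<Longrightarrow>
      runs F rapc Q s"
begin

definition blk :: "nat \<Rightarrow> nat \<Rightarrow> nat set" where "blk v w = {i\<in>I. v \<le> lev i \<and> lev i < w}"

definition bd :: "string \<Rightarrow> nat \<Rightarrow> real" where "bd c j = (if c = ''L'' then Lb j else Ub j)"

definition base :: "state \<Rightarrow> bool" where
  "base s \<longleftrightarrow> nats s ''o'' = od \<and> (\<forall>k. 1 \<le> k \<longrightarrow> k \<le> Suc K \<longrightarrow> nats s ''st'' k = st k) \<and>
     reals s ''a'' = a \<and> reals s ''b'' = b \<and> (\<forall>j\<le>K. reals s ''L'' j = Lb j \<and> reals s ''U'' j = Ub j)"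

definition solved :: "nat \<Rightarrow> nat \<Rightarrow> string \<Rightarrow> string \<Rightarrow> (nat \<Rightarrow> real) \<Rightarrow> bool" where
  "solved v w c d x \<longleftrightarrow> (\<exists>lam. sol v w (bd c (v - 1)) (bd d (w - 1)) lam x) \<and> (\<forall>i\<in>blk v w. ok (x i))"

abbreviation sides :: "string set" where "sides \<equiv> {''L'', ''U''}"

definition good :: "nat \<Rightarrow> nat \<Rightarrow> state \<Rightarrow> bool" where
  "good v w s \<longleftrightarrow> (\<forall>c\<in>sides. \<forall>d\<in>sides. solved v w c d (reals s (c @ d)))"

lemma solved_cong: "(\<And>i. i \<in> blk v w \<Longrightarrow> x i = y i) \<Longrightarrow> solved v w c d x \<longleftrightarrow> solved v w c d y"
  unfolding solved_def using sol_cong[of v w x y] by (auto simp: blk_def)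

lemma base_chg: "base s \<Longrightarrow> chg NS RS s s' \<Longrightarrow> {''o'', ''st''} \<inter> NS = {} \<Longrightarrow> {''a'', ''b'', ''L'', ''U''} \<inter> RS = {} \<Longrightarrow> base s'"
  by (simp add: base_def chg_def)

lemma sum_blk: "v \<le> w \<Longrightarrow> sum x (blk v w) = sum (gs x) {v..<w}"
  by (simp only: blk_def sum_gs)

definition lower :: "nat \<Rightarrow> string \<Rightarrow> string \<Rightarrow> state \<Rightarrow> nat \<Rightarrow> real" where
  "lower t c d s i = (if lev i < t then reals s (c @ ''L'') i else reals s (''U'' @ d) i)"
definition upper :: "nat \<Rightarrow> string \<Rightarrow> string \<Rightarrow> state \<Rightarrow> nat \<Rightarrow> real" where
  "upper t c d s i = (if lev i < t then reals s (c @ ''U'') i else reals s (''L'' @ d) i)"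

text \<open>Collects what \<open>runs_rap\<close> demands of the boxes fetched for one node,
  including that the required amount lies between the sums of the bounds.\<close>

definition box_ok :: "nat \<Rightarrow> nat \<Rightarrow> nat \<Rightarrow> string \<Rightarrow> string \<Rightarrow> state \<Rightarrow> bool" where
  "box_ok v t w c d s \<longleftrightarrow>
     (\<forall>i\<in>blk v w. ok (lower t c d s i) \<and> ok (upper t c d s i) \<and>
        lo i \<le> lower t c d s i \<and> lower t c d s i \<le> upper t c d s i \<and> upper t c d s i \<le> up i) \<and>
     sum (lower t c d s) (blk v w) \<le> bd d (w - 1) - bd c (v - 1) \<and>
     bd d (w - 1) - bd c (v - 1) \<le> sum (upper t c d s) (blk v w)"

lemma blk_ne: "1 \<le> v \<Longrightarrow> v < w \<Longrightarrow> w \<le> Suc K \<Longrightarrow> st v < st w"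
proof (rule ccontr)
  assume *: "1 \<le> v" "v < w" "w \<le> Suc K" "\<not> st v < st w"
  then have "{i\<in>I. v \<le> lev i \<and> lev i < w} = {}" using od(1)[of v w] by auto
  moreover have "grp v \<noteq> {}" using ne[of v] * by auto
  ultimately show False using * by (auto simp: grp_def)
qed

lemma runs_solve_com:
  assumes base: "base s" and vtw: "1 \<le> v" "v \<le> t" "t < w" "w \<le> Suc K"
    and sc: "nats s ''vv'' 0 = v" "nats s ''ww'' 0 = w" "nats s ''rp'' 0 = st v" "nats s ''rm'' 0 = st t" "nats s ''rq'' 0 = st w"
    and cd: "c \<in> sides" "d \<in> sides" and box: "box_ok v t w c d s"
    and post: "\<And>t' s' \<kappa>. chg multiplier_nats (rap_reals \<union> {''c'', ''d'', ''n'' @ c @ d}) s s' \<Longrightarrow>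
      (\<And>i. i \<in> blk v w \<Longrightarrow> ok (reals s' (''n'' @ c @ d) i) \<and>
        reals s' (''n'' @ c @ d) i = clip (lower t c d s i) (\<xi> i \<kappa>) (upper t c d s i)) \<Longrightarrow>
      sum (reals s' (''n'' @ c @ d)) (blk v w) = bd d (w - 1) - bd c (v - 1) \<Longrightarrow>
      t' \<le> (C + 32) * (st w - st v) \<Longrightarrow> Q t' s'"
  shows "runs F (solve_com rapc c d) Q s"
proof -
  let ?n = "''n'' @ c @ d"
  have names: "c @ ''L'' \<in> {''LL'', ''UL''}" "c @ ''U'' \<in> {''LU'', ''UU''}" "''U'' @ d \<in> {''UL'', ''UU''}"
    "''L'' @ d \<in> {''LL'', ''LU''}" "?n \<in> {''nLL'', ''nLU'', ''nUL'', ''nUU''}"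
    using cd by auto
  have st: "st v \<le> st t" "st t \<le> st w" "st v < st w" using od(3)[of v t] od(3)[of t w] blk_ne[of v w] vtw by auto
  have odl: "od ` {st v..<st t} = {i\<in>I. v \<le> lev i \<and> lev i < t}" and odr: "od ` {st t..<st w} = {i\<in>I. t \<le> lev i \<and> lev i < w}"
    and oda: "od ` {st v..<st w} = blk v w" using od(1)[of v t] od(1)[of t w] od(1)[of v w] vtw by (auto simp: blk_def)
  have o: "nats s ''o'' = od" using base by (simp add: base_def)
  show ?thesis
    unfolding solve_com_def runs_Seq runs_RPut
  proof (rule runs_fetch_com[where p = "st v" and q = "st t"], goal_cases)
    case (5 t1 s1)
    have eq1: "nats s1 ''o'' = od" using 5(1) o by (simp add: chg_def)
    show ?case
    proof (rule runs_fetch_com[where p = "st v" and q = "st t"], goal_cases)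
      case (5 t2 s2)
      have chg2: "chg {''j'', ''i''} {''c'', ''d''} s s2" using \<open>chg _ _ s s1\<close> \<open>chg _ _ s1 s2\<close> by (simp add: chg_def)
      then have eq2: "nats s2 ''o'' = od" using o by (simp add: chg_def)
      have d2: "reals s2 ''d'' i = reals s (c @ ''U'') i" "reals s2 ''c'' i = reals s (c @ ''L'') i"
        if "i \<in> I" "v \<le> lev i" "lev i < t" for i
        using 5(2) \<open>\<And>i. reals s1 ''c'' i = _\<close> \<open>chg _ _ s s1\<close> \<open>chg _ _ s1 s2\<close> that names odl o eq1 by (auto simp: chg_def)
      show ?case
      proof (rule runs_fetch_com[where p = "st t" and q = "st w"], goal_cases)
        case (5 t3 s3)
        have chg3: "chg {''j'', ''i''} {''c'', ''d''} s s3" using chg2 \<open>chg _ _ s2 s3\<close> by (simp add: chg_def)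
        then have eq3: "nats s3 ''o'' = od" using o by (simp add: chg_def)
        show ?case
        proof (rule runs_fetch_com[where p = "st t" and q = "st w"], goal_cases)
          case (5 t4 s4)
          note c3 = \<open>\<And>i. reals s3 ''c'' i = _\<close> and d4 = \<open>\<And>i. reals s4 ''d'' i = _\<close>
          have chg4: "chg {''j'', ''i''} {''c'', ''d''} s s4" using chg3 \<open>chg _ _ s3 s4\<close> by (simp add: chg_def)
          have lu: "reals s4 ''c'' i = lower t c d s i" "reals s4 ''d'' i = upper t c d s i" if "i \<in> blk v w" for i
          proof -
            have e: "reals s4 ''c'' = reals s3 ''c''" "reals s3 ''d'' = reals s2 ''d''"
                "reals s2 (''U'' @ d) = reals s (''U'' @ d)" "reals s3 (''L'' @ d) = reals s (''L'' @ d)"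
              using \<open>chg _ _ s3 s4\<close> \<open>chg _ _ s2 s3\<close> chg2 chg3 names by (auto simp: chg_def)
            have i: "i \<in> I" "v \<le> lev i" "lev i < w" using that by (auto simp: blk_def)
            then have mem: "i \<in> od ` {st t..<st w} \<longleftrightarrow> \<not> lev i < t" unfolding odr by auto
            show "reals s4 ''c'' i = lower t c d s i"
              unfolding e(1) c3 eq2 mem lower_def e(3) using d2(2)[OF i(1,2)] by simp
            show "reals s4 ''d'' i = upper t c d s i"
              unfolding d4 eq3 mem upper_def e(2,4) using d2(1)[OF i(1,2)] by simp
          qed
          define s5 where "s5 = rput ''T'' 0 (bd d (w - 1) - bd c (v - 1)) s4"
          have base4: "base s4" using base chg4 by (rule base_chg) auto
          have bdv: "reals s4 d (w - 1) = bd d (w - 1)" "reals s4 c (v - 1) = bd c (v - 1)"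
            using base4 cd vtw by (auto simp: base_def bd_def)
          have sc4: "nats s4 ''ww'' 0 = w" "nats s4 ''vv'' 0 = v" using sc chg4 by (simp_all add: chg_def)
          have okT: "ok (bd d (w - 1) - bd c (v - 1))"
            using bounds[of "w - 1"] bounds[of "v - 1"] vtw by (intro ok_diff) (auto simp: bd_def)
          have eq5: "reals s5 ''c'' = reals s4 ''c''" "reals s5 ''d'' = reals s4 ''d''" by (simp_all add: s5_def)
          have sum5: "sum (reals s4 ''c'') (blk v w) = sum (lower t c d s) (blk v w)"
            "sum (reals s4 ''d'') (blk v w) = sum (upper t c d s) (blk v w)"
            using lu by (auto intro!: sum.cong)
          have chg5: "chg multiplier_nats (rap_reals \<union> {''c'', ''d'', ?n}) s s5" using chg4 by (simp add: chg_def s5_def)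
          have "runs F rapc (\<lambda>t5 s'. runs F (fetch_com ?n ''y'' (nsc ''rp'') (nsc ''rq''))
              (\<lambda>t'. Q (t1 + (t2 + (t3 + (t4 + (1 + (t5 + t'))))))) s') s5"
          proof (rule runs_rap[where p = "st v" and q = "st w" and V = "blk v w"], goal_cases)
            case 8
            show ?case using oda by simp
          next
            case (10 i)
            then show ?case using box lu[of i] unfolding eq5 box_ok_def by auto
          next
            case (14 t5 s6 \<kappa>)
            have chg6: "chg multiplier_nats (rap_reals \<union> {''c'', ''d'', ?n}) s s6"
              using chg5 14(1) by (simp add: chg_def)
            have sc6: "nats s6 ''rp'' 0 = st v" "nats s6 ''rq'' 0 = st w" "nats s6 ''o'' = od"
              using chg6 sc o by (simp_all add: chg_def)
            show ?case
            proof (rule runs_fetch_com[where p = "st v" and q = "st w"], goal_cases)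
              case (5 t6 s7)
              have n7: "reals s7 ?n i = reals s6 ''y'' i" if "i \<in> blk v w" for i
                using 5(2)[of i] that sc6 oda by simp
              show ?case
              proof (rule post[of _ \<kappa>], goal_cases)
                case 1
                show ?case using chg6 5(1) by (simp add: chg_def)
              next
                case (2 i)
                show ?case using 14(2)[OF 2] unfolding eq5 lu[OF 2] n7[OF 2] .
              next
                case 3
                have "sum (reals s7 ?n) (blk v w) = sum (reals s6 ''y'') (blk v w)" using n7 by (intro sum.cong) auto
                then show ?case using 14(3) by (simp add: s5_def)
              next
                case 4
                define D where "D = st w - st v"
                have D: "1 \<le> D" "st t - st v \<le> D" "st w - st t \<le> D" using st by (auto simp: D_def)
                have "t1 + t2 + t3 + t4 \<le> 16 * D + 8"
                  using \<open>t1 \<le> _\<close> \<open>t2 \<le> _\<close> \<open>t3 \<le> _\<close> \<open>t4 \<le> _\<close> D by linarith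
                then show ?case
                  using 5(3) 14(4) D(1) unfolding D_def[symmetric] add_mult_distrib by linarith
              qed
            qed (use sc6 st names(5) in \<open>auto simp: chg_def\<close>)
          qed (use base4 sc chg4 st okT sum5 box od(2)[of v w] vtw in
              \<open>auto simp: s5_def base_def chg_def box_ok_def blk_def\<close>)
          then show ?case using bdv sc4 by (simp add: s5_def)
        qed (use chg3 sc st names in \<open>auto simp: chg_def\<close>)
      qed (use chg2 sc st names in \<open>auto simp: chg_def\<close>)
    qed (use \<open>chg _ _ s s1\<close> sc st names in \<open>auto simp: chg_def\<close>)
  qed (use sc st names in \<open>auto simp: chg_def\<close>)
qed

lemma solD:
  assumes "sol v w x y lam z" "i \<in> I" "v \<le> lev i" "lev i < w"
  shows "z i = \<xi> i (lam (lev i))"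
proof -
  have "\<forall>k i. v \<le> k \<longrightarrow> k < w \<longrightarrow> i \<in> grp k \<longrightarrow> z i = \<xi> i (lam k)"
    using assms(1) unfolding sol_def by (elim conjE)
  then show ?thesis using assms(2-4) by (simp add: grp_def)
qed

lemma sol_sum: "sol v w x y lam z \<Longrightarrow> sum (gs z) {v..<w} = y - x"
  unfolding sol_def by (elim conjE) simp

text \<open>A leaf is processed as a node with empty left half, so it reads its box from the arrays
  of the right half, where the \<open>''U''\<close> side is the lower bound. Presetting these arrays
  lets leaves and inner nodes share one program.\<close>

definition leaf_ready :: "nat \<Rightarrow> state \<Rightarrow> bool" where
  "leaf_ready v s \<longleftrightarrow> (\<forall>i\<in>grp v. \<forall>d\<in>sides. reals s (''U'' @ d) i = lo i \<and> reals s (''L'' @ d) i = up i)"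

definition node_ready :: "nat \<Rightarrow> nat \<Rightarrow> nat \<Rightarrow> state \<Rightarrow> bool" where
  "node_ready v t w s \<longleftrightarrow> 1 \<le> v \<and> w \<le> Suc K \<and>
     (if t = v then w = Suc v \<and> leaf_ready v s else v < t \<and> t < w \<and> good v t s \<and> good t w s)"

text \<open>At an inner node the sums of the lower and of the upper bounds lie below and above the
  required amount by exactly \<open>Ub r - Lb r\<close>, so the allocation has room. At a leaf the
  room comes from the assumption \<open>leaf\<close>.\<close>

lemma node_box_solved:
  assumes rdy: "node_ready v t w s" and cd: "c \<in> sides" "d \<in> sides"
  shows "box_ok v t w c d s"
    and "(\<And>i. i \<in> blk v w \<Longrightarrow> ok (x i) \<and> x i = clip (lower t c d s i) (\<xi> i \<kappa>) (upper t c d s i)) \<Longrightarrow>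
      sum x (blk v w) = bd d (w - 1) - bd c (v - 1) \<Longrightarrow> solved v w c d x"
proof -
  have "box_ok v t w c d s \<and>
    ((\<forall>i\<in>blk v w. ok (x i) \<and> x i = clip (lower t c d s i) (\<xi> i \<kappa>) (upper t c d s i)) \<longrightarrow>
      sum x (blk v w) = bd d (w - 1) - bd c (v - 1) \<longrightarrow> solved v w c d x)"
  proof (cases "t = v")
    case True
    with rdy have w: "w = Suc v" "1 \<le> v" "v \<le> K" and lr: "leaf_ready v s" by (auto simp: node_ready_def)
    have blk: "blk v w = grp v" unfolding w by (auto simp: blk_def grp_def)
    have lu: "lower t c d s i = lo i" "upper t c d s i = up i" if "i \<in> grp v" for i
      using lr that cd True unfolding leaf_ready_def lower_def upper_def grp_def by auto
    have iI: "i \<in> I" if "i \<in> grp v" for i using that by (simp add: grp_def)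
    have sums: "sum (lower t c d s) (grp v) = sum lo (grp v)" "sum (upper t c d s) (grp v) = sum up (grp v)"
      using lu by (auto intro!: sum.cong)
    have lu_le: "lo i \<le> up i" if "i \<in> grp v" for i
      using lo_up[OF iI[OF that], of undefined] by simp
    have "v - 1 \<le> K" using w by simp
    then have b: "Lb v - Ub (v - 1) \<le> bd d v - bd c (v - 1)" "bd d v - bd c (v - 1) \<le> Ub v - Lb (v - 1)"
      using bounds[OF w(3)] bounds[of "v - 1"] by (simp_all add: bd_def)
    have "box_ok v t w c d s"
      unfolding box_ok_def blk sums unfolding w(1) diff_Suc_1
    proof (intro conjI ballI)
      fix i assume i: "i \<in> grp v"
      show "ok (lower t c d s i)" "ok (upper t c d s i)" "lo i \<le> lower t c d s i"
        "lower t c d s i \<le> upper t c d s i" "upper t c d s i \<le> up i"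
        unfolding lu[OF i] using lo_up[OF iI[OF i]] lu_le[OF i] by simp_all
    next
      show "sum lo (grp v) \<le> bd d v - bd c (v - 1)" "bd d v - bd c (v - 1) \<le> sum up (grp v)"
        using leaf[OF w(2,3)] b by linarith+
    qed
    moreover have "solved v w c d x"
      if x: "\<forall>i\<in>blk v w. ok (x i) \<and> x i = clip (lower t c d s i) (\<xi> i \<kappa>) (upper t c d s i)"
        and sx: "sum x (blk v w) = bd d (w - 1) - bd c (v - 1)"
    proof -
      have xi: "x i = \<xi> i \<kappa>" if "i \<in> grp v" for i
        using x lu[OF that] lo_up[OF iI[OF that], of \<kappa>] that unfolding blk by auto
      have "bd c (v - 1) + gs x v = bd d (w - 1)" using sx unfolding blk gs_def by simp
      then have "sol v (Suc v) (bd c (v - 1)) (bd d (w - 1)) (\<lambda>_. \<kappa>) x"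
        using xi by (intro sol_single)
      then show ?thesis unfolding solved_def w using x unfolding w by blast
    qed
    ultimately show ?thesis by blast
  next
    case False
    with rdy have vtw: "1 \<le> v" "v < t" "t < w" "w \<le> Suc K" and g: "good v t s" "good t w s" by (auto simp: node_ready_def)
    obtain r where t: "t = Suc r" using vtw by (cases t) auto
    have sv: "solved v t c e (reals s (c @ e))" "solved t w e d (reals s (e @ d))" if "e \<in> sides" for e
      using g cd that unfolding good_def by blast+
    obtain l1 l2 l3 l4 where
      S1: "sol v t (bd c (v - 1)) (Lb r) l1 (reals s (c @ ''L''))" and
      S2: "sol v t (bd c (v - 1)) (Ub r) l2 (reals s (c @ ''U''))" and
      S3: "sol t w (Lb r) (bd d (w - 1)) l3 (reals s (''L'' @ d))" and
      S4: "sol t w (Ub r) (bd d (w - 1)) l4 (reals s (''U'' @ d))"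
      using sv[of "''L''"] sv[of "''U''"] unfolding solved_def by (auto simp: bd_def t)
    have okl: "ok (reals s (c @ e) i)" if "i \<in> blk v t" "e \<in> sides" for i e
      using sv(1)[OF that(2)] that(1) by (simp add: solved_def)
    have okr: "ok (reals s (e @ d) i)" if "i \<in> blk t w" "e \<in> sides" for i e
      using sv(2)[OF that(2)] that(1) by (simp add: solved_def)
    have LU: "Lb r \<le> Ub r" using bounds[of r] vtw t by simp
    have split: "blk v w = blk v t \<union> blk t w" "blk v t \<inter> blk t w = {}" using vtw by (auto simp: blk_def)
    have finb: "finite (blk v t)" "finite (blk t w)" using fin by (auto simp: blk_def)
    have ll: "lower t c d s i = reals s (c @ ''L'') i" "upper t c d s i = reals s (c @ ''U'') i" if "i \<in> blk v t" for i
      using that by (auto simp: lower_def upper_def blk_def)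
    have lr: "lower t c d s i = reals s (''U'' @ d) i" "upper t c d s i = reals s (''L'' @ d) i" if "i \<in> blk t w" for i
      using that by (auto simp: lower_def upper_def blk_def)
    have sl: "sum (lower t c d s) (blk v w) = (Lb r - bd c (v - 1)) + (bd d (w - 1) - Ub r)"
    proof -
      have "sum (lower t c d s) (blk v t) = sum (reals s (c @ ''L'')) (blk v t)" using ll by (intro sum.cong) auto
      moreover have "sum (lower t c d s) (blk t w) = sum (reals s (''U'' @ d)) (blk t w)" using lr by (intro sum.cong) auto
      ultimately show ?thesis
        unfolding split(1) sum.union_disjoint[OF finb split(2)]
        using sol_sum[OF S1] sol_sum[OF S4] sum_blk[of v t] sum_blk[of t w] vtw by simp
    qed
    have su: "sum (upper t c d s) (blk v w) = (Ub r - bd c (v - 1)) + (bd d (w - 1) - Lb r)"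
    proof -
      have "sum (upper t c d s) (blk v t) = sum (reals s (c @ ''U'')) (blk v t)" using ll by (intro sum.cong) auto
      moreover have "sum (upper t c d s) (blk t w) = sum (reals s (''L'' @ d)) (blk t w)" using lr by (intro sum.cong) auto
      ultimately show ?thesis
        unfolding split(1) sum.union_disjoint[OF finb split(2)]
        using sol_sum[OF S2] sol_sum[OF S3] sum_blk[of v t] sum_blk[of t w] vtw by simp
    qed
    have boxl: "ok (lower t c d s i) \<and> ok (upper t c d s i) \<and>
        lo i \<le> lower t c d s i \<and> lower t c d s i \<le> upper t c d s i \<and> upper t c d s i \<le> up i" if "i \<in> blk v t" for i
    proof -
      have i: "i \<in> I" "v \<le> lev i" "lev i < t" using that by (auto simp: blk_def)
      have "ok (reals s (c @ ''L'') i)" "ok (reals s (c @ ''U'') i)" by (rule okl[OF that], simp)+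
      moreover have "lo i \<le> reals s (c @ ''L'') i" "reals s (c @ ''U'') i \<le> up i"
        unfolding solD[OF S1 i] solD[OF S2 i] using lo_up[OF i(1)] by blast+
      ultimately show ?thesis
        unfolding ll[OF that] using sol_mono[OF S1 S2 order_refl LU i] by blast
    qed
    have boxr: "ok (lower t c d s i) \<and> ok (upper t c d s i) \<and>
        lo i \<le> lower t c d s i \<and> lower t c d s i \<le> upper t c d s i \<and> upper t c d s i \<le> up i" if "i \<in> blk t w" for i
    proof -
      have i: "i \<in> I" "t \<le> lev i" "lev i < w" using that by (auto simp: blk_def)
      have "ok (reals s (''U'' @ d) i)" "ok (reals s (''L'' @ d) i)" by (rule okr[OF that], simp)+
      moreover have "lo i \<le> reals s (''U'' @ d) i" "reals s (''L'' @ d) i \<le> up i"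
        unfolding solD[OF S4 i] solD[OF S3 i] using lo_up[OF i(1)] by blast+
      ultimately show ?thesis
        unfolding lr[OF that] using sol_mono[OF S4 S3 LU order_refl i] by blast
    qed
    have "box_ok v t w c d s"
      unfolding box_ok_def sl su using boxl boxr LU split(1) by auto
    moreover have "solved v w c d x"
      if x: "\<forall>i\<in>blk v w. ok (x i) \<and> x i = clip (lower t c d s i) (\<xi> i \<kappa>) (upper t c d s i)"
        and sx: "sum x (blk v w) = bd d (w - 1) - bd c (v - 1)"
    proof -
      have "\<exists>lam. sol v w (bd c (v - 1)) (bd d (w - 1)) lam x"
      \<comment> \<open>The boxes fetched by the node are the bracketing child solutions, and the
        total of the single-sum allocation is the one hypothesis left besides.\<close>
      proof (rule sol_merge[OF _ _ S1[unfolded t] S2[unfolded t] S3[unfolded t] S4[unfolded t] LU])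
        show "v \<le> r" "Suc r < w" using vtw t by auto
        show "x i = clip (reals s (c @ ''L'') i) (\<xi> i \<kappa>) (reals s (c @ ''U'') i)" if "i \<in> I" "v \<le> lev i" "lev i \<le> r" for i
        proof -
          have "i \<in> blk v t" using that t by (auto simp: blk_def)
          then show ?thesis using x ll split(1) by auto
        qed
        show "x i = clip (reals s (''U'' @ d) i) (\<xi> i \<kappa>) (reals s (''L'' @ d) i)" if "i \<in> I" "r < lev i" "lev i < w" for i
        proof -
          have "i \<in> blk t w" using that t by (auto simp: blk_def)
          then show ?thesis using x lr split(1) by auto
        qed
        show "bd c (v - 1) + sum (gs x) {v..<w} = bd d (w - 1)"
          using sx sum_blk[of v w x] vtw by simp
      qed
      then show ?thesis unfolding solved_def using x by blast
    qed
    ultimately show ?thesis by blast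
  qed
  then show "box_ok v t w c d s"
    and "(\<And>i. i \<in> blk v w \<Longrightarrow> ok (x i) \<and> x i = clip (lower t c d s i) (\<xi> i \<kappa>) (upper t c d s i)) \<Longrightarrow>
      sum x (blk v w) = bd d (w - 1) - bd c (v - 1) \<Longrightarrow> solved v w c d x" by blast+
qed

lemma box_ok_cong:
  assumes "\<And>c d. c \<in> sides \<Longrightarrow> d \<in> sides \<Longrightarrow> reals s' (c @ d) = reals s (c @ d)" "c \<in> sides" "d \<in> sides"
  shows "lower t c d s' = lower t c d s" "upper t c d s' = upper t c d s" "box_ok v t w c d s' \<longleftrightarrow> box_ok v t w c d s"
proof -
  have "reals s' (c @ ''L'') = reals s (c @ ''L'')" "reals s' (c @ ''U'') = reals s (c @ ''U'')"
    "reals s' (''L'' @ d) = reals s (''L'' @ d)" "reals s' (''U'' @ d) = reals s (''U'' @ d)"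
    using assms(1)[of c "''L''"] assms(1)[of c "''U''"] assms(1)[of "''L''" d] assms(1)[of "''U''" d] assms(2,3)
    by simp_all
  then show 1: "lower t c d s' = lower t c d s" "upper t c d s' = upper t c d s"
    by (simp_all add: lower_def upper_def fun_eq_iff)
  show "box_ok v t w c d s' \<longleftrightarrow> box_ok v t w c d s" unfolding box_ok_def 1 ..
qed

lemma runs_node_com:
  assumes base: "base s" and rdy: "node_ready v t w s"
    and sc: "nats s ''vv'' 0 = v" "nats s ''tt'' 0 = t" "nats s ''ww'' 0 = w"
    and post: "\<And>t' s'. chg node_nats node_reals s s' \<Longrightarrow> good v w s' \<Longrightarrow>
      (\<And>c d i. c \<in> sides \<Longrightarrow> d \<in> sides \<Longrightarrow> i \<notin> blk v w \<Longrightarrow> reals s' (c @ d) i = reals s (c @ d) i) \<Longrightarrow>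
      t' \<le> (4 * C + 160) * (st w - st v) \<Longrightarrow> Q t' s'"
  shows "runs F (node_com rapc) Q s"
proof -
  have vtw: "1 \<le> v" "v \<le> t" "t < w" "w \<le> Suc K" using rdy by (auto simp: node_ready_def split: if_splits)
  have st: "st v < st w" using blk_ne[of v w] vtw by simp
  have oda: "od ` {st v..<st w} = blk v w" using od(1)[of v w] vtw by (auto simp: blk_def)
  define inv where "inv s1 \<longleftrightarrow> chg node_nats solve_reals s s1 \<and> nats s1 ''rp'' 0 = st v \<and> nats s1 ''rm'' 0 = st t \<and>
      nats s1 ''rq'' 0 = st w" for s1
  have step: "runs F (solve_com rapc c d) R s1"
    if "inv s1" and cd: "c \<in> sides" "d \<in> sides"
      and R: "\<And>t' s'. inv s' \<Longrightarrow> chg multiplier_nats (rap_reals \<union> {''c'', ''d'', ''n'' @ c @ d}) s1 s' \<Longrightarrow>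
        solved v w c d (reals s' (''n'' @ c @ d)) \<Longrightarrow> t' \<le> (C + 32) * (st w - st v) \<Longrightarrow> R t' s'" for R s1 c d
  proof -
    have chg1: "chg node_nats solve_reals s s1" and sc1: "nats s1 ''rp'' 0 = st v" "nats s1 ''rm'' 0 = st t" "nats s1 ''rq'' 0 = st w"
      using that(1) by (simp_all add: inv_def)
    have base1: "base s1" using base chg1 by (rule base_chg) auto
    have X: "reals s1 (c @ d) = reals s (c @ d)" if "c \<in> sides" "d \<in> sides" for c d
      by (rule chg_reals[OF chg1]) (use that in auto)
    have cong: "lower t c d s1 = lower t c d s" "upper t c d s1 = upper t c d s"
      "box_ok v t w c d s1 \<longleftrightarrow> box_ok v t w c d s"
      by (rule box_ok_cong, erule (1) X, rule cd(1), rule cd(2))+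
    have sc2: "nats s1 ''vv'' 0 = v" "nats s1 ''ww'' 0 = w" using chg1 sc by (simp_all add: chg_def)
    have nm: "''n'' @ c @ d \<in> {''nLL'', ''nLU'', ''nUL'', ''nUU''}" using cd by auto
    show ?thesis
    proof (rule runs_solve_com[OF base1 vtw sc2 sc1 cd], unfold cong, goal_cases)
      case 1
      show ?case by (rule node_box_solved(1)[OF rdy cd])
    next
      case (2 t' s' \<kappa>)
      show ?case
      proof (rule R)
        have "chg node_nats solve_reals s s'"
          by (rule chg_trans[OF chg1 2(1)]) (use nm in auto)
        then show "inv s'"
          unfolding inv_def using sc1 chg_nats[OF 2(1)] by simp
        show "solved v w c d (reals s' (''n'' @ c @ d))"
          by (rule node_box_solved(2)[OF rdy cd 2(2,3)])
      qed (use 2 in auto)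
    qed
  qed
  have writeback: "runs F (fetch_com dst src (nsc ''rp'') (nsc ''rq'')) R s1"
    if s1: "chg node_nats node_reals s s1" "nats s1 ''rp'' 0 = st v" "nats s1 ''rq'' 0 = st w" "dst \<noteq> src"
      and R: "\<And>t' s'. chg {''j'', ''i''} {dst} s1 s' \<Longrightarrow>
        (\<And>i. reals s' dst i = (if i \<in> blk v w then reals s1 src i else reals s1 dst i)) \<Longrightarrow>
        t' \<le> 4 * (st w - st v) + 2 \<Longrightarrow> R t' s'" for R s1 dst src
  proof -
    have "nats s1 ''o'' = od" using base s1(1) by (simp add: base_def chg_def)
    then show ?thesis
      using s1 st oda R by (intro runs_fetch_com[where p = "st v" and q = "st w"]) (auto simp: chg_def)
  qed
  define s1 where "s1 = nput ''rq'' 0 (st w) (nput ''rm'' 0 (st t) (nput ''rp'' 0 (st v) s))"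
  have inv1: "inv s1" by (simp add: inv_def s1_def chg_def)
  have stv: "nats s ''st'' v = st v" "nats s ''st'' t = st t" "nats s ''st'' w = st w"
    using base vtw by (auto simp: base_def)
  have "runs F (solve_com rapc ''L'' ''L'' ;; solve_com rapc ''L'' ''U'' ;; solve_com rapc ''U'' ''L'' ;; solve_com rapc ''U'' ''U'' ;;
     fetch_com ''LL'' ''nLL'' (nsc ''rp'') (nsc ''rq'') ;; fetch_com ''LU'' ''nLU'' (nsc ''rp'') (nsc ''rq'') ;;
     fetch_com ''UL'' ''nUL'' (nsc ''rp'') (nsc ''rq'') ;; fetch_com ''UU'' ''nUU'' (nsc ''rp'') (nsc ''rq''))
     (\<lambda>t'. Q (1 + (1 + (1 + t')))) s1"
    unfolding runs_Seq
  proof (rule step[OF inv1], goal_cases)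
    case (3 t1 s2)
    note a1 = 3
    show ?case
    proof (rule step[OF a1(1)], goal_cases)
      case (3 t2 s3)
      note a2 = 3
      show ?case
      proof (rule step[OF a2(1)], goal_cases)
        case (3 t3 s4)
        note a3 = 3
        show ?case
        proof (rule step[OF a3(1)], goal_cases)
          case (3 t4 s5)
          note a4 = 3
          have N: "solved v w ''L'' ''L'' (reals s5 ''nLL'')" "solved v w ''L'' ''U'' (reals s5 ''nLU'')"
            "solved v w ''U'' ''L'' (reals s5 ''nUL'')" "solved v w ''U'' ''U'' (reals s5 ''nUU'')"
            using a1(2,3) a2(2,3) a3(2,3) a4(2,3) by (simp_all add: chg_def)
          have i5: "chg node_nats solve_reals s s5" "nats s5 ''rp'' 0 = st v" "nats s5 ''rq'' 0 = st w"
            using a4(1) by (simp_all add: inv_def)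
          have c5: "chg node_nats node_reals s s5" using i5(1) by (simp add: chg_def)
          have X5: "reals s5 (c @ d) = reals s (c @ d)" if "c \<in> sides" "d \<in> sides" for c d
            by (rule chg_reals[OF i5(1)]) (use that in auto)
          show ?case
          proof (rule writeback, goal_cases)
            case (5 t5 s6)
            note b1 = 5
            have c6: "chg node_nats node_reals s s6" using c5 b1(1) by (simp add: chg_def)
            show ?case
            proof (rule writeback, goal_cases)
              case (5 t6 s7)
              note b2 = 5
              have c7: "chg node_nats node_reals s s7" using c6 b2(1) by (simp add: chg_def)
              show ?case
              proof (rule writeback, goal_cases)
                case (5 t7 s8)
                note b3 = 5
                have c8: "chg node_nats node_reals s s8" using c7 b3(1) by (simp add: chg_def)
                show ?case
                proof (rule writeback, goal_cases)
                  case (5 t8 s9)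
                  note b4 = 5
                  have R: "reals s9 ''LL'' i = (if i \<in> blk v w then reals s5 ''nLL'' i else reals s5 ''LL'' i)"
                    "reals s9 ''LU'' i = (if i \<in> blk v w then reals s5 ''nLU'' i else reals s5 ''LU'' i)"
                    "reals s9 ''UL'' i = (if i \<in> blk v w then reals s5 ''nUL'' i else reals s5 ''UL'' i)"
                    "reals s9 ''UU'' i = (if i \<in> blk v w then reals s5 ''nUU'' i else reals s5 ''UU'' i)" for i
                    using b1(1,2) b2(1,2) b3(1,2) b4(1,2) by (simp_all add: chg_def)
                  have g: "good v w s9"
                    unfolding good_def using N R solved_cong[of v w "reals s9 _" "reals s5 _"] by (auto 0 0)
                  show ?case
                  proof (rule post[OF _ g])
                    show "chg node_nats node_reals s s9" using c8 b4(1) by (simp add: chg_def)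
                    show "reals s9 (c @ d) i = reals s (c @ d) i" if "c \<in> sides" "d \<in> sides" "i \<notin> blk v w" for c d i
                      using that R[of i] X5[OF that(1,2)] by auto
                    define D where "D = st w - st v"
                    have "1 \<le> D" using st by (simp add: D_def)
                    then show "1 + (1 + (1 + (t1 + (t2 + (t3 + (t4 + (t5 + (t6 + (t7 + t8))))))))) \<le> (4 * C + 160) * (st w - st v)"
                      using a1(4) a2(4) a3(4) a4(4) b1(3) b2(3) b3(3) b4(3)
                      unfolding D_def[symmetric] add_mult_distrib mult.assoc by linarith
                  qed
                qed (use c8 i5 b1(1) b2(1) b3(1) in \<open>simp_all add: chg_def\<close>)
              qed (use c7 i5 b1(1) b2(1) in \<open>simp_all add: chg_def\<close>)
            qed (use c6 i5 b1(1) in \<open>simp_all add: chg_def\<close>)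
          qed (use c5 i5 in \<open>simp_all add: chg_def\<close>)
        qed simp_all
      qed simp_all
    qed simp_all
  qed simp_all
  then show ?thesis
    unfolding node_com_def runs_Seq[of F "nset _ _"] runs_NPut by (simp add: s1_def sc stv)
qed

end

text \<open>\<open>hh = 0\<close> and \<open>gg = 1\<close> encode the pass over the leaves. If the
  right half of a block would start beyond the last group, the block equals its left half and is
  already solved, hence the test of \<open>tt\<close> against \<open>ww\<close>.\<close>

definition level_com :: "com \<Rightarrow> com" where
  "level_com rapc = nset ''vv'' (NConst 1) ;;
     While (NLess (nsc ''vv'') (nsc ''K1''))
       (nset ''tt'' (NPlus (nsc ''vv'') (nsc ''hh'')) ;; nset ''ww'' (NPlus (nsc ''vv'') (nsc ''gg'')) ;;
        Cond (NLess (nsc ''K1'') (nsc ''ww'')) (nset ''ww'' (nsc ''K1'')) Skip ;;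
        Cond (NLess (nsc ''tt'') (nsc ''ww'')) (node_com rapc) Skip ;;
        nset ''vv'' (NPlus (nsc ''vv'') (nsc ''gg'')))"

definition levels_com :: "com \<Rightarrow> com" where
  "levels_com rapc = nset ''hh'' (NConst 0) ;; nset ''gg'' (NConst 1) ;;
     While (NLess (NPlus (nsc ''hh'') (NConst 1)) (nsc ''K1''))
       (level_com rapc ;; nset ''hh'' (nsc ''gg'') ;; nset ''gg'' (dbl (nsc ''gg'')))"

abbreviation "level_nats \<equiv> node_nats \<union> {''vv'', ''tt'', ''ww''}"

context divide_conquer
begin

text \<open>Blocks of width \<open>h\<close> start at the positions with
  \<open>h dvd (k - 1)\<close>, and the last one may be truncated. Only positions from
  \<open>v\<close> on are covered, since the current pass has overwritten those before.\<close>

definition ready :: "nat \<Rightarrow> nat \<Rightarrow> state \<Rightarrow> bool" where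
  "ready h v s \<longleftrightarrow>
     (if h = 0 then \<forall>k. v \<le> k \<longrightarrow> k \<le> K \<longrightarrow> leaf_ready k s
      else \<forall>k. 1 \<le> k \<longrightarrow> v \<le> k \<longrightarrow> k \<le> K \<longrightarrow> h dvd (k - 1) \<longrightarrow> good k (min (k + h) (Suc K)) s)"

definition same_on :: "nat set \<Rightarrow> state \<Rightarrow> state \<Rightarrow> bool" where
  "same_on B s s' \<longleftrightarrow> (\<forall>i\<in>B. \<forall>c\<in>sides. \<forall>d\<in>sides. reals s' (c @ d) i = reals s (c @ d) i)"

lemma good_same: "same_on (blk v w) s s' \<Longrightarrow> good v w s \<Longrightarrow> good v w s'"
  unfolding good_def same_on_def using solved_cong by blast

lemma leaf_same: "same_on (grp v) s s' \<Longrightarrow> leaf_ready v s \<Longrightarrow> leaf_ready v s'"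
  unfolding leaf_ready_def same_on_def by (metis insertCI)

lemma ready_same:
  assumes "ready h v s" "1 \<le> v" "same_on {i\<in>I. v \<le> lev i} s s'"
  shows "ready h v s'"
proof -
  have so: "same_on B s s'" if "B \<subseteq> {i\<in>I. v \<le> lev i}" for B
    using assms(3) that by (auto simp: same_on_def)
  have 1: "same_on (blk k w) s s'" "same_on (grp k) s s'" if "v \<le> k" for k w
    using that by (auto intro!: so simp: blk_def grp_def)
  show ?thesis
    using assms(1) unfolding ready_def using good_same[OF 1(1)] leaf_same[OF 1(2)] by (auto split: if_splits)
qed

lemma ready_mono: "ready h v s \<Longrightarrow> v \<le> v' \<Longrightarrow> ready h v' s"
  by (auto simp: ready_def split: if_splits)

abbreviation "vol \<equiv> st (Suc K) - st 1"

lemma runs_level_com: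
  assumes base: "base s" and hg: "(h = 0 \<and> g = 1) \<or> (1 \<le> h \<and> g = 2 * h)"
    and sc: "nats s ''hh'' 0 = h" "nats s ''gg'' 0 = g" "nats s ''K1'' 0 = Suc K"
    and rdy: "ready h 1 s" and K: "1 \<le> K"
    and post: "\<And>t' s'. chg level_nats node_reals s s' \<Longrightarrow> ready g 1 s' \<Longrightarrow>
      t' \<le> (4 * C + 160) * vol + 12 * K + 2 \<Longrightarrow> Q t' s'"
  shows "runs F (level_com rapc) Q s"
proof -
  let ?A = "4 * C + 160"
  have g: "1 \<le> g" "h dvd g \<or> h = 0" "h \<le> g" using hg by auto
  define Inv where "Inv s' \<longleftrightarrow> chg level_nats node_reals s s' \<and> 1 \<le> nats s' ''vv'' 0 \<and> g dvd (nats s' ''vv'' 0 - 1) \<and>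
      ready h (nats s' ''vv'' 0) s' \<and>
      (\<forall>k. 1 \<le> k \<longrightarrow> k < nats s' ''vv'' 0 \<longrightarrow> k \<le> K \<longrightarrow> g dvd (k - 1) \<longrightarrow> good k (min (k + g) (Suc K)) s')" for s'
  show ?thesis
    unfolding level_com_def runs_Seq[of F "nset ''vv'' _"] runs_NPut
  \<comment> \<open>One summand pays for merging in proportion to the variables still ahead, the
    other for the constant overhead per block. The minimum is needed because \<open>vv\<close> may
    overshoot the end.\<close>
  proof (rule runs_While[where I = Inv and
        \<Phi> = "\<lambda>s'. ?A * (st (Suc K) - st (min (nats s' ''vv'' 0) (Suc K))) + 12 * (Suc K - nats s' ''vv'' 0)"], goal_cases)
    case 1
    have "same_on {i \<in> I. 1 \<le> lev i} s (nput ''vv'' 0 1 s)" by (simp add: same_on_def)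
    then have "ready h 1 (nput ''vv'' 0 1 s)" by (rule ready_same[OF rdy order_refl])
    then show ?case by (simp add: Inv_def chg_def)
  next
    case (2 s1)
    define v where "v = nats s1 ''vv'' 0"
    define w where "w = min (v + g) (Suc K)"
    have I: "chg level_nats node_reals s s1" "1 \<le> v" "g dvd (v - 1)" "ready h v s1"
      "\<And>k. 1 \<le> k \<Longrightarrow> k < v \<Longrightarrow> k \<le> K \<Longrightarrow> g dvd (k - 1) \<Longrightarrow> good k (min (k + g) (Suc K)) s1"
      using 2(1) by (simp_all add: Inv_def v_def)
    have sc1: "nats s1 ''hh'' 0 = h" "nats s1 ''gg'' 0 = g" "nats s1 ''K1'' 0 = Suc K"
      using sc I(1) by (simp_all add: chg_def)
    have vK: "v \<le> K" using 2(2) sc1 by (simp add: v_def)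
    define s2 where "s2 = nput ''ww'' 0 w (nput ''tt'' 0 (v + h) s1)"
    have s2: "chg {''tt'', ''ww''} {} s1 s2" by (simp add: s2_def chg_def)
    have s2eq: "nats s2 ''vv'' 0 = v" "nats s2 ''tt'' 0 = v + h" "nats s2 ''ww'' 0 = w" "nats s2 ''gg'' 0 = g"
      using sc1 by (simp_all add: s2_def v_def)
    have vw: "v < w" "w \<le> Suc K" using vK g by (auto simp: w_def)
    have stvw: "st v \<le> st w" "st w \<le> st (Suc K)" using od(3)[of v w] od(3)[of w "Suc K"] I(2) vw by auto
    have ready2: "ready h v s2" by (rule ready_same[OF I(4,2)]) (simp add: s2_def same_on_def)
    have finish: "Inv (nput ''vv'' 0 (v + g) s3) \<and>
        1 + (6 + t) + (?A * (st (Suc K) - st (min (nats (nput ''vv'' 0 (v + g) s3) ''vv'' 0) (Suc K))) +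
          12 * (Suc K - nats (nput ''vv'' 0 (v + g) s3) ''vv'' 0)) \<le>
        ?A * (st (Suc K) - st (min v (Suc K))) + 12 * (Suc K - v)"
      if s3: "chg level_nats node_reals s2 s3" "good v w s3" "t \<le> ?A * (st w - st v) + 2"
        and same: "\<And>i. i \<notin> blk v w \<Longrightarrow> same_on {i} s2 s3" for t s3
    proof
      let ?s = "nput ''vv'' 0 (v + g) s3"
      have so: "same_on B s1 ?s" if "B \<inter> blk v w = {}" for B
        using same that unfolding same_on_def s2_def by fastforce
      have "chg level_nats node_reals s ?s" using I(1) s2 s3(1) by (simp add: chg_def)
      moreover have "g dvd v + g - 1" using I(2,3) by (metis dvd_add_triv_right_iff Nat.add_diff_assoc2)
      moreover have "ready h (v + g) ?s"
      proof (rule ready_same[OF ready_mono[OF I(4)]])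
        show "same_on {i \<in> I. v + g \<le> lev i} s1 ?s" by (rule so) (auto simp: blk_def w_def)
      qed (use I(2) in auto)
      moreover have "good k (min (k + g) (Suc K)) ?s" if k: "1 \<le> k" "k < v + g" "k \<le> K" "g dvd (k - 1)" for k
      proof (cases "k = v")
        case True
        have "same_on (blk v w) s3 ?s" by (simp add: same_on_def)
        then show ?thesis using good_same s3(2) True by (simp add: w_def)
      next
        case False
        \<comment> \<open>Block starts differ by multiples of \<open>g\<close>, so a block that
          starts before \<open>v\<close> also ends at or before \<open>v\<close> and is untouched by
          this merge.\<close>
        obtain m n where mn: "k - 1 = g * m" "v - 1 = g * n" using k(4) I(3) by (auto elim!: dvdE)
        have "g * m < g * Suc n" using mn k I(2) by simp
        then have "m < Suc n" using g(1) by (metis mult_less_cancel1)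
        moreover have "m \<noteq> n" using False mn k I(2) by auto
        ultimately have "Suc m \<le> n" by simp
        then have "g * Suc m \<le> g * n" by (rule mult_le_mono2)
        then have kv: "k + g \<le> v" using mn k(1) I(2) by simp
        have "same_on (blk k (min (k + g) (Suc K))) s1 ?s"
          by (rule so) (use kv in \<open>auto simp: blk_def\<close>)
        then show ?thesis using good_same I(5)[of k] k kv g(1) by simp
      qed
      ultimately show "Inv ?s" using I(2) by (simp add: Inv_def)
      have m1: "min (v + g) (Suc K) = w" "min v (Suc K) = v" using vK by (simp_all add: w_def)
      have "?A * (st w - st v) + ?A * (st (Suc K) - st w) = ?A * (st (Suc K) - st v)"
        using stvw by (simp flip: add_mult_distrib2)
      moreover have "12 * (Suc K - (v + g)) + 12 \<le> 12 * (Suc K - v)" using vK g(1) by simp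
      ultimately show "1 + (6 + t) + (?A * (st (Suc K) - st (min (nats ?s ''vv'' 0) (Suc K))) +
          12 * (Suc K - nats ?s ''vv'' 0)) \<le> ?A * (st (Suc K) - st (min v (Suc K))) + 12 * (Suc K - v)"
        using s3(3) m1 by simp
    qed
    have main: "runs F (Cond (NLess (nsc ''tt'') (nsc ''ww'')) (node_com rapc) Skip)
       (\<lambda>t s3. Inv (nput ''vv'' 0 (v + g) s3) \<and> nats s3 ''vv'' 0 = v \<and> nats s3 ''gg'' 0 = g \<and>
        1 + (6 + t) + (?A * (st (Suc K) - st (min (nats (nput ''vv'' 0 (v + g) s3) ''vv'' 0) (Suc K))) +
          12 * (Suc K - nats (nput ''vv'' 0 (v + g) s3) ''vv'' 0)) \<le>
        ?A * (st (Suc K) - st (min v (Suc K))) + 12 * (Suc K - v)) s2"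
    proof (cases "v + h < w")
      case True
      then have bv: "bval F (NLess (nsc ''tt'') (nsc ''ww'')) s2" using s2eq by simp
      have base2: "base s2" by (rule base_chg[OF base_chg[OF base I(1)] s2]) auto
      have nr: "node_ready v (v + h) w s2"
      proof (cases "h = 0")
        case True
        then show ?thesis
          using hg ready2 vK I(2) vw by (auto simp: node_ready_def ready_def w_def)
      next
        case False
        have "h dvd v - 1" using g(2) I(2,3) False dvd_trans[of h g "v - 1"] by auto
        moreover have "v + h - 1 = (v - 1) + h" using I(2) by simp
        ultimately have "h dvd v - 1" "h dvd v + h - 1" by (simp_all only: dvd_add_triv_right_iff)
        moreover have "min (v + h) (Suc K) = v + h" "min (v + h + h) (Suc K) = w" "v + h \<le> K"
          using True False hg vw by (auto simp: w_def)
        moreover have gd: "good k (min (k + h) (Suc K)) s2" if "1 \<le> k" "v \<le> k" "k \<le> K" "h dvd (k - 1)" for k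
          using ready2 that False by (simp add: ready_def)
        ultimately have "good v (v + h) s2" "good (v + h) w s2"
          using gd[of v] gd[of "v + h"] I(2) vK by auto
        then show ?thesis using True False I(2) vw by (simp add: node_ready_def)
      qed
      show ?thesis
        unfolding runs_Cond if_P[OF bv]
      proof (rule runs_node_com[OF base2 nr s2eq(1-3)], goal_cases)
        case (1 t s3)
        have c3: "chg level_nats node_reals s2 s3" using 1(1) by (simp add: chg_def)
        have "same_on {i} s2 s3" if "i \<notin> blk v w" for i
          using 1(3)[OF _ _ that] by (simp add: same_on_def)
        moreover have "nats s3 ''vv'' 0 = v" "nats s3 ''gg'' 0 = g" using 1(1) s2eq by (simp_all add: chg_def)
        ultimately show ?case using finish[OF c3 1(2), of "1 + t"] 1(4) by simp
      qed
    next
      case False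
      then have bv: "\<not> bval F (NLess (nsc ''tt'') (nsc ''ww'')) s2" using s2eq by simp
      have h0: "h \<noteq> 0" using False vw by auto
      then have "h dvd v - 1" using g(2) I(3) dvd_trans[of h g "v - 1"] by auto
      then have "good v (min (v + h) (Suc K)) s2" using ready2 h0 I(2) vK by (simp add: ready_def)
      moreover have "min (v + h) (Suc K) = w" using False g hg h0 by (auto simp: w_def)
      ultimately have gd: "good v w s2" by simp
      have "chg level_nats node_reals s2 s2" by (simp add: chg_def)
      then show ?thesis
        unfolding runs_Cond if_not_P[OF bv] runs_Skip
        using finish[OF _ gd, of "1 + 1"] s2eq by (simp add: same_on_def)
    qed
    have seq: "runs F (Cond (NLess (nsc ''tt'') (nsc ''ww'')) (node_com rapc) Skip)
       (\<lambda>t s3. (Inv (nput ''vv'' 0 (nats s3 ''vv'' 0 + nats s3 ''gg'' 0) s3)) \<and>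
        1 + (6 + t) + (?A * (st (Suc K) - st (min (nats s3 ''vv'' 0 + nats s3 ''gg'' 0) (Suc K))) +
          12 * (Suc K - (nats s3 ''vv'' 0 + nats s3 ''gg'' 0))) \<le>
        ?A * (st (Suc K) - st (min v (Suc K))) + 12 * (Suc K - v)) s2"
      by (rule runs_mono[OF main]) auto
    define inner where "inner = Cond (NLess (nsc ''tt'') (nsc ''ww'')) (node_com rapc) Skip"
    note seq = seq[folded inner_def s2_def]
    have nput2: "nput v i x (nput v i y s) = nput v i x s" for v i x y s by (simp add: nput_def)
    show ?case
    proof (cases "Suc K < v + g")
      case True
      then have w: "w = Suc K" by (simp add: w_def)
      then show ?thesis
        using True sc1 v_def[symmetric] w unfolding inner_def[symmetric]
        by (simp add: runs_simps nput2) (rule runs_mono[OF seq[unfolded s2_def w]], auto)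
    next
      case False
      then have w: "w = v + g" by (simp add: w_def)
      then show ?thesis
        using False sc1 v_def[symmetric] w unfolding inner_def[symmetric]
        by (simp add: runs_simps) (rule runs_mono[OF seq[unfolded s2_def w]], auto)
    qed
  next
    case (3 t s1)
    have K1: "nats s1 ''K1'' 0 = Suc K" using 3(1) sc by (simp add: Inv_def chg_def)
    have "ready g 1 s1" using 3(1,2) K1 g(1) by (auto simp: Inv_def ready_def)
    then show ?case using 3(1,3) by (intro post) (auto simp: Inv_def)
  qed
qed

lemma runs_levels_com:
  assumes base: "base s" and K1: "nats s ''K1'' 0 = Suc K" and rdy: "ready 0 1 s" and K: "1 \<le> K" "K \<le> 2 ^ J"
    and post: "\<And>t' s'. chg (level_nats \<union> {''hh'', ''gg''}) node_reals s s' \<Longrightarrow> good 1 (Suc K) s' \<Longrightarrow>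
      t' \<le> ((4 * C + 160) * vol + 12 * K + 6) * (J + 1) + 3 \<Longrightarrow> Q t' s'"
  shows "runs F (levels_com rapc) Q s"
proof -
  let ?NS = "level_nats \<union> {''hh'', ''gg''}" and ?M = "(4 * C + 160) * vol + 12 * K + 6"
  define Inv where "Inv j s' \<longleftrightarrow> chg ?NS node_reals s s' \<and> nats s' ''gg'' 0 = 2 ^ j \<and>
      nats s' ''hh'' 0 = (if j = 0 then 0 else 2 ^ (j - 1)) \<and> ready (nats s' ''hh'' 0) 1 s'" for j s'
  \<comment> \<open>The potential has to be a function of the state alone, so the number of the pass
    is read back from the power of two in \<open>gg\<close>.\<close>
  define idx where "idx s' = (SOME j. nats s' ''gg'' 0 = 2 ^ j)" for s' :: state
  have idx: "idx s' = j" if "nats s' ''gg'' 0 = 2 ^ j" for s' j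
    unfolding idx_def using that by (intro some_equality) auto
  have jJ: "j \<le> J" if "Inv j s'" "nats s' ''hh'' 0 < K" for j s'
  proof (cases j)
    case (Suc j')
    then have "nats s' ''hh'' 0 = 2 ^ j'" using that(1) by (simp add: Inv_def)
    then have "2 ^ j' < (2::nat) ^ J" using that(2) K(2) by (simp only: less_le_trans)
    then have "j' < J" by (simp add: power_strict_increasing_iff)
    then show ?thesis using Suc by simp
  qed simp
  define s1 where "s1 = nput ''gg'' 0 1 (nput ''hh'' 0 0 s)"
  have "Inv 0 s1"
    unfolding Inv_def s1_def using ready_same[OF rdy, of "nput ''gg'' 0 1 (nput ''hh'' 0 0 s)"]
    by (simp add: chg_def same_on_def)
  then have I1: "\<exists>j. Inv j s1" by blast
  have idx1: "idx s1 = 0" using \<open>Inv 0 s1\<close> by (intro idx) (simp add: Inv_def)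
  have "runs F (While (NLess (NPlus (nsc ''hh'') (NConst 1)) (nsc ''K1''))
       (level_com rapc ;; nset ''hh'' (nsc ''gg'') ;; nset ''gg'' (dbl (nsc ''gg''))))
      (\<lambda>t. Q (1 + (1 + t))) s1"
  proof (rule runs_While[where I = "\<lambda>s'. \<exists>j. Inv j s'" and \<Phi> = "\<lambda>s'. ?M * (J + 1 - idx s')"], goal_cases)
    case 1
    show ?case by (fact I1)
  next
    case (2 s2)
    then obtain j where I: "Inv j s2" by blast
    have c2: "chg ?NS node_reals s s2" using I by (simp add: Inv_def)
    have base2: "base s2" by (rule base_chg[OF base c2]) auto
    have K12: "nats s2 ''K1'' 0 = Suc K" using c2 K1 by (simp add: chg_def)
    let ?h = "nats s2 ''hh'' 0" and ?g = "nats s2 ''gg'' 0"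
    have hg: "(?h = 0 \<and> ?g = 1) \<or> (1 \<le> ?h \<and> ?g = 2 * ?h)"
      using I by (cases j) (auto simp: Inv_def)
    have "?h < K" using 2(2) K12 by simp
    then have jJ: "j \<le> J" by (rule jJ[OF I])
    have ij: "idx s2 = j" using I by (intro idx) (simp add: Inv_def)
    show ?case
      unfolding runs_Seq runs_NPut
    proof (rule runs_level_com[OF base2 hg refl refl K12 _ K(1)], goal_cases)
      case 1
      show ?case using I unfolding Inv_def by (elim conjE)
    next
      case (2 t s3)
      let ?s = "nput ''gg'' 0 (2 * ?g) (nput ''hh'' 0 ?g s3)"
      have g3: "nats s3 ''gg'' 0 = ?g" "?g = 2 ^ j" using 2(1) I by (simp_all add: chg_def Inv_def)
      have "ready ?g 1 ?s" by (rule ready_same[OF 2(2)]) (simp_all add: same_on_def)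
      moreover have "chg ?NS node_reals s ?s" using c2 2(1) by (simp add: chg_def)
      ultimately have IS: "Inv (Suc j) ?s" using g3 by (simp add: Inv_def)
      then have iS: "idx ?s = Suc j" by (intro idx) (simp add: Inv_def)
      have "?M * (J + 1 - Suc j) + ?M = ?M * (J + 1 - j)" using jJ by (simp add: Suc_diff_le)
      then show ?case using IS iS ij g3 2(3) by (auto simp: numeral_2_eq_2)
    qed
  next
    case (3 t s2)
    then obtain j where I: "Inv j s2" by blast
    have K12: "nats s2 ''K1'' 0 = Suc K" using I K1 by (simp add: Inv_def chg_def)
    then have h: "K \<le> nats s2 ''hh'' 0" using 3(2) by simp
    have "good 1 (Suc K) s2"
    proof -
      have "good 1 (min (1 + nats s2 ''hh'' 0) (Suc K)) s2"
        using I h K(1) unfolding Inv_def ready_def by auto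
      then show ?thesis using h by (simp add: min_def split: if_splits)
    qed
    then show ?case using I 3(3) idx1 by (intro post) (auto simp: Inv_def)
  qed
  then show ?thesis
    unfolding levels_com_def runs_Seq[of F "nset _ _"] runs_NPut by (simp add: s1_def)
qed

end

section \<open>Rounding, slack variables and counting sort by level\<close>

section \<open>Preprocessing\<close>

definition up_exp :: "vartype \<Rightarrow> rexp \<Rightarrow> rexp" where
  "up_exp \<gamma> e = (case \<gamma> of Continuous \<Rightarrow> e | Integral \<Rightarrow> ceil_exp e)"
definition dn_exp :: "vartype \<Rightarrow> rexp \<Rightarrow> rexp" where
  "dn_exp \<gamma> e = (case \<gamma> of Continuous \<Rightarrow> e | Integral \<Rightarrow> floor_exp e)"
definition rup :: "vartype \<Rightarrow> real \<Rightarrow> real" where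
  "rup \<gamma> r = (case \<gamma> of Continuous \<Rightarrow> r | Integral \<Rightarrow> of_int \<lceil>r\<rceil>)"
definition rdn :: "vartype \<Rightarrow> real \<Rightarrow> real" where
  "rdn \<gamma> r = (case \<gamma> of Continuous \<Rightarrow> r | Integral \<Rightarrow> of_int \<lfloor>r\<rfloor>)"

lemma rval_round [simp]:
  "rval (oracles f \<gamma>) (up_exp \<gamma> e) s = rup \<gamma> (rval (oracles f \<gamma>) e s)"
  "rval (oracles f \<gamma>) (dn_exp \<gamma> e) s = rdn \<gamma> (rval (oracles f \<gamma>) e s)"
  by (cases \<gamma>; simp add: up_exp_def dn_exp_def rup_def rdn_def ceil_exp_def floor_exp_def oracles_def ceiling_def)+

text \<open>An array in the middle of a loop that has processed the cells before \<open>k\<close>;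
  cell 0 keeps its old value.\<close>

definition seg :: "nat \<Rightarrow> (nat \<Rightarrow> 'a) \<Rightarrow> (nat \<Rightarrow> 'a) \<Rightarrow> nat \<Rightarrow> 'a" where
  "seg k h g i = (if 1 \<le> i \<and> i < k then h i else g i)"

lemma seg_simps: "seg (Suc 0) h g = g" "1 \<le> k \<Longrightarrow> seg (Suc k) h g = (seg k h g)(k := h k)" "seg k h g k = g k"
  by (auto simp: seg_def fun_eq_iff)

abbreviation at_j :: "string \<Rightarrow> rexp" where "at_j v \<equiv> RGet v (nsc ''j'')"
abbreviation rsquare :: "rexp \<Rightarrow> rexp" where "rsquare e \<equiv> RTimes e e"

text \<open>\<open>B\<close> collects squares instead of absolute values: sums of squares of
  integers are integers, so the slack bounds stay integral, and no case distinction is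
  needed.\<close>

definition round_com :: "vartype \<Rightarrow> string \<Rightarrow> string \<Rightarrow> nexp \<Rightarrow> com" where
  "round_com \<gamma> v w hi = For ''j'' (NConst 1) hi
     (RPut v (nsc ''j'') (up_exp \<gamma> (at_j v)) ;; RPut w (nsc ''j'') (dn_exp \<gamma> (at_j w)) ;;
      rset ''B'' (RPlus (rsc ''B'') (RPlus (RConst 1) (RPlus (rsquare (at_j v)) (rsquare (at_j w))))))"

lemma runs_round_com:
  assumes vw: "distinct [v, w, ''B'']" and "1 \<le> H" and hi: "\<And>s'. chg {''j''} {v, w, ''B''} s s' \<Longrightarrow> nval hi s' = H"
    and post: "\<And>t s'. chg {''j''} {v, w, ''B''} s s' \<Longrightarrow>
      reals s' v = seg H (rup \<gamma> \<circ> reals s v) (reals s v) \<Longrightarrow> reals s' w = seg H (rdn \<gamma> \<circ> reals s w) (reals s w) \<Longrightarrow>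
      reals s' ''B'' 0 = reals s ''B'' 0 + (\<Sum>j = 1..<H. 1 + ((rup \<gamma> (reals s v j))\<^sup>2 + (rdn \<gamma> (reals s w j))\<^sup>2)) \<Longrightarrow>
      t \<le> 5 * H \<Longrightarrow> Q t s'"
  shows "runs (oracles f \<gamma>) (round_com \<gamma> v w hi) Q s"
  unfolding round_com_def
proof (rule runs_For_const[where A = 1 and H = H and C = 3 and
      I = "\<lambda>k s'. chg {''j''} {v, w, ''B''} s s' \<and> 1 \<le> k \<and>
        reals s' v = seg k (rup \<gamma> \<circ> reals s v) (reals s v) \<and> reals s' w = seg k (rdn \<gamma> \<circ> reals s w) (reals s w) \<and>
        reals s' ''B'' 0 = reals s ''B'' 0 + (\<Sum>j = 1..<k. 1 + ((rup \<gamma> (reals s v j))\<^sup>2 + (rdn \<gamma> (reals s w j))\<^sup>2))"], goal_cases)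
  case (5 k s1)
  moreover have "v \<noteq> w" "w \<noteq> v" "v \<noteq> ''B''" "''B'' \<noteq> v" "w \<noteq> ''B''" "''B'' \<noteq> w" using vw by auto
  ultimately show ?case
    by (simp add: runs_simps chg_def seg_simps power2_eq_square)
next
  case (6 t s1)
  then show ?case by (intro post) auto
qed (use assms in \<open>auto simp: chg_def seg_simps\<close>)

abbreviation "position v \<equiv> RPlus (RDivide (at_j v) (at_j ''a'')) (at_j ''b'')"

definition reach_com :: com where
  "reach_com = For ''j'' (NConst 1) (NPlus (nsc ''n'') (NConst 1))
     (rset ''M'' (RPlus (rsc ''M'') (RPlus (RConst 1) (RPlus (rsquare (position ''l'')) (rsquare (position ''u''))))))"

lemma runs_reach_com:
  assumes "n = nats s ''n'' 0"
    and post: "\<And>t s'. chg {''j''} {''M''} s s' \<Longrightarrow>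
      reals s' ''M'' 0 = reals s ''M'' 0 + (\<Sum>j = 1..<Suc n. 1 + ((reals s ''l'' j / reals s ''a'' j + reals s ''b'' j)\<^sup>2 +
        (reals s ''u'' j / reals s ''a'' j + reals s ''b'' j)\<^sup>2)) \<Longrightarrow>
      t \<le> 3 * n + 2 \<Longrightarrow> Q t s'"
  shows "runs F reach_com Q s"
  unfolding reach_com_def
proof (rule runs_For_const[where A = 1 and H = "Suc n" and C = 1 and
      I = "\<lambda>k s'. chg {''j''} {''M''} s s' \<and> 1 \<le> k \<and>
        reals s' ''M'' 0 = reals s ''M'' 0 + (\<Sum>j = 1..<k. 1 + ((reals s ''l'' j / reals s ''a'' j + reals s ''b'' j)\<^sup>2 +
        (reals s ''u'' j / reals s ''a'' j + reals s ''b'' j)\<^sup>2))"], goal_cases)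
  case (5 k s1)
  then show ?case
    by (simp add: runs_simps chg_def power2_eq_square)
next
  case (6 t s1)
  then show ?case by (intro post) auto
qed (use assms in \<open>auto simp: chg_def\<close>)

text \<open>Cells \<open>n + 2 * k - 1\<close> and \<open>n + 2 * k\<close> belong to group
  \<open>k\<close>; as with \<open>seg\<close>, this is the array when the loop counter has reached
  \<open>k\<close>.\<close>

definition pairs :: "nat \<Rightarrow> nat \<Rightarrow> (nat \<Rightarrow> 'a) \<Rightarrow> (nat \<Rightarrow> 'a) \<Rightarrow> (nat \<Rightarrow> 'a) \<Rightarrow> nat \<Rightarrow> 'a" where
  "pairs n k h h' g i =
     (if n < i \<and> i < n + 2 * k - 1 then if odd (i - n) then h ((i - n + 1) div 2) else h' ((i - n) div 2) else g i)"

lemma pairs_simps: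
  "pairs n (Suc 0) h h' g = g"
  "1 \<le> k \<Longrightarrow> pairs n (Suc k) h h' g = (pairs n k h h' g)(n + k + k - Suc 0 := h k, n + k + k := h' k)"
proof -
  show "pairs n (Suc k) h h' g = (pairs n k h h' g)(n + k + k - Suc 0 := h k, n + k + k := h' k)" if k: "1 \<le> k"
  proof
    fix i
    consider "i = n + 2 * k" | "i = n + 2 * k - 1" | "i < n + 2 * k - 1" | "n + 2 * k < i" by linarith
    then show "pairs n (Suc k) h h' g i = ((pairs n k h h' g)(n + k + k - Suc 0 := h k, n + k + k := h' k)) i"
    proof cases
      case 2
      obtain k' where "k = Suc k'" using k by (cases k) auto
      then show ?thesis using 2 by (simp add: pairs_def)
    qed (use k in \<open>auto simp: pairs_def\<close>)
  qed
qed (auto simp: pairs_def fun_eq_iff)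

abbreviation "even_slot \<equiv> NPlus (NPlus (nsc ''n'') (nsc ''j'')) (nsc ''j'')"
abbreviation "odd_slot \<equiv> NMinus even_slot (NConst 1)"

text \<open>On the axis of \<open>f\<close> the first slack of a group begins at \<open>M\<close>
  and the second ends at \<open>- M\<close>, outside the positions of all original boxes. This is
  how both acquire extreme marginal costs without a separate penalty.\<close>

definition slack_com :: com where
  "slack_com = For ''j'' (NConst 1) (nsc ''K1'')
     (NPut ''level'' odd_slot (nsc ''j'') ;; RPut ''a'' odd_slot (RConst 1) ;; RPut ''b'' odd_slot (rsc ''M'') ;;
      RPut ''l'' odd_slot (RConst 0) ;; RPut ''u'' odd_slot (rsc ''B'') ;;
      NPut ''level'' even_slot (nsc ''j'') ;; RPut ''a'' even_slot (RConst 1) ;;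
      RPut ''b'' even_slot (RMinus (RConst 0) (rsc ''M'')) ;;
      RPut ''l'' even_slot (RMinus (RConst 0) (rsc ''B'')) ;; RPut ''u'' even_slot (RConst 0))"

abbreviation "slack_reals \<equiv> {''a'', ''b'', ''l'', ''u''}"

lemma runs_slack_com:
  assumes "n = nats s ''n'' 0" "M = reals s ''M'' 0" "B = reals s ''B'' 0" "nats s ''K1'' 0 = Suc K"
    and post: "\<And>t s'. chg {''j'', ''level''} slack_reals s s' \<Longrightarrow>
      nats s' ''level'' = pairs n (Suc K) id id (nats s ''level'') \<Longrightarrow>
      reals s' ''a'' = pairs n (Suc K) (\<lambda>_. 1) (\<lambda>_. 1) (reals s ''a'') \<Longrightarrow>
      reals s' ''b'' = pairs n (Suc K) (\<lambda>_. M) (\<lambda>_. - M) (reals s ''b'') \<Longrightarrow>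
      reals s' ''l'' = pairs n (Suc K) (\<lambda>_. 0) (\<lambda>_. - B) (reals s ''l'') \<Longrightarrow>
      reals s' ''u'' = pairs n (Suc K) (\<lambda>_. B) (\<lambda>_. 0) (reals s ''u'') \<Longrightarrow>
      t \<le> 12 * K + 2 \<Longrightarrow> Q t s'"
  shows "runs F slack_com Q s"
  unfolding slack_com_def
proof (rule runs_For_const[where A = 1 and H = "Suc K" and C = 10 and
      I = "\<lambda>k s'. chg {''j'', ''level''} slack_reals s s' \<and> 1 \<le> k \<and>
        nats s' ''level'' = pairs n k id id (nats s ''level'') \<and>
        reals s' ''a'' = pairs n k (\<lambda>_. 1) (\<lambda>_. 1) (reals s ''a'') \<and>
        reals s' ''b'' = pairs n k (\<lambda>_. M) (\<lambda>_. - M) (reals s ''b'') \<and>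
        reals s' ''l'' = pairs n k (\<lambda>_. 0) (\<lambda>_. - B) (reals s ''l'') \<and>
        reals s' ''u'' = pairs n k (\<lambda>_. B) (\<lambda>_. 0) (reals s ''u'')"], goal_cases)
  case (5 k s1)
  then have "nats s1 ''n'' 0 = n" "reals s1 ''M'' 0 = M" "reals s1 ''B'' 0 = B" using assms by (simp_all add: chg_def)
  then show ?case using 5
    by (simp add: runs_simps chg_def pairs_simps)
next
  case (6 t s1)
  then show ?case by (intro post) auto
qed (use assms in \<open>auto simp: chg_def pairs_simps\<close>)

text \<open>A counting sort: levels are small integers, so arranging the variables by group is
  linear. \<open>st\<close> keeps the group boundaries, while \<open>pt\<close> holds the moving
  insertion points.\<close>

definition sort_com :: com where
  "sort_com =
     For ''i'' (NConst 1) (nsc ''N1'')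
       (NPut ''cn'' (NGet ''level'' (nsc ''i'')) (NPlus (NGet ''cn'' (NGet ''level'' (nsc ''i''))) (NConst 1))) ;;
     NPut ''st'' (NConst 1) (NConst 0) ;;
     For ''j'' (NConst 1) (nsc ''K1'')
       (NPut ''st'' (NPlus (nsc ''j'') (NConst 1)) (NPlus (NGet ''st'' (nsc ''j'')) (NGet ''cn'' (nsc ''j''))) ;;
        NPut ''pt'' (nsc ''j'') (NGet ''st'' (nsc ''j''))) ;;
     For ''i'' (NConst 1) (nsc ''N1'')
       (NPut ''o'' (NGet ''pt'' (NGet ''level'' (nsc ''i''))) (nsc ''i'') ;;
        NPut ''pt'' (NGet ''level'' (nsc ''i'')) (NPlus (NGet ''pt'' (NGet ''level'' (nsc ''i''))) (NConst 1)))"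

context
  fixes lev :: "nat \<Rightarrow> nat" and N K :: nat
  assumes lev: "\<And>i. 1 \<le> i \<Longrightarrow> i \<le> N \<Longrightarrow> 1 \<le> lev i \<and> lev i \<le> K"
begin

definition before :: "nat \<Rightarrow> nat \<Rightarrow> nat" where "before i k = card {i'\<in>{1..<i}. lev i' = k}"
definition below :: "nat \<Rightarrow> nat" where "below k = card {i\<in>{1..<Suc N}. lev i < k}"
definition pos :: "nat \<Rightarrow> nat" where "pos i = below (lev i) + before i (lev i)"

lemma before_Suc: "1 \<le> i \<Longrightarrow> before (Suc i) = (before i)(lev i := Suc (before i (lev i)))"
proof
  fix k assume "1 \<le> i"
  then have "{i'\<in>{1..<Suc i}. lev i' = k} =
      (if lev i = k then insert i {i'\<in>{1..<i}. lev i' = k} else {i'\<in>{1..<i}. lev i' = k})"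
    by (auto simp: less_Suc_eq)
  then show "before (Suc i) k = ((before i)(lev i := Suc (before i (lev i)))) k"
    by (simp add: before_def)
qed

lemma below_1: "below (Suc 0) = 0"
proof -
  have "{i\<in>{1..<Suc N}. lev i < Suc 0} = {}" using lev by fastforce
  then show ?thesis by (simp only: below_def card.empty)
qed

lemma below_Suc: "below (Suc k) = below k + before (Suc N) k"
proof -
  have "{i\<in>{1..<Suc N}. lev i < Suc k} = {i\<in>{1..<Suc N}. lev i < k} \<union> {i\<in>{1..<Suc N}. lev i = k}" by auto
  then show ?thesis unfolding below_def before_def by (simp only:) (rule card_Un_disjoint, auto)
qed

lemma below_mono: "v \<le> w \<Longrightarrow> below v \<le> below w"
  unfolding below_def by (rule card_mono) (simp, blast intro: less_le_trans)

lemma before_mono: "1 \<le> i \<Longrightarrow> i < i' \<Longrightarrow> lev i = k \<Longrightarrow> before i k < before i' k"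
proof -
  assume *: "1 \<le> i" "i < i'" "lev i = k"
  then have "i \<in> {j\<in>{1..<i'}. lev j = k}" "i \<notin> {j\<in>{1..<i}. lev j = k}"
    "{j\<in>{1..<i}. lev j = k} \<subseteq> {j\<in>{1..<i'}. lev j = k}" by auto
  then show ?thesis unfolding before_def by (intro psubset_card_mono) (simp, blast)
qed

text \<open>Any range of groups occupies a contiguous range of the sorted order, which is what lets
  a node address its variables by two boundaries.\<close>

lemma pos_bij:
  assumes "v \<le> w"
  shows "bij_betw pos {i\<in>{1..N}. v \<le> lev i \<and> lev i < w} {below v..<below w}"
proof -
  let ?B = "{i\<in>{1..N}. v \<le> lev i \<and> lev i < w}"
  have in_block: "below (lev i) \<le> pos i" "pos i < below (Suc (lev i))" if "1 \<le> i" "i \<le> N" for i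
    using before_mono[of i "Suc N" "lev i"] that by (simp_all add: pos_def below_Suc)
  have inj: "inj_on pos ?B"
  proof (rule linorder_inj_onI)
    fix i j assume ij: "i < j" "i \<in> ?B" "j \<in> ?B"
    show "pos i \<noteq> pos j"
    proof (cases "lev i" "lev j" rule: linorder_cases)
      case less
      then show ?thesis using in_block[of i] in_block[of j] below_mono[of "Suc (lev i)" "lev j"] ij by auto
    next
      case equal
      then show ?thesis using before_mono[of i j "lev i"] ij by (simp add: pos_def)
    next
      case greater
      then show ?thesis using in_block[of i] in_block[of j] below_mono[of "Suc (lev j)" "lev i"] ij by auto
    qed
  qed auto
  have sub: "pos ` ?B \<subseteq> {below v..<below w}"
  proof (rule image_subsetI)
    fix i assume "i \<in> ?B"
    then show "pos i \<in> {below v..<below w}"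
      using in_block[of i] below_mono[of v "lev i"] below_mono[of "Suc (lev i)" w] by simp
  qed
  have "{i\<in>{1..<Suc N}. lev i < w} = {i\<in>{1..<Suc N}. lev i < v} \<union> ?B" using assms by (auto simp: less_Suc_eq_le)
  moreover have "card ({i\<in>{1..<Suc N}. lev i < v} \<union> ?B) = card {i\<in>{1..<Suc N}. lev i < v} + card ?B"
    by (rule card_Un_disjoint) (simp, simp, blast dest: leD)
  ultimately have "below w = below v + card ?B" by (simp only: below_def)
  then have "card (pos ` ?B) = card {below v..<below w}" using card_image[OF inj] by simp
  then have "pos ` ?B = {below v..<below w}" using sub by (intro card_subset_eq) auto
  then show ?thesis using inj by (simp add: bij_betw_def)
qed

lemma runs_sort_com:
  assumes s: "nats s ''level'' = lev" "nats s ''N1'' 0 = Suc N" "nats s ''K1'' 0 = Suc K" "nats s ''cn'' = (\<lambda>_. 0)"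
    and post: "\<And>t s'. chg {''cn'', ''st'', ''pt'', ''o'', ''i'', ''j''} {} s s' \<Longrightarrow>
      (\<And>k. 1 \<le> k \<Longrightarrow> k \<le> Suc K \<Longrightarrow> nats s' ''st'' k = below k) \<Longrightarrow>
      (\<And>v w. 1 \<le> v \<Longrightarrow> v \<le> w \<Longrightarrow> w \<le> Suc K \<Longrightarrow>
        nats s' ''o'' ` {below v..<below w} = {i\<in>{1..N}. v \<le> lev i \<and> lev i < w} \<and>
        inj_on (nats s' ''o'') {below v..<below w}) \<Longrightarrow>
      t \<le> 7 * N + 4 * K + 7 \<Longrightarrow> Q t s'"
  shows "runs F sort_com Q s"
  unfolding sort_com_def runs_Seq runs_NPut
proof (rule runs_For_const[where A = 1 and H = "Suc N" and C = 1 and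
      I = "\<lambda>k s'. chg {''cn'', ''i''} {} s s' \<and> nats s' ''cn'' = before k"], goal_cases)
  case 3
  have "before 1 = (\<lambda>_. 0)" by (rule ext) (simp add: before_def)
  then show ?case using s by (simp add: chg_def)
next
  case (5 k s1)
  then show ?case using s by (simp add: runs_simps chg_def before_Suc)
next
  case (6 t1 s1)
  show ?case
  proof (rule runs_For_const[where A = 1 and H = "Suc K" and C = 2 and
        I = "\<lambda>k s'. chg {''cn'', ''i'', ''j'', ''st'', ''pt''} {} s s' \<and> nats s' ''cn'' = before (Suc N) \<and>
          (\<forall>j. 1 \<le> j \<longrightarrow> j \<le> k \<longrightarrow> nats s' ''st'' j = below j) \<and> (\<forall>j. 1 \<le> j \<longrightarrow> j < k \<longrightarrow> nats s' ''pt'' j = below j)"],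
      goal_cases)
    case 3
    then show ?case using 6 by (auto simp: chg_def below_1)
  next
    case (5 k s2)
    then show ?case by (simp add: runs_simps chg_def below_Suc le_Suc_eq less_Suc_eq)
  next
    case (6 t2 s2)
    note s2 = 6
    show ?case
    proof (rule runs_For_const[where A = 1 and H = "Suc N" and C = 2 and
          I = "\<lambda>k s'. chg {''cn'', ''i'', ''j'', ''st'', ''pt'', ''o''} {} s s' \<and> k \<le> Suc N \<and>
            nats s' ''st'' = nats s2 ''st'' \<and>
            (\<forall>j. 1 \<le> j \<longrightarrow> j \<le> K \<longrightarrow> nats s' ''pt'' j = below j + before k j) \<and>
            (\<forall>i. 1 \<le> i \<longrightarrow> i < k \<longrightarrow> nats s' ''o'' (pos i) = i)"], goal_cases)
      case 3
      then show ?case using s2 by (auto simp: chg_def before_def)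
    next
      case (5 k s3)
      have k: "1 \<le> lev k" "lev k \<le> K" using lev[of k] 5 by auto
      have inj: "inj_on pos {i\<in>{1..N}. 0 \<le> lev i \<and> lev i < Suc K}" using pos_bij[of 0 "Suc K"] by (simp add: bij_betw_def)
      have "pos i \<noteq> pos k" if "1 \<le> i" "i < k" for i
      proof
        assume "pos i = pos k"
        then have "i = k" by (rule inj_onD[OF inj]) (use that 5(3,4) lev[of i] lev[of k] in auto)
        then show False using that by simp
      qed
      moreover have "nats s3 ''pt'' (lev k) = pos k" using 5(1) k by (simp add: pos_def)
      moreover have "k \<le> N" using 5(3) by simp
      ultimately show ?case using 5 k s
        by (simp add: runs_simps chg_def before_Suc less_Suc_eq[of _ k] pos_def[of k])
    next
      case (6 t3 s3)
      then have s3: "chg {''cn'', ''st'', ''pt'', ''o'', ''i'', ''j''} {} s s3" "nats s3 ''st'' = nats s2 ''st''"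
        "\<And>i. 1 \<le> i \<Longrightarrow> i \<le> N \<Longrightarrow> nats s3 ''o'' (pos i) = i"
        by (auto simp: insert_commute)
      show ?case
      proof (rule post[OF s3(1)], goal_cases)
        case (1 k)
        then show ?case using s3(2) s2(1) by auto
      next
        case (2 v w)
        let ?B = "{i\<in>{1..N}. v \<le> lev i \<and> lev i < w}"
        have pB: "{below v..<below w} = pos ` ?B" using pos_bij[OF 2(2)] by (simp add: bij_betw_def)
        have id: "nats s3 ''o'' (pos i) = i" if "i \<in> ?B" for i using s3(3) that by auto
        show ?case
          unfolding pB image_image using id by (auto intro!: inj_onI)
      next
        case 3
        then show ?case using 6(3) s2(3) \<open>t1 \<le> _\<close> by simp
      qed
    qed (use s2 s in \<open>simp_all add: chg_def\<close>)
  qed (use 6 s in \<open>simp_all add: chg_def\<close>)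
qed (use s in \<open>simp_all add: chg_def\<close>)

end

definition init_com :: com where
  "init_com = For ''i'' (NConst 1) (nsc ''N1'')
     (RPut ''UL'' (nsc ''i'') (at_i ''l'') ;; RPut ''UU'' (nsc ''i'') (at_i ''l'') ;;
      RPut ''LL'' (nsc ''i'') (at_i ''u'') ;; RPut ''LU'' (nsc ''i'') (at_i ''u''))"

lemma runs_init_com:
  assumes "nats s ''N1'' 0 = Suc N"
    and post: "\<And>t s'. chg {''i''} {''UL'', ''UU'', ''LL'', ''LU''} s s' \<Longrightarrow>
      (\<And>i. 1 \<le> i \<Longrightarrow> i \<le> N \<Longrightarrow> reals s' ''UL'' i = reals s ''l'' i \<and> reals s' ''UU'' i = reals s ''l'' i \<and>
        reals s' ''LL'' i = reals s ''u'' i \<and> reals s' ''LU'' i = reals s ''u'' i) \<Longrightarrow>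
      t \<le> 6 * N + 2 \<Longrightarrow> Q t s'"
  shows "runs F init_com Q s"
  unfolding init_com_def
proof (rule runs_For_const[where A = 1 and H = "Suc N" and C = 4 and
      I = "\<lambda>k s'. chg {''i''} {''UL'', ''UU'', ''LL'', ''LU''} s s' \<and>
        (\<forall>i. 1 \<le> i \<longrightarrow> i < k \<longrightarrow> reals s' ''UL'' i = reals s ''l'' i \<and> reals s' ''UU'' i = reals s ''l'' i \<and>
        reals s' ''LL'' i = reals s ''u'' i \<and> reals s' ''LU'' i = reals s ''u'' i)"], goal_cases)
  case (5 k s1)
  then show ?case by (simp add: runs_simps chg_def less_Suc_eq)
next
  case (6 t s1)
  then show ?case by (intro post) auto
qed (use assms in \<open>auto simp: chg_def\<close>)

definition output_com :: com where
  "output_com = For ''i'' (NConst 1) (NPlus (nsc ''n'') (NConst 1)) (RPut ''x'' (nsc ''i'') (at_i ''LL''))"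

lemma runs_output_com:
  assumes "nats s ''n'' 0 = n"
    and post: "\<And>t s'. (\<And>i. 1 \<le> i \<Longrightarrow> i \<le> n \<Longrightarrow> reals s' ''x'' i = reals s ''LL'' i) \<Longrightarrow> t \<le> 3 * n + 2 \<Longrightarrow> Q t s'"
  shows "runs F output_com Q s"
  unfolding output_com_def
proof (rule runs_For_const[where A = 1 and H = "Suc n" and C = 1 and
      I = "\<lambda>k s'. chg {''i''} {''x''} s s' \<and> (\<forall>i. 1 \<le> i \<longrightarrow> i < k \<longrightarrow> reals s' ''x'' i = reals s ''LL'' i)"], goal_cases)
  case (5 k s1)
  then show ?case by (simp add: runs_simps chg_def less_Suc_eq)
next
  case (6 t s1)
  then show ?case by (intro post) auto
qed (use assms in \<open>auto simp: chg_def\<close>)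

text \<open>The total \<open>R\<close> becomes one further nested constraint with equal bounds at
  index \<open>m + 1\<close>. \<open>K1\<close> and \<open>N1\<close> point one past the last group
  and the last padded variable.\<close>

definition nc_com :: "vartype \<Rightarrow> com" where
  "nc_com \<gamma> =
     nset ''K1'' (NPlus (nsc ''m'') (NConst 2)) ;;
     nset ''N1'' (NPlus (NPlus (nsc ''n'') (NPlus (nsc ''m'') (nsc ''m''))) (NConst 3)) ;;
     RPut ''L'' (NPlus (nsc ''m'') (NConst 1)) (rsc ''R'') ;; RPut ''U'' (NPlus (nsc ''m'') (NConst 1)) (rsc ''R'') ;;
     round_com \<gamma> ''L'' ''U'' (nsc ''K1'') ;; round_com \<gamma> ''l'' ''u'' (NPlus (nsc ''n'') (NConst 1)) ;;
     reach_com ;; slack_com ;; sort_com ;; init_com ;;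
     levels_com (case \<gamma> of Continuous \<Rightarrow> rap_cont_com | Integral \<Rightarrow> rap_int_com) ;; output_com"

section \<open>Consistency of the padding and return to the original problem\<close>

section \<open>The padded instance\<close>

definition admissible :: "vartype \<Rightarrow> real \<Rightarrow> bool" where "admissible \<gamma> r \<longleftrightarrow> (\<gamma> = Integral \<longrightarrow> r \<in> \<int>)"

lemma admissible_intros [simp]:
  "admissible \<gamma> (rup \<gamma> r)" "admissible \<gamma> (rdn \<gamma> r)" "admissible \<gamma> 0" "admissible \<gamma> 1"
  by (cases \<gamma>; simp add: admissible_def rup_def rdn_def)+

lemma admissible_arith:
  "admissible \<gamma> x \<Longrightarrow> admissible \<gamma> y \<Longrightarrow> admissible \<gamma> (x + y)"
  "admissible \<gamma> x \<Longrightarrow> admissible \<gamma> y \<Longrightarrow> admissible \<gamma> (x - y)"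
  "admissible \<gamma> x \<Longrightarrow> admissible \<gamma> (- x)" "admissible \<gamma> x \<Longrightarrow> admissible \<gamma> (x\<^sup>2)"
  "(\<And>i. i \<in> A \<Longrightarrow> admissible \<gamma> (g i)) \<Longrightarrow> admissible \<gamma> (sum g A)"
  unfolding admissible_def by (auto intro: Ints_sum)

text \<open>These two equivalences are why rounding the bounds discards no admissible point.\<close>

lemma rup_le_iff: "admissible \<gamma> y \<Longrightarrow> rup \<gamma> r \<le> y \<longleftrightarrow> r \<le> y"
  and le_rdn_iff: "admissible \<gamma> y \<Longrightarrow> y \<le> rdn \<gamma> r \<longleftrightarrow> y \<le> r"
  by (cases \<gamma>; auto simp: admissible_def rup_def rdn_def ceiling_le_iff le_floor_iff elim!: Ints_cases)+

lemma round_admissible: "admissible \<gamma> y \<Longrightarrow> rup \<gamma> y = y" "admissible \<gamma> y \<Longrightarrow> rdn \<gamma> y = y"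
  by (cases \<gamma>; auto simp: admissible_def rup_def rdn_def elim!: Ints_cases)+

lemma abs_le_squares: "\<bar>x\<bar> + \<bar>y\<bar> \<le> 1 + (x\<^sup>2 + y\<^sup>2)" for x y :: real
proof -
  have "0 \<le> (\<bar>x\<bar> - 1)\<^sup>2" "0 \<le> (\<bar>y\<bar> - 1)\<^sup>2" "0 \<le> x\<^sup>2" "0 \<le> y\<^sup>2" by simp_all
  moreover have "(\<bar>x\<bar> - 1)\<^sup>2 = x\<^sup>2 - 2 * \<bar>x\<bar> + 1" "(\<bar>y\<bar> - 1)\<^sup>2 = y\<^sup>2 - 2 * \<bar>y\<bar> + 1"
    by (simp_all add: power2_diff)
  ultimately show ?thesis by linarith
qed

locale nc_instance =
  fixes P :: nc_problem and \<gamma> :: vartype and z :: "nat \<Rightarrow> real"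
  assumes wf: "nc_wf P" and feas: "feasible \<gamma> P z"
begin

abbreviation "n \<equiv> num_vars P"
abbreviation "m \<equiv> num_nested P"
definition "K = Suc m"
definition "N = n + 2 * K"
definition "L0 = (restrict0 m (nested_lower P))(K := total P)"
definition "U0 = (restrict0 m (nested_upper P))(K := total P)"
definition "l0 = restrict0 n (var_lower P)"
definition "u0 = restrict0 n (var_upper P)"
definition "a0 = restrict0 n (weight P)"
definition "b0 = restrict0 n (shift P)"
definition "Lb = seg (Suc K) (rup \<gamma> \<circ> L0) L0"
definition "Ub = seg (Suc K) (rdn \<gamma> \<circ> U0) U0"
definition "l1 = seg (Suc n) (rup \<gamma> \<circ> l0) l0"
definition "u1 = seg (Suc n) (rdn \<gamma> \<circ> u0) u0"
definition "B = 0 + (\<Sum>j = 1..<Suc K. 1 + ((rup \<gamma> (L0 j))\<^sup>2 + (rdn \<gamma> (U0 j))\<^sup>2)) +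
  (\<Sum>j = 1..<Suc n. 1 + ((rup \<gamma> (l0 j))\<^sup>2 + (rdn \<gamma> (u0 j))\<^sup>2))"
definition "M = 0 + (\<Sum>j = 1..<Suc n. 1 + ((l1 j / a0 j + b0 j)\<^sup>2 + (u1 j / a0 j + b0 j)\<^sup>2))"
definition "lev = pairs n (Suc K) id id (restrict0 n (level P))"
definition "a = pairs n (Suc K) (\<lambda>_. 1) (\<lambda>_. 1) a0"
definition "b = pairs n (Suc K) (\<lambda>_. M) (\<lambda>_. - M) b0"
definition "lo = pairs n (Suc K) (\<lambda>_. 0) (\<lambda>_. - B) l1"
definition "up = pairs n (Suc K) (\<lambda>_. B) (\<lambda>_. 0) u1"
definition "I = {1..N}"
definition "psum x j = (\<Sum>i | i \<in> {1..n} \<and> level P i \<le> j. x i)" for x :: "nat \<Rightarrow> real"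

lemma nested_mono:
  assumes "1 \<le> j" "j \<le> j'" "j' \<le> m"
  shows "nested P j \<subseteq> nested P j'"
  using assms(2,1,3)
proof (induction j' rule: dec_induct)
  case (step j')
  then have "nested P j' \<subset> nested P (Suc j')" using wf by (simp add: nc_wf_def)
  then show ?case using step by auto
qed simp

lemma nested_sub: "1 \<le> j \<Longrightarrow> j \<le> m \<Longrightarrow> nested P j \<subseteq> {1..n}"
  using nested_mono[of j m] wf by (auto simp: nc_wf_def)

lemma level_range: "1 \<le> level P i \<and> level P i \<le> K"
proof -
  have "1 \<le> level P i \<and> (level P i \<le> m \<longrightarrow> i \<in> nested P (level P i))"
    unfolding level_def by (rule LeastI[of _ K]) (simp add: K_def)
  moreover have "level P i \<le> K" unfolding level_def by (rule Least_le) (simp add: K_def)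
  ultimately show ?thesis by simp
qed

lemma level_le_iff: "1 \<le> j \<Longrightarrow> j \<le> m \<Longrightarrow> level P i \<le> j \<longleftrightarrow> i \<in> nested P j"
proof
  assume j: "1 \<le> j" "j \<le> m"
  show "level P i \<le> j" if "i \<in> nested P j" unfolding level_def by (rule Least_le) (use j that in simp)
  assume le: "level P i \<le> j"
  have "1 \<le> level P i \<and> (level P i \<le> m \<longrightarrow> i \<in> nested P (level P i))"
    unfolding level_def by (rule LeastI[of _ K]) (simp add: K_def)
  then show "i \<in> nested P j" using nested_mono[of "level P i" j] le j by auto
qed

text \<open>Each strict inclusion adds an element; the first set may be empty, but the last is a
  proper subset of all variables, which makes up for it. Hence the \<open>2 * (m + 1)\<close> slacks
  enlarge the instance only by a constant factor.\<close>

lemma num_nested_le: "m \<le> n"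
proof -
  have "j \<le> Suc (card (nested P j))" if "1 \<le> j" "j \<le> m" for j
    using that
  proof (induction j rule: dec_induct)
    case (step j)
    then have "nested P j \<subset> nested P (Suc j)" using wf by (simp add: nc_wf_def)
    moreover have "finite (nested P (Suc j))" using nested_sub[of "Suc j"] step by (auto intro: finite_subset)
    ultimately have "card (nested P j) < card (nested P (Suc j))" by (intro psubset_card_mono)
    then show ?case using step by simp
  qed simp
  then have "m \<le> Suc (card (nested P m))" using wf by (simp add: nc_wf_def)
  moreover have "card (nested P m) < card {1..n}" using wf by (intro psubset_card_mono) (auto simp: nc_wf_def)
  ultimately show ?thesis by simp
qed

lemma psum_nested: "1 \<le> j \<Longrightarrow> j \<le> m \<Longrightarrow> psum x j = sum x (nested P j)"
  unfolding psum_def using level_le_iff[of j] nested_sub[of j] by (intro sum.cong) auto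

lemma psum_all: "psum x K = sum x {1..n}"
  unfolding psum_def using level_range by (intro sum.cong) auto

lemma admissible_total: "admissible \<gamma> (total P)"
proof -
  have "admissible \<gamma> (sum z {1..n})" using feas by (intro admissible_arith) (auto simp: feasible_def admissible_def)
  then show ?thesis using feas by (simp add: feasible_def)
qed

lemma Lb_Ub: "Lb 0 = 0" "Ub 0 = 0" "Lb K = total P" "Ub K = total P"
  using round_admissible[OF admissible_total] by (simp_all add: Lb_def Ub_def L0_def U0_def seg_def restrict0_def K_def)

text \<open>Sums of admissible values are admissible, so the nested bounds may be rounded like those
  of the variables; the condition on the total is the case \<open>j = K\<close>.\<close>

lemma feasible_iff:
  "feasible \<gamma> P x \<longleftrightarrow> (\<forall>i\<in>{1..n}. admissible \<gamma> (x i) \<and> l1 i \<le> x i \<and> x i \<le> u1 i) \<and>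
     (\<forall>j\<in>{1..K}. Lb j \<le> psum x j \<and> psum x j \<le> Ub j)"
proof (cases "\<forall>i\<in>{1..n}. admissible \<gamma> (x i)")
  case True
  have 1: "admissible \<gamma> (psum x j)" for j unfolding psum_def using True by (intro admissible_arith) auto
  have 2: "l1 i \<le> x i \<and> x i \<le> u1 i \<longleftrightarrow> var_lower P i \<le> x i \<and> x i \<le> var_upper P i" if "i \<in> {1..n}" for i
    using that True rup_le_iff[of \<gamma> "x i"] le_rdn_iff[of \<gamma> "x i"] by (simp add: l1_def u1_def seg_def l0_def u0_def restrict0_def)
  have 3: "Lb j \<le> psum x j \<and> psum x j \<le> Ub j \<longleftrightarrow> nested_lower P j \<le> sum x (nested P j) \<and> sum x (nested P j) \<le> nested_upper P j"
    if "j \<in> {1..m}" for j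
    using that rup_le_iff[OF 1[of j]] le_rdn_iff[OF 1[of j]] psum_nested[of j x]
    by (simp add: Lb_def Ub_def seg_def L0_def U0_def restrict0_def K_def)
  have "{1..K} = insert K {1..m}" by (auto simp: K_def)
  then have "(\<forall>j\<in>{1..K}. Lb j \<le> psum x j \<and> psum x j \<le> Ub j) \<longleftrightarrow> sum x {1..n} = total P \<and>
      (\<forall>j\<in>{1..m}. nested_lower P j \<le> sum x (nested P j) \<and> sum x (nested P j) \<le> nested_upper P j)"
    using 3 Lb_Ub(3,4) psum_all[of x] by auto
  then show ?thesis using 2 True by (auto simp: feasible_def admissible_def)
qed (auto simp: feasible_def admissible_def)

lemma in_I:
  assumes "i \<in> I"
  obtains "i \<in> {1..n}" "lev i = level P i" "a i = weight P i" "b i = shift P i" "lo i = l1 i" "up i = u1 i"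
  | k where "1 \<le> k" "k \<le> K" "i = n + 2 * k - 1" "n < i" "lev i = k" "a i = 1" "b i = M" "lo i = 0" "up i = B"
  | k where "1 \<le> k" "k \<le> K" "i = n + 2 * k" "n < i" "lev i = k" "a i = 1" "b i = - M" "lo i = - B" "up i = 0"
proof (cases "i \<le> n")
  case True
  then show ?thesis using assms that(1)
    by (simp add: I_def lev_def a_def b_def lo_def up_def pairs_def restrict0_def a0_def b0_def)
next
  case False
  define j where "j = i - n"
  have j: "i = n + j" "1 \<le> j" "j \<le> 2 * K" using assms False by (simp_all add: j_def I_def N_def)
  have rng: "n < i" "i < n + 2 * Suc K - 1" using j by simp_all
  have ij: "i - n = j" using j by simp
  note defs = lev_def a_def b_def lo_def up_def pairs_def ij rng simp_thms if_True id_apply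
  show ?thesis
  proof (cases "odd j")
    case True
    then obtain k where k: "j = 2 * k + 1" by (elim oddE)
    show ?thesis
      by (rule that(2)[of "Suc k"]) (use True j k rng in \<open>simp_all add: defs\<close>)
  next
    case False
    then obtain k where k: "j = 2 * k" by (auto elim!: evenE)
    show ?thesis
      by (rule that(3)[of k]) (use False j k rng in \<open>simp_all add: defs\<close>)
  qed
qed

lemma orig: "i \<in> {1..n} \<Longrightarrow> i \<in> I \<and> lev i = level P i \<and> a i = weight P i \<and> b i = shift P i \<and> lo i = l1 i \<and> up i = u1 i"
proof -
  assume i: "i \<in> {1..n}"
  then have I: "i \<in> I" by (simp add: I_def N_def)
  then show ?thesis by (cases rule: in_I) (use i I in auto)
qed

text \<open>\<open>B\<close> dominates at once all box ends of a group and the resource levels on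
  both sides of it, so one slack alone can make up for whatever the group lacks.\<close>

lemma B_bounds:
  assumes "G \<subseteq> {1..n}" "j \<le> K" "j' \<le> K"
  shows "(\<Sum>i\<in>G. \<bar>l1 i\<bar> + \<bar>u1 i\<bar>) + \<bar>Lb j\<bar> + \<bar>Ub j'\<bar> \<le> B"
proof -
  have "(\<Sum>i\<in>G. \<bar>l1 i\<bar> + \<bar>u1 i\<bar>) \<le> (\<Sum>i\<in>{1..<Suc n}. \<bar>l1 i\<bar> + \<bar>u1 i\<bar>)"
    using assms(1) by (intro sum_mono2) auto
  also have "\<dots> \<le> (\<Sum>i = 1..<Suc n. 1 + ((rup \<gamma> (l0 i))\<^sup>2 + (rdn \<gamma> (u0 i))\<^sup>2))"
  proof (rule sum_mono)
    fix i assume "i \<in> {1..<Suc n}"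
    then have "l1 i = rup \<gamma> (l0 i)" "u1 i = rdn \<gamma> (u0 i)" by (simp_all add: l1_def u1_def seg_def)
    then show "\<bar>l1 i\<bar> + \<bar>u1 i\<bar> \<le> 1 + ((rup \<gamma> (l0 i))\<^sup>2 + (rdn \<gamma> (u0 i))\<^sup>2)" by (simp only: abs_le_squares)
  qed
  finally have 1: "(\<Sum>i\<in>G. \<bar>l1 i\<bar> + \<bar>u1 i\<bar>) \<le> (\<Sum>i = 1..<Suc n. 1 + ((rup \<gamma> (l0 i))\<^sup>2 + (rdn \<gamma> (u0 i))\<^sup>2))" .
  have mem: "\<bar>g j\<bar> \<le> (\<Sum>i\<in>{1..<Suc K}. \<bar>g i\<bar>)" if "g 0 = 0" "j \<le> K" for g :: "nat \<Rightarrow> real" and j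
  proof (cases "j = 0")
    case True
    then show ?thesis using that by (simp add: sum_nonneg del: sum.op_ivl_Suc)
  next
    case False
    then show ?thesis using that by (intro member_le_sum) auto
  qed
  have "\<bar>Lb j\<bar> + \<bar>Ub j'\<bar> \<le> (\<Sum>i\<in>{1..<Suc K}. \<bar>Lb i\<bar>) + (\<Sum>i\<in>{1..<Suc K}. \<bar>Ub i\<bar>)"
    using mem[of Lb j, OF Lb_Ub(1) assms(2)] mem[of Ub j', OF Lb_Ub(2) assms(3)] by (rule add_mono)
  also have "\<dots> = (\<Sum>i\<in>{1..<Suc K}. \<bar>Lb i\<bar> + \<bar>Ub i\<bar>)" by (rule sum.distrib[symmetric])
  also have "\<dots> \<le> (\<Sum>i = 1..<Suc K. 1 + ((rup \<gamma> (L0 i))\<^sup>2 + (rdn \<gamma> (U0 i))\<^sup>2))"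
  proof (rule sum_mono)
    fix i assume "i \<in> {1..<Suc K}"
    then have "Lb i = rup \<gamma> (L0 i)" "Ub i = rdn \<gamma> (U0 i)" by (simp_all add: Lb_def Ub_def seg_def)
    then show "\<bar>Lb i\<bar> + \<bar>Ub i\<bar> \<le> 1 + ((rup \<gamma> (L0 i))\<^sup>2 + (rdn \<gamma> (U0 i))\<^sup>2)" by (simp only: abs_le_squares)
  qed
  finally show ?thesis using 1 unfolding B_def by linarith
qed

lemma B_nonneg: "0 \<le> B"
  using B_bounds[of "{}" 0 0] by (simp add: Lb_Ub)

lemma M_bounds:
  assumes "i \<in> {1..n}"
  shows "- M \<le> l1 i / weight P i + shift P i" "u1 i / weight P i + shift P i \<le> M" "0 \<le> M"
proof -
  let ?p = "\<lambda>j. (l1 j / a0 j + b0 j)\<^sup>2 + (u1 j / a0 j + b0 j)\<^sup>2"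
  have "\<bar>l1 i / a0 i + b0 i\<bar> + \<bar>u1 i / a0 i + b0 i\<bar> \<le> 1 + ?p i" by (rule abs_le_squares)
  also have "\<dots> \<le> M" unfolding M_def add_0 using assms by (intro member_le_sum) auto
  finally have "\<bar>l1 i / weight P i + shift P i\<bar> + \<bar>u1 i / weight P i + shift P i\<bar> \<le> M"
    using assms by (simp add: a0_def b0_def restrict0_def)
  then show "- M \<le> l1 i / weight P i + shift P i" "u1 i / weight P i + shift P i \<le> M" "0 \<le> M" by linarith+
qed

lemma admissible_B: "admissible \<gamma> B"
  unfolding B_def by (intro admissible_arith) simp_all

text \<open>The rounded nested bounds are in order because the prefix sums of the feasible point lie
  between them; feasibility is used here, as it is in \<open>box\<close> for the variables.\<close>

lemma admissible_bounds: "j \<le> K \<Longrightarrow> admissible \<gamma> (Lb j) \<and> admissible \<gamma> (Ub j) \<and> Lb j \<le> Ub j"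
proof (cases "j = 0")
  case False
  assume "j \<le> K"
  then have "Lb j = rup \<gamma> (L0 j)" "Ub j = rdn \<gamma> (U0 j)" using False by (simp_all add: Lb_def Ub_def seg_def)
  moreover have "Lb j \<le> psum z j" "psum z j \<le> Ub j" using feas False \<open>j \<le> K\<close> by (auto simp: feasible_iff)
  ultimately show ?thesis by simp
qed (simp add: Lb_Ub)

lemma box:
  assumes "i \<in> I"
  shows "0 < a i" "admissible \<gamma> (lo i)" "admissible \<gamma> (up i)" "lo i \<le> up i"
proof -
  have "i \<in> {1..n} \<Longrightarrow> l1 i \<le> z i \<and> z i \<le> u1 i \<and> 0 < weight P i \<and> admissible \<gamma> (l1 i) \<and> admissible \<gamma> (u1 i)"
    using feas wf by (auto simp: feasible_iff nc_wf_def l1_def u1_def seg_def)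
  with assms show "0 < a i" "admissible \<gamma> (lo i)" "admissible \<gamma> (up i)" "lo i \<le> up i"
    by (cases rule: in_I; force simp: admissible_B admissible_arith B_nonneg)+
qed

lemma lev_range: "i \<in> I \<Longrightarrow> 1 \<le> lev i \<and> lev i \<le> K"
  by (cases i rule: in_I) (use level_range in auto)

lemma slots:
  assumes "1 \<le> k" "k \<le> K"
  shows "{i\<in>I. lev i = k} = {i\<in>{1..n}. level P i = k} \<union> {n + 2 * k - 1, n + 2 * k}" (is "_ = ?G \<union> ?S")
    and "lo (n + 2 * k - 1) = 0" "lo (n + 2 * k) = - B" "up (n + 2 * k - 1) = B" "up (n + 2 * k) = 0"
proof -
  have mem: "n + 2 * k - 1 \<in> I" "n + 2 * k \<in> I" using assms unfolding I_def N_def atLeastAtMost_iff by linarith+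
  have l: "lev (n + 2 * k - 1) = k \<and> lo (n + 2 * k - 1) = 0 \<and> up (n + 2 * k - 1) = B"
    using mem(1)
  proof (cases rule: in_I)
    case (2 k')
    then have "k' = k" using assms(1) by linarith
    then show ?thesis using 2 by simp
  next
    case (3 k')
    then have False using assms(1) by presburger
    then show ?thesis ..
  next
    case 1
    then have False using assms(1) unfolding atLeastAtMost_iff by linarith
    then show ?thesis ..
  qed
  have r: "lev (n + 2 * k) = k \<and> lo (n + 2 * k) = - B \<and> up (n + 2 * k) = 0"
    using mem(2)
  proof (cases rule: in_I)
    case (2 k')
    then have False using assms(1) by presburger
    then show ?thesis ..
  qed (use assms(1) in auto)
  show "lo (n + 2 * k - 1) = 0" "lo (n + 2 * k) = - B" "up (n + 2 * k - 1) = B" "up (n + 2 * k) = 0"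
    using l r by simp_all
  have "i \<in> ?G \<union> ?S" if "i \<in> I" "lev i = k" for i
    using that by (cases rule: in_I) auto
  moreover have "lev i = k" "i \<in> I" if "i \<in> ?G" for i
  proof -
    show "i \<in> I" using that by (auto simp: I_def N_def)
    then show "lev i = k" by (cases rule: in_I) (use that in auto)
  qed
  ultimately show "{i\<in>I. lev i = k} = ?G \<union> ?S" using l r mem by blast
qed

lemma leaf_bounds:
  assumes "1 \<le> k" "k \<le> K"
  shows "sum lo {i\<in>I. lev i = k} \<le> Lb k - Ub (k - 1)" "Ub k - Lb (k - 1) \<le> sum up {i\<in>I. lev i = k}"
proof -
  let ?G = "{i\<in>{1..n}. level P i = k}"
  have split: "sum h {i\<in>I. lev i = k} = sum h ?G + h (n + 2 * k - 1) + h (n + 2 * k)" for h :: "nat \<Rightarrow> real"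
    unfolding slots(1)[OF assms] by (subst sum.union_disjoint) (use assms(1) in auto)
  have G: "lo i = l1 i" "up i = u1 i" if "i \<in> ?G" for i
  proof -
    have "i \<in> I" using that by (simp add: I_def N_def)
    then show "lo i = l1 i" "up i = u1 i" by (cases rule: in_I; use that in auto)+
  qed
  have sub: "?G \<subseteq> {1..n}" by auto
  have "sum lo ?G \<le> (\<Sum>i\<in>?G. \<bar>l1 i\<bar> + \<bar>u1 i\<bar>)" using G by (intro sum_mono) auto
  moreover have "- (\<Sum>i\<in>?G. \<bar>l1 i\<bar> + \<bar>u1 i\<bar>) \<le> sum up ?G"
    unfolding sum_negf[symmetric] using G by (intro sum_mono) auto
  ultimately show "sum lo {i\<in>I. lev i = k} \<le> Lb k - Ub (k - 1)" "Ub k - Lb (k - 1) \<le> sum up {i\<in>I. lev i = k}"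
    unfolding split slots(2-5)[OF assms]
    using B_bounds[OF sub, of k "k - 1"] B_bounds[OF sub, of "k - 1" k] assms by linarith+
qed

end

text \<open>What the reduction needs of a response function. The assumption \<open>sg\<close> says
  that \<open>\<xi> i \<kappa>\<close> minimizes, over the admissible points of its box, the cost of
  \<open>i\<close> minus \<open>sg \<kappa>\<close> times its value. The last three say that an
  active slack saturates all original variables and that the two kinds of slack are never active
  together.\<close>

locale nc_reduction = nc_instance P \<gamma> z for P \<gamma> z +
  fixes f :: "real \<Rightarrow> real" and \<xi> :: "nat \<Rightarrow> 'k::linorder \<Rightarrow> real" and sg :: "'k \<Rightarrow> real"
  assumes xi_mono: "\<And>i \<kappa> \<kappa>'. i \<in> I \<Longrightarrow> \<kappa> \<le> \<kappa>' \<Longrightarrow> \<xi> i \<kappa> \<le> \<xi> i \<kappa>'"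
    and xi_range: "\<And>i \<kappa>. i \<in> I \<Longrightarrow> lo i \<le> \<xi> i \<kappa> \<and> \<xi> i \<kappa> \<le> up i"
    and sg_mono: "\<And>\<kappa> \<kappa>'. \<kappa> \<le> \<kappa>' \<Longrightarrow> sg \<kappa> \<le> sg \<kappa>'"
    and sg: "\<And>i \<kappa> y. i \<in> I \<Longrightarrow> admissible \<gamma> y \<Longrightarrow> lo i \<le> y \<Longrightarrow> y \<le> up i \<Longrightarrow>
      a i * f (\<xi> i \<kappa> / a i + b i) + sg \<kappa> * (y - \<xi> i \<kappa>) \<le> a i * f (y / a i + b i)"
    and odd_slack: "\<And>i j \<theta>. i \<in> I \<Longrightarrow> j \<in> {1..n} \<Longrightarrow> a i = 1 \<Longrightarrow> b i = M \<Longrightarrow> lo i = 0 \<Longrightarrow> 0 < \<xi> i \<theta> \<Longrightarrow> \<xi> j \<theta> = up j"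
    and even_slack: "\<And>i j \<theta>. i \<in> I \<Longrightarrow> j \<in> {1..n} \<Longrightarrow> a i = 1 \<Longrightarrow> b i = - M \<Longrightarrow> up i = 0 \<Longrightarrow> \<xi> i \<theta> < 0 \<Longrightarrow> \<xi> j \<theta> = lo j"
    and slack_order: "\<And>i j \<theta>. i \<in> I \<Longrightarrow> j \<in> I \<Longrightarrow> a i = 1 \<Longrightarrow> b i = M \<Longrightarrow> lo i = 0 \<Longrightarrow> 
      a j = 1 \<Longrightarrow> b j = - M \<Longrightarrow> up j = 0 \<Longrightarrow> \<xi> i \<theta> = 0 \<or> \<xi> j \<theta> = 0"
begin

sublocale nested_groups I lev \<xi> Lb Ub
  by unfold_locales (auto simp: I_def xi_mono)

lemma sum_original:
  assumes "\<And>i. i \<in> I \<Longrightarrow> n < i \<Longrightarrow> x i = 0"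
  shows "sum (gs x) {1..<Suc j} = psum x j"
proof -
  have "sum (gs x) {1..<Suc j} = sum x {i\<in>I. 1 \<le> lev i \<and> lev i < Suc j}" by (rule sum_gs) simp
  also have "\<dots> = psum x j"
    unfolding psum_def
  proof (rule sum.mono_neutral_right)
    show "{i \<in> {1..n}. level P i \<le> j} \<subseteq> {i \<in> I. 1 \<le> lev i \<and> lev i < Suc j}"
      using orig level_range by force
    show "\<forall>i\<in>{i \<in> I. 1 \<le> lev i \<and> lev i < Suc j} - {i \<in> {1..n}. level P i \<le> j}. x i = 0"
    proof
      fix i assume i: "i \<in> {i \<in> I. 1 \<le> lev i \<and> lev i < Suc j} - {i \<in> {1..n}. level P i \<le> j}"
      have "n < i"
      proof (rule ccontr)
        assume "\<not> n < i"
        then have "i \<in> {1..n}" using i by (simp add: I_def)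
        then show False using orig[of i] i by auto
      qed
      then show "x i = 0" using assms i by simp
    qed
  qed (simp add: fin)
  finally show ?thesis .
qed

lemma sol_gives_optimal:
  assumes S: "sol 1 (Suc K) 0 (total P) lam x" and adm: "\<And>i. i \<in> I \<Longrightarrow> admissible \<gamma> (x i)"
  shows "optimal f \<gamma> P x"
proof -
  define pad where "pad y i = (if i \<in> {1..n} then y i else 0)" for y :: "nat \<Rightarrow> real" and i
  have pad_sum: "sum (gs (pad y)) {1..<Suc j} = psum y j" for y j
  proof -
    have "sum (gs (pad y)) {1..<Suc j} = psum (pad y) j" by (rule sum_original) (simp add: pad_def)
    also have "\<dots> = psum y j" by (simp add: psum_def pad_def)
    finally show ?thesis .
  qed
  have feas_sum: "0 + sum (gs (pad y)) {1..<Suc K} = total P"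
    "\<And>k. 1 \<le> k \<Longrightarrow> Suc k < Suc K \<Longrightarrow> Lb k \<le> 0 + sum (gs (pad y)) {1..<Suc k} \<and> 0 + sum (gs (pad y)) {1..<Suc k} \<le> Ub k"
    if "feasible \<gamma> P y" for y
  proof -
    show "0 + sum (gs (pad y)) {1..<Suc K} = total P"
      unfolding pad_sum using that by (simp add: psum_all feasible_def)
    show "Lb k \<le> 0 + sum (gs (pad y)) {1..<Suc k} \<and> 0 + sum (gs (pad y)) {1..<Suc k} \<le> Ub k"
      if "1 \<le> k" "Suc k < Suc K" for k
      unfolding pad_sum using \<open>feasible \<gamma> P y\<close> that by (simp add: feasible_iff)
  qed
  have x: "x i = \<xi> i (lam (lev i))" if "i \<in> I" for i
    using that S lev_range[OF that] by (simp add: sol_def grp_def)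
  have slack: "x i = 0" if i: "i \<in> I" "n < i" for i
  proof (rule ccontr)
    assume ne: "x i \<noteq> 0"
    let ?\<theta> = "lam (lev i)"
    have padz: "lo j \<le> pad z j \<and> pad z j \<le> up j" if "j \<in> {1..n}" for j
      using that feas orig[OF that] by (simp add: pad_def feasible_iff)
    \<comment> \<open>An active odd slack means that its multiplier and all larger ones hold the
      original variables at their upper bounds and the even slacks at zero, so all responses
      dominate \<open>pad z\<close>. An active even slack is the mirror image.\<close>
    have "(\<forall>\<kappa> \<ge> ?\<theta>. \<forall>j\<in>I. pad z j \<le> \<xi> j \<kappa>) \<or> (\<forall>\<kappa> \<le> ?\<theta>. \<forall>j\<in>I. \<xi> j \<kappa> \<le> pad z j)"
      using i(1)
    proof (cases rule: in_I)
      case (2 k)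
      then have pos: "0 < \<xi> i ?\<theta>" using ne x[OF i(1)] xi_range[OF i(1), of ?\<theta>] by simp
      have "pad z j \<le> \<xi> j \<kappa>" if "?\<theta> \<le> \<kappa>" "j \<in> I" for j \<kappa>
      proof -
        have pos': "0 < \<xi> i \<kappa>" using pos xi_mono[OF i(1) that(1)] by simp
        show ?thesis using that(2)
        proof (cases rule: in_I)
          case 1
          then show ?thesis using odd_slack[OF i(1), of j \<kappa>] 2 pos' padz[of j] by simp
        next
          case (2 k')
          then show ?thesis using xi_range[OF that(2), of \<kappa>] by (simp add: pad_def)
        next
          case (3 k')
          then show ?thesis using slack_order[OF i(1) that(2), of \<kappa>] 2 pos' by (simp add: pad_def)
        qed
      qed
      then show ?thesis by blast
    next
      case (3 k)
      then have neg: "\<xi> i ?\<theta> < 0" using ne x[OF i(1)] xi_range[OF i(1), of ?\<theta>] by simp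
      have "\<xi> j \<kappa> \<le> pad z j" if "\<kappa> \<le> ?\<theta>" "j \<in> I" for j \<kappa>
      proof -
        have neg': "\<xi> i \<kappa> < 0" using neg xi_mono[OF i(1) that(1)] by simp
        show ?thesis using that(2)
        proof (cases rule: in_I)
          case 1
          then show ?thesis using even_slack[OF i(1), of j \<kappa>] 3 neg' padz[of j] by simp
        next
          case (2 k')
          then show ?thesis using slack_order[OF that(2) i(1), of \<kappa>] 3 neg' by (simp add: pad_def)
        next
          case (3 k')
          then show ?thesis using xi_range[OF that(2), of \<kappa>] by (simp add: pad_def)
        qed
      qed
      then show ?thesis by blast
    qed (use i in simp)
    then have "x i = pad z i"
    proof
      assume "\<forall>\<kappa> \<ge> ?\<theta>. \<forall>j\<in>I. pad z j \<le> \<xi> j \<kappa>"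
      then show ?thesis
      proof (rule sol_bounded_by_feasible(1)[OF S, rotated -1])
        show "0 + sum (gs (pad z)) {1..<Suc K} = total P" by (rule feas_sum(1)[OF feas])
        show "Lb k \<le> 0 + sum (gs (pad z)) {1..<Suc k} \<and> 0 + sum (gs (pad z)) {1..<Suc k} \<le> Ub k"
          if "1 \<le> k" "Suc k < Suc K" for k
          by (rule feas_sum(2)[OF feas that])
      qed (use i lev_range[OF i(1)] in auto)
    next
      assume "\<forall>\<kappa> \<le> ?\<theta>. \<forall>j\<in>I. \<xi> j \<kappa> \<le> pad z j"
      then show ?thesis
      proof (rule sol_bounded_by_feasible(2)[OF S, rotated -1])
        show "0 + sum (gs (pad z)) {1..<Suc K} = total P" by (rule feas_sum(1)[OF feas])
        show "Lb k \<le> 0 + sum (gs (pad z)) {1..<Suc k} \<and> 0 + sum (gs (pad z)) {1..<Suc k} \<le> Ub k"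
          if "1 \<le> k" "Suc k < Suc K" for k
          by (rule feas_sum(2)[OF feas that])
      qed (use i lev_range[OF i(1)] in auto)
    qed
    then show False using ne i by (simp add: pad_def)
  qed
  have x_sum: "sum (gs x) {1..<Suc j} = psum x j" for j
    by (rule sum_original) (rule slack)
  have "feasible \<gamma> P x"
    unfolding feasible_iff
  proof (intro conjI ballI)
    fix i assume i: "i \<in> {1..n}"
    show "admissible \<gamma> (x i)" "l1 i \<le> x i" "x i \<le> u1 i"
      using orig[OF i] adm[of i] x[of i] xi_range[of i] by auto
  next
    fix j assume j: "j \<in> {1..K}"
    have "Lb j \<le> psum x j \<and> psum x j \<le> Ub j"
    proof (cases "j = K")
      case True
      have "sum (gs x) {1..<Suc K} = total P" using S by (simp add: sol_def del: sum.op_ivl_Suc)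
      then show ?thesis using True x_sum[of K] by (simp add: Lb_Ub del: sum.op_ivl_Suc)
    next
      case False
      then have "1 \<le> j" "Suc j < Suc K" using j by auto
      then have "Lb j \<le> 0 + sum (gs x) {1..<Suc j} \<and> 0 + sum (gs x) {1..<Suc j} \<le> Ub j"
        using S unfolding sol_def by blast
      then show ?thesis unfolding x_sum add_0 .
    qed
    then show "Lb j \<le> psum x j" "psum x j \<le> Ub j" by auto
  qed
  moreover have "objective f P x \<le> objective f P y" if y: "feasible \<gamma> P y" for y
  proof -
    \<comment> \<open>Each group has a single multiplier, so the sum over groups supplied by
      \<open>sol_optimal\<close> becomes a sum over variables, from which the slacks drop
      out.\<close>
    let ?g = "\<lambda>i. sg (lam (lev i)) * (pad y i - x i)"
    have "0 \<le> (\<Sum>k = 1..<Suc K. sg (lam k) * (gs (pad y) k - gs x k))"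
      by (rule sol_optimal[OF S _ feas_sum[OF y] sg_mono]) simp_all
    also have "\<dots> = sum (gs ?g) {1..<Suc K}"
      unfolding gs_def sum_subtractf[symmetric] sum_distrib_left by (intro sum.cong refl) (auto simp: grp_def)
    also have "\<dots> = sum ?g {i\<in>I. 1 \<le> lev i \<and> lev i < Suc K}" by (rule sum_gs) simp
    also have "\<dots> = sum ?g {1..n}"
    proof (rule sum.mono_neutral_right)
      show "{1..n} \<subseteq> {i\<in>I. 1 \<le> lev i \<and> lev i < Suc K}" using orig lev_range by (force simp: less_Suc_eq_le)
      show "\<forall>i\<in>{i\<in>I. 1 \<le> lev i \<and> lev i < Suc K} - {1..n}. ?g i = 0"
        using slack by (auto simp: pad_def I_def)
    qed (simp add: fin)
    also have "\<dots> \<le> (\<Sum>i\<in>{1..n}. weight P i * f (y i / weight P i + shift P i) - weight P i * f (x i / weight P i + shift P i))"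
    proof (rule sum_mono)
      fix i assume i: "i \<in> {1..n}"
      then show "?g i \<le> weight P i * f (y i / weight P i + shift P i) - weight P i * f (x i / weight P i + shift P i)"
        using sg[of i "y i" "lam (lev i)"] y orig[OF i] x[of i] by (simp add: pad_def feasible_iff)
    qed
    finally show ?thesis by (simp add: objective_def sum_subtractf)
  qed
  ultimately show ?thesis by (simp add: optimal_def)
qed

lemma optimal_cong:
  assumes "\<And>i. i \<in> {1..n} \<Longrightarrow> x i = y i" "optimal f \<gamma> P x"
  shows "optimal f \<gamma> P y"
proof -
  have "psum x j = psum y j" for j unfolding psum_def using assms(1) by (intro sum.cong) auto
  then have "feasible \<gamma> P x \<longleftrightarrow> feasible \<gamma> P y" unfolding feasible_iff using assms(1) by simp
  moreover have "objective f P x = objective f P y" unfolding objective_def using assms(1) by (intro sum.cong) auto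
  ultimately show ?thesis using assms(2) by (simp add: optimal_def)
qed

lemma runs_nc_com:
  assumes rapc: "rapc = (case \<gamma> of Continuous \<Rightarrow> rap_cont_com | Integral \<Rightarrow> rap_int_com)" and J: "K \<le> 2 ^ J"
    and runs_rap: "\<And>s Q p q od V. reals s ''a'' = a \<Longrightarrow> reals s ''b'' = b \<Longrightarrow> nats s ''o'' = od \<Longrightarrow>
      nats s ''rp'' 0 = p \<Longrightarrow> nats s ''rq'' 0 = q \<Longrightarrow> p < q \<Longrightarrow> inj_on od {p..<q} \<Longrightarrow>
      V = od ` {p..<q} \<Longrightarrow> V \<subseteq> I \<Longrightarrow>
      (\<And>i. i \<in> V \<Longrightarrow> admissible \<gamma> (reals s ''c'' i) \<and> admissible \<gamma> (reals s ''d'' i) \<and>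
        lo i \<le> reals s ''c'' i \<and> reals s ''c'' i \<le> reals s ''d'' i \<and> reals s ''d'' i \<le> up i) \<Longrightarrow>
      admissible \<gamma> (reals s ''T'' 0) \<Longrightarrow> sum (reals s ''c'') V \<le> reals s ''T'' 0 \<Longrightarrow> reals s ''T'' 0 \<le> sum (reals s ''d'') V \<Longrightarrow>
      (\<And>t s' \<kappa>. chg multiplier_nats rap_reals s s' \<Longrightarrow>
        (\<And>i. i \<in> V \<Longrightarrow> admissible \<gamma> (reals s' ''y'' i) \<and>
          reals s' ''y'' i = clip (reals s ''c'' i) (\<xi> i \<kappa>) (reals s ''d'' i)) \<Longrightarrow>
        sum (reals s' ''y'') V = reals s ''T'' 0 \<Longrightarrow> t \<le> C * (q - p) \<Longrightarrow> Q t s') \<Longrightarrow>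
      runs (oracles f \<gamma>) rapc Q s"
  shows "runs (oracles f \<gamma>) (nc_com \<gamma>)
    (\<lambda>t s. optimal f \<gamma> P (solution s) \<and> t \<le> (4 * C + 260) * N * (J + 1)) (input_state P)"
proof -
  let ?F = "oracles f \<gamma>" and ?st = "below lev N"
  let ?Q = "\<lambda>t s. optimal f \<gamma> P (solution s) \<and> t \<le> (4 * C + 260) * N * (J + 1)"
  define s0 where "s0 = input_state P"
  define s1 where "s1 = rput ''U'' K (total P) (rput ''L'' K (total P) (nput ''N1'' 0 (Suc N) (nput ''K1'' 0 (Suc K) s0)))"
  have s1: "nats s1 ''n'' 0 = n" "nats s1 ''K1'' 0 = Suc K" "nats s1 ''N1'' 0 = Suc N"
    "nats s1 ''level'' = restrict0 n (level P)" "nats s1 ''cn'' = (\<lambda>_. 0)"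
    "reals s1 ''L'' = L0" "reals s1 ''U'' = U0" "reals s1 ''l'' = l0" "reals s1 ''u'' = u0"
    "reals s1 ''a'' = a0" "reals s1 ''b'' = b0" "reals s1 ''B'' 0 = 0" "reals s1 ''M'' 0 = 0"
    by (simp_all add: s1_def s0_def input_state_def L0_def U0_def l0_def u0_def a0_def b0_def)
  define rest where "rest = round_com \<gamma> ''L'' ''U'' (nsc ''K1'') ;; round_com \<gamma> ''l'' ''u'' (NPlus (nsc ''n'') (NConst 1)) ;;
     reach_com ;; slack_com ;; sort_com ;; init_com ;; levels_com rapc ;; output_com"
  have main: "runs ?F rest (\<lambda>t. ?Q (1 + (1 + (1 + (1 + t))))) s1"
    unfolding rest_def runs_Seq
  proof (rule runs_round_com[where H = "Suc K"], goal_cases)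
    case (4 t1 s2)
    note t1 = 4(5)
    have s2: "nats s2 ''n'' 0 = n" "nats s2 ''K1'' 0 = Suc K" "nats s2 ''N1'' 0 = Suc N"
      "nats s2 ''level'' = restrict0 n (level P)" "nats s2 ''cn'' = (\<lambda>_. 0)"
      "reals s2 ''l'' = l0" "reals s2 ''u'' = u0" "reals s2 ''a'' = a0" "reals s2 ''b'' = b0" "reals s2 ''M'' 0 = 0"
      using 4(1) s1 by (simp_all add: chg_def)
    have LU2: "reals s2 ''L'' = Lb" "reals s2 ''U'' = Ub"
      using 4(2,3) s1 by (simp_all add: Lb_def Ub_def)
    have B2: "reals s2 ''B'' 0 = 0 + (\<Sum>j = 1..<Suc K. 1 + ((rup \<gamma> (L0 j))\<^sup>2 + (rdn \<gamma> (U0 j))\<^sup>2))"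
      using 4(4) unfolding s1 .
    show ?case
    proof (rule runs_round_com[where H = "Suc n"], goal_cases)
      case (4 t2 s3)
      note t2 = 4(5)
      have s3: "nats s3 ''n'' 0 = n" "nats s3 ''K1'' 0 = Suc K" "nats s3 ''N1'' 0 = Suc N"
        "nats s3 ''level'' = restrict0 n (level P)" "nats s3 ''cn'' = (\<lambda>_. 0)"
        "reals s3 ''a'' = a0" "reals s3 ''b'' = b0" "reals s3 ''M'' 0 = 0" "reals s3 ''L'' = Lb" "reals s3 ''U'' = Ub"
        using 4(1) s2 LU2 by (simp_all add: chg_def)
      have lu3: "reals s3 ''l'' = l1" "reals s3 ''u'' = u1"
        using 4(2,3) s2 by (simp_all add: l1_def u1_def)
      have B3: "reals s3 ''B'' 0 = B"
        using 4(4) unfolding B2 s2 B_def .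
      show ?case
      proof (rule runs_reach_com[where n = n], goal_cases)
        case (2 t3 s4)
        note t3 = 2(3)
        have s4: "nats s4 ''n'' 0 = n" "nats s4 ''K1'' 0 = Suc K" "nats s4 ''N1'' 0 = Suc N"
          "nats s4 ''level'' = restrict0 n (level P)" "nats s4 ''cn'' = (\<lambda>_. 0)"
          "reals s4 ''a'' = a0" "reals s4 ''b'' = b0" "reals s4 ''L'' = Lb" "reals s4 ''U'' = Ub"
          "reals s4 ''l'' = l1" "reals s4 ''u'' = u1" "reals s4 ''B'' 0 = B"
          using 2(1) s3 lu3 B3 by (simp_all add: chg_def)
        have M4: "reals s4 ''M'' 0 = M"
          using 2(2) unfolding s3 lu3 M_def .
        show ?case
        proof (rule runs_slack_com[where n = n and M = M and B = B and K = K], goal_cases)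
          case (5 t4 s5)
          note t4 = 5(7)
          have s5: "nats s5 ''n'' 0 = n" "nats s5 ''K1'' 0 = Suc K" "nats s5 ''N1'' 0 = Suc N" "nats s5 ''cn'' = (\<lambda>_. 0)"
            "reals s5 ''L'' = Lb" "reals s5 ''U'' = Ub"
            using 5(1) s4 by (simp_all add: chg_def)
          have data5: "nats s5 ''level'' = lev" "reals s5 ''a'' = a" "reals s5 ''b'' = b" "reals s5 ''l'' = lo" "reals s5 ''u'' = up"
            using 5(2-6) s4 by (simp_all add: lev_def a_def b_def lo_def up_def)
          show ?case
          proof (rule runs_sort_com[where lev = lev and N = N and K = K], goal_cases)
            case (1 i)
            then show ?case using lev_range[of i] by (simp add: I_def)
          next
            case (6 t5 s6)
            note t5 = 6(4)
            define od where "od = nats s6 ''o''"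
            have st6: "\<And>k. 1 \<le> k \<Longrightarrow> k \<le> Suc K \<Longrightarrow> nats s6 ''st'' k = ?st k" by (fact 6(2))
            have od6: "\<And>v w. 1 \<le> v \<Longrightarrow> v \<le> w \<Longrightarrow> w \<le> Suc K \<Longrightarrow>
                od ` {?st v..<?st w} = {i\<in>I. v \<le> lev i \<and> lev i < w} \<and> inj_on od {?st v..<?st w}"
              unfolding I_def od_def by (fact 6(3))
            have s6: "nats s6 ''n'' 0 = n" "nats s6 ''K1'' 0 = Suc K" "nats s6 ''N1'' 0 = Suc N"
              "reals s6 ''L'' = Lb" "reals s6 ''U'' = Ub" "reals s6 ''a'' = a" "reals s6 ''b'' = b"
              "reals s6 ''l'' = lo" "reals s6 ''u'' = up"
              using 6(1) s5 data5 by (simp_all add: chg_def)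
            interpret divide_conquer I lev \<xi> Lb Ub ?F rapc C K a b lo up "admissible \<gamma>" od ?st
            proof (unfold_locales, goal_cases)
              case (1 i \<kappa>)
              then show ?case using box(2,3)[OF 1] xi_range[OF 1] by simp
            next
              case (2 x y)
              then show ?case by (rule admissible_arith)
            next
              case (3 j)
              then show ?case by (rule admissible_bounds)
            next
              case (4 k)
              then show ?case using leaf_bounds[OF 4] by (simp add: grp_def)
            next
              case (5 k)
              then show ?case unfolding grp_def slots(1)[OF 5] by simp
            next
              case (6 v w)
              then show ?case using od6[OF 6] by simp
            next
              case (7 v w)
              then show ?case using od6[OF 7] by simp
            next
              case (8 v w)
              then show ?case by (intro below_mono[where K = K]) (use lev_range in \<open>auto simp: I_def\<close>)
            next
              case (9 s Q p q V)
              show ?case by (rule runs_rap[OF 9(1-9) _ 9(11-13)]) (use 9(10,14) in blast)+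
            qed
            show ?case
            proof (rule runs_init_com[where N = N], goal_cases)
              case 1
              show ?case by (fact s6(3))
            next
              case (2 t6 s7)
              note t6 = 2(3)
              have s7: "nats s7 ''n'' 0 = n" "nats s7 ''K1'' 0 = Suc K" "nats s7 ''o'' = od" "nats s7 ''st'' = nats s6 ''st''"
                "reals s7 ''L'' = Lb" "reals s7 ''U'' = Ub" "reals s7 ''a'' = a" "reals s7 ''b'' = b"
                using 2(1) s6 by (simp_all add: chg_def od_def)
              have base7: "base s7" using s7 st6 by (simp add: base_def)
              have "leaf_ready k s7" for k
                unfolding leaf_ready_def
              proof (intro ballI)
                fix i d assume i: "i \<in> grp k" and d: "d \<in> sides"
                have "1 \<le> i" "i \<le> N" using i unfolding grp_def by (simp_all add: I_def)
                then show "reals s7 (''U'' @ d) i = lo i \<and> reals s7 (''L'' @ d) i = up i"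
                  using 2(2)[of i] s6(8,9) d by auto
              qed
              then have ready7: "ready 0 1 s7" by (simp add: ready_def)
              have K1: "1 \<le> K" by (simp add: K_def)
              show ?case
              proof (rule runs_levels_com[OF base7 s7(2) ready7 K1 J], goal_cases)
                case (1 t7 s8)
                note t7 = 1(3)
                have "solved 1 (Suc K) ''L'' ''L'' (reals s8 ''LL'')" using 1(2) by (simp add: good_def)
                then obtain lam where lam: "sol 1 (Suc K) 0 (total P) lam (reals s8 ''LL'')"
                  and adm: "\<forall>i\<in>blk 1 (Suc K). admissible \<gamma> (reals s8 ''LL'' i)"
                  unfolding solved_def by (auto simp: bd_def Lb_Ub)
                have opt: "optimal f \<gamma> P (reals s8 ''LL'')"
                  by (rule sol_gives_optimal[OF lam]) (use adm lev_range in \<open>auto simp: blk_def less_Suc_eq_le\<close>)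
                have n8: "nats s8 ''n'' 0 = n" using 1(1) s7(1) by (simp add: chg_def)
                show ?case
                proof (rule runs_output_com[OF n8], goal_cases)
                  case (1 t8 s9)
                  have "optimal f \<gamma> P (solution s9)"
                    unfolding solution_def by (rule optimal_cong[OF _ opt]) (use 1(1) in simp)
                  \<comment> \<open>The passes cost at most \<open>(4 * C + 172) * N\<close> each;
                    all preprocessing, the output and the remaining constant fit into
                    \<open>88 * N\<close>.\<close>
                  moreover have "4 + (t1 + (t2 + (t3 + (t4 + (t5 + (t6 + (t7 + t8))))))) \<le> (4 * C + 260) * N * (J + 1)"
                  proof -
                    have "?st (Suc K) = card {i\<in>{1..<Suc N}. lev i < Suc K}"
                      by (rule below_def[where K = K]) (use lev_range in \<open>auto simp: I_def\<close>)
                    also have "\<dots> \<le> card {1..<Suc N}" by (rule card_mono) auto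
                    finally have "?st (Suc K) - ?st 1 \<le> N" by simp
                    then have "(4 * C + 160) * (?st (Suc K) - ?st 1) \<le> (4 * C + 160) * N" by (rule mult_le_mono2)
                    moreover have nK: "n \<le> N" "2 * K \<le> N" "1 \<le> N" by (simp_all add: N_def K_def)
                    ultimately have "(4 * C + 160) * (?st (Suc K) - ?st 1) + 12 * K + 6 \<le> (4 * C + 160) * N + 12 * N"
                      by linarith
                    then have "((4 * C + 160) * (?st (Suc K) - ?st 1) + 12 * K + 6) * (J + 1) \<le> ((4 * C + 160) * N + 12 * N) * (J + 1)"
                      by (rule mult_le_mono1)
                    then have "t7 \<le> (4 * C + 172) * N * (J + 1) + 3" using t7 by (simp add: algebra_simps)
                    moreover have "4 + (t1 + (t2 + (t3 + (t4 + (t5 + (t6 + t8)))))) + 3 \<le> 88 * N"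
                    proof -
                      have "t1 \<le> 8 * N" "t2 \<le> 10 * N" "t3 \<le> 5 * N" "t4 \<le> 8 * N" "t5 \<le> 16 * N" "t6 \<le> 8 * N" "t8 \<le> 5 * N"
                        using t1 t2 t3 t4 t5 t6 1(2) nK by simp_all
                      then show ?thesis using nK(3) by simp
                    qed
                    moreover have "88 * N \<le> 88 * N * (J + 1)" by simp
                    moreover have "(4 * C + 260) * N * (J + 1) = (4 * C + 172) * N * (J + 1) + 88 * N * (J + 1)"
                      by (simp add: algebra_simps)
                    ultimately show ?thesis by linarith
                  qed
                  ultimately show ?case by simp
                qed
              qed
            qed
          qed (use s5 data5 in simp_all)
        qed (use s4 M4 in simp_all)
      qed (use s3 in simp)
    qed (use s2 in \<open>simp_all add: chg_def\<close>)
  qed (use s1 in \<open>simp_all add: chg_def\<close>)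
  have nc: "nc_com \<gamma> =
     nset ''K1'' (NPlus (nsc ''m'') (NConst 2)) ;;
     nset ''N1'' (NPlus (NPlus (nsc ''n'') (NPlus (nsc ''m'') (nsc ''m''))) (NConst 3)) ;;
     RPut ''L'' (NPlus (nsc ''m'') (NConst 1)) (rsc ''R'') ;; RPut ''U'' (NPlus (nsc ''m'') (NConst 1)) (rsc ''R'') ;; rest"
    by (simp add: nc_com_def rest_def rapc)
  show ?thesis
    unfolding nc runs_Seq runs_NPut runs_RPut
    by (rule back_subst[where P = "runs ?F rest (\<lambda>t. ?Q (1 + (1 + (1 + (1 + t)))))", OF main])
      (simp add: s1_def s0_def input_state_def K_def N_def numeral_3_eq_3 add.commute mult_2)
qed

end

section \<open>Response functions for real and integer variables, and the final bound\<close>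

section \<open>The two variable types\<close>

context nc_instance
begin

text \<open>The multiplier is a position on the common axis of \<open>f\<close>: variables with
  equal \<open>x / a + b\<close> have equal marginal cost, so positions can stand in for
  derivatives.\<close>

definition cont_value :: "nat \<Rightarrow> real \<Rightarrow> real" where
  "cont_value i \<kappa> = clip (lo i) (a i * (\<kappa> - b i)) (up i)"

lemma orig_position:
  assumes "j \<in> {1..n}"
  shows "- M \<le> lo j / a j + b j" "up j / a j + b j \<le> M"
  using M_bounds[OF assms] orig[OF assms] by simp_all

lemma M_nonneg: "0 \<le> M"
  using M_bounds(3)[of 1] wf by (simp add: nc_wf_def)

lemma cont_reduction:
  assumes f: "convex_on UNIV f" and \<gamma>: "\<gamma> = Continuous"
  shows "nc_reduction P \<gamma> z f cont_value (subgrad f)"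
proof (unfold_locales, goal_cases)
  case (1 i \<kappa> \<kappa>')
  then have "a i * (\<kappa> - b i) \<le> a i * (\<kappa>' - b i)" using box(1)[OF 1(1)] by simp
  then show ?case by (auto simp: cont_value_def)
next
  case (2 i \<kappa>)
  then show ?case using box(4)[OF 2] by (auto simp: cont_value_def)
next
  case (3 \<kappa> \<kappa>')
  then show ?case by (rule subgrad_mono[OF f])
next
  case (4 i \<kappa> y)
  define x where "x = cont_value i \<kappa>"
  define X where "X = x / a i + b i"
  have a: "0 < a i" by (rule box(1)[OF 4(1)])
  have lu: "lo i \<le> up i" by (rule box(4)[OF 4(1)])
  have pos: "\<kappa> = a i * (\<kappa> - b i) / a i + b i" using a by simp
  \<comment> \<open>An unclipped response sits at position \<open>\<kappa>\<close> itself. A clipped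
    one is displaced from \<open>\<kappa>\<close> towards its box, the direction in which all other
    points \<open>y\<close> of the box lie, so monotonicity of \<open>subgrad\<close> has the right
    sign.\<close>
  have "subgrad f \<kappa> * (y - x) \<le> subgrad f X * (y - x)"
  proof -
    have "a i * (\<kappa> - b i) < lo i \<or> up i < a i * (\<kappa> - b i) \<or> x = a i * (\<kappa> - b i)"
      using lu unfolding x_def cont_value_def by linarith
    then consider "a i * (\<kappa> - b i) < lo i" | "up i < a i * (\<kappa> - b i)" | "x = a i * (\<kappa> - b i)" by blast
    then show ?thesis
    proof cases
      case 1
      then have x: "x = lo i" using lu by (auto simp: x_def cont_value_def)
      have "a i * (\<kappa> - b i) / a i \<le> lo i / a i" using 1 a by (intro divide_right_mono) auto
      then have "\<kappa> \<le> X" using pos by (simp add: X_def x)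
      then show ?thesis using 4(3) x by (intro mult_right_mono subgrad_mono[OF f]) auto
    next
      case 2
      then have x: "x = up i" using lu by (auto simp: x_def cont_value_def)
      have "up i / a i \<le> a i * (\<kappa> - b i) / a i" using 2 a by (intro divide_right_mono) auto
      then have "X \<le> \<kappa>" using pos by (simp add: X_def x)
      then show ?thesis using 4(4) x by (intro mult_right_mono_neg subgrad_mono[OF f]) auto
    next
      case 3
      then have "X = \<kappa>" using a by (simp add: X_def)
      then show ?thesis by simp
    qed
  qed
  also have "subgrad f X * (y - x) = a i * (subgrad f X * ((y / a i + b i) - X))"
    using a by (simp add: X_def field_simps)
  finally have "a i * f X + subgrad f \<kappa> * (y - x) \<le> a i * (f X + subgrad f X * ((y / a i + b i) - X))"
    by (simp add: distrib_left)
  also have "\<dots> \<le> a i * f (y / a i + b i)" using a subgrad[OF f] by (intro mult_left_mono) auto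
  finally show ?case by (simp add: X_def x_def)
next
  case (5 i j \<theta>)
  have j: "j \<in> I" using orig[OF 5(2)] by simp
  have "M < \<theta>" using 5(3-6) by (auto simp: cont_value_def max_def min_def split: if_splits)
  then have "up j / a j + b j \<le> \<theta>" using orig_position(2)[OF 5(2)] by simp
  then have "up j \<le> a j * (\<theta> - b j)" using box(1)[OF j] by (simp add: field_simps)
  then show ?case using box(4)[OF j] by (simp add: cont_value_def)
next
  case (6 i j \<theta>)
  have j: "j \<in> I" using orig[OF 6(2)] by simp
  have "\<theta> < - M" using 6(3-6) by (auto simp: cont_value_def max_def min_def split: if_splits)
  then have "\<theta> \<le> lo j / a j + b j" using orig_position(1)[OF 6(2)] by simp
  then have "a j * (\<theta> - b j) \<le> lo j" using box(1)[OF j] by (simp add: field_simps)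
  then show ?case using box(4)[OF j] by (simp add: cont_value_def)
next
  case (7 i j \<theta>)
  then show ?case using box(4)[OF 7(1)] box(4)[OF 7(2)] M_nonneg
    by (auto simp: cont_value_def max_def min_def)
qed

definition int_value :: "(real \<Rightarrow> real) \<Rightarrow> nat \<Rightarrow> lexkey \<Rightarrow> real" where
  "int_value f i = step_val (unit_key f a b i) \<lfloor>lo i\<rfloor> \<lfloor>up i\<rfloor>"

lemma int_value_cut:
  assumes "convex_on UNIV f" "\<gamma> = Integral" "i \<in> I"
  obtains k where "int_value f i \<kappa> = of_int k" "lo i \<le> of_int k" "of_int k \<le> up i"
    "\<And>t. lo i \<le> of_int t \<Longrightarrow> of_int t < up i \<Longrightarrow> unit_key f a b i t \<le> \<kappa> \<longleftrightarrow> t < k"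
proof -
  have fl: "of_int \<lfloor>lo i\<rfloor> = lo i" "of_int \<lfloor>up i\<rfloor> = up i"
    using box(2,3)[OF assms(3)] assms(2) by (auto simp: admissible_def elim!: Ints_cases)
  have le: "\<lfloor>lo i\<rfloor> \<le> \<lfloor>up i\<rfloor>" using box(4)[OF assms(3)] by (rule floor_mono)
  obtain k where k: "\<lfloor>lo i\<rfloor> \<le> k" "k \<le> \<lfloor>up i\<rfloor>" "int_value f i \<kappa> = of_int k"
    "\<And>t. \<lfloor>lo i\<rfloor> \<le> t \<Longrightarrow> t < \<lfloor>up i\<rfloor> \<Longrightarrow> unit_key f a b i t \<le> \<kappa> \<longleftrightarrow> t < k"
  proof (rule step_val_cut[of "unit_key f a b i" "\<lfloor>lo i\<rfloor>" "\<lfloor>up i\<rfloor>" \<kappa>], goal_cases)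
    case (1 t t')
    then show ?case by (intro unit_key_strict_mono assms(1) box(1)[OF assms(3)])
  next
    case 2
    show ?case by (fact le)
  next
    case (3 k)
    show ?case by (rule 3(1)[OF 3(2,3)]) (use 3(4,5) in \<open>simp_all add: int_value_def\<close>)
  qed
  show ?thesis
  proof (rule that[OF k(3)])
    have "(of_int \<lfloor>lo i\<rfloor> :: real) \<le> of_int k" "(of_int k :: real) \<le> of_int \<lfloor>up i\<rfloor>"
      using k(1,2) by (simp_all only: of_int_le_iff)
    then show "lo i \<le> of_int k" "of_int k \<le> up i" by (simp_all only: fl)
    fix t assume t: "lo i \<le> of_int t" "of_int t < up i"
    have "(of_int \<lfloor>lo i\<rfloor> :: real) \<le> of_int t" "(of_int t :: real) < of_int \<lfloor>up i\<rfloor>"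
      using t by (simp_all only: fl)
    then have "\<lfloor>lo i\<rfloor> \<le> t" "t < \<lfloor>up i\<rfloor>" by (simp_all only: of_int_le_iff of_int_less_iff)
    then show "unit_key f a b i t \<le> \<kappa> \<longleftrightarrow> t < k" by (rule k(4))
  qed
qed

lemma sum_of_steps:
  fixes c :: "int \<Rightarrow> real"
  assumes "p \<le> q" "\<And>t. p \<le> t \<Longrightarrow> t < q \<Longrightarrow> c (t + 1) - c t \<le> S"
  shows "c q - c p \<le> S * of_int (q - p)"
  using assms
proof (induction q rule: int_ge_induct)
  case (step q)
  have "c q - c p \<le> S * of_int (q - p)" using step(2,3) by simp
  moreover have "c (q + 1) - c q \<le> S" using step(1,3) by simp
  ultimately show ?case by (simp add: algebra_simps)
qed simp

text \<open>A nonzero value includes the first step of the slack, and that step starts at position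
  \<open>M\<close>; comparing keys with this one step suffices later.\<close>

lemma odd_slack_key:
  assumes f: "convex_on UNIV f" and \<gamma>: "\<gamma> = Integral"
    and i: "i \<in> I" "a i = 1" "b i = M" "lo i = 0" "int_value f i \<theta> \<noteq> 0"
  shows "unit_key f a b i 0 \<le> \<theta>"
proof -
  obtain k where k: "int_value f i \<theta> = of_int k" "lo i \<le> of_int k" "of_int k \<le> up i"
    "\<And>t. lo i \<le> of_int t \<Longrightarrow> of_int t < up i \<Longrightarrow> unit_key f a b i t \<le> \<theta> \<longleftrightarrow> t < k"
    by (rule int_value_cut[OF f \<gamma> i(1), of \<theta>]) (rule that; simp)
  have "0 < k" using k(1,2) i(4,5) by simp
  then have "0 < up i" using k(3) by (metis less_le_trans of_int_0_less_iff)
  then show ?thesis using k(4)[of 0] i(4) \<open>0 < k\<close> by simp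
qed

lemma even_slack_key:
  assumes f: "convex_on UNIV f" and \<gamma>: "\<gamma> = Integral"
    and i: "i \<in> I" "a i = 1" "b i = - M" "up i = 0" "int_value f i \<theta> \<noteq> 0"
  shows "\<theta> < unit_key f a b i (- 1)"
proof -
  obtain k where k: "int_value f i \<theta> = of_int k" "lo i \<le> of_int k" "of_int k \<le> up i"
    "\<And>t. lo i \<le> of_int t \<Longrightarrow> of_int t < up i \<Longrightarrow> unit_key f a b i t \<le> \<theta> \<longleftrightarrow> t < k"
    by (rule int_value_cut[OF f \<gamma> i(1), of \<theta>]) (rule that; simp)
  have k1: "k \<le> - 1" using k(1,3) i(4,5) by simp
  then have "(of_int k :: real) \<le> of_int (- 1)" by (simp only: of_int_le_iff)
  then have "lo i \<le> of_int (- 1)" using k(2) by linarith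
  then have "\<not> unit_key f a b i (- 1) \<le> \<theta>" using k(4)[of "- 1"] i(4) k1 by simp
  then show ?thesis by simp
qed

lemma int_reduction:
  assumes f: "convex_on UNIV f" and \<gamma>: "\<gamma> = Integral"
  shows "nc_reduction P \<gamma> z f (int_value f) fst"
proof (unfold_locales, goal_cases)
  case (1 i \<kappa> \<kappa>')
  then show ?case unfolding int_value_def by (intro step_val_mono)
next
  case (2 i \<kappa>)
  then show ?case by (rule int_value_cut[OF f \<gamma>, of i \<kappa>]) simp
next
  case (3 \<kappa> \<kappa>')
  then show ?case by (auto simp: less_eq_prod_def)
next
  case (4 i \<kappa> y)
  obtain k where k: "int_value f i \<kappa> = of_int k" "lo i \<le> of_int k" "of_int k \<le> up i"
    "\<And>t. lo i \<le> of_int t \<Longrightarrow> of_int t < up i \<Longrightarrow> unit_key f a b i t \<le> \<kappa> \<longleftrightarrow> t < k"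
    by (rule int_value_cut[OF f \<gamma> 4(1), of \<kappa>]) (rule that; simp)
  obtain l where l: "y = of_int l" using 4(2) \<gamma> by (auto simp: admissible_def elim!: Ints_cases)
  define c where "c t = a i * f (of_int t / a i + b i)" for t :: int
  have step: "c (t + 1) - c t = fst (unit_key f a b i t)" for t
    by (simp add: c_def unit_key_def algebra_simps)
  \<comment> \<open>Steps below the cut cost at most \<open>fst \<kappa>\<close>, those above it at
    least as much; telescoping from \<open>k\<close> to \<open>l\<close> in either direction gives
    the supporting line.\<close>
  have "fst \<kappa> * (of_int l - of_int k) \<le> c l - c k"
  proof (cases "l \<le> k")
    case True
    have "c (t + 1) - c t \<le> fst \<kappa>" if t: "l \<le> t" "t < k" for t
    proof -
      have "(of_int l :: real) \<le> of_int t" "(of_int t :: real) < of_int k" using t by simp_all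
      then have "unit_key f a b i t \<le> \<kappa>" using k(3) k(4)[of t] t 4(3) l by linarith
      then show ?thesis unfolding step by (auto simp: less_eq_prod_def)
    qed
    then have "c k - c l \<le> fst \<kappa> * of_int (k - l)" by (rule sum_of_steps[OF True])
    then show ?thesis by (simp add: algebra_simps)
  next
    case False
    have "(- c (t + 1)) - (- c t) \<le> - fst \<kappa>" if t: "k \<le> t" "t < l" for t
    proof -
      have "(of_int k :: real) \<le> of_int t" "(of_int t :: real) < of_int l" using t by simp_all
      then have "\<not> unit_key f a b i t \<le> \<kappa>" using k(2) k(4)[of t] t 4(4) l by linarith
      then have "\<kappa> \<le> unit_key f a b i t" by simp
      then have "fst \<kappa> \<le> fst (unit_key f a b i t)" by (auto simp: less_eq_prod_def)
      then show ?thesis using step[of t] by simp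
    qed
    then have "(- c l) - (- c k) \<le> - fst \<kappa> * of_int (l - k)" by (intro sum_of_steps[where c = "\<lambda>t. - c t"]) (use False in auto)
    then show ?thesis by (simp add: algebra_simps)
  qed
  then show ?case by (simp add: k(1) l c_def)
next
  case (5 i j \<theta>)
  have j: "j \<in> I" using orig[OF 5(2)] by simp
  have key: "unit_key f a b i 0 \<le> \<theta>" by (rule odd_slack_key[OF f \<gamma> 5(1,3-5)]) (use 5(6) in simp)
  obtain k where k: "int_value f j \<theta> = of_int k" "lo j \<le> of_int k" "of_int k \<le> up j"
    "\<And>t. lo j \<le> of_int t \<Longrightarrow> of_int t < up j \<Longrightarrow> unit_key f a b j t \<le> \<theta> \<longleftrightarrow> t < k"
    by (rule int_value_cut[OF f \<gamma> j, of \<theta>]) (rule that; simp)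
  show ?case
  proof (rule ccontr)
    assume "int_value f j \<theta> \<noteq> up j"
    then have lt: "of_int k < up j" using k(1,3) by simp
    obtain u where u: "up j = of_int u" using box(3)[OF j] \<gamma> by (auto simp: admissible_def elim!: Ints_cases)
    have "k + 1 \<le> u" using lt u by simp
    then have "of_int k + 1 \<le> up j" unfolding u by linarith
    then have "(of_int k + 1) / a j \<le> up j / a j" using box(1)[OF j] by (intro divide_right_mono) auto
    \<comment> \<open>Step \<open>k\<close> of an original variable ends at or before
      \<open>M\<close>, where the first step of the slack begins; having the smaller key it would
      have been taken.\<close>
    then have "unit_key f a b j k < unit_key f a b i 0"
      using orig_position(2)[OF 5(2)] 5(3,4) box(1)[OF j] by (intro unit_key_less[OF f]) auto
    then have "unit_key f a b j k \<le> \<theta>" using key by (meson less_le_trans less_imp_le)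
    then show False using k(4)[of k] k(2) lt by simp
  qed
next
  case (6 i j \<theta>)
  have j: "j \<in> I" using orig[OF 6(2)] by simp
  have key: "\<theta> < unit_key f a b i (- 1)" by (rule even_slack_key[OF f \<gamma> 6(1,3-5)]) (use 6(6) in simp)
  obtain k where k: "int_value f j \<theta> = of_int k" "lo j \<le> of_int k" "of_int k \<le> up j"
    "\<And>t. lo j \<le> of_int t \<Longrightarrow> of_int t < up j \<Longrightarrow> unit_key f a b j t \<le> \<theta> \<longleftrightarrow> t < k"
    by (rule int_value_cut[OF f \<gamma> j, of \<theta>]) (rule that; simp)
  show ?case
  proof (rule ccontr)
    assume "int_value f j \<theta> \<noteq> lo j"
    then have lt: "lo j < of_int k" using k(1,2) by simp
    obtain l where l: "lo j = of_int l" using box(2)[OF j] \<gamma> by (auto simp: admissible_def elim!: Ints_cases)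
    have lk: "l < k" using lt l by simp
    have "unit_key f a b i (- 1) < unit_key f a b j l"
      using orig_position(1)[OF 6(2)] 6(3,4) box(1)[OF j] l by (intro unit_key_less[OF f]) auto
    then have "\<theta> < unit_key f a b j l" using key by (rule less_trans[rotated])
    then have "\<not> unit_key f a b j l \<le> \<theta>" by (simp only: not_le)
    moreover have "(of_int l :: real) < up j" using lt k(3) l by linarith
    ultimately show False using k(4)[of l] l lk by simp
  qed
next
  case (7 i j \<theta>)
  show ?case
  proof (rule ccontr)
    assume ne: "\<not> (int_value f i \<theta> = 0 \<or> int_value f j \<theta> = 0)"
    \<comment> \<open>The topmost step of the even slack ends at \<open>- M\<close>, the lowest step
      of the odd slack begins at \<open>M\<close>.\<close>
    have "unit_key f a b j (- 1) < unit_key f a b i 0"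
      using 7 M_nonneg by (intro unit_key_less[OF f]) auto
    moreover have "unit_key f a b i 0 \<le> \<theta>" by (rule odd_slack_key[OF f \<gamma> 7(1,3-5)]) (use ne in simp)
    moreover have "\<theta> < unit_key f a b j (- 1)" by (rule even_slack_key[OF f \<gamma> 7(2,6-8)]) (use ne in simp)
    ultimately show False by (meson less_le_trans less_trans less_irrefl)
  qed
qed

lemma runs_rap_cont:
  assumes \<gamma>: "\<gamma> = Continuous" and s: "reals s ''a'' = a" "reals s ''b'' = b" "nats s ''o'' = od"
    "nats s ''rp'' 0 = p" "nats s ''rq'' 0 = q" "p < q" and inj: "inj_on od {p..<q}" and V: "V = od ` {p..<q}" "V \<subseteq> I"
    and cd: "\<And>i. i \<in> V \<Longrightarrow> admissible \<gamma> (reals s ''c'' i) \<and> admissible \<gamma> (reals s ''d'' i) \<and>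
      lo i \<le> reals s ''c'' i \<and> reals s ''c'' i \<le> reals s ''d'' i \<and> reals s ''d'' i \<le> up i"
    and T: "sum (reals s ''c'') V \<le> reals s ''T'' 0" "reals s ''T'' 0 \<le> sum (reals s ''d'') V"
    and post: "\<And>t s' \<kappa>. chg multiplier_nats rap_reals s s' \<Longrightarrow>
      (\<And>i. i \<in> V \<Longrightarrow> admissible \<gamma> (reals s' ''y'' i) \<and>
        reals s' ''y'' i = clip (reals s ''c'' i) (cont_value i \<kappa>) (reals s ''d'' i)) \<Longrightarrow>
      sum (reals s' ''y'') V = reals s ''T'' 0 \<Longrightarrow> t \<le> 44000 * (q - p) \<Longrightarrow> Q t s'"
  shows "runs F rap_cont_com Q s"
proof -
  have sumV: "(\<Sum>j = p..<q. h (od j)) = sum h V" for h :: "nat \<Rightarrow> real"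
    unfolding V(1) using sum.reindex[OF inj, of h] by simp
  have odV: "od j \<in> V" if "p \<le> j" "j < q" for j using that by (simp add: V(1))
  show ?thesis
  proof (rule runs_rap_cont_com, unfold s, goal_cases)
    case 1
    show ?case by (fact s(6))
  next
    case (2 j)
    then show ?case using odV[of j] cd[of "od j"] box(1)[of "od j"] V(2) by auto
  next
    case 3
    show ?case using T(1) by (simp only: sumV)
  next
    case 4
    show ?case using T(2) by (simp only: sumV)
  next
    case (5 t s' x)
    show ?case
    proof (rule post[where \<kappa> = x])
      show "chg multiplier_nats rap_reals s s'" using 5(1) by (simp add: chg_def)
      show "sum (reals s' ''y'') V = reals s ''T'' 0" using 5(3) by (simp only: sumV)
      show "t \<le> 44000 * (q - p)" by (fact 5(4))
      fix i assume i: "i \<in> V"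
      then obtain j where j: "p \<le> j" "j < q" "i = od j" using V(1) by auto
      have "reals s' ''y'' i = clip (reals s ''c'' i) (a i * (x - b i)) (reals s ''d'' i)"
        unfolding j(3) by (rule 5(2)[OF j(1,2)])
      \<comment> \<open>The box of the subproblem lies inside that of the variable, so clipping to
        both is clipping to the smaller one.\<close>
      also have "\<dots> = clip (reals s ''c'' i) (cont_value i x) (reals s ''d'' i)"
        using cd[OF i] by (auto simp: cont_value_def max_def min_def)
      finally show "admissible \<gamma> (reals s' ''y'' i) \<and> reals s' ''y'' i = clip (reals s ''c'' i) (cont_value i x) (reals s ''d'' i)"
        using \<gamma> by (simp add: admissible_def)
    qed
  qed
qed

lemma runs_rap_int:
  assumes f: "convex_on UNIV f" and \<gamma>: "\<gamma> = Integral" and s: "reals s ''a'' = a" "reals s ''b'' = b" "nats s ''o'' = od"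
    "nats s ''rp'' 0 = p" "nats s ''rq'' 0 = q" "p < q" and inj: "inj_on od {p..<q}" and V: "V = od ` {p..<q}" "V \<subseteq> I"
    and cd: "\<And>i. i \<in> V \<Longrightarrow> admissible \<gamma> (reals s ''c'' i) \<and> admissible \<gamma> (reals s ''d'' i) \<and>
      lo i \<le> reals s ''c'' i \<and> reals s ''c'' i \<le> reals s ''d'' i \<and> reals s ''d'' i \<le> up i"
    and T: "admissible \<gamma> (reals s ''T'' 0)" "sum (reals s ''c'') V \<le> reals s ''T'' 0" "reals s ''T'' 0 \<le> sum (reals s ''d'') V"
    and post: "\<And>t s' \<kappa>. chg multiplier_nats rap_reals s s' \<Longrightarrow>
      (\<And>i. i \<in> V \<Longrightarrow> admissible \<gamma> (reals s' ''y'' i) \<and>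
        reals s' ''y'' i = clip (reals s ''c'' i) (int_value f i \<kappa>) (reals s ''d'' i)) \<Longrightarrow>
      sum (reals s' ''y'') V = reals s ''T'' 0 \<Longrightarrow> t \<le> 250000 * (q - p) \<Longrightarrow> Q t s'"
  shows "runs (oracles f Integral) rap_int_com Q s"
proof -
  interpret int_oracles "oracles f Integral" f
    by unfold_locales (simp_all add: oracles_def f)
  define c where "c i = \<lfloor>reals s ''c'' i\<rfloor>" for i
  define d where "d i = \<lfloor>reals s ''d'' i\<rfloor>" for i
  have fl: "of_int \<lfloor>r\<rfloor> = r" if "admissible \<gamma> r" for r
    using that \<gamma> by (auto simp: admissible_def elim!: Ints_cases)
  have c: "reals s ''c'' i = of_int (c i)" and d: "reals s ''d'' i = of_int (d i)"
    and cle: "c i \<le> d i" and loc: "\<lfloor>lo i\<rfloor> \<le> c i" and dup: "d i \<le> \<lfloor>up i\<rfloor>" if "i \<in> V" for i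
  proof -
    show "reals s ''c'' i = of_int (c i)" unfolding c_def by (rule fl[symmetric]) (use cd[OF that] in blast)
    show "reals s ''d'' i = of_int (d i)" unfolding d_def by (rule fl[symmetric]) (use cd[OF that] in blast)
    show "c i \<le> d i" "\<lfloor>lo i\<rfloor> \<le> c i" "d i \<le> \<lfloor>up i\<rfloor>"
      unfolding c_def d_def using cd[OF that] by (auto intro!: floor_mono)
  qed
  have sums: "sum (reals s ''c'') V = of_int (sum c V)" "sum (reals s ''d'') V = of_int (sum d V)"
    using c d by simp_all
  have V': "nats s ''o'' ` {nats s ''rp'' 0..<nats s ''rq'' 0} = V" by (simp add: s V)
  show ?thesis
  proof (rule runs_rap_int_com[where c = c and d = d and T = "\<lfloor>reals s ''T'' 0\<rfloor>"], unfold V', unfold s, goal_cases)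
    case 1
    show ?case by (fact s(6))
  next
    case 2
    show ?case by (fact inj)
  next
    case (3 i)
    then show ?case using c d by simp
  next
    case (4 i)
    then show ?case using cle box(1)[of i] V(2) by auto
  next
    case 5
    show ?case by (rule fl[OF T(1), symmetric])
  next
    case 6
    show ?case using T(2) unfolding sums by (simp add: le_floor_iff)
  next
    case 7
    have "of_int \<lfloor>reals s ''T'' 0\<rfloor> \<le> (of_int (sum d V) :: real)" using T(3) unfolding sums fl[OF T(1)] .
    then show ?case by (simp only: of_int_le_iff)
  next
    case (8 t s' x \<kappa>)
    note x = 8
    show ?case
    proof (rule post[where \<kappa> = \<kappa>])
      show "chg multiplier_nats rap_reals s s'" by (fact x(1))
      have "sum (reals s' ''y'') V = of_int (sum x V)" using x(2) by simp
      then show "sum (reals s' ''y'') V = reals s ''T'' 0" using x(4) fl[OF T(1)] by (simp only:)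
      show "t \<le> 250000 * (q - p)" by (fact x(7))
      fix i assume i: "i \<in> V"
      have "clip (of_int (c i)) (int_value f i \<kappa>) (of_int (d i)) = of_int (x i)"
        unfolding int_value_def
      proof (rule step_val_clip)
        show "unit_key f a b i t < unit_key f a b i t'" if "t < t'" for t t'
          by (rule unit_key_strict_mono[OF f box(1) that]) (use i V(2) in auto)
      qed (use i x(3,5,6) loc dup in auto)
      then show "admissible \<gamma> (reals s' ''y'' i) \<and> reals s' ''y'' i = clip (reals s ''c'' i) (int_value f i \<kappa>) (reals s ''d'' i)"
        using x(2)[OF i] c[OF i] d[OF i] by (simp add: admissible_def)
    qed
  qed
qed

end

lemma nc_com_solves:
  assumes f: "convex_on UNIV f" and wf: "nc_wf P" and feas: "feasible \<gamma> P z" and J: "Suc (num_nested P) \<le> 2 ^ J"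
  shows "runs (oracles f \<gamma>) (nc_com \<gamma>)
    (\<lambda>t s. optimal f \<gamma> P (solution s) \<and> t \<le> 1000260 * (num_vars P + 2 * Suc (num_nested P)) * (J + 1)) (input_state P)"
proof -
  interpret nc_instance P \<gamma> z using wf feas by unfold_locales
  have J': "K \<le> 2 ^ J" using J by (simp add: K_def)
  have N: "N = n + 2 * Suc m" by (simp add: N_def K_def)
  show ?thesis
  proof (cases \<gamma>)
    case Continuous
    interpret nc_reduction P \<gamma> z f cont_value "subgrad f" by (rule cont_reduction[OF f Continuous])
    have "runs (oracles f \<gamma>) (nc_com \<gamma>)
        (\<lambda>t s. optimal f \<gamma> P (solution s) \<and> t \<le> (4 * 44000 + 260) * N * (J + 1)) (input_state P)"
    proof (rule runs_nc_com[where rapc = rap_cont_com, OF _ J'], goal_cases)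
      case 1
      show ?case by (simp add: Continuous)
    next
      case (2 s Q p q od V)
      show ?case by (rule runs_rap_cont[OF Continuous 2(1-9) _ 2(12,13)]) (use 2(10,14) in blast)+
    qed
    moreover have "(4 * 44000 + 260) * N * (J + 1) \<le> 1000260 * N * (J + 1)" by (intro mult_le_mono) simp_all
    ultimately show ?thesis unfolding N[symmetric] by (elim runs_mono) (meson order_trans)
  next
    case Integral
    interpret nc_reduction P \<gamma> z f "int_value f" fst by (rule int_reduction[OF f Integral])
    have "runs (oracles f \<gamma>) (nc_com \<gamma>)
        (\<lambda>t s. optimal f \<gamma> P (solution s) \<and> t \<le> (4 * 250000 + 260) * N * (J + 1)) (input_state P)"
    proof (rule runs_nc_com[where rapc = rap_int_com, OF _ J'], goal_cases)
      case 1
      show ?case by (simp add: Integral)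
    next
      case (2 s Q p q od V)
      have "runs (oracles f Integral) rap_int_com Q s"
        by (rule runs_rap_int[OF f Integral 2(1-9) _ 2(11-13)]) (use 2(10,14) in blast)+
      then show ?case by (simp add: Integral)
    qed
    then show ?thesis by (simp add: N)
  qed
qed

theorem corollary6:
  fixes f :: "real \<Rightarrow> real"
  assumes "convex_on UNIV f"
  shows "solvable_in_O f Continuous n_log_m \<and> solvable_in_O f Integral n_log_m"
proof -
  have "solvable_in_O f \<gamma> n_log_m" for \<gamma>
    unfolding solvable_in_O_def
  \<comment> \<open>\<open>20005200 = 1000260 * 5 * 4\<close>: the integer case gives
    \<open>4 * 250000 + 260\<close>, padding at most quintuples \<open>n\<close>, and the number of
    passes is at most \<open>4 * l\<close>.\<close>
  proof (intro exI[of _ "nc_com \<gamma>"] exI[of _ "20005200 :: real"] allI impI)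
    fix P assume P: "nc_wf P \<and> (\<exists>x. feasible \<gamma> P x)"
    then obtain z where z: "feasible \<gamma> P z" by blast
    interpret nc_instance P \<gamma> z using P z by unfold_locales auto
    have m: "1 \<le> m" using P by (simp add: nc_wf_def)
    define l where "l = max 1 (log 2 (real m))"
    define J where "J = nat \<lceil>log 2 (real (Suc m))\<rceil>"
    have "0 \<le> log 2 (real (Suc m))" by simp
    then have J: "real J = of_int \<lceil>log 2 (real (Suc m))\<rceil>" unfolding J_def by (intro of_nat_nat) linarith
    have "real (Suc m) = 2 powr log 2 (real (Suc m))" by simp
    also have "\<dots> \<le> 2 powr real J" unfolding J by (intro powr_mono) auto
    finally have J1: "Suc m \<le> 2 ^ J" by (simp add: powr_realpow del: of_nat_Suc flip: of_nat_le_iff)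
    \<comment> \<open>Rounding up and \<open>Suc m \<le> 2 * m\<close> add at most 1 each; the
      maximum with 1 in \<open>l\<close> absorbs the resulting constant even at
      \<open>m = 1\<close>.\<close>
    have "log 2 (real (Suc m)) \<le> log 2 (2 * real m)" using m by simp
    also have "\<dots> = 1 + log 2 (real m)" using m by (simp add: log_mult)
    finally have "real J + 1 \<le> 3 + log 2 (real m)" unfolding J by linarith
    then have J2: "real J + 1 \<le> 4 * l" by (simp add: l_def)
    obtain t s where ts: "exec (oracles f \<gamma>) (nc_com \<gamma>) (input_state P) t s" "optimal f \<gamma> P (solution s)"
      "t \<le> 1000260 * (n + 2 * Suc m) * (J + 1)"
      using nc_com_solves[OF assms _ z J1] P unfolding runs_def by blast
    have n5: "n + 2 * Suc m \<le> 5 * n" using num_nested_le m by simp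
    have "t \<le> 1000260 * (5 * n) * (J + 1)"
      by (rule order_trans[OF ts(3)]) (intro mult_le_mono n5 order_refl)
    then have "real t \<le> real (1000260 * (5 * n) * (J + 1))" by (simp only: of_nat_le_iff)
    also have "\<dots> = 5001300 * real n * (real J + 1)" by (simp add: algebra_simps)
    also have "\<dots> \<le> 5001300 * real n * (4 * l)" by (rule mult_left_mono[OF J2]) simp
    finally have "real t \<le> 20005200 * n_log_m n m" by (simp add: n_log_m_def l_def)
    then show "\<exists>t s. exec (oracles f \<gamma>) (nc_com \<gamma>) (input_state P) t s \<and> optimal f \<gamma> P (solution s) \<and>
        real t \<le> 20005200 * n_log_m n m" using ts(1,2) by blast
  qed
  then show ?thesis by blast
qed

end
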